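(* Let $d\ge 2$ and let $P_n$ be the spherical convex hull of $n\ge d+1$ independent uniform random points on the closed halfsphere $\mathbb{S}_e^+\subset\mathbb{S}^d$. Then $$\mathbb{E}\, S(P_n)=\frac{d\,\omega_d}{\pi^d}\binom{n}{d}\int_0^\pi\left(1-\frac{x}{\pi}\right)^{n-d}\sin^{d-1}x\,\mathrm{d}x .$$ Further, $$\mathbb{E}\, S(P_n)=\omega_d\left(1-\binom{d+1}{3}\pi^2\,n^{-2}+O(n^{-3})\right)$$ as $n\to\infty$.
   Context: $d\ge 2$ is an integer; $\mathbb{S}^d$ is the unit sphere of $\mathbb{R}^{d+1}$ with standard scalar product $\langle\cdot,\cdot\rangle$; $\sigma$ is the spherical Lebesgue measure on $\mathbb{S}^d$ and $\sigma_{d-1}$ the $(d-1)$-dimensional spherical Lebesgue measure on $(d-1)$-dimensional great subspheres. For $k\ge 1$, $\omega_k=2\pi^{k/2}/\Gamma(k/2)$ (so $\omega_{d+1}=\sigma(\mathbb{S}^d)$). Fix $e\in\mathbb{S}^d$; $\mathbb{S}_e^+=\{u\in\mathbb{S}^d:\langle u,e\rangle\ge 0\}$, and $\mu=\frac{2}{\omega_{d+1}}\,\sigma$ restricted to $\mathbb{S}_e^+$ is the uniform probability measure on $\mathbb{S}_e^+$. Let $X_1,\dots,X_n$ be independent random points in $\mathbb{S}_e^+$, each with distribution $\mu$, and $P_n=\mathrm{conv}_s\{X_1,\dots,X_n\}$, where $\mathrm{conv}_s(A)=\mathbb{S}^d\cap\mathrm{pos}\,A$ and $\mathrm{pos}$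 denotes the positive hull in $\mathbb{R}^{d+1}$ (the set of all finite linear combinations with nonnegative coefficients). A spherical polytope is an intersection $C\cap\mathbb{S}^d$ with $C$ a pointed closed convex polyhedral cone in $\mathbb{R}^{d+1}$; its $k$-dimensional faces are the intersections with $\mathbb{S}^d$ of the $(k+1)$-dimensional faces of $C$. The surface area of a spherical polytope $P$ is $S(P)=\sum_{F}\sigma_{d-1}(F)$, the sum being over all $(d-1)$-dimensional faces $F$ of $P$. Almost surely $P_n$ is a spherical polytope. *)

theory Defs
  imports "HOL-Probability.Probability" "HOL-Library.Landau_Symbols"
begin

text \<open>
  The sphere is \<open>sphere 0 1\<close> in a Euclidean space \<open>'a\<close> of dimension \<open>d + 1\<close>.
\<close>

definition omega :: "nat \<Rightarrow> real" where
  "omega k = 2 * pi powr (real k / 2) / Gamma (real k / 2)"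


text \<open>
  Lebesgue measure of dimension \<open>dim L\<close> on a linear subspace \<open>L\<close>, as a Borel measure on the
  ambient space: the image of the product Lebesgue measure under the coordinates of an
  orthonormal basis of \<open>L\<close> (the choice is immaterial, by rotation invariance).
  For \<open>B = Basis\<close> this is the library fact \<open>lborel_eq\<close>.
\<close>

definition orthonormal_basis_of :: "'a::euclidean_space set \<Rightarrow> 'a set \<Rightarrow> bool" where
  "orthonormal_basis_of L B \<longleftrightarrow> pairwise orthogonal B \<and> (\<forall>b\<in>B. norm b = 1) \<and> span B = L"

definition subspace_lborel :: "'a::euclidean_space set \<Rightarrow> 'a measure" where
  "subspace_lborel L =
     (let B = (SOME B. orthonormal_basis_of L B)
      in distr (\<Pi>\<^sub>M b\<in>B. (lborel :: real measure)) borel (\<lambda>f. \<Sum>b\<in>B. f b *\<^sub>R b))"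

text \<open>
  Spherical Lebesgue measure of the great subsphere \<open>L \<inter> sphere 0 1\<close>, which has dimension
  \<open>dim L - 1\<close>.  A Borel set \<open>A\<close> gets \<open>dim L\<close> times the \<open>dim L\<close>-dimensional Lebesgue measure of
  the truncated cone over \<open>A\<close>, that is, of the points \<open>r *\<^sub>R u\<close> with \<open>u \<in> A \<inter> L\<close>, \<open>norm u = 1\<close>
  and \<open>0 < r \<le> 1\<close>; recall \<open>sgn x = x /\<^sub>R norm x\<close>.
\<close>

definition great_sphere_measure :: "'a::euclidean_space set \<Rightarrow> 'a measure" where
  "great_sphere_measure L =
     scale_measure (of_nat (dim L))
       (distr (restrict_space (subspace_lborel L) (cball 0 1 - {0})) borel sgn)"

abbreviation sphere_measure :: "'a::euclidean_space measure" where
  "sphere_measure \<equiv> great_sphere_measure UNIV"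


definition halfsphere :: "'a::euclidean_space \<Rightarrow> 'a set" where
  "halfsphere e = {u \<in> sphere 0 1. u \<bullet> e \<ge> 0}"

text \<open>Here \<open>DIM('a) = d + 1\<close>, so the constant is \<open>2 / omega (d + 1)\<close>.\<close>

definition halfsphere_uniform :: "'a::euclidean_space \<Rightarrow> 'a measure" where
  "halfsphere_uniform e =
     density sphere_measure (\<lambda>u. ennreal (2 / omega DIM('a)) * indicator (halfsphere e) u)"

definition halfsphere_sample ::
    "'a::euclidean_space \<Rightarrow> nat \<Rightarrow> 'w measure \<Rightarrow> (nat \<Rightarrow> 'w \<Rightarrow> 'a) \<Rightarrow> bool" where
  "halfsphere_sample e n M X \<longleftrightarrow>
     prob_space M \<and>
     prob_space.indep_vars M (\<lambda>_. borel) X {1..n} \<and>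
     (\<forall>i\<in>{1..n}. distr M borel (X i) = halfsphere_uniform e)"


definition pos :: "'a::real_vector set \<Rightarrow> 'a set" where
  "pos A = {\<Sum>x\<in>B. c x *\<^sub>R x | B c. finite B \<and> B \<subseteq> A \<and> (\<forall>x\<in>B. 0 \<le> c x)}"

definition conv_s :: "'a::real_normed_vector set \<Rightarrow> 'a set" where
  "conv_s A = sphere 0 1 \<inter> pos A"

definition pointed_polyhedral_cone :: "'a::euclidean_space set \<Rightarrow> bool" where
  "pointed_polyhedral_cone C \<longleftrightarrow> polyhedron C \<and> cone C \<and> C \<inter> uminus ` C = {0}"

text \<open>
  A spherical polytope is a set \<open>P = C \<inter> sphere 0 1\<close> with \<open>C\<close> a pointed polyhedral cone; \<open>C\<close> is
  determined by \<open>P\<close>.  (A \<open>polyhedron\<close> is convex and closed.)  As usual, \<open>C\<close> itself counts as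
  one of its faces; this matters below only for polytopes of dimension \<open>d - 1\<close>.  The surface
  area is \<open>0\<close> on sets that are not spherical polytopes.
\<close>

definition spherical_face :: "nat \<Rightarrow> 'a::euclidean_space set \<Rightarrow> 'a set \<Rightarrow> bool" where
  "spherical_face k F P \<longleftrightarrow>
     (\<exists>C G. pointed_polyhedral_cone C \<and> P = C \<inter> sphere 0 1 \<and>
            G face_of C \<and> aff_dim G = int k + 1 \<and> F = G \<inter> sphere 0 1)"

text \<open>With \<open>DIM('a) = d + 1\<close>, the faces below are those of dimension \<open>d - 1\<close>.\<close>

definition surface_area :: "'a::euclidean_space set \<Rightarrow> real" where
  "surface_area P =
     (\<Sum>F | spherical_face (DIM('a) - 2) F P. measure (great_sphere_measure (span F)) F)"

definition expected_surface_area ::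
    "nat \<Rightarrow> 'w measure \<Rightarrow> (nat \<Rightarrow> 'w \<Rightarrow> 'a::euclidean_space) \<Rightarrow> real" where
  "expected_surface_area n M X =
     (\<integral>\<omega>. surface_area (conv_s ((\<lambda>i. X i \<omega>) ` {1..n})) \<partial>M)"

end

theory Submission
  imports Defs "HOL-Real_Asymp.Real_Asymp"
begin

text \<open>
  A uniform point of the halfsphere is \<open>sgn (flip e z)\<close> with \<open>z\<close> uniform in the unit ball, where
  \<open>flip e z\<close> is whichever of \<open>z\<close> and \<open>- z\<close> lies on the side of \<open>e\<close>.  Almost surely the points are in
  general position, so \<open>S(P\<^sub>n)\<close> is the sum over the \<open>d\<close>-subsets \<open>J\<close> of the area of
  \<open>conv\<^sub>s(X\<^sub>J)\<close>, counted when the remaining points lie on one side of the hyperplane spanned by \<open>X\<^sub>J\<close>.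
  If \<open>x\<close> is the angle between \<open>e\<close> and the normal of this hyperplane, that happens with
  conditional probability \<open>(1 - x/\<pi>)^(n-d) + (x/\<pi>)^(n-d)\<close>.

  By rotation invariance one may average over \<open>e\<close>.  For fixed \<open>z\<^sub>J\<close> the area depends on \<open>e\<close> only
  through the direction of its projection to the hyperplane, hence it is independent of \<open>x\<close>,
  whose density is proportional to \<open>sin^(d-1) x\<close>.  This gives the formula up to a factor that does not
  depend on \<open>n\<close>, and the factor is found by letting \<open>n \<rightarrow> \<infinity>\<close>.  The polytope then fills the halfsphere:
  its facets become nearly orthogonal to \<open>e\<close>, so that their areas may be compared with those of their
  projections along \<open>e\<close>, which tile \<open>e\<^sup>\<bottom>\<close>.
\<close>

section \<open>Asymptotics of the integral\<close>

text \<open>Conditioning on the hyperplane of X_J would call for the joint law of d points given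
  their span. Moving \<open>e\<close> instead leaves the points and their normal \<open>u\<close>
  fixed, so the law of the angle comes from one polar decomposition around \<open>u\<close>. The
  price is an unknown factor, the mean facet area \<open>prism_mean\<close> over random points and
  poles. It is never computed: it depends on the dimension alone, the shadows of the facets have
  total mass 1 up to exponentially small errors, and the Beta integral makes the right-hand side
  without \<open>omega d\<close> tend to 1. Fixing the factor needs n to infinity at a fixed
  tolerance \<open>\<eta>\<close> for the tilt of facets, and then \<open>\<eta>\<close> to 0.

  The base 1 - x/pi is the share of the halfsphere on one side of the hyperplane, a lune of angle pi
  - x. Facet areas are kept in full dimension: the area is \<open>omega d\<close> times the
  probability that a uniform ball point projects into the cone of the facet. Hence comparisons
  involve only \<open>lborel\<close> of the whole space, and a linear map suffices to pass from
  projection along \<open>u\<close> to projection along \<open>e\<close>.\<close>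

lemma sin_power_approx:
  "\<exists>C\<ge>0. \<forall>x\<in>{0..pi}. \<bar>sin x ^ p - (x ^ p - real p / 6 * x ^ (p + 2))\<bar> \<le> C * x ^ (p + 4)"
proof (induction p)
  case (Suc p)
  then obtain C where C: "C \<ge> 0" "\<And>x. x \<in> {0..pi} \<Longrightarrow> \<bar>sin x ^ p - (x ^ p - real p / 6 * x ^ (p + 2))\<bar> \<le> C * x ^ (p + 4)"
    by blast
  \<comment> \<open>The three summands bound the three errors in the product of the expansions of
    sin^p and sin: the old error times \<open>sin x\<close>, the main part times the fifth-order
    error \<open>b\<close>, and the cross term p/36 x^(p+5), which is not part of the next
    expansion.\<close>
  define C' where "C' = C + (1 + real p / 6 * pi\<^sup>2) + real p / 36"
  show ?case
  proof (intro exI[of _ C'] conjI ballI)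
    show "0 \<le> C'" using C(1) by (simp add: C'_def)
    fix x :: real assume x: "x \<in> {0..pi}"
    define a where "a = sin x ^ p - (x ^ p - real p / 6 * x ^ (p + 2))"
    define b where "b = sin x - (x - x ^ 3 / 6)"
    have a: "\<bar>a\<bar> \<le> C * x ^ (p + 4)" using C(2)[OF x] by (simp add: a_def)
    have b: "\<bar>b\<bar> \<le> x ^ 5"
    proof -
      have "(\<Sum>m<5. sin_coeff m * x ^ m) = x - x ^ 3 / 6"
      proof -
        have "{..<5::nat} = {0, 1, 2, 3, 4}" by auto
        then show ?thesis by (simp add: sin_coeff_def fact_numeral)
      qed
      then have "\<bar>b\<bar> \<le> inverse (fact 5) * \<bar>x\<bar> ^ 5"
        using Maclaurin_sin_bound[of x 5] by (simp add: b_def)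
      also have "\<dots> \<le> 1 * x ^ 5"
        using x by (intro mult_mono) (auto simp: fact_numeral)
      finally show ?thesis by simp
    qed
    have s: "\<bar>sin x\<bar> \<le> x" using x by (simp add: abs_sin_x_le_abs_x[of x, simplified] abs_of_nonneg) (use abs_sin_x_le_abs_x[of x] in auto)
    have "sin x ^ Suc p - (x ^ Suc p - real (Suc p) / 6 * x ^ (Suc p + 2))
      = a * sin x + (x ^ p - real p / 6 * x ^ (p + 2)) * b + real p / 36 * x ^ (p + 5)"
      unfolding a_def b_def by (simp add: field_simps eval_nat_numeral)
    also have "\<bar>\<dots>\<bar> \<le> \<bar>a * sin x\<bar> + \<bar>(x ^ p - real p / 6 * x ^ (p + 2)) * b\<bar> + \<bar>real p / 36 * x ^ (p + 5)\<bar>"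
      by linarith
    also have "\<bar>a * sin x\<bar> \<le> C * x ^ (p + 5)"
    proof -
      have "\<bar>a * sin x\<bar> \<le> (C * x ^ (p + 4)) * x"
        unfolding abs_mult using a s x C(1) by (intro mult_mono) auto
      then show ?thesis by (simp add: eval_nat_numeral mult_ac)
    qed
    also have "\<bar>(x ^ p - real p / 6 * x ^ (p + 2)) * b\<bar> \<le> (1 + real p / 6 * pi\<^sup>2) * x ^ (p + 5)"
    proof -
      have "\<bar>x ^ p - real p / 6 * x ^ (p + 2)\<bar> \<le> \<bar>x ^ p\<bar> + \<bar>real p / 6 * x ^ (p + 2)\<bar>" by linarith
      also have "\<dots> = (1 + real p / 6 * x\<^sup>2) * x ^ p"
        using x by (simp add: algebra_simps power_add power2_eq_square abs_mult)
      also have "\<dots> \<le> (1 + real p / 6 * pi\<^sup>2) * x ^ p"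
        using x by (intro mult_right_mono add_left_mono mult_left_mono power_mono) auto
      finally have "\<bar>(x ^ p - real p / 6 * x ^ (p + 2)) * b\<bar> \<le> ((1 + real p / 6 * pi\<^sup>2) * x ^ p) * x ^ 5"
        unfolding abs_mult using b x by (intro mult_mono) auto
      then show ?thesis by (simp add: power_add mult.assoc)
    qed
    also have "\<bar>real p / 36 * x ^ (p + 5)\<bar> = real p / 36 * x ^ (p + 5)" using x by simp
    finally show "\<bar>sin x ^ Suc p - (x ^ Suc p - real (Suc p) / 6 * x ^ (Suc p + 2))\<bar> \<le> C' * x ^ (Suc p + 4)"
      by (simp add: C'_def algebra_simps eval_nat_numeral)
  qed
qed (auto intro: exI[of _ 0])

text \<open>A Beta integral B(k + 1, m + 1), rescaled to length pi. Each integration by parts trades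
  a power of x for a power of 1 - x/pi, so \<open>m\<close> must stay arbitrary in the induction on
  \<open>k\<close>.\<close>

lemma has_integral_beta_pi:
  "((\<lambda>x. (1 - x / pi) ^ m * x ^ k) has_integral (pi ^ (k + 1) * fact k * fact m / fact (m + k + 1))) {0..pi}"
proof (induction k arbitrary: m)
  case 0
  have "((\<lambda>x. (1 - x / pi) ^ m) has_integral
      (- pi / real (m + 1) * (1 - pi / pi) ^ (m + 1) - (- pi / real (m + 1) * (1 - 0 / pi) ^ (m + 1)))) {0..pi}"
  proof (rule fundamental_theorem_of_calculus)
    fix x :: real
    have "((\<lambda>x. (1 - x / pi) ^ Suc m) has_real_derivative (1 + real m) * ((- 1 / pi) * (1 - x / pi) ^ m)) (at x within {0..pi})"
      by (rule DERIV_power_Suc) (auto intro!: derivative_eq_intros)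
    from DERIV_cmult[OF this, of "- pi / real (m + 1)"]
    have "((\<lambda>x. - pi / real (m + 1) * (1 - x / pi) ^ (m + 1)) has_real_derivative
      (- pi / real (m + 1)) * (real (m + 1) * (1 - x / pi) ^ m * (- 1 / pi))) (at x within {0..pi})"
      by (simp add: mult_ac)
    moreover have "(- pi / r) * (r * A * (- 1 / pi)) = A" if "r > 0" for r A :: real
      using that by simp
    from this[of "real (m + 1)"] have "(- pi / real (m + 1)) * (real (m + 1) * (1 - x / pi) ^ m * (- 1 / pi)) = (1 - x / pi) ^ m"
      by simp
    ultimately show "((\<lambda>x. - pi / real (m + 1) * (1 - x / pi) ^ (m + 1)) has_vector_derivative (1 - x / pi) ^ m) (at x within {0..pi})"
      by (simp only: has_real_derivative_iff_has_vector_derivative)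
  qed simp
  moreover have "- pi / real (m + 1) * (1 - pi / pi) ^ (m + 1) - (- pi / real (m + 1) * (1 - 0 / pi) ^ (m + 1))
    = pi ^ (0 + 1) * fact 0 * fact m / fact (m + 0 + 1)"
    by (simp add: divide_simps)
  ultimately show ?case by simp
next
  case (Suc k)
  \<comment> \<open>The integrand is the derivative of -pi/(m+1) (1 - x/pi)^(m+1) x^(k+1), which
    vanishes at pi through the first power and at 0 through the second.\<close>
  have ibp: "((\<lambda>x. (1 - x / pi) ^ m * x ^ Suc k - pi * real (Suc k) / real (m + 1) * ((1 - x / pi) ^ Suc m * x ^ k)) has_integral
     (- pi / real (m + 1) * (1 - pi / pi) ^ Suc m * pi ^ Suc k - (- pi / real (m + 1) * (1 - 0 / pi) ^ Suc m * 0 ^ Suc k))) {0..pi}"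
  proof (rule fundamental_theorem_of_calculus)
    fix x :: real assume "x \<in> {0..pi}"
    have 1: "((\<lambda>x. (1 - x / pi) ^ Suc m) has_real_derivative (1 + real m) * ((- 1 / pi) * (1 - x / pi) ^ m)) (at x within {0..pi})"
      by (rule DERIV_power_Suc) (auto intro!: derivative_eq_intros)
    have 2: "((\<lambda>x. x ^ Suc k) has_real_derivative (1 + real k) * (1 * x ^ k)) (at x within {0..pi})"
      by (rule DERIV_power_Suc) (auto intro!: derivative_eq_intros)
    from DERIV_cmult[OF DERIV_mult[OF 1 2], of "- pi / real (m + 1)"]
    have "((\<lambda>x. - pi / real (m + 1) * (1 - x / pi) ^ Suc m * x ^ Suc k) has_real_derivative
      (- pi / real (m + 1)) * ((real (Suc m) * (1 - x / pi) ^ m * (- 1 / pi)) * x ^ Suc k + (1 - x / pi) ^ Suc m * (real (Suc k) * x ^ k))) (at x within {0..pi})"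
      by (simp add: mult_ac)
    also have "(- pi / real (m + 1)) * ((real (Suc m) * (1 - x / pi) ^ m * (- 1 / pi)) * x ^ Suc k + (1 - x / pi) ^ Suc m * (real (Suc k) * x ^ k))
      = (1 - x / pi) ^ m * x ^ Suc k - pi * real (Suc k) / real (m + 1) * ((1 - x / pi) ^ Suc m * x ^ k)"
    proof -
      have "(- pi / r) * ((r * A * (- 1 / pi)) * B + E * (F * G)) = A * B - pi * F / r * (E * G)" if "r > 0" for r A B E F G :: real
        using that by (simp add: field_simps)
      from this[of "real (Suc m)"] show ?thesis by simp
    qed
    finally show "((\<lambda>x. - pi / real (m + 1) * (1 - x / pi) ^ Suc m * x ^ Suc k) has_vector_derivative
       ((1 - x / pi) ^ m * x ^ Suc k - pi * real (Suc k) / real (m + 1) * ((1 - x / pi) ^ Suc m * x ^ k))) (at x within {0..pi})"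
      by (simp add: has_real_derivative_iff_has_vector_derivative)
  qed simp
  have h: "((\<lambda>x. ((1 - x / pi) ^ m * x ^ Suc k - pi * real (Suc k) / real (m + 1) * ((1 - x / pi) ^ Suc m * x ^ k))
     + pi * real (Suc k) / real (m + 1) * ((1 - x / pi) ^ Suc m * x ^ k)) has_integral
     0 + pi * real (Suc k) / real (m + 1) * (pi ^ (k + 1) * fact k * fact (Suc m) / fact (Suc m + k + 1))) {0..pi}"
    using ibp by (intro has_integral_add has_integral_mult_right Suc.IH) simp
  have eq: "0 + pi * real (Suc k) / real (m + 1) * (pi ^ (k + 1) * fact k * fact (Suc m) / fact (Suc m + k + 1))
     = pi ^ (Suc k + 1) * fact (Suc k) * fact m / fact (m + Suc k + 1)"
  proof -
    have "0 + pi * K / M * (P * f * (M * g) / h) = (pi * P) * (K * f) * g / h" if "M > 0" for K M P f g h :: real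
      using that by (simp add: field_simps)
    from this[of "real (m + 1)" "real (Suc k)" "pi ^ (k + 1)" "fact k" "fact m" "fact (m + Suc k + 1)"]
    show ?thesis by (simp only: fact_Suc of_nat_Suc) (simp add: mult_ac)
  qed
  show ?case using h unfolding eq by (simp only: diff_add_cancel)
qed

text \<open>The prefactor d/pi^d binom(n,d) turns the Beta integral of x^(d-1+j) into pi^j
  (d-1+j)!/(d-1)! n!/(n+j)!. This is exactly 1 for j = 0, of order n^-2 for j = 2 and of order n^-4
  for j = 4, so the expansion of sin^(d-1) can be integrated term by term. The leading 1 later
  serves to find the unknown constant.\<close>

lemma facet_integral_expansion:
  assumes "d \<ge> 1"
  shows "(\<lambda>n. real d / pi ^ d * real (n choose d) * integral {0..pi} (\<lambda>x. (1 - x / pi) ^ (n - d) * sin x ^ (d - 1))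
    - (1 - real ((d + 1) choose 3) * pi\<^sup>2 / real n ^ 2)) \<in> O(\<lambda>n. 1 / real n ^ 3)"
proof -
  define p where "p = d - 1"
  have d: "d = Suc p" using assms by (simp add: p_def)
  obtain C where C: "C \<ge> 0" "\<And>x. x \<in> {0..pi} \<Longrightarrow> \<bar>sin x ^ p - (x ^ p - real p / 6 * x ^ (p + 2))\<bar> \<le> C * x ^ (p + 4)"
    using sin_power_approx[of p] by blast
  define I where "I = (\<lambda>n. integral {0..pi} (\<lambda>x. (1 - x / pi) ^ (n - d) * sin x ^ p))"
  define \<beta> where "\<beta> = (\<lambda>n k. pi ^ (k + 1) * fact k * fact (n - d) / fact (n - d + k + 1) :: real)"
  define c where "c = (\<lambda>n. real d / pi ^ d * real (n choose d))"
  \<comment> \<open>\<open>K\<close> collects the 1/6 of the sine expansion and the factorial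
    quotient for j = 2; it equals pi^2 binom(d+1,3). \<open>K4\<close> does the same for the error
    term.\<close>
  define K where "K = pi\<^sup>2 * real (p + 2) * real (p + 1) * real p / 6"
  define K4 where "K4 = C * (pi ^ 4 * real (p + 4) * real (p + 3) * real (p + 2) * real (p + 1))"
  have bound: "\<bar>I n - (\<beta> n p - real p / 6 * \<beta> n (p + 2))\<bar> \<le> C * \<beta> n (p + 4)" for n
  proof -
    have int: "(\<lambda>x. (1 - x / pi) ^ (n - d) * sin x ^ p) integrable_on {0..pi}"
      by (intro integrable_continuous_real continuous_intros) auto
    have h: "((\<lambda>x. (1 - x / pi) ^ (n - d) * x ^ p - real p / 6 * ((1 - x / pi) ^ (n - d) * x ^ (p + 2))) has_integral
       (\<beta> n p - real p / 6 * \<beta> n (p + 2))) {0..pi}"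
      unfolding \<beta>_def by (intro has_integral_diff has_integral_mult_right has_integral_beta_pi)
    have "((\<lambda>x. (1 - x / pi) ^ (n - d) * sin x ^ p - ((1 - x / pi) ^ (n - d) * x ^ p - real p / 6 * ((1 - x / pi) ^ (n - d) * x ^ (p + 2)))) has_integral
       I n - (\<beta> n p - real p / 6 * \<beta> n (p + 2))) {0..pi}"
      unfolding I_def by (intro has_integral_diff h integrable_integral int)
    note f = this
    have g: "((\<lambda>x. C * ((1 - x / pi) ^ (n - d) * x ^ (p + 4))) has_integral C * \<beta> n (p + 4)) {0..pi}"
      unfolding \<beta>_def by (intro has_integral_mult_right has_integral_beta_pi)
    have "norm (I n - (\<beta> n p - real p / 6 * \<beta> n (p + 2))) \<le> C * \<beta> n (p + 4)"
      unfolding integral_unique[OF f, symmetric] integral_unique[OF g, symmetric]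
    proof (rule integral_norm_bound_integral[OF has_integral_integrable[OF f] has_integral_integrable[OF g]])
      fix x assume x: "x \<in> {0..pi}"
      have "\<bar>(1 - x / pi) ^ (n - d) * (sin x ^ p - (x ^ p - real p / 6 * x ^ (p + 2)))\<bar>
        \<le> (1 - x / pi) ^ (n - d) * (C * x ^ (p + 4))"
        unfolding abs_mult using x C(2)[OF x] by (intro mult_mono) auto
      then show "norm ((1 - x / pi) ^ (n - d) * sin x ^ p - ((1 - x / pi) ^ (n - d) * x ^ p - real p / 6 * ((1 - x / pi) ^ (n - d) * x ^ (p + 2))))
        \<le> C * ((1 - x / pi) ^ (n - d) * x ^ (p + 4))"
        by (simp add: algebra_simps)
    qed
    then show ?thesis by simp
  qed
  have c\<beta>: "c n * \<beta> n (p + j) = pi ^ j * fact (p + j) / fact p * (fact n / fact (n + j))" if "n \<ge> d" for n j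
  proof -
    have bin: "real (n choose d) = fact n / (fact d * fact (n - d))"
      using that by (rule binomial_fact)
    have idx: "n - d + (p + j) + 1 = n + j" using that d by simp
    have "r / P * (N / ((r * b) * e)) * (P * Q * f * e / g) = Q * f / b * (N / g)"
      if "r > 0" "P > 0" "e > 0" for r P N b e Q f g :: real
      using that by (simp add: field_simps)
    from this[of "real d" "pi ^ d" "fact (n - d)" "fact n" "fact p" "pi ^ j" "fact (p + j)" "fact (n + j)"]
    have E: "real d / pi ^ d * (fact n / ((real d * fact p) * fact (n - d))) * (pi ^ d * pi ^ j * fact (p + j) * fact (n - d) / fact (n + j))
      = pi ^ j * fact (p + j) / fact p * (fact n / fact (n + j))"
      using assms by simp
    have f: "fact d = real d * fact p" by (simp add: d)
    have w: "pi ^ (p + j + 1) = pi ^ d * pi ^ j" by (simp add: d power_add)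
    show ?thesis unfolding c_def \<beta>_def bin f w idx by (rule E)
  qed
  have f2: "fact (k + 2) = real (k + 1) * real (k + 2) * fact k" for k
    by (simp add: eval_nat_numeral mult_ac)
  have f4: "fact (k + 4) = real (k + 1) * real (k + 2) * real (k + 3) * real (k + 4) * fact k" for k
    by (simp add: eval_nat_numeral mult_ac)
  have q: "P * (a * f) / f * (g / (b * g)) = P * a / b" if "f > 0" "g > 0" for P a b f g :: real
    using that by simp
  have c2: "c n * \<beta> n (p + 2) = pi\<^sup>2 * (real (p + 1) * real (p + 2)) / (real (n + 1) * real (n + 2))" if "n \<ge> d" for n
    unfolding c\<beta>[OF that] f2 by (rule q) auto
  have c4: "c n * \<beta> n (p + 4) = pi ^ 4 * (real (p + 1) * real (p + 2) * real (p + 3) * real (p + 4))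
      / (real (n + 1) * real (n + 2) * real (n + 3) * real (n + 4))" if "n \<ge> d" for n
    unfolding c\<beta>[OF that] f4 by (rule q) auto
  have c0': "c n * \<beta> n (p + 0) = 1" if "n \<ge> d" for n
    unfolding c\<beta>[OF that] by simp
  have ev: "eventually (\<lambda>n. \<bar>c n * I n - (1 - K / (real (n + 1) * real (n + 2)))\<bar> \<le> K4 / (real (n + 1) * real (n + 2) * real (n + 3) * real (n + 4))) at_top"
    using eventually_ge_at_top[of d]
  proof eventually_elim
    fix n assume n: "n \<ge> d"
    have c0: "c n \<ge> 0" by (simp add: c_def)
    have "c n * (\<beta> n p - real p / 6 * \<beta> n (p + 2)) = c n * \<beta> n (p + 0) - real p / 6 * (c n * \<beta> n (p + 2))"
      by (simp add: algebra_simps)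
    also have "\<dots> = 1 - K / (real (n + 1) * real (n + 2))"
      unfolding c0'[OF n] c2[OF n] K_def by (simp add: mult_ac)
    finally have e1: "c n * (\<beta> n p - real p / 6 * \<beta> n (p + 2)) = 1 - K / (real (n + 1) * real (n + 2))" .
    have e2: "c n * (C * \<beta> n (p + 4)) = K4 / (real (n + 1) * real (n + 2) * real (n + 3) * real (n + 4))"
    proof -
      have "c n * (C * \<beta> n (p + 4)) = C * (c n * \<beta> n (p + 4))" by simp
      also have "\<dots> = K4 / (real (n + 1) * real (n + 2) * real (n + 3) * real (n + 4))"
        unfolding c4[OF n] K4_def by (simp add: mult_ac)
      finally show ?thesis .
    qed
    have "\<bar>c n * I n - c n * (\<beta> n p - real p / 6 * \<beta> n (p + 2))\<bar> = c n * \<bar>I n - (\<beta> n p - real p / 6 * \<beta> n (p + 2))\<bar>"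
      using c0 by (simp add: abs_mult right_diff_distrib[symmetric])
    also have "\<dots> \<le> c n * (C * \<beta> n (p + 4))" using bound c0 by (rule mult_left_mono)
    finally show "\<bar>c n * I n - (1 - K / (real (n + 1) * real (n + 2)))\<bar> \<le> K4 / (real (n + 1) * real (n + 2) * real (n + 3) * real (n + 4))"
      unfolding e1 e2 .
  qed
  have "(\<lambda>n. c n * I n - (1 - K / (real (n + 1) * real (n + 2)))) \<in> O(\<lambda>n. K4 / (real (n + 1) * real (n + 2) * real (n + 3) * real (n + 4)))"
    by (rule bigoI[of _ 1], rule eventually_mono[OF ev], unfold mult_1 real_norm_def)
       (rule order_trans[OF _ abs_ge_self])
  also have "(\<lambda>n. K4 / (real (n + 1) * real (n + 2) * real (n + 3) * real (n + 4))) \<in> O(\<lambda>n. 1 / real n ^ 3)"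
    by real_asymp
  finally have 1: "(\<lambda>n. c n * I n - (1 - K / (real (n + 1) * real (n + 2)))) \<in> O(\<lambda>n. 1 / real n ^ 3)" .
  \<comment> \<open>The second term is K/((n+1)(n+2)). Replacing it by K/n^2 costs an error of order
    n^-3, which dominates the remainder of order n^-4.\<close>
  have "(\<lambda>n::nat. 1 / real n ^ 2 - 1 / (real (n + 1) * real (n + 2))) \<in> O(\<lambda>n. 1 / real n ^ 3)"
    by real_asymp
  then have "(\<lambda>n::nat. K * (1 / real n ^ 2 - 1 / (real (n + 1) * real (n + 2)))) \<in> O(\<lambda>n. 1 / real n ^ 3)"
    by (cases "K = 0") auto
  from sum_in_bigo(1)[OF 1 this]
  have "(\<lambda>n. c n * I n - (1 - K / real n ^ 2)) \<in> O(\<lambda>n. 1 / real n ^ 3)"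
    by (simp add: algebra_simps)
  moreover have "K = real ((d + 1) choose 3) * pi\<^sup>2"
  proof -
    have "real (Suc (Suc p) choose 3) = real (p + 2) * real (p + 1) * real p / 6"
    proof (cases p)
      case (Suc q)
      have e: "Suc (Suc p) = q + 3" using Suc by simp
      have "real (q + 3 choose 3) = fact (q + 3) / (fact 3 * fact q)"
        using binomial_fact[of 3 "q + 3", where 'a=real] by simp
      moreover have "fact (q + 3) = real (q + 1) * real (q + 2) * real (q + 3) * fact q"
        by (simp add: eval_nat_numeral mult_ac)
      ultimately have "real (q + 3 choose 3) = real (q + 1) * real (q + 2) * real (q + 3) * fact q / (6 * fact q)"
        by (simp add: fact_numeral)
      then show ?thesis unfolding e using Suc by (simp add: mult_ac)
    qed simp
    then show ?thesis by (simp add: K_def d)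
  qed
  ultimately show ?thesis by (simp add: c_def I_def p_def mult.assoc)
qed

section \<open>Lebesgue measure in orthonormal coordinates\<close>

lemma nn_integral_lborel_affine:
  fixes f :: "'a::euclidean_space \<Rightarrow> ennreal"
  assumes [measurable]: "f \<in> borel_measurable borel" and c: "c \<noteq> 0"
  shows "(\<integral>\<^sup>+x. f x \<partial>lborel) = ennreal (\<bar>c\<bar> ^ DIM('a)) * (\<integral>\<^sup>+x. f (t + c *\<^sub>R x) \<partial>lborel)"
  by (subst lborel_affine[OF c, of t])
     (simp add: nn_integral_density nn_integral_distr nn_integral_cmult)

text \<open>Uniqueness of Haar measure. In the double integral of 1_A(x) 1_C(y), shift y by x,
  exchange the integrals, shift x by y using the invariance of \<open>\<mu>\<close>, exchange again
  and reflect: the roles of \<open>\<mu>\<close> and \<open>lborel\<close> are swapped.\<close>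

lemma translation_invariant_proportional:
  fixes \<mu> :: "'a::euclidean_space measure"
  assumes sets[measurable_cong]: "sets \<mu> = sets borel" and sf: "sigma_finite_measure \<mu>"
    and inv: "\<And>a. distr \<mu> borel (\<lambda>x. x + a) = \<mu>"
    and [measurable]: "A \<in> sets borel" "C \<in> sets borel"
  shows "emeasure \<mu> A * emeasure lborel C = emeasure lborel A * emeasure \<mu> C"
proof -
  interpret sigma_finite_measure \<mu> by fact
  interpret pair_sigma_finite \<mu> lborel ..
  have "emeasure \<mu> A * emeasure lborel C
      = (\<integral>\<^sup>+x. \<integral>\<^sup>+y. indicator A x * indicator C y \<partial>lborel \<partial>\<mu>)"
    by (simp add: nn_integral_cmult nn_integral_multc)
  also have "\<dots> = (\<integral>\<^sup>+x. \<integral>\<^sup>+y. indicator A x * indicator C (x + y) \<partial>lborel \<partial>\<mu>)"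
  proof (rule nn_integral_cong)
    fix x :: 'a
    show "(\<integral>\<^sup>+y. indicator A x * indicator C y \<partial>lborel)
        = (\<integral>\<^sup>+y. (indicator A x * indicator C (x + y) :: ennreal) \<partial>lborel)"
      by (subst nn_integral_lborel_affine[where c = 1 and t = x]) simp_all
  qed
  also have "\<dots> = (\<integral>\<^sup>+y. \<integral>\<^sup>+x. indicator A x * indicator C (x + y) \<partial>\<mu> \<partial>lborel)"
    by (rule Fubini'[symmetric]) measurable
  also have "\<dots> = (\<integral>\<^sup>+y. \<integral>\<^sup>+x. indicator A (x - y) * indicator C x \<partial>\<mu> \<partial>lborel)"
  proof (rule nn_integral_cong)
    fix y :: 'a
    show "(\<integral>\<^sup>+x. indicator A x * indicator C (x + y) \<partial>\<mu>)
        = (\<integral>\<^sup>+x. (indicator A (x - y) * indicator C x :: ennreal) \<partial>\<mu>)"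
      by (subst (2) inv[of y, symmetric], subst nn_integral_distr) auto
  qed
  also have "\<dots> = (\<integral>\<^sup>+x. \<integral>\<^sup>+y. indicator A (x - y) * indicator C x \<partial>lborel \<partial>\<mu>)"
    by (rule Fubini') measurable
  also have "\<dots> = (\<integral>\<^sup>+x. emeasure lborel A * indicator C x \<partial>\<mu>)"
  proof (rule nn_integral_cong)
    fix x :: 'a
    have "emeasure lborel A = (\<integral>\<^sup>+y. indicator A (x - y) \<partial>lborel)"
      using nn_integral_lborel_affine[where c = "-1" and t = x and f = "indicator A"] by simp
    then show "(\<integral>\<^sup>+y. indicator A (x - y) * indicator C x \<partial>lborel) = emeasure lborel A * indicator C x"
      by (simp add: nn_integral_multc)
  qed
  also have "\<dots> = emeasure lborel A * emeasure \<mu> C"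
    by (simp add: nn_integral_cmult)
  finally show ?thesis .
qed

lemma emeasure_cball_pos_finite:
  "0 < emeasure lborel (cball (0::'a::euclidean_space) 1)" "emeasure lborel (cball (0::'a) 1) < \<infinity>"
proof -
  show "0 < emeasure lborel (cball (0::'a::euclidean_space) 1)"
    by (simp add: emeasure_cball)
  show "emeasure lborel (cball (0::'a) 1) < \<infinity>"
    using emeasure_bounded_finite[of "cball (0::'a) 1"] by simp
qed

lemma translation_invariant_eq_lborel:
  fixes \<mu> :: "'a::euclidean_space measure"
  assumes sets: "sets \<mu> = sets borel" and sf: "sigma_finite_measure \<mu>"
    and inv: "\<And>a. distr \<mu> borel (\<lambda>x. x + a) = \<mu>"
    and ball: "emeasure \<mu> (cball 0 1) = emeasure lborel (cball (0::'a) 1)"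
  shows "\<mu> = lborel"
proof (rule measure_eqI)
  fix A assume "A \<in> sets \<mu>"
  then have A: "A \<in> sets borel" using sets by simp
  have "emeasure \<mu> A * emeasure lborel (cball (0::'a) 1) = emeasure lborel A * emeasure lborel (cball (0::'a) 1)"
    using translation_invariant_proportional[OF sets sf inv A, of "cball 0 1"] ball by simp
  then have "emeasure \<mu> A * emeasure lborel (cball (0::'a) 1) / emeasure lborel (cball (0::'a) 1)
     = emeasure lborel A * emeasure lborel (cball (0::'a) 1) / emeasure lborel (cball (0::'a) 1)"
    by simp
  then show "emeasure \<mu> A = emeasure lborel A"
    using emeasure_cball_pos_finite[where 'a='a] by (simp add: ennreal_mult_divide_eq)
qed (simp add: sets)

lemma distr_lborel_linear_translation_invariant:
  fixes T :: "'a::euclidean_space \<Rightarrow> 'b::euclidean_space"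
  assumes T: "linear T" "surj T"
  shows "distr (distr lborel borel T) borel (\<lambda>x. x + a) = distr lborel borel T"
proof -
  have [measurable]: "T \<in> borel_measurable borel"
    using T(1) by (intro borel_measurable_continuous_onI linear_continuous_on linear_linear[THEN iffD2])
  obtain b where b: "a = T b" using T(2) by (auto simp: surj_def)
  have sh: "lborel = distr lborel borel (\<lambda>x. b + x)"
    using lborel_affine[of 1 b] by (simp add: density_1)
  have "distr (distr lborel borel T) borel (\<lambda>x. x + a) = distr lborel borel (\<lambda>x. T (b + x))"
    by (subst distr_distr) (auto simp: comp_def b linear_add[OF T(1)] add.commute)
  also have "\<dots> = distr (distr lborel borel (\<lambda>x. b + x)) borel T"
    by (subst distr_distr) (auto simp: comp_def)
  finally show ?thesis using sh by simp
qed

lemma sigma_finite_measure_cball: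
  fixes \<mu> :: "'a::euclidean_space measure"
  assumes "sets \<mu> = sets borel" and "\<And>n::nat. emeasure \<mu> (cball 0 (real n)) \<noteq> \<infinity>"
  shows "sigma_finite_measure \<mu>"
proof (rule sigma_finite_measure.intro, intro exI conjI)
  show "countable (range (\<lambda>n::nat. cball (0::'a) (real n)))" by simp
  show "range (\<lambda>n::nat. cball (0::'a) (real n)) \<subseteq> sets \<mu>" unfolding assms(1) by auto
  show "\<Union> (range (\<lambda>n::nat. cball (0::'a) (real n))) = space \<mu>"
  proof -
    have "space \<mu> = UNIV" using sets_eq_imp_space_eq[OF assms(1)] by simp
    moreover have "x \<in> (\<Union>n::nat. cball (0::'a) (real n))" for x :: 'a
      using real_arch_simple[of "norm x"] by simp
    ultimately show ?thesis by blast
  qed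
  show "\<forall>a\<in>range (\<lambda>n::nat. cball (0::'a) (real n)). emeasure \<mu> a \<noteq> \<infinity>"
    using assms(2) by blast
qed

text \<open>\<open>c\<close> is 1/|det T|, obtained from uniqueness of Haar measure: the image of
  \<open>lborel\<close> under \<open>T\<close> is translation invariant, and finite on balls since
  an injective linear map is bounded below, so it is a multiple of \<open>lborel\<close>.\<close>

lemma emeasure_lborel_linear_vimage:
  fixes T :: "'a::euclidean_space \<Rightarrow> 'a"
  assumes T: "linear T" "inj T"
  obtains c :: real where "0 \<le> c"
    "\<And>A. A \<in> sets borel \<Longrightarrow> emeasure lborel (T -` A) = ennreal c * emeasure lborel A"
proof -
  have sj: "surj T" using T linear_injective_imp_surjective by blast
  have m[measurable]: "T \<in> borel_measurable borel"
    using T by (intro borel_measurable_continuous_onI linear_continuous_on linear_linear[THEN iffD2])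
  obtain k where k: "k > 0" "\<And>x. k * norm x \<le> norm (T x)"
    using linear_inj_bounded_below_pos[OF T] by (metis mult.commute)
  have fin: "emeasure (distr lborel borel T) (cball 0 r) < \<infinity>" for r
  proof -
    have "T -` cball 0 r \<subseteq> cball 0 (r / k)"
      using k by (auto simp: field_simps) (metis order_trans mult.commute)
    then have "emeasure lborel (T -` cball 0 r) \<le> emeasure lborel (cball (0::'a) (r / k))"
      by (intro emeasure_mono) auto
    also have "\<dots> < \<infinity>" by (rule emeasure_bounded_finite) simp
    finally show ?thesis by (simp add: emeasure_distr)
  qed
  have sf: "sigma_finite_measure (distr lborel borel T)"
    using fin by (intro sigma_finite_measure_cball) (auto simp: less_top)
  define C where "C = emeasure (distr lborel borel T) (cball 0 1) / emeasure lborel (cball (0::'a) 1)"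
  have CC: "C < \<infinity>"
    using fin[of 1] emeasure_cball_pos_finite[where 'a='a] unfolding C_def
    by (metis ennreal_divide_eq_top_iff infinity_ennreal_def less_irrefl less_top)
  show ?thesis
  proof (rule that[of "enn2real C"])
    fix A :: "'a set" assume A: "A \<in> sets borel"
    have "emeasure (distr lborel borel T) A * emeasure lborel (cball (0::'a) 1)
       = emeasure lborel A * emeasure (distr lborel borel T) (cball 0 1)"
      by (intro translation_invariant_proportional sf A distr_lborel_linear_translation_invariant T sj) auto
    moreover have "emeasure (distr lborel borel T) A
       = emeasure (distr lborel borel T) A * emeasure lborel (cball (0::'a) 1) / emeasure lborel (cball (0::'a) 1)"
      using emeasure_cball_pos_finite[where 'a='a] by (subst ennreal_mult_divide_eq) auto
    ultimately have "emeasure (distr lborel borel T) A = C * emeasure lborel A"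
      unfolding C_def by (simp add: ennreal_times_divide mult.commute)
    then show "emeasure lborel (T -` A) = ennreal (enn2real C) * emeasure lborel A"
      using CC A by (simp add: emeasure_distr less_top)
  qed simp
qed

text \<open>The image is a multiple of \<open>lborel\<close> by translation invariance, and the
  factor is 1 because \<open>T\<close> preserves the unit ball.\<close>

lemma distr_lborel_orthogonal:
  fixes T :: "'a::euclidean_space \<Rightarrow> 'a"
  assumes T: "orthogonal_transformation T"
  shows "distr lborel borel T = lborel"
proof (rule translation_invariant_eq_lborel)
  have lin: "linear T" and sj: "surj T" and inj: "inj T"
    using T orthogonal_transformation_linear orthogonal_transformation_surj orthogonal_transformation_inj
    by blast+
  have m[measurable]: "T \<in> borel_measurable borel"
    using lin by (intro borel_measurable_continuous_onI linear_continuous_on linear_linear[THEN iffD2])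
  show "distr (distr lborel borel T) borel (\<lambda>x. x + a) = distr lborel borel T" for a
    by (rule distr_lborel_linear_translation_invariant[OF lin sj])
  have em: "emeasure (distr lborel borel T) (cball 0 r) = emeasure lborel (cball (0::'a) r)" for r
  proof -
    have "T -` cball 0 r = cball 0 r"
      using T by (auto simp: orthogonal_transformation_norm)
    then show ?thesis by (simp add: emeasure_distr)
  qed
  show "sigma_finite_measure (distr lborel borel T)"
  proof (rule sigma_finite_measure_cball)
    show "emeasure (distr lborel borel T) (cball 0 (real n)) \<noteq> \<infinity>" for n
      using emeasure_bounded_finite[of "cball (0::'a) (real n)"] by (simp add: em less_top)
  qed simp
  show "emeasure (distr lborel borel T) (cball 0 1) = emeasure lborel (cball (0::'a) 1)"
    by (rule em)
qed simp

interpretation lborel_PiM: product_sigma_finite "\<lambda>_. lborel :: real measure"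
  by standard

lemma distr_PiM_lborel_shift:
  assumes "finite B"
  shows "distr (\<Pi>\<^sub>M b\<in>B. (lborel::real measure)) (\<Pi>\<^sub>M b\<in>B. lborel) (\<lambda>f. \<lambda>b\<in>B. f b + a b) = (\<Pi>\<^sub>M b\<in>B. lborel)"
    (is "distr ?M ?M ?g = ?M")
proof (rule lborel_PiM.PiM_eqI[OF assms])
  fix A :: "'a \<Rightarrow> real set" assume A: "\<And>i. i \<in> B \<Longrightarrow> A i \<in> sets lborel"
  have [measurable]: "?g \<in> measurable ?M ?M"
    by (intro measurable_restrict) measurable
  have "?g -` Pi\<^sub>E B A \<inter> space ?M = (\<Pi>\<^sub>E b\<in>B. (\<lambda>x. x + a b) -` A b)"
    by (auto simp: space_PiM PiE_def Pi_def)
  moreover have m: "(\<lambda>x. x + a b) -` A b \<in> sets lborel" if "b \<in> B" for b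
    using measurable_sets[of "\<lambda>x. x + a b" borel borel "A b"] A[OF that] by simp
  ultimately have "emeasure (distr ?M ?M ?g) (Pi\<^sub>E B A) = (\<Prod>b\<in>B. emeasure lborel ((\<lambda>x. x + a b) -` A b))"
    using A assms by (simp add: emeasure_distr sets_PiM_I_finite lborel_PiM.emeasure_PiM)
  also have "\<dots> = (\<Prod>b\<in>B. emeasure lborel (A b))"
  proof (rule prod.cong[OF refl])
    fix b assume "b \<in> B"
    have "emeasure lborel (A b) = emeasure (distr lborel borel (\<lambda>x. a b + x)) (A b)"
      using lborel_affine[of 1 "a b"] by (simp add: density_1)
    then show "emeasure lborel ((\<lambda>x. x + a b) -` A b) = emeasure lborel (A b)"
      using A[OF \<open>b \<in> B\<close>] by (simp add: emeasure_distr add.commute)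
  qed
  finally show "emeasure (distr ?M ?M ?g) (Pi\<^sub>E B A) = (\<Prod>b\<in>B. emeasure lborel (A b))" .
qed simp

text \<open>Homogeneity of degree \<open>card B\<close>, checked on boxes, where each coordinate
  contributes one factor \<open>r\<close>. The restriction to \<open>B\<close> keeps the scaled
  family inside the product space, whose members are \<open>undefined\<close> off
  \<open>B\<close>.\<close>

lemma nn_integral_PiM_lborel_scale:
  assumes "finite B" and r: "0 < r" and F: "F \<in> borel_measurable (\<Pi>\<^sub>M b\<in>B. (lborel::real measure))"
  shows "(\<integral>\<^sup>+f. F f \<partial>(\<Pi>\<^sub>M b\<in>B. lborel))
       = ennreal (r ^ card B) * (\<integral>\<^sup>+f. F (\<lambda>b\<in>B. r * f b) \<partial>(\<Pi>\<^sub>M b\<in>B. (lborel::real measure)))"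
    (is "integral\<^sup>N ?M F = _")
proof -
  define g where "g = (\<lambda>f::'a \<Rightarrow> real. \<lambda>b\<in>B. r * f b)"
  have [measurable]: "g \<in> measurable ?M ?M"
    unfolding g_def by (intro measurable_restrict) measurable
  have "?M = density (distr ?M ?M g) (\<lambda>_. ennreal (r ^ card B))"
  proof (rule lborel_PiM.PiM_eqI[OF assms(1), symmetric])
    fix A :: "'a \<Rightarrow> real set" assume A: "\<And>i. i \<in> B \<Longrightarrow> A i \<in> sets lborel"
    have AA: "Pi\<^sub>E B A \<in> sets ?M" using A assms by (simp add: sets_PiM_I_finite)
    have "g -` Pi\<^sub>E B A \<inter> space ?M = (\<Pi>\<^sub>E b\<in>B. (\<lambda>x. r * x) -` A b)"
      by (auto simp: space_PiM PiE_def Pi_def g_def)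
    moreover have m: "(\<lambda>x. r * x) -` A b \<in> sets lborel" if "b \<in> B" for b
      using measurable_sets[of "\<lambda>x. r * x" borel borel "A b"] A[OF that] by simp
    ultimately have "emeasure (distr ?M ?M g) (Pi\<^sub>E B A) = (\<Prod>b\<in>B. emeasure lborel ((\<lambda>x. r * x) -` A b))"
      using A assms by (simp add: emeasure_distr sets_PiM_I_finite lborel_PiM.emeasure_PiM)
    then have "emeasure (density (distr ?M ?M g) (\<lambda>_. ennreal (r ^ card B))) (Pi\<^sub>E B A)
        = (\<Prod>b\<in>B. ennreal r) * (\<Prod>b\<in>B. emeasure lborel ((\<lambda>x. r * x) -` A b))"
      using AA r by (simp add: emeasure_density nn_integral_cmult ennreal_power)
    also have "\<dots> = (\<Prod>b\<in>B. ennreal r * emeasure lborel ((\<lambda>x. r * x) -` A b))"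
      by (simp add: prod.distrib)
    also have "\<dots> = (\<Prod>b\<in>B. emeasure lborel (A b))"
    proof (rule prod.cong[OF refl])
      fix b assume b: "b \<in> B"
      have "emeasure lborel (A b) = emeasure (density (distr lborel borel (\<lambda>x. 0 + r *\<^sub>R x)) (\<lambda>_. \<bar>r\<bar>^DIM(real))) (A b)"
        using lborel_affine[of r "0::real"] r by simp
      also have "\<dots> = ennreal r * emeasure lborel ((\<lambda>x. r * x) -` A b)"
        using A[OF b] r by (simp add: emeasure_density nn_integral_cmult emeasure_distr)
      finally show "ennreal r * emeasure lborel ((\<lambda>x. r * x) -` A b) = emeasure lborel (A b)" by simp
    qed
    finally show "emeasure (density (distr ?M ?M g) (\<lambda>_. ennreal (r ^ card B))) (Pi\<^sub>E B A) = (\<Prod>b\<in>B. emeasure lborel (A b))" .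
  qed simp
  then have "integral\<^sup>N ?M F = integral\<^sup>N (density (distr ?M ?M g) (\<lambda>_. ennreal (r ^ card B))) F"
    by simp
  also have "\<dots> = ennreal (r ^ card B) * (\<integral>\<^sup>+f. F (g f) \<partial>?M)"
    using F by (simp add: nn_integral_density nn_integral_distr nn_integral_cmult)
  finally show ?thesis by (simp add: g_def)
qed

lemma orthonormal_basis_of_facts:
  fixes B :: "'a::euclidean_space set"
  assumes "orthonormal_basis_of L B"
  shows "finite B" "independent B" "card B = dim L" "span B = L"
    "\<And>b c. b \<in> B \<Longrightarrow> c \<in> B \<Longrightarrow> b \<bullet> c = (if b = c then 1 else 0)"
proof -
  from assms have o: "pairwise orthogonal B" "\<And>b. b \<in> B \<Longrightarrow> norm b = 1" and s: "span B = L"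
    by (auto simp: orthonormal_basis_of_def)
  have "0 \<notin> B" using o(2) by force
  with o(1) show ind: "independent B" by (rule pairwise_orthogonal_independent)
  then show "finite B" by (simp add: independent_imp_finite)
  show "card B = dim L" using ind s dim_span_eq_card_independent[of B] by simp
  show "span B = L" by fact
  show "b \<bullet> c = (if b = c then 1 else 0)" if "b \<in> B" "c \<in> B" for b c
    using o that by (auto simp: pairwise_def orthogonal_def norm_eq_1)
qed

lemma inner_orthonormal_sum:
  assumes "orthonormal_basis_of L B" "c \<in> B"
  shows "(\<Sum>b\<in>B. f b *\<^sub>R b) \<bullet> c = f c"
  using orthonormal_basis_of_facts[OF assms(1)] assms(2)
  by (simp add: inner_sum_left if_distrib[of "\<lambda>x. _ * x"] cong: if_cong)

lemma norm_orthonormal_sum: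
  assumes "orthonormal_basis_of L B"
  shows "(norm (\<Sum>b\<in>B. f b *\<^sub>R b))\<^sup>2 = (\<Sum>b\<in>B. (f b)\<^sup>2)"
proof -
  have "(norm (\<Sum>b\<in>B. f b *\<^sub>R b))\<^sup>2 = (\<Sum>c\<in>B. f c * ((\<Sum>b\<in>B. f b *\<^sub>R b) \<bullet> c))"
    by (simp add: power2_norm_eq_inner inner_sum_right)
  then show ?thesis
    using inner_orthonormal_sum[OF assms] by (simp add: power2_eq_square)
qed

lemma measurable_basis_sum[measurable]:
  fixes B :: "'a::euclidean_space set"
  shows "(\<lambda>f. \<Sum>b\<in>B. f b *\<^sub>R b) \<in> borel_measurable (\<Pi>\<^sub>M b\<in>B. (lborel::real measure))"
proof (intro borel_measurable_sum borel_measurable_scaleR borel_measurable_const)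
  fix b assume "b \<in> B"
  then show "(\<lambda>f. f b) \<in> borel_measurable (\<Pi>\<^sub>M b\<in>B. (lborel::real measure))"
    using measurable_component_singleton[of b B "\<lambda>_. lborel::real measure"] by simp
qed

lemma emeasure_orthonormal_cball:
  assumes B: "orthonormal_basis_of L B" and "0 < r"
  shows "emeasure (distr (\<Pi>\<^sub>M b\<in>B. (lborel::real measure)) borel (\<lambda>f. \<Sum>b\<in>B. f b *\<^sub>R b)) (cball 0 r)
    = ennreal (unit_ball_vol (real (card B)) * r ^ card B)"
proof -
  have "(\<lambda>f. \<Sum>b\<in>B. f b *\<^sub>R b) -` cball 0 r \<inter> space (\<Pi>\<^sub>M b\<in>B. (lborel::real measure))
     = {f. sqrt (\<Sum>i\<in>B. (f i)\<^sup>2) \<le> r} \<inter> space (\<Pi>\<^sub>M b\<in>B. (lborel::real measure))"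
    using norm_orthonormal_sum[OF B, symmetric] by auto
  then show ?thesis
    using emeasure_cball_aux[OF orthonormal_basis_of_facts(1)[OF B] \<open>0 < r\<close>]
    by (simp add: emeasure_distr)
qed

text \<open>Orthonormal coordinates preserve the norm, so the image measure gives the unit ball its
  usual volume; translation invariance does the rest. This makes the choice of basis in
  \<open>subspace_lborel\<close> harmless on the whole space.\<close>

lemma lborel_eq_orthonormal:
  fixes B :: "'a::euclidean_space set"
  assumes B: "orthonormal_basis_of UNIV B"
  shows "distr (\<Pi>\<^sub>M b\<in>B. (lborel::real measure)) borel (\<lambda>f. \<Sum>b\<in>B. f b *\<^sub>R b) = lborel"
    (is "distr ?M borel ?s = _")
proof (rule translation_invariant_eq_lborel)
  note fin = orthonormal_basis_of_facts(1)[OF B]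
  have card: "card B = DIM('a)" using orthonormal_basis_of_facts(3)[OF B] by simp
  have ball: "emeasure (distr ?M borel ?s) (cball 0 r) = emeasure lborel (cball (0::'a) r)" if "0 < r" for r
    using emeasure_orthonormal_cball[OF B that] that by (simp add: emeasure_cball card)
  show "emeasure (distr ?M borel ?s) (cball 0 1) = emeasure lborel (cball (0::'a) 1)"
    by (rule ball) simp
  show "sigma_finite_measure (distr ?M borel ?s)"
  proof (rule sigma_finite_measure_cball)
    fix n :: nat
    have "emeasure (distr ?M borel ?s) (cball 0 (real n)) \<le> emeasure (distr ?M borel ?s) (cball 0 (real n + 1))"
      by (intro emeasure_mono) auto
    also have "\<dots> < \<infinity>"
      using emeasure_bounded_finite[of "cball (0::'a) (real n + 1)"] by (subst ball) simp_all
    finally show "emeasure (distr ?M borel ?s) (cball 0 (real n)) \<noteq> \<infinity>" by simp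
  qed simp
  fix a :: 'a
  have "a \<in> span B" using B by (simp add: orthonormal_basis_of_def)
  then obtain k where k: "a = (\<Sum>b\<in>B. k b *\<^sub>R b)"
    using fin by (auto simp: span_finite)
  define g where "g = (\<lambda>f::'a \<Rightarrow> real. \<lambda>b\<in>B. f b + k b)"
  have [measurable]: "g \<in> measurable ?M ?M"
    unfolding g_def by (intro measurable_restrict) measurable
  have "distr (distr ?M borel ?s) borel (\<lambda>x. x + a) = distr ?M borel (\<lambda>f. ?s f + a)"
    by (subst distr_distr) (auto simp: comp_def)
  also have "(\<lambda>f. ?s f + a) = ?s \<circ> g"
    by (auto simp: fun_eq_iff g_def k scaleR_add_left sum.distrib)
  also have "distr ?M borel (?s \<circ> g) = distr (distr ?M ?M g) borel ?s"
    by (subst distr_distr) auto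
  also have "distr ?M ?M g = ?M"
    unfolding g_def by (rule distr_PiM_lborel_shift[OF fin])
  finally show "distr (distr ?M borel ?s) borel (\<lambda>x. x + a) = distr ?M borel ?s" .
qed simp

section \<open>Splitting Lebesgue measure along given directions\<close>

lemma orthonormal_basis_of_exists:
  assumes "subspace L" shows "\<exists>B. orthonormal_basis_of L B"
proof -
  obtain B where "pairwise orthogonal B" "\<And>x. x \<in> B \<Longrightarrow> norm x = 1" "span B = L"
    using orthonormal_basis_subspace[OF assms] by blast
  then show ?thesis unfolding orthonormal_basis_of_def by blast
qed

lemma orthonormal_basis_of_insert:
  fixes u :: "'a::euclidean_space"
  assumes "norm u = 1" "orthonormal_basis_of L B" "\<And>x. x \<in> L \<Longrightarrow> x \<bullet> u = 0"
  shows "u \<notin> B" "orthonormal_basis_of (span (insert u L)) (insert u B)"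
proof -
  have BL: "B \<subseteq> L" using assms(2) span_superset by (auto simp: orthonormal_basis_of_def)
  show "u \<notin> B" using assms(1,3) BL by (auto simp: norm_eq_1 dest: subsetD)
  have "span (insert u B) = span (insert u L)"
  proof -
    have L: "L = span B" using assms(2) by (simp add: orthonormal_basis_of_def)
    have "span B = span L" unfolding L by (simp only: span_span)
    then show ?thesis by (simp add: span_insert)
  qed
  moreover have "pairwise orthogonal (insert u B)"
    using assms BL unfolding orthonormal_basis_of_def
    by (auto simp: pairwise_insert orthogonal_def inner_commute subset_iff)
  ultimately show "orthonormal_basis_of (span (insert u L)) (insert u B)"
    using assms by (auto simp: orthonormal_basis_of_def)
qed

lemma orthogonal_complement_span:
  fixes u :: "'a::euclidean_space"
  shows "span (insert u {x. x \<bullet> u = 0}) = UNIV" "subspace {x. x \<bullet> u = 0}"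
proof -
  show s: "subspace {x. x \<bullet> u = 0}" by (auto simp: subspace_def inner_left_distrib)
  have "x \<in> span (insert u {x. x \<bullet> u = 0})" for x
  proof (cases "u = 0")
    case False
    have "x - ((x \<bullet> u) / (u \<bullet> u)) *\<^sub>R u \<in> {x. x \<bullet> u = 0}"
      using False by (simp add: inner_diff_left)
    then show ?thesis unfolding span_insert by (auto intro: span_base)
  qed (auto intro: span_base)
  then show "span (insert u {x. x \<bullet> u = 0}) = UNIV" by auto
qed

lemma nn_integral_lborel_split:
  fixes u :: "'a::euclidean_space"
  assumes u: "norm u = 1" and B: "orthonormal_basis_of {x. x \<bullet> u = 0} B"
    and [measurable]: "F \<in> borel_measurable borel"
  shows "(\<integral>\<^sup>+x. F x \<partial>lborel) =
    (\<integral>\<^sup>+f. \<integral>\<^sup>+s. F (s *\<^sub>R u + (\<Sum>b\<in>B. f b *\<^sub>R b)) \<partial>lborel \<partial>(\<Pi>\<^sub>M b\<in>B. (lborel::real measure)))"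
proof -
  have ins: "u \<notin> B" "orthonormal_basis_of UNIV (insert u B)"
    using orthonormal_basis_of_insert[OF u B] orthogonal_complement_span[of u] by auto
  have fin: "finite B" using orthonormal_basis_of_facts(1)[OF B] .
  have "(\<integral>\<^sup>+x. F x \<partial>lborel) = (\<integral>\<^sup>+x. F x \<partial>distr (\<Pi>\<^sub>M b\<in>insert u B. (lborel::real measure)) borel (\<lambda>f. \<Sum>b\<in>insert u B. f b *\<^sub>R b))"
    by (simp only: lborel_eq_orthonormal[OF ins(2)])
  also have "\<dots> = (\<integral>\<^sup>+f. F (\<Sum>b\<in>insert u B. f b *\<^sub>R b) \<partial>(\<Pi>\<^sub>M b\<in>insert u B. (lborel::real measure)))"
    by (subst nn_integral_distr) auto
  also have "\<dots> = (\<integral>\<^sup>+f. \<integral>\<^sup>+s. F (\<Sum>b\<in>insert u B. (f(u := s)) b *\<^sub>R b) \<partial>lborel \<partial>(\<Pi>\<^sub>M b\<in>B. (lborel::real measure)))"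
    by (rule lborel_PiM.product_nn_integral_insert[OF fin ins(1)]) measurable
  also have "\<dots> = (\<integral>\<^sup>+f. \<integral>\<^sup>+s. F (s *\<^sub>R u + (\<Sum>b\<in>B. f b *\<^sub>R b)) \<partial>lborel \<partial>(\<Pi>\<^sub>M b\<in>B. (lborel::real measure)))"
  proof (intro nn_integral_cong arg_cong[where f=F])
    fix f :: "'a \<Rightarrow> real" and s :: real
    have "(\<Sum>b\<in>B. (f(u := s)) b *\<^sub>R b) = (\<Sum>b\<in>B. f b *\<^sub>R b)"
      by (rule sum.cong) (use ins in auto)
    then show "(\<Sum>b\<in>insert u B. (f(u := s)) b *\<^sub>R b) = s *\<^sub>R u + (\<Sum>b\<in>B. f b *\<^sub>R b)"
      using ins fin by simp
  qed
  finally show ?thesis .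
qed

text \<open>Both sides are integrals of f against measures in the variable s, and these agree on
  intervals, where the fundamental theorem turns the weight into a difference of tangents.\<close>

lemma nn_integral_tan:
  fixes f :: "real \<Rightarrow> ennreal"
  assumes [measurable]: "f \<in> borel_measurable borel"
  shows "(\<integral>\<^sup>+s. f s \<partial>lborel) =
    (\<integral>\<^sup>+t. indicator {-pi/2<..<pi/2} t * ennreal (inverse ((cos t)\<^sup>2)) * f (tan t) \<partial>lborel)"
proof -
  define w where "w = (\<lambda>t::real. indicator {-pi/2<..<pi/2} t * ennreal (inverse ((cos t)\<^sup>2)))"
  have [measurable]: "w \<in> borel_measurable borel" unfolding w_def by measurable
  have [measurable]: "(tan :: real \<Rightarrow> real) \<in> borel_measurable borel" unfolding tan_def by measurable
  have "lborel = distr (density lborel w) borel tan"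
  proof (rule lborel_eqI)
    fix l u :: real assume "\<And>b. b \<in> Basis \<Longrightarrow> l \<bullet> b \<le> u \<bullet> b"
    then have lu: "l \<le> u" by simp
    have set: "t \<in> {-pi/2<..<pi/2} \<and> tan t \<in> box l u \<longleftrightarrow> t \<in> {arctan l<..<arctan u}" for t
    proof (cases "t \<in> {-pi/2<..<pi/2}")
      case True
      then have "arctan (tan t) = t" by (intro arctan_tan) auto
      then show ?thesis using True arctan_less_iff[of l "tan t"] arctan_less_iff[of "tan t" u]
        by (simp add: box_real)
    qed (use arctan_bounded[of l] arctan_bounded[of u] in auto)
    have "emeasure (distr (density lborel w) borel tan) (box l u)
      = (\<integral>\<^sup>+t. w t * indicator (tan -` box l u) t \<partial>lborel)"
      using measurable_sets_borel[of tan borel "box l u"] by (simp add: emeasure_distr emeasure_density)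
    also have "\<dots> = (\<integral>\<^sup>+t. ennreal (inverse ((cos t)\<^sup>2)) * indicator {arctan l<..<arctan u} t \<partial>lborel)"
      using set by (intro nn_integral_cong) (auto simp: w_def indicator_def)
    also have "\<dots> = (\<integral>\<^sup>+t. ennreal (inverse ((cos t)\<^sup>2)) * indicator {arctan l..arctan u} t \<partial>lborel)"
    proof (rule nn_integral_cong_AE)
      show "AE t in lborel. ennreal (inverse ((cos t)\<^sup>2)) * indicator {arctan l<..<arctan u} t
          = ennreal (inverse ((cos t)\<^sup>2)) * indicator {arctan l..arctan u} t"
        using AE_lborel_singleton[of "arctan l"] AE_lborel_singleton[of "arctan u"]
        by eventually_elim (auto simp: indicator_def)
    qed
    also have "\<dots> = ennreal (tan (arctan u) - tan (arctan l))"
    proof (rule nn_integral_FTC_Icc)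
      show "arctan l \<le> arctan u" using lu by (simp add: arctan_le_iff)
      fix t assume "t \<in> {arctan l..arctan u}"
      then have "cos t > 0" using arctan_bounded[of l] arctan_bounded[of u] by (intro cos_gt_zero_pi) auto
      then show "DERIV tan t :> inverse ((cos t)\<^sup>2)" by (intro DERIV_tan) auto
    qed auto
    finally show "emeasure (distr (density lborel w) borel tan) (box l u) = ennreal (\<Prod>b\<in>Basis. (u - l) \<bullet> b)"
      by (simp add: tan_arctan)
  qed simp
  then have "(\<integral>\<^sup>+s. f s \<partial>lborel) = (\<integral>\<^sup>+s. f s \<partial>distr (density lborel w) borel tan)" by simp
  also have "\<dots> = (\<integral>\<^sup>+t. w t * f (tan t) \<partial>lborel)"
    by (simp add: nn_integral_distr nn_integral_density)
  finally show ?thesis by (simp add: w_def)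
qed

section \<open>The uniform distribution on the ball\<close>

definition ball_measure :: "'a::euclidean_space measure" where
  "ball_measure = uniform_measure lborel (cball 0 1)"

lemma sets_ball_measure[measurable_cong, simp]: "sets ball_measure = sets borel"
  and space_ball_measure[simp]: "space ball_measure = UNIV"
  by (simp_all add: ball_measure_def)

lemma prob_space_ball_measure: "prob_space (ball_measure :: 'a::euclidean_space measure)"
  unfolding ball_measure_def
  by (rule prob_space_uniform_measure) (use emeasure_cball_pos_finite[where 'a='a] in auto)

lemma nn_integral_ball_measure:
  fixes f :: "'a::euclidean_space \<Rightarrow> ennreal"
  assumes [measurable]: "f \<in> borel_measurable borel"
  shows "(\<integral>\<^sup>+x. f x \<partial>ball_measure) = (\<integral>\<^sup>+x. f x * indicator (cball 0 1) x \<partial>lborel) / emeasure lborel (cball (0::'a) 1)"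
  unfolding ball_measure_def by (rule nn_integral_uniform_measure) auto

lemma AE_ball_measure:
  assumes "AE x in lborel. P x" shows "AE x in ball_measure. P x"
  using assms emeasure_cball_pos_finite[where 'a='a] unfolding ball_measure_def
  by (intro AE_uniform_measureI) auto

lemma distr_ball_measure_orthogonal:
  fixes T :: "'a::euclidean_space \<Rightarrow> 'a"
  assumes T: "orthogonal_transformation T"
  shows "distr ball_measure borel T = ball_measure"
proof (rule measure_eqI)
  have lin: "linear T"
    using T orthogonal_transformation_linear by blast
  have m[measurable]: "T \<in> borel_measurable borel"
    using lin by (intro borel_measurable_continuous_onI linear_continuous_on linear_linear[THEN iffD2])
  fix A assume "A \<in> sets (distr (ball_measure :: 'a measure) borel T)"
  then have A[measurable]: "A \<in> sets borel" by simp
  have "emeasure lborel (cball 0 1 \<inter> A) = emeasure (distr lborel borel T) (cball 0 1 \<inter> A)"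
    by (simp add: distr_lborel_orthogonal[OF T])
  also have "\<dots> = emeasure lborel (T -` (cball 0 1 \<inter> A))"
    by (subst emeasure_distr) auto
  also have "T -` (cball 0 1 \<inter> A) = cball 0 1 \<inter> T -` A"
    using T by (auto simp: orthogonal_transformation_norm)
  finally show "emeasure (distr ball_measure borel T) A = emeasure ball_measure A"
    by (simp add: ball_measure_def emeasure_distr emeasure_uniform_measure measurable_sets_borel[OF m A])
qed simp

text \<open>Outside [-1, 1] the value of \<open>arccos\<close> is a definite description of an empty
  predicate, hence always the same constant, here \<open>arccos 2\<close>. Inside it is
  continuous.\<close>

lemma measurable_arccos[measurable]: "(arccos :: real \<Rightarrow> real) \<in> borel_measurable borel"
proof -
  have "arccos y = (if y \<in> {-1..1} then arccos y else arccos 2)" for y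
  proof (cases "y \<in> {-1..1}")
    case False
    then have "(\<lambda>x. 0 \<le> x \<and> x \<le> pi \<and> cos x = y) = (\<lambda>x. 0 \<le> x \<and> x \<le> pi \<and> cos x = 2)"
    proof (intro ext)
      fix x show "(0 \<le> x \<and> x \<le> pi \<and> cos x = y) = (0 \<le> x \<and> x \<le> pi \<and> cos x = 2)"
      proof -
        have "cos x \<noteq> y" using False cos_le_one[of x] cos_ge_minus_one[of x] by force
        moreover have "cos x \<noteq> 2" using cos_le_one[of x] by linarith
        ultimately show ?thesis by simp
      qed
    qed
    then show ?thesis using False by (simp add: arccos_def)
  qed simp
  moreover have "(\<lambda>y::real. if y \<in> {-1..1} then arccos y else arccos 2) \<in> borel_measurable borel"
    by (intro borel_measurable_continuous_on_if continuous_on_arccos') (auto intro: continuous_on_const)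
  ultimately show ?thesis by presburger
qed

text \<open>Since \<open>G\<close> depends only on the direction of the orthogonal projection \<open>y\<close> to \<open>u\<^sup>\<bottom>\<close>, substituting
  \<open>x = r tan t u + y\<close> with \<open>r = norm y\<close> separates the two integrations.\<close>

lemma nn_integral_angle_split:
  fixes u :: "'a::euclidean_space" and G :: "'a \<Rightarrow> ennreal"
  assumes u: "norm u = 1" and D: "DIM('a) \<ge> 2"
    and [measurable]: "G \<in> borel_measurable borel"
    and G1: "\<And>s x. G (s *\<^sub>R u + x) = G x" and G2: "\<And>r x. r > 0 \<Longrightarrow> G (r *\<^sub>R x) = G x"
  obtains K where "\<And>\<phi>. \<phi> \<in> borel_measurable borel \<Longrightarrow> (\<integral>\<^sup>+x. \<phi> (arccos ((u \<bullet> x) / norm x)) * G x \<partial>ball_measure)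
      = K * (\<integral>\<^sup>+t. \<phi> t * ennreal (sin t ^ (DIM('a) - 2)) * indicator {0..pi} t \<partial>lborel)"
proof -
  obtain B where B: "orthonormal_basis_of {x. x \<bullet> u = 0} B"
    using orthonormal_basis_of_exists orthogonal_complement_span(2) by blast
  note Bf = orthonormal_basis_of_facts[OF B]
  have Bu: "b \<bullet> u = 0" if "b \<in> B" for b
    using Bf(4) that span_base[of b B] by auto
  have cardB: "card B = DIM('a) - 1"
  proof -
    have "u \<noteq> 0" using u by auto
    then show ?thesis using Bf(3) dim_hyperplane[of u] by (simp add: inner_commute)
  qed
  then have Bne: "B \<noteq> {}" using D by auto
  define N where "N = (\<Pi>\<^sub>M b\<in>B. (lborel::real measure))"
  define y where "y = (\<lambda>f::'a \<Rightarrow> real. \<Sum>b\<in>B. f b *\<^sub>R b)"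
  have [measurable]: "y \<in> borel_measurable N" unfolding y_def N_def by (rule measurable_basis_sum)
  have sfN: "sigma_finite_measure N" unfolding N_def
    by (rule lborel_PiM.sigma_finite[OF Bf(1)])
  have yu: "y f \<bullet> u = 0" for f using Bu by (simp add: y_def inner_sum_left)
  have nsu: "(norm (s *\<^sub>R u + y f))\<^sup>2 = s\<^sup>2 + (norm (y f))\<^sup>2" for s f
    using u yu[of f] by (simp add: norm_eq_1 power2_norm_eq_inner inner_add_left inner_add_right inner_commute) (simp add: power2_eq_square)
  have isu: "u \<bullet> (s *\<^sub>R u + y f) = s" for s f
    using u yu[of f] by (simp add: norm_eq_1 inner_add_right inner_commute)
  have yfold: "(\<Sum>b\<in>B. f b *\<^sub>R b) = y f" for f by (simp add: y_def)
  have yr: "y (\<lambda>b\<in>B. r * f b) = r *\<^sub>R y f" for r f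
    by (simp add: y_def scaleR_sum_right)
  have ynz: "AE f in N. y f \<noteq> 0"
  proof -
    have "{f \<in> space N. y f = 0} \<subseteq> (\<Pi>\<^sub>E b\<in>B. {0})"
    proof
      fix f assume f: "f \<in> {f \<in> space N. y f = 0}"
      then have "f b = 0" if "b \<in> B" for b
        using inner_orthonormal_sum[OF B that, of f] by (simp add: y_def)
      with f show "f \<in> (\<Pi>\<^sub>E b\<in>B. {0})" by (auto simp: N_def space_PiM PiE_def extensional_def fun_eq_iff)
    qed
    moreover have "emeasure N (\<Pi>\<^sub>E b\<in>B. {0}) = 0"
      unfolding N_def using Bf(1) Bne by (subst lborel_PiM.emeasure_PiM) auto
    moreover have "(\<Pi>\<^sub>E b\<in>B. {0}) \<in> sets N"
      unfolding N_def using Bf(1) by (intro sets_PiM_I_finite) auto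
    ultimately show ?thesis by (intro AE_I[of _ _ "\<Pi>\<^sub>E b\<in>B. {0}"]) auto
  qed
  \<comment> \<open>The part of the integral that lives in the hyperplane, weighted by the length of
    the projection. This weight is the Jacobian of scaling s by that length, and it raises the
    degree of homogeneity from \<open>card B\<close> to \<open>DIM('a)\<close>.\<close>
  define K where "K = (\<integral>\<^sup>+f. G (y f) * ennreal (norm (y f)) * indicator {..1} (norm (y f)) \<partial>N)"
  have KI: "(\<integral>\<^sup>+f. G (y f) * ennreal (norm (y f)) * indicator {..r} (norm (y f)) \<partial>N) = ennreal (r ^ DIM('a)) * K"
    if r: "0 < r" for r
  proof -
    have "(\<integral>\<^sup>+f. G (y f) * ennreal (norm (y f)) * indicator {..r} (norm (y f)) \<partial>N)
      = ennreal (r ^ card B) * (\<integral>\<^sup>+f. G (y (\<lambda>b\<in>B. r * f b)) * ennreal (norm (y (\<lambda>b\<in>B. r * f b))) * indicator {..r} (norm (y (\<lambda>b\<in>B. r * f b))) \<partial>N)"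
      unfolding N_def by (rule nn_integral_PiM_lborel_scale[OF Bf(1) r]) (fold N_def, measurable)
    also have "\<dots> = ennreal (r ^ card B) * (\<integral>\<^sup>+f. ennreal r * (G (y f) * ennreal (norm (y f)) * indicator {..1} (norm (y f))) \<partial>N)"
    proof (rule arg_cong2[where f="(*)", OF refl], rule nn_integral_cong)
      fix f
      have "indicator {..r} (r * norm (y f)) = (indicator {..1} (norm (y f)) :: ennreal)"
        using r by (simp add: indicator_def)
      then show "G (y (\<lambda>b\<in>B. r * f b)) * ennreal (norm (y (\<lambda>b\<in>B. r * f b))) * indicator {..r} (norm (y (\<lambda>b\<in>B. r * f b)))
        = ennreal r * (G (y f) * ennreal (norm (y f)) * indicator {..1} (norm (y f)))"
        using r by (simp add: yr G2 ennreal_mult mult_ac)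
    qed
    also have "\<dots> = ennreal (r ^ card B) * (ennreal r * K)"
      by (subst nn_integral_cmult) (auto simp: K_def)
    also have "\<dots> = ennreal (r ^ DIM('a)) * K"
    proof -
      have "DIM('a) = Suc (card B)" using cardB D by simp
      then show ?thesis using r by (simp add: ennreal_mult mult_ac)
    qed
    finally show ?thesis .
  qed
  interpret N: sigma_finite_measure N by fact
  interpret P: pair_sigma_finite lborel N ..
  have main: "(\<integral>\<^sup>+x. \<phi> (arccos ((u \<bullet> x) / norm x)) * G x * indicator (cball 0 1) x \<partial>lborel)
      = K * (\<integral>\<^sup>+t. \<phi> t * ennreal (sin t ^ (DIM('a) - 2)) * indicator {0..pi} t \<partial>lborel)"
    if [measurable]: "\<phi> \<in> borel_measurable borel" for \<phi>
  proof -
    have "(\<integral>\<^sup>+x. \<phi> (arccos ((u \<bullet> x) / norm x)) * G x * indicator (cball 0 1) x \<partial>lborel)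
      = (\<integral>\<^sup>+f. \<integral>\<^sup>+s. \<phi> (arccos (s / sqrt (s\<^sup>2 + (norm (y f))\<^sup>2))) * G (y f) * indicator {..1} (s\<^sup>2 + (norm (y f))\<^sup>2) \<partial>lborel \<partial>N)"
      (is "_ = (\<integral>\<^sup>+f. ?I f \<partial>N)")
    proof (rule trans[OF nn_integral_lborel_split[OF u B]])
      show "(\<lambda>x. \<phi> (arccos ((u \<bullet> x) / norm x)) * G x * indicator (cball 0 1) x) \<in> borel_measurable borel"
      proof -
        have [measurable]: "cball (0::'a) 1 \<in> sets borel" by simp
        show ?thesis by measurable
      qed
    next
      show "(\<integral>\<^sup>+f. \<integral>\<^sup>+s. \<phi> (arccos ((u \<bullet> (s *\<^sub>R u + (\<Sum>b\<in>B. f b *\<^sub>R b))) / norm (s *\<^sub>R u + (\<Sum>b\<in>B. f b *\<^sub>R b)))) *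
           G (s *\<^sub>R u + (\<Sum>b\<in>B. f b *\<^sub>R b)) * indicator (cball 0 1) (s *\<^sub>R u + (\<Sum>b\<in>B. f b *\<^sub>R b)) \<partial>lborel \<partial>(\<Pi>\<^sub>M b\<in>B. lborel))
        = (\<integral>\<^sup>+f. ?I f \<partial>N)"
        unfolding N_def[symmetric] yfold
      proof (intro nn_integral_cong, goal_cases)
      case (1 f s)
      have n: "norm (s *\<^sub>R u + y f) = sqrt (s\<^sup>2 + (norm (y f))\<^sup>2)"
        by (simp add: nsu[symmetric])
      have "indicator (cball 0 1) (s *\<^sub>R u + y f) = (indicator {..1} (s\<^sup>2 + (norm (y f))\<^sup>2) :: ennreal)"
        by (auto simp: indicator_def n)
      then show ?case
        unfolding isu n G1 by simp
      qed
    qed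
    \<comment> \<open>With r = norm (y f) and s = r tan t, the squared norm s^2 + r^2 becomes (r /
      cos t)^2. Hence the ball condition is r \<le> cos t, and the angle to \<open>u\<close> is pi/2
      - t whatever r is.\<close>
    also have "\<dots> = (\<integral>\<^sup>+f. \<integral>\<^sup>+t. indicator {-pi/2<..<pi/2} t * ennreal (inverse ((cos t)\<^sup>2)) *
         \<phi> (pi/2 - t) * (G (y f) * ennreal (norm (y f)) * indicator {..cos t} (norm (y f))) \<partial>lborel \<partial>N)"
    proof (rule nn_integral_cong_AE, use ynz in eventually_elim)
      fix f assume f: "y f \<noteq> 0"
      define r where "r = norm (y f)"
      have r: "r > 0" using f by (simp add: r_def)
      have "?I f = ennreal r * (\<integral>\<^sup>+s. \<phi> (arccos (r * s / sqrt ((r * s)\<^sup>2 + r\<^sup>2))) * G (y f) * indicator {..1} ((r * s)\<^sup>2 + r\<^sup>2) \<partial>lborel)"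
        using r unfolding r_def[symmetric]
        by (subst nn_integral_real_affine[where t=0 and c=r]) (auto simp: mult_ac)
      also have "\<dots> = ennreal r * (\<integral>\<^sup>+t. indicator {-pi/2<..<pi/2} t * ennreal (inverse ((cos t)\<^sup>2)) *
          (\<phi> (arccos (r * tan t / sqrt ((r * tan t)\<^sup>2 + r\<^sup>2))) * G (y f) * indicator {..1} ((r * tan t)\<^sup>2 + r\<^sup>2)) \<partial>lborel)"
        by (subst nn_integral_tan) auto
      also have "\<dots> = (\<integral>\<^sup>+t. ennreal r * (indicator {-pi/2<..<pi/2} t * ennreal (inverse ((cos t)\<^sup>2)) *
          (\<phi> (arccos (r * tan t / sqrt ((r * tan t)\<^sup>2 + r\<^sup>2))) * G (y f) * indicator {..1} ((r * tan t)\<^sup>2 + r\<^sup>2))) \<partial>lborel)"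
      proof -
        have [measurable]: "(tan :: real \<Rightarrow> real) \<in> borel_measurable borel" unfolding tan_def by measurable
        show ?thesis by (subst nn_integral_cmult) auto
      qed
      also have "\<dots> = (\<integral>\<^sup>+t. indicator {-pi/2<..<pi/2} t * ennreal (inverse ((cos t)\<^sup>2)) *
         \<phi> (pi/2 - t) * (G (y f) * ennreal (norm (y f)) * indicator {..cos t} (norm (y f))) \<partial>lborel)"
      proof (rule nn_integral_cong)
        fix t :: real
        show "ennreal r * (indicator {-pi/2<..<pi/2} t * ennreal (inverse ((cos t)\<^sup>2)) *
          (\<phi> (arccos (r * tan t / sqrt ((r * tan t)\<^sup>2 + r\<^sup>2))) * G (y f) * indicator {..1} ((r * tan t)\<^sup>2 + r\<^sup>2)))
          = indicator {-pi/2<..<pi/2} t * ennreal (inverse ((cos t)\<^sup>2)) *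
         \<phi> (pi/2 - t) * (G (y f) * ennreal (norm (y f)) * indicator {..cos t} (norm (y f)))"
        proof (cases "t \<in> {-pi/2<..<pi/2}")
          case True
          then have c: "cos t > 0" by (intro cos_gt_zero_pi) auto
          have q: "(r * tan t)\<^sup>2 + r\<^sup>2 = (r / cos t)\<^sup>2"
          proof -
            have "(r * tan t)\<^sup>2 + r\<^sup>2 = (r / cos t)\<^sup>2 * ((sin t)\<^sup>2 + (cos t)\<^sup>2)"
              using c unfolding sin_squared_eq by (simp add: tan_def power_divide power_mult_distrib sin_squared_eq) (simp add: field_simps)
            then show ?thesis by simp
          qed
          have "r * tan t / (r / cos t) = sin t" using c r by (simp add: tan_def)
          moreover have "arccos (sin t) = pi/2 - t"
            using True arccos_cos[of "pi/2 - t"] by (simp add: cos_diff)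
          moreover have "indicator {..1} ((r / cos t)\<^sup>2) = (indicator {..cos t} r :: ennreal)"
            using c r by (auto simp: indicator_def field_simps abs_square_le_1 power_le_one_iff)
          moreover have "sqrt ((r / cos t)\<^sup>2) = r / cos t" using c r by simp
          ultimately show ?thesis using True unfolding q r_def[symmetric] by (simp add: mult_ac)
        qed simp
      qed
      finally show "?I f = \<dots>" .
    qed
    also have "\<dots> = (\<integral>\<^sup>+t. \<integral>\<^sup>+f. indicator {-pi/2<..<pi/2} t * ennreal (inverse ((cos t)\<^sup>2)) *
         \<phi> (pi/2 - t) * (G (y f) * ennreal (norm (y f)) * indicator {..cos t} (norm (y f))) \<partial>N \<partial>lborel)"
      by (rule P.Fubini') (simp only: indicator_def atMost_iff greaterThanLessThan_iff, measurable)
    \<comment> \<open>By \<open>KI\<close> with r = cos t the hyperplane integral is K cos^D t,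
      where D is the dimension; the Jacobian 1/cos^2 leaves the exponent D - 2.\<close>
    also have "\<dots> = (\<integral>\<^sup>+t. K * (indicator {-pi/2<..<pi/2} t * \<phi> (pi/2 - t) * ennreal (cos t ^ (DIM('a) - 2))) \<partial>lborel)"
    proof (rule nn_integral_cong)
      fix t :: real
      have "(\<integral>\<^sup>+f. indicator {-pi/2<..<pi/2} t * ennreal (inverse ((cos t)\<^sup>2)) *
         \<phi> (pi/2 - t) * (G (y f) * ennreal (norm (y f)) * indicator {..cos t} (norm (y f))) \<partial>N)
        = indicator {-pi/2<..<pi/2} t * ennreal (inverse ((cos t)\<^sup>2)) *
         \<phi> (pi/2 - t) * (\<integral>\<^sup>+f. (G (y f) * ennreal (norm (y f)) * indicator {..cos t} (norm (y f))) \<partial>N)"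
        by (subst nn_integral_cmult) auto
      also have "\<dots> = K * (indicator {-pi/2<..<pi/2} t * \<phi> (pi/2 - t) * ennreal (cos t ^ (DIM('a) - 2)))"
      proof (cases "t \<in> {-pi/2<..<pi/2}")
        case True
        then have c: "cos t > 0" by (intro cos_gt_zero_pi) auto
        obtain k where k: "DIM('a) = k + 2" using D by (metis le_add_diff_inverse2)
        have "ennreal (inverse ((cos t)\<^sup>2)) * ennreal (cos t ^ DIM('a)) = ennreal (cos t ^ (DIM('a) - 2))"
          using c unfolding k by (subst ennreal_mult[symmetric]) (auto simp: field_simps power2_eq_square)
        then show ?thesis using True unfolding KI[OF c] by (simp add: mult_ac) (metis mult.assoc mult.commute)
      qed simp
      finally show "(\<integral>\<^sup>+f. indicator {-pi/2<..<pi/2} t * ennreal (inverse ((cos t)\<^sup>2)) *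
         \<phi> (pi/2 - t) * (G (y f) * ennreal (norm (y f)) * indicator {..cos t} (norm (y f))) \<partial>N) = \<dots>" .
    qed
    also have "\<dots> = K * (\<integral>\<^sup>+t. indicator {-pi/2<..<pi/2} t * \<phi> (pi/2 - t) * ennreal (cos t ^ (DIM('a) - 2)) \<partial>lborel)"
      by (subst nn_integral_cmult) auto
    \<comment> \<open>Reflecting t to pi/2 - t makes t the angle itself and turns the cosine into a
      sine.\<close>
    also have "(\<integral>\<^sup>+t. indicator {-pi/2<..<pi/2} t * \<phi> (pi/2 - t) * ennreal (cos t ^ (DIM('a) - 2)) \<partial>lborel)
      = (\<integral>\<^sup>+t. indicator {-pi/2<..<pi/2} (pi/2 - t) * \<phi> t * ennreal (cos (pi/2 - t) ^ (DIM('a) - 2)) \<partial>lborel)"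
      by (subst nn_integral_real_affine[where t="pi/2" and c="-1"]) auto
    also have "\<dots> = (\<integral>\<^sup>+t. \<phi> t * ennreal (sin t ^ (DIM('a) - 2)) * indicator {0..pi} t \<partial>lborel)"
    proof (rule nn_integral_cong_AE)
      show "AE t in lborel. indicator {-pi/2<..<pi/2} (pi/2 - t) * \<phi> t * ennreal (cos (pi/2 - t) ^ (DIM('a) - 2))
          = \<phi> t * ennreal (sin t ^ (DIM('a) - 2)) * indicator {0..pi} t"
        using AE_lborel_singleton[of "0::real"] AE_lborel_singleton[of pi]
        by eventually_elim (auto simp: indicator_def cos_diff mult_ac)
    qed
    finally show ?thesis .
  qed
  show ?thesis
  proof (rule that[of "K / emeasure lborel (cball (0::'a) 1)"])
    fix \<phi> :: "real \<Rightarrow> ennreal" assume [measurable]: "\<phi> \<in> borel_measurable borel"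
    show "(\<integral>\<^sup>+x. \<phi> (arccos ((u \<bullet> x) / norm x)) * G x \<partial>ball_measure)
      = K / emeasure lborel (cball (0::'a) 1) * (\<integral>\<^sup>+t. \<phi> t * ennreal (sin t ^ (DIM('a) - 2)) * indicator {0..pi} t \<partial>lborel)"
    proof (subst nn_integral_ball_measure)
      have "K * X / Y = K / Y * X" for X Y :: ennreal
        by (simp add: divide_ennreal_def mult_ac)
      then show "(\<integral>\<^sup>+x. \<phi> (arccos ((u \<bullet> x) / norm x)) * G x * indicator (cball 0 1) x \<partial>lborel) / emeasure lborel (cball (0::'a) 1)
        = K / emeasure lborel (cball (0::'a) 1) * (\<integral>\<^sup>+t. \<phi> t * ennreal (sin t ^ (DIM('a) - 2)) * indicator {0..pi} t \<partial>lborel)"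
        by (simp only: main[OF \<open>\<phi> \<in> borel_measurable borel\<close>])
    qed measurable
  qed
qed

text \<open>Coordinates adapted to the plane of \<open>e\<close> and \<open>v\<close>: the two
  variables of the plane are separated, and \<open>N\<close> with \<open>y\<close> parametrizes its
  orthogonal complement.\<close>

lemma nn_integral_lborel_split2:
  fixes e v :: "'a::euclidean_space"
  assumes e: "norm e = 1" and v: "norm v = 1" and ev: "e \<bullet> v = 0"
  obtains N :: "('a \<Rightarrow> real) measure" and y
  where "sigma_finite_measure N" "y \<in> borel_measurable N" "\<And>f. y f \<bullet> e = 0" "\<And>f. y f \<bullet> v = 0"
    "\<And>F. F \<in> borel_measurable borel \<Longrightarrow> (\<integral>\<^sup>+x. F x \<partial>lborel) =
      (\<integral>\<^sup>+f. \<integral>\<^sup>+s. \<integral>\<^sup>+a. F (a *\<^sub>R v + (s *\<^sub>R e + y f)) \<partial>lborel \<partial>lborel \<partial>N)"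
proof -
  define L where "L = {x. x \<bullet> e = 0 \<and> x \<bullet> v = 0}"
  have sL: "subspace L" by (auto simp: L_def subspace_def inner_left_distrib)
  obtain B where B: "orthonormal_basis_of L B" using orthonormal_basis_of_exists[OF sL] by blast
  note Bf = orthonormal_basis_of_facts[OF B]
  have Le: "x \<bullet> e = 0" "x \<bullet> v = 0" if "x \<in> L" for x using that by (auto simp: L_def)
  have ins: "e \<notin> B" "orthonormal_basis_of (span (insert e L)) (insert e B)"
    using orthonormal_basis_of_insert[OF e B Le(1)] by auto
  have "span (insert e L) = {x. x \<bullet> v = 0}"
  proof
    have "insert e L \<subseteq> {x. x \<bullet> v = 0}" using ev by (auto simp: L_def)
    then show "span (insert e L) \<subseteq> {x. x \<bullet> v = 0}"
      using orthogonal_complement_span(2) by (rule span_minimal)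
    show "{x. x \<bullet> v = 0} \<subseteq> span (insert e L)"
    proof
      fix x assume "x \<in> {x. x \<bullet> v = 0}"
      then have "x - (x \<bullet> e) *\<^sub>R e \<in> L"
        using e ev by (simp add: L_def inner_diff_left norm_eq_1)
      then show "x \<in> span (insert e L)" unfolding span_insert by (auto intro: span_base)
    qed
  qed
  then have B2: "orthonormal_basis_of {x. x \<bullet> v = 0} (insert e B)" using ins(2) by simp
  define y where "y = (\<lambda>f::'a \<Rightarrow> real. \<Sum>b\<in>B. f b *\<^sub>R b)"
  define N where "N = (\<Pi>\<^sub>M b\<in>B. (lborel::real measure))"
  show ?thesis
  proof (rule that[of N y])
    show "sigma_finite_measure N" unfolding N_def by (rule lborel_PiM.sigma_finite[OF Bf(1)])
    show "y \<in> borel_measurable N" unfolding y_def N_def by (rule measurable_basis_sum)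
    have BL: "b \<in> L" if "b \<in> B" for b using Bf(4) span_base[OF that] by simp
    show "y f \<bullet> e = 0" "y f \<bullet> v = 0" for f
      using BL by (auto simp: y_def inner_sum_left L_def)
    fix F :: "'a \<Rightarrow> ennreal" assume [measurable]: "F \<in> borel_measurable borel"
    have [measurable]: "(\<lambda>f. \<Sum>b\<in>insert e B. f b *\<^sub>R b) \<in> borel_measurable (\<Pi>\<^sub>M b\<in>insert e B. (lborel::real measure))"
      by (rule measurable_basis_sum)
    have "(\<integral>\<^sup>+x. F x \<partial>lborel) = (\<integral>\<^sup>+f. \<integral>\<^sup>+a. F (a *\<^sub>R v + (\<Sum>b\<in>insert e B. f b *\<^sub>R b)) \<partial>lborel \<partial>(\<Pi>\<^sub>M b\<in>insert e B. (lborel::real measure)))"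
      by (rule nn_integral_lborel_split[OF v B2]) measurable
    also have "\<dots> = (\<integral>\<^sup>+f. \<integral>\<^sup>+s. \<integral>\<^sup>+a. F (a *\<^sub>R v + (\<Sum>b\<in>insert e B. (f(e := s)) b *\<^sub>R b)) \<partial>lborel \<partial>lborel \<partial>N)"
      unfolding N_def by (rule lborel_PiM.product_nn_integral_insert[OF Bf(1) ins(1)]) measurable
    also have "\<dots> = (\<integral>\<^sup>+f. \<integral>\<^sup>+s. \<integral>\<^sup>+a. F (a *\<^sub>R v + (s *\<^sub>R e + y f)) \<partial>lborel \<partial>lborel \<partial>N)"
    proof (intro nn_integral_cong arg_cong[where f=F])
      fix f :: "'a \<Rightarrow> real" and s a :: real
      have "(\<Sum>b\<in>B. (f(e := s)) b *\<^sub>R b) = (\<Sum>b\<in>B. f b *\<^sub>R b)"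
        by (rule sum.cong) (use ins in auto)
      then show "a *\<^sub>R v + (\<Sum>b\<in>insert e B. (f(e := s)) b *\<^sub>R b) = a *\<^sub>R v + (s *\<^sub>R e + y f)"
        using ins Bf(1) by (simp add: y_def)
    qed
    finally show "(\<integral>\<^sup>+x. F x \<partial>lborel) = (\<integral>\<^sup>+f. \<integral>\<^sup>+s. \<integral>\<^sup>+a. F (a *\<^sub>R v + (s *\<^sub>R e + y f)) \<partial>lborel \<partial>lborel \<partial>N)" .
  qed
qed

lemma nn_integral_id_Ioc:
  assumes "0 \<le> r"
  shows "(\<integral>\<^sup>+s. ennreal s * indicator {0<..r} s \<partial>lborel) = ennreal (r\<^sup>2 / 2)"
proof -
  have "(\<integral>\<^sup>+s. ennreal s * indicator {0<..r} s \<partial>lborel) = (\<integral>\<^sup>+s. ennreal s * indicator {0..r} s \<partial>lborel)"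
    by (intro nn_integral_cong) (auto simp: indicator_def)
  also have "\<dots> = ennreal (r\<^sup>2 / 2 - 0\<^sup>2 / 2)"
    by (rule nn_integral_FTC_Icc) (use assms in \<open>auto intro!: derivative_eq_intros\<close>)
  finally show ?thesis by simp
qed

text \<open>Seen in the plane of \<open>e\<close> and \<open>v\<close>, the set is a sector of
  opening pi - x. In the variables s and t with a = s tan t, the radial integral cancels the
  Jacobian 1/cos^2, so the measure is uniform in the angle t. The factor \<open>K\<close> is left
  open here and found from x = 0 when it is used.\<close>

lemma emeasure_lune_proportional:
  fixes e v :: "'a::euclidean_space"
  assumes e: "norm e = 1" and v: "norm v = 1" and ev: "e \<bullet> v = 0"
  obtains K where "\<And>x. 0 \<le> x \<Longrightarrow> x \<le> pi \<Longrightarrow>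
    emeasure ball_measure {z. 0 < z \<bullet> e \<and> 0 < z \<bullet> (cos x *\<^sub>R e + sin x *\<^sub>R v)} = ennreal (pi - x) * K"
proof (rule nn_integral_lborel_split2[OF e v ev], goal_cases)
  case (1 N y)
  have [measurable]: "y \<in> borel_measurable N" by (rule 1(3))
  note sf = 1(2) and ye = 1(4,5) and split = 1(6)
  define q where "q = (\<lambda>f. (norm (y f))\<^sup>2)"
  have [measurable]: "q \<in> borel_measurable N" unfolding q_def by measurable
  have [measurable]: "cball (0::'a) 1 \<in> sets borel" by simp
  \<comment> \<open>For a fixed component orthogonal to the plane, the remaining disc has squared
    radius 1 - q, and (1 - q)/2 is its area per unit of angle. Components of norm above 1 contribute
    0, as \<open>ennreal\<close> truncates negative numbers.\<close>
  define K where "K = (\<integral>\<^sup>+f. ennreal ((1 - q f) / 2) \<partial>N)"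
  have main: "emeasure lborel ({z. 0 < z \<bullet> e \<and> 0 < z \<bullet> (cos x *\<^sub>R e + sin x *\<^sub>R v)} \<inter> cball 0 1)
     = ennreal (pi - x) * K" if x: "0 \<le> x" "x \<le> pi" for x
  proof -
    have "emeasure lborel ({z. 0 < z \<bullet> e \<and> 0 < z \<bullet> (cos x *\<^sub>R e + sin x *\<^sub>R v)} \<inter> cball 0 1)
      = (\<integral>\<^sup>+z. indicator ({z. 0 < z \<bullet> e \<and> 0 < z \<bullet> (cos x *\<^sub>R e + sin x *\<^sub>R v)} \<inter> cball 0 1) z \<partial>lborel)"
      by simp
    also have "\<dots> = (\<integral>\<^sup>+f. \<integral>\<^sup>+s. \<integral>\<^sup>+a. indicator {0<..} s * indicator {0<..} (s * cos x + a * sin x) * indicator {..1} (a\<^sup>2 + (s\<^sup>2 + q f)) \<partial>lborel \<partial>lborel \<partial>N)"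
    proof (subst split, measurable, intro nn_integral_cong)
      fix f s a
      have "(norm (a *\<^sub>R v + (s *\<^sub>R e + y f)))\<^sup>2 = a\<^sup>2 + (s\<^sup>2 + q f)"
        using e v ev ye[of f]
        by (simp add: q_def norm_eq_1 power2_norm_eq_inner inner_add_left inner_add_right inner_commute)
           (simp add: power2_eq_square)
      then have "norm (a *\<^sub>R v + (s *\<^sub>R e + y f)) \<le> 1 \<longleftrightarrow> a\<^sup>2 + (s\<^sup>2 + q f) \<le> 1"
        using abs_square_le_1[of "norm (a *\<^sub>R v + (s *\<^sub>R e + y f))"] by simp
      moreover have "(a *\<^sub>R v + (s *\<^sub>R e + y f)) \<bullet> e = s" "(a *\<^sub>R v + (s *\<^sub>R e + y f)) \<bullet> v = a"
        using e v ev ye[of f] by (simp_all add: norm_eq_1 inner_add_left) (simp add: inner_commute)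
      ultimately show "indicator ({z. 0 < z \<bullet> e \<and> 0 < z \<bullet> (cos x *\<^sub>R e + sin x *\<^sub>R v)} \<inter> cball 0 1) (a *\<^sub>R v + (s *\<^sub>R e + y f))
         = (indicator {0<..} s * indicator {0<..} (s * cos x + a * sin x) * indicator {..1} (a\<^sup>2 + (s\<^sup>2 + q f)) :: ennreal)"
        by (auto simp: indicator_def inner_add_right mult_ac)
    qed
    also have "\<dots> = (\<integral>\<^sup>+f. ennreal (pi - x) * ennreal ((1 - q f) / 2) \<partial>N)"
    proof (rule nn_integral_cong)
      fix f
      define c where "c = 1 - q f"
      have "(\<integral>\<^sup>+s. \<integral>\<^sup>+a. indicator {0<..} s * indicator {0<..} (s * cos x + a * sin x) * indicator {..1} (a\<^sup>2 + (s\<^sup>2 + q f)) \<partial>lborel \<partial>lborel)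
        = (\<integral>\<^sup>+s. \<integral>\<^sup>+t. ennreal (inverse ((cos t)\<^sup>2)) * indicator {-pi/2<..<pi/2} t * indicator {x - pi/2<..} t *
            (ennreal s * indicator {0<..} s * indicator {..c * (cos t)\<^sup>2} (s\<^sup>2)) \<partial>lborel \<partial>lborel)"
      proof (rule nn_integral_cong)
        fix s :: real
        show "(\<integral>\<^sup>+a. indicator {0<..} s * indicator {0<..} (s * cos x + a * sin x) * indicator {..1} (a\<^sup>2 + (s\<^sup>2 + q f)) \<partial>lborel)
          = (\<integral>\<^sup>+t. ennreal (inverse ((cos t)\<^sup>2)) * indicator {-pi/2<..<pi/2} t * indicator {x - pi/2<..} t *
            (ennreal s * indicator {0<..} s * indicator {..c * (cos t)\<^sup>2} (s\<^sup>2)) \<partial>lborel)"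
        proof (cases "s > 0")
          case True
          have "(\<integral>\<^sup>+a. indicator {0<..} s * indicator {0<..} (s * cos x + a * sin x) * indicator {..1} (a\<^sup>2 + (s\<^sup>2 + q f)) \<partial>lborel)
            = ennreal s * (\<integral>\<^sup>+a. indicator {0<..} (s * cos x + (s * a) * sin x) * indicator {..1} ((s * a)\<^sup>2 + (s\<^sup>2 + q f)) \<partial>lborel)"
            using True by (subst nn_integral_real_affine[where t=0 and c=s]) auto
          also have "\<dots> = ennreal s * (\<integral>\<^sup>+t. indicator {-pi/2<..<pi/2} t * ennreal (inverse ((cos t)\<^sup>2)) *
              (indicator {0<..} (s * cos x + (s * tan t) * sin x) * indicator {..1} ((s * tan t)\<^sup>2 + (s\<^sup>2 + q f))) \<partial>lborel)"
            by (subst nn_integral_tan) auto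
          also have "\<dots> = (\<integral>\<^sup>+t. ennreal s * (indicator {-pi/2<..<pi/2} t * ennreal (inverse ((cos t)\<^sup>2)) *
              (indicator {0<..} (s * cos x + (s * tan t) * sin x) * indicator {..1} ((s * tan t)\<^sup>2 + (s\<^sup>2 + q f)))) \<partial>lborel)"
          proof -
            have [measurable]: "(tan :: real \<Rightarrow> real) \<in> borel_measurable borel" unfolding tan_def by measurable
            show ?thesis by (subst nn_integral_cmult) auto
          qed
          also have "\<dots> = (\<integral>\<^sup>+t. ennreal (inverse ((cos t)\<^sup>2)) * indicator {-pi/2<..<pi/2} t * indicator {x - pi/2<..} t *
            (ennreal s * indicator {0<..} s * indicator {..c * (cos t)\<^sup>2} (s\<^sup>2)) \<partial>lborel)"
          proof (rule nn_integral_cong)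
            fix t :: real
            show "ennreal s * (indicator {-pi/2<..<pi/2} t * ennreal (inverse ((cos t)\<^sup>2)) *
              (indicator {0<..} (s * cos x + (s * tan t) * sin x) * indicator {..1} ((s * tan t)\<^sup>2 + (s\<^sup>2 + q f))))
              = ennreal (inverse ((cos t)\<^sup>2)) * indicator {-pi/2<..<pi/2} t * indicator {x - pi/2<..} t *
            (ennreal s * indicator {0<..} s * indicator {..c * (cos t)\<^sup>2} (s\<^sup>2))"
            proof (cases "t \<in> {-pi/2<..<pi/2}")
              case t: True
              then have ct: "cos t > 0" by (intro cos_gt_zero_pi) auto
              have "s * cos x + (s * tan t) * sin x = s / cos t * cos (x - t)"
                using ct by (simp add: tan_def cos_diff field_simps)
              then have "0 < s * cos x + (s * tan t) * sin x \<longleftrightarrow> 0 < cos (x - t)"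
                using ct True by (simp add: zero_less_mult_iff zero_less_divide_iff)
              \<comment> \<open>The cosine is positive for x - t strictly between -pi/2 and pi/2.
                The lower bound is automatic from x \<ge> 0 and t < pi/2, so the condition is the
                upper one.\<close>
              also have "\<dots> \<longleftrightarrow> x - pi/2 < t"
              proof
                assume "x - pi/2 < t"
                then show "0 < cos (x - t)" using t x by (intro cos_gt_zero_pi) auto
              next
                assume a: "0 < cos (x - t)"
                show "x - pi/2 < t"
                proof (rule ccontr)
                  assume "\<not> x - pi/2 < t"
                  then have "0 \<le> cos (pi - (x - t))" using t x by (intro cos_ge_zero) auto
                  with a show False by simp
                qed
              qed
              finally have 1: "indicator {0<..} (s * cos x + (s * tan t) * sin x) = (indicator {x - pi/2<..} t :: ennreal)"
                by (simp add: indicator_def)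
              have "(s * tan t)\<^sup>2 + s\<^sup>2 = s\<^sup>2 / (cos t)\<^sup>2"
                using ct by (simp add: tan_def power_divide power_mult_distrib sin_squared_eq) (simp add: field_simps)
              then have "(s * tan t)\<^sup>2 + (s\<^sup>2 + q f) \<le> 1 \<longleftrightarrow> s\<^sup>2 / (cos t)\<^sup>2 \<le> c"
                by (auto simp: c_def)
              also have "\<dots> \<longleftrightarrow> s\<^sup>2 \<le> c * (cos t)\<^sup>2" using ct by (simp add: divide_le_eq)
              finally have 2: "indicator {..1} ((s * tan t)\<^sup>2 + (s\<^sup>2 + q f)) = (indicator {..c * (cos t)\<^sup>2} (s\<^sup>2) :: ennreal)"
                by (simp add: indicator_def)
              show ?thesis using t True unfolding 1 2 by (simp add: mult_ac)
            qed simp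
          qed
          finally show ?thesis .
        qed simp
      qed
      also have "\<dots> = (\<integral>\<^sup>+t. \<integral>\<^sup>+s. ennreal (inverse ((cos t)\<^sup>2)) * indicator {-pi/2<..<pi/2} t * indicator {x - pi/2<..} t *
            (ennreal s * indicator {0<..} s * indicator {..c * (cos t)\<^sup>2} (s\<^sup>2)) \<partial>lborel \<partial>lborel)"
        by (rule lborel_pair.Fubini')
           (simp only: indicator_def atMost_iff greaterThanLessThan_iff greaterThan_iff, measurable)
      also have "\<dots> = (\<integral>\<^sup>+t. ennreal (c / 2) * indicator {x - pi/2<..<pi/2} t \<partial>lborel)"
      proof (rule nn_integral_cong)
        fix t :: real
        have "(\<integral>\<^sup>+s. ennreal (inverse ((cos t)\<^sup>2)) * indicator {-pi/2<..<pi/2} t * indicator {x - pi/2<..} t *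
            (ennreal s * indicator {0<..} s * indicator {..c * (cos t)\<^sup>2} (s\<^sup>2)) \<partial>lborel)
          = ennreal (inverse ((cos t)\<^sup>2)) * indicator {-pi/2<..<pi/2} t * indicator {x - pi/2<..} t *
            (\<integral>\<^sup>+s. (ennreal s * indicator {0<..} s * indicator {..c * (cos t)\<^sup>2} (s\<^sup>2)) \<partial>lborel)"
          by (subst nn_integral_cmult) auto
        also have "\<dots> = ennreal (c / 2) * indicator {x - pi/2<..<pi/2} t"
        proof (cases "t \<in> {x - pi/2<..<pi/2}")
          case True
          then have ct: "cos t > 0" using x by (intro cos_gt_zero_pi) auto
          have "(\<integral>\<^sup>+s. (ennreal s * indicator {0<..} s * indicator {..c * (cos t)\<^sup>2} (s\<^sup>2)) \<partial>lborel)
            = ennreal (c * (cos t)\<^sup>2 / 2)"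
          proof (cases "c \<ge> 0")
            case c: True
            have "(ennreal s * indicator {0<..} s * indicator {..c * (cos t)\<^sup>2} (s\<^sup>2))
              = ennreal s * indicator {0<..sqrt (c * (cos t)\<^sup>2)} s" for s
            proof -
              have "s\<^sup>2 \<le> c * (cos t)\<^sup>2 \<longleftrightarrow> s \<le> sqrt (c * (cos t)\<^sup>2)" if "s > 0"
              proof -
                have "sqrt (s\<^sup>2) \<le> sqrt (c * (cos t)\<^sup>2) \<longleftrightarrow> s\<^sup>2 \<le> c * (cos t)\<^sup>2" by (rule real_sqrt_le_iff)
                then show ?thesis using that by simp
              qed
              then show ?thesis by (auto simp: indicator_def)
            qed
            then show ?thesis using c by (simp add: nn_integral_id_Ioc)
          next
            case False
            then have "c * (cos t)\<^sup>2 < 0" using ct by (simp add: mult_neg_pos)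
            then have "indicator {..c * (cos t)\<^sup>2} (s\<^sup>2) = (0::ennreal)" for s :: real
              by (simp add: indicator_def) (smt (verit) zero_le_power2)
            then show ?thesis using \<open>c * (cos t)\<^sup>2 < 0\<close> by (simp add: ennreal_neg)
          qed
          moreover have "ennreal (inverse ((cos t)\<^sup>2)) * ennreal (c * (cos t)\<^sup>2 / 2) = ennreal (c / 2)"
            using ct by (simp add: ennreal_mult'[symmetric] field_simps)
          ultimately show ?thesis using True x by auto
        qed (use x in \<open>auto simp: indicator_def\<close>)
        finally show "(\<integral>\<^sup>+s. ennreal (inverse ((cos t)\<^sup>2)) * indicator {-pi/2<..<pi/2} t * indicator {x - pi/2<..} t *
            (ennreal s * indicator {0<..} s * indicator {..c * (cos t)\<^sup>2} (s\<^sup>2)) \<partial>lborel) = \<dots>" .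
      qed
      also have "\<dots> = ennreal (c / 2) * ennreal (pi - x)"
        using x by (simp add: nn_integral_cmult)
      finally show "(\<integral>\<^sup>+s. \<integral>\<^sup>+a. indicator {0<..} s * indicator {0<..} (s * cos x + a * sin x) * indicator {..1} (a\<^sup>2 + (s\<^sup>2 + q f)) \<partial>lborel \<partial>lborel)
        = ennreal (pi - x) * ennreal ((1 - q f) / 2)"
        by (simp add: c_def mult.commute)
    qed
    also have "\<dots> = ennreal (pi - x) * K"
      unfolding K_def by (subst nn_integral_cmult) auto
    finally show ?thesis .
  qed
  show ?thesis
  proof (rule that[of "K / emeasure lborel (cball (0::'a) 1)"])
    fix x :: real assume x: "0 \<le> x" "x \<le> pi"
    have "emeasure ball_measure {z. 0 < z \<bullet> e \<and> 0 < z \<bullet> (cos x *\<^sub>R e + sin x *\<^sub>R v)}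
      = emeasure lborel ({z. 0 < z \<bullet> e \<and> 0 < z \<bullet> (cos x *\<^sub>R e + sin x *\<^sub>R v)} \<inter> cball 0 1) / emeasure lborel (cball (0::'a) 1)"
      unfolding ball_measure_def by (subst emeasure_uniform_measure) (auto simp: Int_commute)
    then show "emeasure ball_measure {z. 0 < z \<bullet> e \<and> 0 < z \<bullet> (cos x *\<^sub>R e + sin x *\<^sub>R v)} = ennreal (pi - x) * (K / emeasure lborel (cball (0::'a) 1))"
      using main[OF x] by (simp add: ennreal_times_divide)
  qed
qed

lemma AE_ball_measure_hyperplane:
  fixes u :: "'a::euclidean_space"
  assumes "u \<noteq> 0" shows "AE z in ball_measure. z \<bullet> u \<noteq> 0"
proof (rule AE_ball_measure)
  have "negligible {z. u \<bullet> z = 0}" using assms by (intro negligible_hyperplane) auto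
  then have "{z. u \<bullet> z = 0} \<in> null_sets lebesgue" by (simp add: negligible_iff_null_sets)
  then have "AE z in lebesgue. \<not> u \<bullet> z = 0" by (intro AE_I'[of "{z. u \<bullet> z = 0}"]) auto
  then show "AE z in lborel. z \<bullet> u \<noteq> 0" by (simp add: AE_completion_iff inner_commute)
qed

definition flip :: "'a::real_inner \<Rightarrow> 'a \<Rightarrow> 'a" where
  "flip e z = (if z \<bullet> e \<ge> 0 then z else - z)"

lemma measurable_flip[measurable]:
  fixes f g :: "'b \<Rightarrow> 'a::euclidean_space"
  assumes [measurable]: "f \<in> borel_measurable M" "g \<in> borel_measurable M"
  shows "(\<lambda>x. flip (f x) (g x)) \<in> borel_measurable M"
  unfolding flip_def by measurable

lemma distr_ball_measure_uminus: "distr ball_measure borel uminus = (ball_measure :: 'a::euclidean_space measure)"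
  by (rule distr_ball_measure_orthogonal) (auto simp: orthogonal_transformation_def linear_uminus linear_iff)

lemma emeasure_ball_measure_uminus:
  fixes A :: "'a::euclidean_space set"
  assumes "A \<in> sets borel"
  shows "emeasure ball_measure {z. - z \<in> A} = emeasure ball_measure A"
proof -
  have "emeasure ball_measure A = emeasure (distr ball_measure borel uminus) A"
    by (simp add: distr_ball_measure_uminus)
  also have "\<dots> = emeasure ball_measure {z. - z \<in> A}"
    using assms by (subst emeasure_distr) (auto simp: vimage_def)
  finally show ?thesis by simp
qed

text \<open>Up to a null set, the event consists of the lune of \<open>e\<close> and
  \<open>u\<close> and its mirror image under z to -z; the lune has opening pi minus the angle of
  \<open>e\<close> and \<open>u\<close>. The case u = e, where the probability is 1, fixes the
  factor.\<close>

lemma measure_flip_halfspace: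
  fixes e u :: "'a::euclidean_space"
  assumes e: "norm e = 1" and u: "norm u = 1" and D: "DIM('a) \<ge> 2"
  shows "measure ball_measure {z. 0 < u \<bullet> flip e z} = 1 - arccos (u \<bullet> e) / pi"
proof -
  interpret prob_space "ball_measure :: 'a measure" by (rule prob_space_ball_measure)
  define x where "x = arccos (u \<bullet> e)"
  have ue: "\<bar>u \<bullet> e\<bar> \<le> 1" using Cauchy_Schwarz_ineq2[of u e] e u by simp
  then have x: "0 \<le> x" "x \<le> pi" "cos x = u \<bullet> e"
    by (auto simp: x_def arccos_lbound arccos_ubound cos_arccos abs_le_iff)
  define w where "w = u - cos x *\<^sub>R e"
  have "(norm w)\<^sup>2 = 1 - (cos x)\<^sup>2"
    using e u x(3) unfolding w_def power2_norm_eq_inner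
    by (simp add: norm_eq_1 inner_diff_left inner_diff_right inner_commute) (simp add: power2_eq_square)
  then have nw2: "(norm w)\<^sup>2 = (sin x)\<^sup>2" by (simp add: sin_squared_eq)
  have sx: "sin x \<ge> 0" using x by (simp add: sin_ge_zero)
  have nw: "norm w = sin x" using nw2 sx by (simp add: power2_eq_iff_nonneg)
  have ew: "e \<bullet> w = 0" using e x(3) by (simp add: w_def inner_diff_right norm_eq_1 inner_commute)
  \<comment> \<open>\<open>v\<close> is the direction of the component of \<open>u\<close>
    orthogonal to \<open>e\<close>. If u = e or u = -e, this component vanishes, and any unit vector
    orthogonal to \<open>e\<close> will do; one exists in dimension at least 2.\<close>
  obtain v where v: "norm v = 1" "e \<bullet> v = 0" "u = cos x *\<^sub>R e + sin x *\<^sub>R v"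
  proof (cases "sin x = 0")
    case True
    obtain v where "v \<noteq> 0" "orthogonal e v" using orthogonal_to_vector_exists[of e] D by blast
    then show ?thesis using True nw
      by (intro that[of "v /\<^sub>R norm v"]) (auto simp: w_def orthogonal_def)
  next
    case False
    then show ?thesis using nw ew sx
      by (intro that[of "w /\<^sub>R sin x"]) (auto simp: w_def)
  qed
  obtain K where K: "\<And>x. 0 \<le> x \<Longrightarrow> x \<le> pi \<Longrightarrow>
    emeasure ball_measure {z. 0 < z \<bullet> e \<and> 0 < z \<bullet> (cos x *\<^sub>R e + sin x *\<^sub>R v)} = ennreal (pi - x) * K"
    using emeasure_lune_proportional[OF e v(1,2)] by blast
  have AEe: "AE z in ball_measure. z \<bullet> e \<noteq> 0" using e by (intro AE_ball_measure_hyperplane) auto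
  have sym: "emeasure ball_measure {z. z \<bullet> e < 0 \<and> z \<bullet> w < 0} = emeasure ball_measure {z. 0 < z \<bullet> e \<and> 0 < z \<bullet> w}" for w
    using emeasure_ball_measure_uminus[of "{z. 0 < z \<bullet> e \<and> 0 < z \<bullet> w}"] by simp
  have two: "emeasure ball_measure {z. 0 < w \<bullet> flip e z} = 2 * emeasure ball_measure {z. 0 < z \<bullet> e \<and> 0 < z \<bullet> w}" for w
  proof -
    have "emeasure ball_measure {z. 0 < w \<bullet> flip e z}
      = emeasure ball_measure ({z. 0 < z \<bullet> e \<and> 0 < z \<bullet> w} \<union> {z. z \<bullet> e < 0 \<and> z \<bullet> w < 0})"
      by (rule emeasure_eq_AE) (use AEe in \<open>auto simp: flip_def inner_commute elim!: eventually_mono\<close>)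
    also have "\<dots> = emeasure ball_measure {z. 0 < z \<bullet> e \<and> 0 < z \<bullet> w} + emeasure ball_measure {z. z \<bullet> e < 0 \<and> z \<bullet> w < 0}"
      by (rule plus_emeasure[symmetric]) auto
    finally show ?thesis unfolding sym by (simp add: mult_2)
  qed
  have "1 = emeasure ball_measure {z. 0 < e \<bullet> flip e z}"
  proof -
    have "emeasure ball_measure {z. 0 < e \<bullet> flip e z} = emeasure ball_measure (space (ball_measure :: 'a measure))"
      by (rule emeasure_eq_AE) (use AEe in \<open>auto simp: flip_def inner_commute elim!: eventually_mono\<close>)
    then show ?thesis using emeasure_space_1 by simp
  qed
  then have K1: "2 * (ennreal pi * K) = 1" using K[of 0] by (simp add: two)
  then have "K \<noteq> \<infinity>" by (auto simp: ennreal_mult_top)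
  then obtain k where k: "K = ennreal k" "k \<ge> 0" by (cases K) auto
  have "ennreal (2 * (pi * k)) = ennreal 1" using K1 k by (simp add: ennreal_mult)
  then have k2: "2 * (pi * k) = 1" using k by (subst (asm) ennreal_inj) auto
  have "emeasure ball_measure {z. 0 < u \<bullet> flip e z} = 2 * (ennreal (pi - x) * K)"
    using K[OF x(1,2)] v(3) by (simp add: two)
  also have "\<dots> = ennreal (2 * ((pi - x) * k))" using x k by (simp add: ennreal_mult)
  also have "2 * ((pi - x) * k) = 1 - x / pi"
  proof -
    have "k = 1 / (2 * pi)" using k2 by (simp add: field_simps)
    then show ?thesis by (simp add: field_simps)
  qed
  finally show ?thesis using x by (simp add: measure_def x_def)
qed

section \<open>Spherical measures\<close>

lemma omega_eq_unit_ball_vol: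
  assumes "k > 0" shows "omega k = real k * unit_ball_vol (real k)"
proof -
  have eq: "Gamma (real k / 2 + 1) = (real k / 2) * Gamma (real k / 2)"
    using assms by (intro Gamma_plus1) (auto dest: nonpos_Ints_nonpos)
  show ?thesis using assms Gamma_real_pos[of "real k / 2"]
    unfolding omega_def unit_ball_vol_def eq by simp
qed

lemma omega_pos: "k > 0 \<Longrightarrow> omega k > 0"
  by (simp add: omega_eq_unit_ball_vol)

lemma subspace_lborel_eq:
  fixes L :: "'a::euclidean_space set"
  assumes "subspace L"
  obtains B where "orthonormal_basis_of L B"
    "subspace_lborel L = distr (\<Pi>\<^sub>M b\<in>B. (lborel :: real measure)) borel (\<lambda>f. \<Sum>b\<in>B. f b *\<^sub>R b)"
  using someI_ex[OF orthonormal_basis_of_exists[OF assms]] that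
  unfolding subspace_lborel_def Let_def by blast

lemma subspace_lborel_UNIV: "subspace_lborel UNIV = (lborel :: 'a::euclidean_space measure)"
proof -
  obtain B :: "'a set" where "orthonormal_basis_of UNIV B"
    "subspace_lborel UNIV = distr (\<Pi>\<^sub>M b\<in>B. (lborel :: real measure)) borel (\<lambda>f. \<Sum>b\<in>B. f b *\<^sub>R b)"
    by (rule subspace_lborel_eq[OF subspace_UNIV])
  then show ?thesis using lborel_eq_orthonormal by simp
qed

lemma sets_subspace_lborel[simp, measurable_cong]: "sets (subspace_lborel L) = sets borel"
  and space_subspace_lborel[simp]: "space (subspace_lborel L) = UNIV"
  by (simp_all add: subspace_lborel_def Let_def)

lemma measurable_sgn_vector[measurable]:
  fixes f :: "'b \<Rightarrow> 'a::euclidean_space"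
  assumes [measurable]: "f \<in> borel_measurable M"
  shows "(\<lambda>x. sgn (f x)) \<in> borel_measurable M"
  unfolding sgn_div_norm by measurable

lemma emeasure_great_sphere_measure:
  fixes L :: "'a::euclidean_space set"
  assumes [measurable]: "A \<in> sets borel"
  shows "emeasure (great_sphere_measure L) A
    = of_nat (dim L) * emeasure (subspace_lborel L) {x. sgn x \<in> A \<and> x \<in> cball 0 1 - {0}}"
proof -
  have C: "cball 0 1 - {0::'a} \<in> sets borel" by (intro sets.Diff) auto
  have "emeasure (distr (restrict_space (subspace_lborel L) (cball 0 1 - {0})) borel sgn) A
    = emeasure (restrict_space (subspace_lborel L) (cball 0 1 - {0})) (sgn -` A \<inter> (cball 0 1 - {0}))"
    using C by (subst emeasure_distr) (auto simp: space_restrict_space intro!: measurable_restrict_space1)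
  also have "\<dots> = emeasure (subspace_lborel L) (sgn -` A \<inter> (cball 0 1 - {0}))"
    using C by (subst emeasure_restrict_space) auto
  also have "sgn -` A \<inter> (cball 0 1 - {0}) = {x. sgn x \<in> A \<and> x \<in> cball 0 1 - {0}}" by auto
  finally show ?thesis unfolding great_sphere_measure_def
    by (simp add: emeasure_scale_measure)
qed

lemma sets_great_sphere_measure[simp, measurable_cong]: "sets (great_sphere_measure L) = sets borel"
  by (simp add: great_sphere_measure_def)

text \<open>The spherical measure is D times the volume of a truncated cone, so it is proportional
  to the law of the direction of a uniform ball point. Folding by \<open>flip\<close> doubles the
  mass on the halfsphere, matching the 2 in 2/omega(D); the factor D cancels, as omega(D) is D times
  the volume of the ball.\<close>

lemma halfsphere_uniform_eq_distr:
  fixes e :: "'a::euclidean_space"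
  assumes e: "norm e = 1"
  shows "halfsphere_uniform e = distr ball_measure borel (\<lambda>z. sgn (flip e z))"
proof (rule measure_eqI)
  show "sets (halfsphere_uniform e) = sets (distr ball_measure borel (\<lambda>z. sgn (flip e z)))"
    by (simp add: halfsphere_uniform_def)
  fix A assume "A \<in> sets (halfsphere_uniform e)"
  then have [measurable]: "A \<in> sets borel" by (simp add: halfsphere_uniform_def)
  have H[measurable]: "halfsphere e \<in> sets borel"
  proof -
    have "halfsphere e = sphere 0 1 \<inter> {u. 0 \<le> u \<bullet> e}" by (auto simp: halfsphere_def)
    moreover have "sphere (0::'a) 1 \<in> sets borel" by simp
    ultimately show ?thesis by simp
  qed
  have [measurable]: "cball (0::'a) 1 \<in> sets borel" by simp
  have AEe: "AE z in ball_measure. z \<bullet> e \<noteq> 0" using e by (intro AE_ball_measure_hyperplane) auto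
  define W where "W = {z. 0 < z \<bullet> e \<and> sgn z \<in> A}"
  have [measurable]: "W \<in> sets borel" unfolding W_def by measurable
  have "emeasure (distr ball_measure borel (\<lambda>z. sgn (flip e z))) A = emeasure ball_measure {z. sgn (flip e z) \<in> A}"
    by (subst emeasure_distr) (auto simp: vimage_def)
  also have "\<dots> = emeasure ball_measure (W \<union> {z. - z \<in> W})"
    by (rule emeasure_eq_AE) (use AEe in \<open>auto simp: flip_def W_def elim!: eventually_mono\<close>)
  also have "\<dots> = emeasure ball_measure W + emeasure ball_measure {z. - z \<in> W}"
    by (rule plus_emeasure[symmetric]) (auto simp: W_def)
  also have "\<dots> = 2 * emeasure ball_measure W"
    by (simp add: emeasure_ball_measure_uminus mult_2)
  also have "emeasure ball_measure W = emeasure lborel (cball 0 1 \<inter> W) / emeasure lborel (cball (0::'a) 1)"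
    unfolding ball_measure_def by (rule emeasure_uniform_measure) auto
  also have "emeasure lborel (cball (0::'a) 1) = ennreal (unit_ball_vol (real DIM('a)))"
    by (simp add: emeasure_cball)
  finally have 1: "emeasure (distr ball_measure borel (\<lambda>z. sgn (flip e z))) A
    = 2 * (emeasure lborel (cball 0 1 \<inter> W) / ennreal (unit_ball_vol (real DIM('a))))" .
  have "emeasure (halfsphere_uniform e) A
    = (\<integral>\<^sup>+x. ennreal (2 / omega DIM('a)) * indicator (halfsphere e \<inter> A) x \<partial>sphere_measure)"
  proof -
    have m: "(\<lambda>u. ennreal (2 / omega DIM('a)) * indicator (halfsphere e) u) \<in> borel_measurable sphere_measure"
      by measurable
    have "A \<in> sets sphere_measure" by simp
    then show ?thesis unfolding halfsphere_uniform_def emeasure_density[OF m \<open>A \<in> sets sphere_measure\<close>]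
      by (intro nn_integral_cong) (auto simp: indicator_def)
  qed
  also have "\<dots> = ennreal (2 / omega DIM('a)) * emeasure sphere_measure (halfsphere e \<inter> A)"
    by (rule nn_integral_cmult_indicator) simp
  also have "emeasure sphere_measure (halfsphere e \<inter> A) = of_nat DIM('a) * emeasure lborel
     {x. sgn x \<in> halfsphere e \<inter> A \<and> x \<in> cball 0 1 - {0}}"
    by (subst emeasure_great_sphere_measure) (auto simp: subspace_lborel_UNIV)
  also have "emeasure lborel {x. sgn x \<in> halfsphere e \<inter> A \<and> x \<in> cball 0 1 - {0}} = emeasure lborel (cball 0 1 \<inter> W)"
  proof (rule emeasure_eq_AE)
    have "negligible {z. e \<bullet> z = 0}" using e by (intro negligible_hyperplane) auto
    then have "{z. e \<bullet> z = 0} \<in> null_sets lebesgue" by (simp add: negligible_iff_null_sets)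
    then have "AE z in lebesgue. \<not> e \<bullet> z = 0" by (intro AE_I'[of "{z. e \<bullet> z = 0}"]) auto
    then have "AE z in lborel. z \<bullet> e \<noteq> 0" by (simp add: AE_completion_iff inner_commute)
    then show "AE x in lborel. (x \<in> {x. sgn x \<in> halfsphere e \<inter> A \<and> x \<in> cball 0 1 - {0}}) = (x \<in> cball 0 1 \<inter> W)"
    proof (eventually_elim)
      fix z assume "z \<bullet> e \<noteq> 0"
      then show "(z \<in> {x. sgn x \<in> halfsphere e \<inter> A \<and> x \<in> cball 0 1 - {0}}) = (z \<in> cball 0 1 \<inter> W)"
      proof -
        have "z \<noteq> 0" using \<open>z \<bullet> e \<noteq> 0\<close> by auto
        then have "0 \<le> sgn z \<bullet> e \<longleftrightarrow> 0 < z \<bullet> e"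
          using \<open>z \<bullet> e \<noteq> 0\<close> by (simp add: sgn_div_norm zero_le_mult_iff less_le)
        then show ?thesis using \<open>z \<noteq> 0\<close> by (auto simp: W_def halfsphere_def norm_sgn)
      qed
    qed
    show "{x. sgn x \<in> halfsphere e \<inter> A \<and> x \<in> cball 0 1 - {0}} \<in> sets lborel" by measurable
    show "cball 0 1 \<inter> W \<in> sets lborel" by measurable
  qed
  also have "ennreal (2 / omega DIM('a)) * (of_nat DIM('a) * emeasure lborel (cball 0 1 \<inter> W))
     = 2 * (emeasure lborel (cball 0 1 \<inter> W) / ennreal (unit_ball_vol (real DIM('a))))"
  proof -
    have v: "unit_ball_vol (real DIM('a)) > 0" by simp
    have "ennreal (2 / omega DIM('a)) * of_nat DIM('a) = ennreal (2 / unit_ball_vol (real DIM('a)))"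
      using v by (simp add: ennreal_mult'[symmetric] ennreal_of_nat_eq_real_of_nat omega_eq_unit_ball_vol)
    also have "\<dots> = 2 / ennreal (unit_ball_vol (real DIM('a)))"
      using v divide_ennreal[of 2 "unit_ball_vol (real DIM('a))"] by simp
    finally show ?thesis by (simp add: mult.assoc[symmetric]) (simp add: divide_ennreal_def mult_ac)
  qed
  finally show "emeasure (halfsphere_uniform e) A = emeasure (distr ball_measure borel (\<lambda>z. sgn (flip e z))) A"
    unfolding 1 .
qed

text \<open>The prism over a cone in the hyperplane \<open>u\<^sup>\<bottom>\<close> replaces the lower-dimensional measure by \<open>ball_measure\<close>.\<close>

lemma measure_great_sphere_hyperplane:
  fixes u :: "'a::euclidean_space"
  assumes u: "norm u = 1" and D: "DIM('a) \<ge> 2"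
    and G[measurable]: "G \<in> sets borel" and cone: "\<And>r x. 0 < r \<Longrightarrow> r *\<^sub>R x \<in> G \<longleftrightarrow> x \<in> G"
  shows "measure (great_sphere_measure {x. x \<bullet> u = 0}) (G \<inter> sphere 0 1)
    = omega (DIM('a) - 1) * measure ball_measure {w. w - (w \<bullet> u) *\<^sub>R u \<in> G}"
proof -
  define L where "L = {x. x \<bullet> u = 0}"
  have sL: "subspace L" unfolding L_def by (rule orthogonal_complement_span)
  obtain B where B: "orthonormal_basis_of L B" and
    sl: "subspace_lborel L = distr (\<Pi>\<^sub>M b\<in>B. (lborel :: real measure)) borel (\<lambda>f. \<Sum>b\<in>B. f b *\<^sub>R b)"
    by (rule subspace_lborel_eq[OF sL])
  note Bf = orthonormal_basis_of_facts[OF B]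
  have dimL: "dim L = DIM('a) - 1"
  proof -
    have "u \<noteq> 0" using u by auto
    then show ?thesis using dim_hyperplane[of u] by (simp add: inner_commute L_def)
  qed
  have Bu: "b \<bullet> u = 0" if "b \<in> B" for b
    using Bf(4) span_base[OF that] by (auto simp: L_def)
  define N where "N = (\<Pi>\<^sub>M b\<in>B. (lborel::real measure))"
  define y where "y = (\<lambda>f::'a \<Rightarrow> real. \<Sum>b\<in>B. f b *\<^sub>R b)"
  have [measurable]: "y \<in> borel_measurable N" unfolding y_def N_def by (rule measurable_basis_sum)
  have sfN: "sigma_finite_measure N" unfolding N_def by (rule lborel_PiM.sigma_finite[OF Bf(1)])
  interpret N: sigma_finite_measure N by fact
  interpret P: pair_sigma_finite N lborel ..
  have yu: "y f \<bullet> u = 0" for f using Bu by (simp add: y_def inner_sum_left)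
  have nsu: "(norm (s *\<^sub>R u + y f))\<^sup>2 = s\<^sup>2 + (norm (y f))\<^sup>2" for s f
    using u yu[of f] by (simp add: norm_eq_1 power2_norm_eq_inner inner_add_left inner_add_right inner_commute)
       (simp add: power2_eq_square)
  have yr: "y (\<lambda>b\<in>B. r * f b) = r *\<^sub>R y f" for r f
    by (simp add: y_def scaleR_sum_right)
  have [measurable]: "cball (0::'a) 1 \<in> sets borel" by simp
  have slN: "subspace_lborel L = distr N borel y" by (simp add: sl N_def y_def)
  \<comment> \<open>\<open>H\<close> is the hyperplane volume of the part of \<open>G\<close> within
    squared radius t. With the square as argument, 1 - s^2 can be inserted directly; for negative t
    the value is 0.\<close>
  define H where "H = (\<lambda>G::'a set. \<lambda>t. \<integral>\<^sup>+f. indicator G (y f) * indicator {..t} ((norm (y f))\<^sup>2) \<partial>N)"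
  define J where "J = (\<integral>\<^sup>+s. ennreal (sqrt (1 - s\<^sup>2) ^ (DIM('a) - 1)) * indicator {-1..1} s \<partial>lborel)"
  have Hscale: "H G (t\<^sup>2) = ennreal (t ^ (DIM('a) - 1)) * H G 1"
    if t: "0 < t" and [measurable]: "G \<in> sets borel" and cone: "\<And>r x. 0 < r \<Longrightarrow> r *\<^sub>R x \<in> G \<longleftrightarrow> x \<in> G" for t G
  proof -
    have "H G (t\<^sup>2) = ennreal (t ^ card B) * (\<integral>\<^sup>+f. indicator G (y (\<lambda>b\<in>B. t * f b)) * indicator {..t\<^sup>2} ((norm (y (\<lambda>b\<in>B. t * f b)))\<^sup>2) \<partial>N)"
      unfolding H_def N_def by (rule nn_integral_PiM_lborel_scale[OF Bf(1) t]) (fold N_def, measurable)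
    also have "\<dots> = ennreal (t ^ card B) * (\<integral>\<^sup>+f. indicator G (y f) * indicator {..1} ((norm (y f))\<^sup>2) \<partial>N)"
      using t by (intro arg_cong2[where f="(*)", OF refl] nn_integral_cong)
        (auto simp: yr indicator_def cone power_mult_distrib)
    finally show ?thesis using Bf(3) dimL by (simp add: H_def)
  qed
  have prism: "emeasure lborel ({w. w - (w \<bullet> u) *\<^sub>R u \<in> G} \<inter> cball 0 1) = J * H G 1"
    if [measurable]: "G \<in> sets borel" and cone: "\<And>r x. 0 < r \<Longrightarrow> r *\<^sub>R x \<in> G \<longleftrightarrow> x \<in> G" for G
  proof -
    have "emeasure lborel ({w. w - (w \<bullet> u) *\<^sub>R u \<in> G} \<inter> cball 0 1)
      = (\<integral>\<^sup>+w. indicator G (w - (w \<bullet> u) *\<^sub>R u) * indicator (cball 0 1) w \<partial>lborel)"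
    proof -
      have "emeasure lborel ({w. w - (w \<bullet> u) *\<^sub>R u \<in> G} \<inter> cball 0 1)
        = (\<integral>\<^sup>+w. indicator ({w. w - (w \<bullet> u) *\<^sub>R u \<in> G} \<inter> cball 0 1) w \<partial>lborel)"
        by (rule nn_integral_indicator[symmetric]) measurable
      also have "\<dots> = (\<integral>\<^sup>+w. indicator G (w - (w \<bullet> u) *\<^sub>R u) * indicator (cball 0 1) w \<partial>lborel)"
        by (intro nn_integral_cong) (simp add: indicator_def)
      finally show ?thesis .
    qed
    also have "\<dots> = (\<integral>\<^sup>+f. \<integral>\<^sup>+s. indicator G ((s *\<^sub>R u + y f) - ((s *\<^sub>R u + y f) \<bullet> u) *\<^sub>R u) * indicator (cball 0 1) (s *\<^sub>R u + y f) \<partial>lborel \<partial>N)"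
      using nn_integral_lborel_split[OF u B[unfolded L_def], of "\<lambda>w. indicator G (w - (w \<bullet> u) *\<^sub>R u) * indicator (cball 0 1) w"]
      unfolding N_def y_def by simp
    also have "\<dots> = (\<integral>\<^sup>+f. \<integral>\<^sup>+s. indicator G (y f) * indicator {..1 - s\<^sup>2} ((norm (y f))\<^sup>2) \<partial>lborel \<partial>N)"
    proof (intro nn_integral_cong)
      fix f s
      have "s *\<^sub>R u + y f - ((s *\<^sub>R u + y f) \<bullet> u) *\<^sub>R u = y f"
        using yu[of f] u by (simp add: inner_add_left norm_eq_1)
      moreover have "norm (s *\<^sub>R u + y f) \<le> 1 \<longleftrightarrow> (norm (y f))\<^sup>2 \<le> 1 - s\<^sup>2"
        using nsu[of s f] abs_square_le_1[of "norm (s *\<^sub>R u + y f)"] by auto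
      ultimately show "indicator G (s *\<^sub>R u + y f - ((s *\<^sub>R u + y f) \<bullet> u) *\<^sub>R u) * indicator (cball 0 1) (s *\<^sub>R u + y f)
        = (indicator G (y f) * indicator {..1 - s\<^sup>2} ((norm (y f))\<^sup>2) :: ennreal)"
        by (simp only: indicator_def mem_cball_0 atMost_iff)
    qed
    also have "\<dots> = (\<integral>\<^sup>+s. H G (1 - s\<^sup>2) \<partial>lborel)"
      unfolding H_def
      by (rule P.Fubini'[symmetric]) (simp only: indicator_def atMost_iff, measurable)
    also have "\<dots> = (\<integral>\<^sup>+s. (ennreal (sqrt (1 - s\<^sup>2) ^ (DIM('a) - 1)) * indicator {-1..1} s) * H G 1 \<partial>lborel)"
    proof (rule nn_integral_cong_AE)
      show "AE s in lborel. H G (1 - s\<^sup>2) = (ennreal (sqrt (1 - s\<^sup>2) ^ (DIM('a) - 1)) * indicator {-1..1} s) * H G 1"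
        using AE_lborel_singleton[of "1::real"] AE_lborel_singleton[of "-1::real"]
      proof eventually_elim
        fix s :: real assume s: "s \<noteq> 1" "s \<noteq> -1"
        show "H G (1 - s\<^sup>2) = (ennreal (sqrt (1 - s\<^sup>2) ^ (DIM('a) - 1)) * indicator {-1..1} s) * H G 1"
        proof (cases "\<bar>s\<bar> < 1")
          case True
          then have "0 < 1 - s\<^sup>2" by (simp add: abs_square_less_1)
          then show ?thesis using Hscale[of "sqrt (1 - s\<^sup>2)" G] that True by (simp add: indicator_def abs_less_iff)
        next
          case False
          then have "\<bar>s\<bar> > 1" using s by (auto simp: abs_if split: if_splits)
          then have "1 - s\<^sup>2 < 0" by (metis abs_square_le_1 diff_less_0_iff_less not_le)
          then have "indicator {..1 - s\<^sup>2} ((norm (y f))\<^sup>2) = (0::ennreal)" for f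
            by (simp add: indicator_def) (smt (verit) zero_le_power2)
          then have "H G (1 - s\<^sup>2) = 0" by (simp add: H_def)
          then show ?thesis using \<open>\<bar>s\<bar> > 1\<close> by (auto simp: indicator_def)
        qed
      qed
    qed
    also have "\<dots> = J * H G 1" unfolding J_def by (rule nn_integral_multc) measurable
    finally show ?thesis .
  qed
  have Hball: "H G 1 = emeasure (subspace_lborel L) (G \<inter> cball 0 1)" if [measurable]: "G \<in> sets borel" for G
  proof -
    have "emeasure (subspace_lborel L) (G \<inter> cball 0 1) = (\<integral>\<^sup>+x. indicator (G \<inter> cball 0 1) x \<partial>distr N borel y)"
      unfolding slN by simp
    also have "\<dots> = (\<integral>\<^sup>+f. indicator (G \<inter> cball 0 1) (y f) \<partial>N)"
      by (rule nn_integral_distr) auto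
    also have "\<dots> = H G 1" unfolding H_def
      by (intro nn_integral_cong) (auto simp: indicator_def abs_square_le_1)
    finally show ?thesis ..
  qed
  define ud where "ud = unit_ball_vol (real (DIM('a) - 1))"
  have ud: "ud > 0" by (simp add: ud_def)
  have HU: "H UNIV 1 = ennreal ud"
    using Hball[of UNIV] emeasure_orthonormal_cball[OF B, of 1] sl Bf(3) dimL by (simp add: ud_def)
  have lam: "emeasure lborel (cball (0::'a) 1) = J * ennreal ud"
    using prism[of UNIV] HU by simp
  have Jf: "J \<noteq> 0" "J \<noteq> \<infinity>"
    using lam emeasure_cball_pos_finite[where 'a='a] ud by (auto simp: ennreal_top_mult)
  then obtain j where j: "J = ennreal j" "j > 0" by (cases J) (auto simp: order_less_le)
  have HG: "H G 1 \<le> ennreal ud"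
    unfolding HU[symmetric] unfolding H_def by (intro nn_integral_mono) (auto simp: indicator_def)
  then obtain h where h: "H G 1 = ennreal h" "h \<ge> 0" by (cases "H G 1") (auto simp: top_unique)
  \<comment> \<open>\<open>J\<close>, the integral over the height, is common to the prism over
    \<open>G\<close> and to the whole ball, so the probability is the ratio of the hyperplane
    volumes of \<open>G\<close> and of the full unit ball there.\<close>
  have "emeasure ball_measure {w. w - (w \<bullet> u) *\<^sub>R u \<in> G} = J * H G 1 / (J * ennreal ud)"
    unfolding ball_measure_def using prism[OF G cone] lam
    by (subst emeasure_uniform_measure) (auto simp: Int_commute)
  also have "\<dots> = ennreal (h / ud)"
    using j h ud by (simp add: ennreal_mult'[symmetric] divide_ennreal)
  finally have bm: "measure ball_measure {w. w - (w \<bullet> u) *\<^sub>R u \<in> G} = h / ud"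
    using h ud by (simp add: measure_def)
  have "emeasure (great_sphere_measure L) (G \<inter> sphere 0 1)
    = of_nat (dim L) * emeasure (subspace_lborel L) {x. sgn x \<in> G \<inter> sphere 0 1 \<and> x \<in> cball 0 1 - {0}}"
    by (rule emeasure_great_sphere_measure) measurable
  also have "{x. sgn x \<in> G \<inter> sphere 0 1 \<and> x \<in> cball 0 1 - {0}} = G \<inter> cball 0 1 - {0}"
  proof -
    have "sgn x \<in> G \<longleftrightarrow> x \<in> G" if "x \<noteq> 0" for x
      using cone[of "inverse (norm x)" x] that by (simp add: sgn_div_norm)
    then show ?thesis by (auto simp: norm_sgn)
  qed
  \<comment> \<open>The hyperplane has dimension at least 1, so the origin is a null set.\<close>
  also have "emeasure (subspace_lborel L) (G \<inter> cball 0 1 - {0}) = emeasure (subspace_lborel L) (G \<inter> cball 0 1)"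
  proof (rule emeasure_Diff_null_set)
    have "emeasure (subspace_lborel L) {0} = 0"
    proof -
      have B0: "B \<noteq> {}" using Bf(3) dimL D by auto
      have "y -` {0} \<inter> space N = (\<Pi>\<^sub>E b\<in>B. {0})"
      proof (intro set_eqI iffI)
        fix f assume f: "f \<in> y -` {0} \<inter> space N"
        then have "f b = 0" if "b \<in> B" for b
          using inner_orthonormal_sum[OF B that, of f] by (simp add: y_def)
        with f show "f \<in> (\<Pi>\<^sub>E b\<in>B. {0})" by (auto simp: N_def space_PiM PiE_def extensional_def fun_eq_iff)
      qed (auto simp: N_def space_PiM y_def PiE_def Pi_def)
      moreover have "emeasure N (\<Pi>\<^sub>E b\<in>B. {0}) = 0"
        unfolding N_def using Bf(1) B0 by (subst lborel_PiM.emeasure_PiM) auto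
      ultimately show ?thesis unfolding slN by (subst emeasure_distr) auto
    qed
    then show "{0} \<in> null_sets (subspace_lborel L)" by auto
  qed measurable
  also have "\<dots> = ennreal h" using Hball[OF G] h by simp
  finally have "measure (great_sphere_measure L) (G \<inter> sphere 0 1) = real (dim L) * h"
    using h by (simp add: measure_def enn2real_mult)
  also have "\<dots> = omega (DIM('a) - 1) * (h / ud)"
  proof -
    have "DIM('a) - 1 > 0" using D by simp
    show ?thesis unfolding dimL omega_eq_unit_ball_vol[OF \<open>DIM('a) - 1 > 0\<close>] ud_def[symmetric] using ud by simp
  qed
  finally show ?thesis unfolding bm L_def .
qed

section \<open>Positive hulls as finitely generated cones\<close>

text \<open>\<open>pos\<close> ranges over subsets of the image, where equal points are merged.
  Passing to indices, the coefficients are carried by chosen preimages; passing back, those of equal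
  points are added.\<close>

lemma pos_image_iff:
  assumes "finite J"
  shows "x \<in> pos (y ` J) \<longleftrightarrow> (\<exists>c. (\<forall>j\<in>J. 0 \<le> c j) \<and> x = (\<Sum>j\<in>J. c j *\<^sub>R y j))"
proof
  assume "x \<in> pos (y ` J)"
  then obtain B c where B: "finite B" "B \<subseteq> y ` J" "\<forall>b\<in>B. 0 \<le> c b" "x = (\<Sum>b\<in>B. c b *\<^sub>R b)"
    by (auto simp: pos_def)
  define g where "g = inv_into J y"
  have g: "g b \<in> J" "y (g b) = b" if "b \<in> B" for b
    unfolding g_def using that B(2) by (auto intro: inv_into_into f_inv_into_f)
  have inj: "inj_on g B" unfolding g_def by (rule inj_on_inv_into[OF B(2)])
  define k where "k = (\<lambda>j. if j \<in> g ` B then c (y j) else 0)"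
  have "(\<Sum>j\<in>J. k j *\<^sub>R y j) = (\<Sum>j\<in>g ` B. k j *\<^sub>R y j)"
    using assms g by (intro sum.mono_neutral_right) (auto simp: k_def)
  also have "\<dots> = (\<Sum>b\<in>B. c b *\<^sub>R b)"
    using g by (subst sum.reindex[OF inj]) (auto simp: k_def intro!: sum.cong)
  finally show "\<exists>c. (\<forall>j\<in>J. 0 \<le> c j) \<and> x = (\<Sum>j\<in>J. c j *\<^sub>R y j)"
    using B g by (intro exI[of _ k]) (auto simp: k_def)
next
  assume "\<exists>c. (\<forall>j\<in>J. 0 \<le> c j) \<and> x = (\<Sum>j\<in>J. c j *\<^sub>R y j)"
  then obtain c where c: "\<forall>j\<in>J. 0 \<le> c j" "x = (\<Sum>j\<in>J. c j *\<^sub>R y j)" by blast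
  define k where "k = (\<lambda>b. \<Sum>j\<in>{j \<in> J. y j = b}. c j)"
  have "x = (\<Sum>b\<in>y ` J. \<Sum>j\<in>{j \<in> J. y j = b}. c j *\<^sub>R y j)"
    unfolding c(2) using assms by (rule sum.image_gen)
  also have "\<dots> = (\<Sum>b\<in>y ` J. k b *\<^sub>R b)"
    by (intro sum.cong) (auto simp: k_def scaleR_sum_left)
  finally show "x \<in> pos (y ` J)"
    unfolding pos_def using assms c(1) by (auto intro!: exI[of _ "y ` J"] exI[of _ k] sum_nonneg simp: k_def)
qed

text \<open>Gives access to the library theory of convex cones; in particular a finitely generated
  cone is a polyhedron, so its faces are exposed.\<close>

lemma pos_eq_convex_cone_hull: "pos A = convex_cone hull A"
proof
  show "pos A \<subseteq> convex_cone hull A"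
  proof
    fix x assume "x \<in> pos A"
    then obtain B c where B: "finite B" "B \<subseteq> A" "\<forall>b\<in>B. 0 \<le> c b" "x = (\<Sum>b\<in>B. c b *\<^sub>R b)"
      by (auto simp: pos_def)
    have "(\<Sum>b\<in>B. c b *\<^sub>R b) \<in> convex_cone hull A"
      using B(1-3)
    proof (induction B)
      case (insert b B)
      then have "c b *\<^sub>R b \<in> convex_cone hull A" by (intro convex_cone_hull_mul hull_inc) auto
      then show ?case using insert by (simp add: convex_cone_hull_add)
    qed (simp add: convex_cone_hull_contains_0)
    then show "x \<in> convex_cone hull A" using B by simp
  qed
  show "convex_cone hull A \<subseteq> pos A"
  proof (rule hull_minimal)
    show "A \<subseteq> pos A"
    proof
      fix x assume "x \<in> A"
      then show "x \<in> pos A" unfolding pos_def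
        by (intro CollectI exI[of _ "{x}"] exI[of _ "\<lambda>_. 1"]) auto
    qed
    show "convex_cone (pos A)"
      unfolding convex_cone_iff
    proof (intro conjI ballI allI impI)
      show "0 \<in> pos A" unfolding pos_def by (intro CollectI exI[of _ "{}"]) auto
    next
      fix x z assume "x \<in> pos A" "z \<in> pos A"
      then obtain B c B' c' where B: "finite B" "B \<subseteq> A" "\<forall>b\<in>B. 0 \<le> c b" "x = (\<Sum>b\<in>B. c b *\<^sub>R b)"
        "finite B'" "B' \<subseteq> A" "\<forall>b\<in>B'. 0 \<le> c' b" "z = (\<Sum>b\<in>B'. c' b *\<^sub>R b)"
        by (auto simp: pos_def)
      define k where "k = (\<lambda>b. (if b \<in> B then c b else 0) + (if b \<in> B' then c' b else 0 :: real))"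
      have "x = (\<Sum>b\<in>B \<union> B'. (if b \<in> B then c b else 0) *\<^sub>R b)"
        unfolding B using B by (intro sum.mono_neutral_cong_left) auto
      moreover have "z = (\<Sum>b\<in>B \<union> B'. (if b \<in> B' then c' b else 0) *\<^sub>R b)"
        unfolding B using B by (intro sum.mono_neutral_cong_left) auto
      ultimately have "x + z = (\<Sum>b\<in>B \<union> B'. k b *\<^sub>R b)"
        by (simp add: k_def scaleR_add_left sum.distrib)
      then show "x + z \<in> pos A" unfolding pos_def using B
        by (intro CollectI exI[of _ "B \<union> B'"] exI[of _ k]) (auto simp: k_def)
    next
      fix x and r :: real assume "x \<in> pos A" "0 \<le> r"
      then obtain B c where B: "finite B" "B \<subseteq> A" "\<forall>b\<in>B. 0 \<le> c b" "x = (\<Sum>b\<in>B. c b *\<^sub>R b)"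
        by (auto simp: pos_def)
      then show "r *\<^sub>R x \<in> pos A" unfolding pos_def using \<open>0 \<le> r\<close>
        by (intro CollectI exI[of _ B] exI[of _ "\<lambda>b. r * c b"]) (auto simp: scaleR_sum_right)
    qed
  qed
qed

lemma pos_cone: "x \<in> pos A \<Longrightarrow> 0 \<le> r \<Longrightarrow> r *\<^sub>R x \<in> pos A"
  by (simp add: pos_eq_convex_cone_hull convex_cone_hull_mul)

lemma zero_in_pos: "0 \<in> pos A"
  by (simp add: pos_eq_convex_cone_hull convex_cone_hull_contains_0)

lemma convex_pos: "convex (pos A)"
  by (simp add: pos_eq_convex_cone_hull convex_convex_cone_hull)

lemma pos_inc: "x \<in> A \<Longrightarrow> x \<in> pos A"
  by (simp add: pos_eq_convex_cone_hull hull_inc)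

lemma pos_mono: "A \<subseteq> B \<Longrightarrow> pos A \<subseteq> pos B"
  by (simp add: pos_eq_convex_cone_hull hull_mono)

lemma polyhedron_pos: "finite A \<Longrightarrow> polyhedron (pos (A :: 'a::euclidean_space set))"
  by (simp add: pos_eq_convex_cone_hull polyhedron_convex_cone_hull)

lemma closed_pos: "finite A \<Longrightarrow> closed (pos (A :: 'a::euclidean_space set))"
  by (simp add: polyhedron_pos polyhedron_imp_closed)

lemma span_pos: "span (pos A) = span A"
proof
  have "pos A \<subseteq> span A"
    unfolding pos_eq_convex_cone_hull
    by (rule hull_minimal) (auto simp: span_base convex_cone_span)
  then show "span (pos A) \<subseteq> span A" by (simp add: span_minimal)
  show "span A \<subseteq> span (pos A)" by (rule span_mono) (auto intro: pos_inc)
qed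

text \<open>\<open>spherical_face\<close> speaks of some cone with a given trace on the sphere;
  normalizing vectors recovers the cone from the trace.\<close>

lemma cone_determined_by_sphere:
  fixes C C' :: "'a::real_normed_vector set"
  assumes "C \<inter> sphere 0 1 \<subseteq> C'" "0 \<in> C'"
    and c: "\<And>x r. x \<in> C \<Longrightarrow> 0 \<le> r \<Longrightarrow> r *\<^sub>R x \<in> C" and c': "\<And>x r. x \<in> C' \<Longrightarrow> 0 \<le> r \<Longrightarrow> r *\<^sub>R x \<in> C'"
  shows "C \<subseteq> C'"
proof
  fix x assume x: "x \<in> C"
  show "x \<in> C'"
  proof (cases "x = 0")
    case False
    have "inverse (norm x) *\<^sub>R x \<in> C \<inter> sphere 0 1" using c[OF x, of "inverse (norm x)"] False by simp
    then have "norm x *\<^sub>R inverse (norm x) *\<^sub>R x \<in> C'" using assms(1) c' by (meson norm_ge_zero subsetD)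
    then show ?thesis using False by simp
  qed (use assms in simp)
qed

section \<open>Faces of finitely generated cones\<close>

text \<open>The lower bound \<open>1\<close> instead of \<open>> 0\<close> is a normalization of \<open>u\<close> (\<open>I\<close> is finite) that makes the condition closed.\<close>

definition face_index :: "'i set \<Rightarrow> ('i \<Rightarrow> 'a::euclidean_space) \<Rightarrow> 'i set \<Rightarrow> bool" where
  "face_index I y J \<longleftrightarrow> (\<exists>u. (\<forall>j\<in>J. u \<bullet> y j = 0) \<and> (\<forall>i\<in>I - J. 1 \<le> u \<bullet> y i))"

lemma face_index_iff_pos:
  assumes "finite I"
  shows "face_index I y J \<longleftrightarrow> (\<exists>u. (\<forall>j\<in>J. u \<bullet> y j = 0) \<and> (\<forall>i\<in>I - J. 0 < u \<bullet> y i))"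
proof
  assume "face_index I y J"
  then show "\<exists>u. (\<forall>j\<in>J. u \<bullet> y j = 0) \<and> (\<forall>i\<in>I - J. 0 < u \<bullet> y i)"
    unfolding face_index_def by (meson less_le_trans zero_less_one)
next
  assume "\<exists>u. (\<forall>j\<in>J. u \<bullet> y j = 0) \<and> (\<forall>i\<in>I - J. 0 < u \<bullet> y i)"
  then obtain u where u: "\<forall>j\<in>J. u \<bullet> y j = 0" "\<forall>i\<in>I - J. 0 < u \<bullet> y i" by blast
  define r where "r = Min (insert 1 ((\<lambda>i. u \<bullet> y i) ` (I - J)))"
  have fin: "finite (insert 1 ((\<lambda>i. u \<bullet> y i) ` (I - J)))" using assms by auto
  have r: "r > 0" unfolding r_def using fin u(2) by (subst Min_gr_iff) auto
  have "r \<le> u \<bullet> y i" if "i \<in> I - J" for i unfolding r_def using fin that by (intro Min_le) auto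
  then show "face_index I y J" unfolding face_index_def
    using u r by (intro exI[of _ "inverse r *\<^sub>R u"]) (auto simp: field_simps)
qed

text \<open>If \<open>u\<close> annihilates a nonnegative combination, it annihilates every term, so
  no generator outside \<open>J\<close> takes part. The third claim recovers \<open>J\<close> from
  its face, so that no facet is counted twice.\<close>

lemma supporting_face_eq_pos:
  fixes y :: "'i \<Rightarrow> 'a::euclidean_space"
  assumes "finite I" "J \<subseteq> I" and u: "\<And>j. j \<in> J \<Longrightarrow> u \<bullet> y j = 0" "\<And>i. i \<in> I - J \<Longrightarrow> 0 < u \<bullet> y i"
  shows "\<And>x. x \<in> pos (y ` I) \<Longrightarrow> 0 \<le> u \<bullet> x" "pos (y ` I) \<inter> {x. u \<bullet> x = 0} = pos (y ` J)"
    "{i \<in> I. y i \<in> pos (y ` J)} = J"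
proof -
  have J: "finite J" using assms finite_subset by blast
  have nn: "0 \<le> u \<bullet> y i" if "i \<in> I" for i using u that by (cases "i \<in> J") (auto simp: less_imp_le)
  show ge: "0 \<le> u \<bullet> x" if "x \<in> pos (y ` I)" for x
    using that nn unfolding pos_image_iff[OF \<open>finite I\<close>] by (auto simp: inner_sum_right intro!: sum_nonneg)
  have Ju: "u \<bullet> x = 0" if "x \<in> pos (y ` J)" for x
    using that u(1) unfolding pos_image_iff[OF J] by (auto simp: inner_sum_right intro!: sum.neutral)
  show "pos (y ` I) \<inter> {x. u \<bullet> x = 0} = pos (y ` J)"
  proof
    show "pos (y ` J) \<subseteq> pos (y ` I) \<inter> {x. u \<bullet> x = 0}"
      using Ju pos_mono[of "y ` J" "y ` I"] assms(2) by blast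
    show "pos (y ` I) \<inter> {x. u \<bullet> x = 0} \<subseteq> pos (y ` J)"
    proof
      fix x assume x: "x \<in> pos (y ` I) \<inter> {x. u \<bullet> x = 0}"
      then obtain c where c: "\<forall>i\<in>I. 0 \<le> c i" "x = (\<Sum>i\<in>I. c i *\<^sub>R y i)"
        using pos_image_iff[OF \<open>finite I\<close>] by blast
      have "(\<Sum>i\<in>I. c i * (u \<bullet> y i)) = 0" using x c by (simp add: inner_sum_right)
      then have "\<forall>i\<in>I. c i * (u \<bullet> y i) = 0"
        using c nn by (subst (asm) sum_nonneg_eq_0_iff) (auto simp: \<open>finite I\<close>)
      then have "c i = 0" if "i \<in> I - J" for i using u(2)[OF that] that by force
      then have "x = (\<Sum>i\<in>J. c i *\<^sub>R y i)"
        unfolding c(2) using assms by (intro sum.mono_neutral_right) auto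
      then show "x \<in> pos (y ` J)" unfolding pos_image_iff[OF J] using c assms(2) by blast
    qed
  qed
  show "{i \<in> I. y i \<in> pos (y ` J)} = J"
  proof
    show "J \<subseteq> {i \<in> I. y i \<in> pos (y ` J)}" using assms(2) by (auto intro: pos_inc)
    show "{i \<in> I. y i \<in> pos (y ` J)} \<subseteq> J"
    proof
      fix i assume i: "i \<in> {i \<in> I. y i \<in> pos (y ` J)}"
      then have "u \<bullet> y i = 0" using Ju by blast
      then show "i \<in> J" using u(2)[of i] i by force
    qed
  qed
qed

lemma face_index_imp_face_of:
  fixes y :: "'i \<Rightarrow> 'a::euclidean_space"
  assumes I: "finite I" "J \<subseteq> I" and "face_index I y J"
  shows "pos (y ` J) face_of pos (y ` I)" "{i \<in> I. y i \<in> pos (y ` J)} = J"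
proof -
  obtain u where u: "\<forall>j\<in>J. u \<bullet> y j = 0" "\<forall>i\<in>I - J. 0 < u \<bullet> y i"
    using assms(3) unfolding face_index_iff_pos[OF I(1)] by blast
  note s = supporting_face_eq_pos[OF I, of u y]
  have "(pos (y ` I) \<inter> {x. u \<bullet> x = 0}) face_of pos (y ` I)"
    using s(1) u by (intro face_of_Int_supporting_hyperplane_ge convex_pos) auto
  then show "pos (y ` J) face_of pos (y ` I)" using s(2) u by simp
  show "{i \<in> I. y i \<in> pos (y ` J)} = J" using s(3) u by simp
qed

text \<open>Faces of a polyhedron are exposed, and for a cone the exposing hyperplane passes through
  the origin. Its normal separates the generators into those on the face and those strictly to one
  side.\<close>

lemma face_of_pos_imp_face_index:
  fixes y :: "'i \<Rightarrow> 'a::euclidean_space"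
  assumes I: "finite I" and G: "G face_of pos (y ` I)" "G \<noteq> {}"
  shows "face_index I y {i \<in> I. y i \<in> G}" "G = pos (y ` {i \<in> I. y i \<in> G})"
proof -
  let ?C = "pos (y ` I)" and ?J = "{i \<in> I. y i \<in> G}"
  have "G exposed_face_of ?C" using G polyhedron_pos[of "y ` I"] I by (simp add: exposed_face_of_polyhedron)
  then obtain a b where ab: "?C \<subseteq> {x. a \<bullet> x \<le> b}" "G = ?C \<inter> {x. a \<bullet> x = b}"
    unfolding exposed_face_of_def by blast
  \<comment> \<open>The bound \<open>b\<close> is 0: twice a point of the face still lies in the
    cone, so 2b \<le> b, while the origin gives 0 \<le> b.\<close>
  obtain x0 where x0: "x0 \<in> G" using G by blast
  have "2 *\<^sub>R x0 \<in> ?C" using x0 ab by (intro pos_cone) auto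
  then have "2 * b \<le> b" using ab x0 by auto
  moreover have "0 \<le> b" using ab(1) zero_in_pos[of "y ` I"] by auto
  ultimately have b: "b = 0" by simp
  have u: "(- a) \<bullet> y j = 0" if "j \<in> ?J" for j using that ab b by auto
  have u': "0 < (- a) \<bullet> y i" if "i \<in> I - ?J" for i
  proof -
    have "y i \<in> ?C" using that by (auto intro: pos_inc)
    then have "a \<bullet> y i \<le> 0" "a \<bullet> y i \<noteq> 0" using that ab b by auto
    then show ?thesis by simp
  qed
  show "face_index I y ?J" unfolding face_index_iff_pos[OF I] using u u' by blast
  have "pos (y ` I) \<inter> {x. (- a) \<bullet> x = 0} = pos (y ` ?J)"
    by (rule supporting_face_eq_pos(2)[OF I _ u u']) auto
  moreover have "G = pos (y ` I) \<inter> {x. (- a) \<bullet> x = 0}" using ab b by auto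
  ultimately show "G = pos (y ` ?J)" by (rule trans[rotated])
qed

text \<open>The cone is pointed exactly when {0} is a face. The generators on that face are the zero
  vectors, hence the index set on the right, which is empty for nonzero points.\<close>

lemma pointed_pos_iff_face_index:
  fixes y :: "'i \<Rightarrow> 'a::euclidean_space"
  assumes I: "finite I"
  shows "pointed_polyhedral_cone (pos (y ` I)) \<longleftrightarrow> face_index I y {i \<in> I. y i = 0}"
proof
  assume "face_index I y {i \<in> I. y i = 0}"
  then obtain u where u: "\<forall>i\<in>I - {i \<in> I. y i = 0}. 0 < u \<bullet> y i"
    unfolding face_index_iff_pos[OF I] by blast
  have s: "pos (y ` I) \<inter> {x. u \<bullet> x = 0} = pos (y ` {i \<in> I. y i = 0})" "\<And>x. x \<in> pos (y ` I) \<Longrightarrow> 0 \<le> u \<bullet> x"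
    using supporting_face_eq_pos[OF I, of "{i \<in> I. y i = 0}" u y] u by auto
  have "pos (y ` {i \<in> I. y i = 0}) \<subseteq> pos {0}" by (rule pos_mono) auto
  also have "pos {0::'a} \<subseteq> {0}" unfolding pos_eq_convex_cone_hull by (rule hull_minimal) auto
  finally have z: "pos (y ` I) \<inter> {x. u \<bullet> x = 0} \<subseteq> {0}" using s(1) by simp
  have "x = 0" if x: "x \<in> pos (y ` I)" "- x \<in> pos (y ` I)" for x
    using s(2)[OF x(1)] s(2)[OF x(2)] z x(1) by auto
  then have "pos (y ` I) \<inter> uminus ` pos (y ` I) = {0}"
    using zero_in_pos[of "y ` I"] by force
  then show "pointed_polyhedral_cone (pos (y ` I))"
    unfolding pointed_polyhedral_cone_def using I by (auto simp: polyhedron_pos cone_def pos_cone)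
next
  assume p: "pointed_polyhedral_cone (pos (y ` I))"
  \<comment> \<open>If the origin were inside a segment of the cone, two opposite nonzero vectors
    would belong to the cone.\<close>
  have "{0} face_of pos (y ` I)"
    unfolding face_of_singleton extreme_point_of_def
  proof (intro conjI ballI zero_in_pos notI)
    fix a b assume ab: "a \<in> pos (y ` I)" "b \<in> pos (y ` I)" "0 \<in> open_segment a b"
    then obtain t where t: "a \<noteq> b" "0 < t" "t < 1" "0 = (1 - t) *\<^sub>R a + t *\<^sub>R b"
      unfolding in_segment by blast
    then have "(1 - t) *\<^sub>R a = - (t *\<^sub>R b)" by (simp add: eq_neg_iff_add_eq_0)
    moreover have "(1 - t) *\<^sub>R a \<in> pos (y ` I)" "t *\<^sub>R b \<in> pos (y ` I)"
      using ab t by (auto intro!: pos_cone)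
    ultimately have "(1 - t) *\<^sub>R a \<in> pos (y ` I) \<inter> uminus ` pos (y ` I)" by auto
    then have "(1 - t) *\<^sub>R a = 0" using p unfolding pointed_polyhedral_cone_def by auto
    then show False using t by auto
  qed
  from face_of_pos_imp_face_index(1)[OF I this] show "face_index I y {i \<in> I. y i = 0}" by simp
qed

text \<open>The preimage of \<open>pos (y ` J)\<close> under the orthogonal projection to \<open>span (y ` J)\<close>.  When the span is a
  hyperplane, \<open>omega d\<close> times its \<open>ball_measure\<close> is the area of the facet.\<close>

definition prism :: "'i set \<Rightarrow> ('i \<Rightarrow> 'a::euclidean_space) \<Rightarrow> 'a set" where
  "prism J y = {w. \<exists>c. (\<forall>j\<in>J. 0 \<le> c j) \<and> (\<forall>i\<in>J. (w - (\<Sum>j\<in>J. c j *\<^sub>R y j)) \<bullet> y i = 0)}"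

lemma codim1_span_eq_hyperplane:
  fixes S :: "'a::euclidean_space set"
  assumes "dim S = DIM('a) - 1"
  obtains u where "norm u = 1" "span S = {x. x \<bullet> u = 0}"
proof -
  have "dim S < DIM('a)" using assms by simp
  then obtain a where a: "a \<noteq> 0" "span S \<subseteq> {x. a \<bullet> x = 0}" using lowdim_subset_hyperplane by blast
  have "span S = {x. a \<bullet> x = 0}"
    using a assms dim_hyperplane[of a] by (intro subspace_dim_equal) (auto simp: subspace_hyperplane)
  then show ?thesis using a by (intro that[of "a /\<^sub>R norm a"]) (auto simp: inner_commute)
qed

text \<open>The residual of \<open>w\<close> is orthogonal to all generators, hence to their span,
  and so is a multiple of \<open>u\<close>. Stating \<open>prism\<close> by orthogonality to the
  generators instead of through \<open>u\<close> keeps it a closed condition on points and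
  coefficients, on which its measurability rests.\<close>

lemma prism_eq_projection:
  fixes y :: "'i \<Rightarrow> 'a::euclidean_space"
  assumes "finite J" and u: "norm u = 1" and sp: "span (y ` J) = {x. x \<bullet> u = 0}"
  shows "w \<in> prism J y \<longleftrightarrow> w - (w \<bullet> u) *\<^sub>R u \<in> pos (y ` J)"
proof
  have uu: "u \<bullet> u = 1" using u by (simp add: norm_eq_1)
  have yu: "y j \<bullet> u = 0" if "j \<in> J" for j using span_base[of "y j" "y ` J"] sp that by auto
  {
    assume "w - (w \<bullet> u) *\<^sub>R u \<in> pos (y ` J)"
    then obtain c where c: "\<forall>j\<in>J. 0 \<le> c j" "w - (w \<bullet> u) *\<^sub>R u = (\<Sum>j\<in>J. c j *\<^sub>R y j)"
      using pos_image_iff[OF assms(1)] by blast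
    have "w - (\<Sum>j\<in>J. c j *\<^sub>R y j) = (w \<bullet> u) *\<^sub>R u" using c(2) by (simp add: algebra_simps)
    then show "w \<in> prism J y" unfolding prism_def using c(1) yu by (auto simp: inner_commute intro!: exI[of _ c])
  next
    assume "w \<in> prism J y"
    then obtain c where c: "\<forall>j\<in>J. 0 \<le> c j" "\<forall>i\<in>J. (w - (\<Sum>j\<in>J. c j *\<^sub>R y j)) \<bullet> y i = 0"
      unfolding prism_def by blast
    define s where "s = (\<Sum>j\<in>J. c j *\<^sub>R y j)"
    define v where "v = w - (w \<bullet> u) *\<^sub>R u - s"
    have su: "s \<bullet> u = 0" using yu by (auto simp: s_def inner_sum_left intro!: sum.neutral)
    have "v \<bullet> u = 0" using su uu by (simp add: v_def inner_diff_left)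
    then have "v \<in> span (y ` J)" using sp by simp
    moreover have "v \<bullet> x = 0" if "x \<in> span (y ` J)" for x
      using that
    proof (induction rule: span_induct_alt)
      case (step r x z)
      then obtain j where j: "j \<in> J" "x = y j" by blast
      have "v \<bullet> x = (w - s) \<bullet> y j - (w \<bullet> u) * (u \<bullet> y j)" by (simp add: v_def j inner_diff_left algebra_simps)
      then have "v \<bullet> x = 0" using c(2) j(1) yu[OF j(1)] by (simp add: s_def inner_commute)
      with step show ?case by (simp add: inner_add_right)
    qed simp
    ultimately have "v = 0" by (metis inner_eq_zero_iff)
    then have "w - (w \<bullet> u) *\<^sub>R u = s" by (simp add: v_def)
    then show "w - (w \<bullet> u) *\<^sub>R u \<in> pos (y ` J)" unfolding s_def pos_image_iff[OF assms(1)] using c(1) by blast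
  }
qed

lemma aff_dim_pos: "aff_dim (pos (A :: 'a::euclidean_space set)) = int (dim A)"
proof -
  have "0 \<in> affine hull (pos A)" by (simp add: hull_inc zero_in_pos)
  then have "aff_dim (pos A) = int (dim (pos A))" by (rule aff_dim_zero)
  also have "dim (pos A) = dim A" by (metis dim_span span_pos)
  finally show ?thesis .
qed

text \<open>The cone \<open>C\<close> of the definition is determined by its trace, so it is the
  hull of the points, and its nonempty faces correspond to index sets. A spherical face of dimension
  k comes from a cone of dimension k + 1.\<close>

lemma spherical_face_conv_s_iff:
  fixes y :: "'i \<Rightarrow> 'a::euclidean_space"
  assumes I: "finite I"
  shows "spherical_face k F (conv_s (y ` I)) \<longleftrightarrow> pointed_polyhedral_cone (pos (y ` I)) \<and>
    (\<exists>J. J \<subseteq> I \<and> face_index I y J \<and> dim (y ` J) = k + 1 \<and> F = pos (y ` J) \<inter> sphere 0 1)"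
proof
  assume "spherical_face k F (conv_s (y ` I))"
  then obtain C G where C: "pointed_polyhedral_cone C" "sphere 0 1 \<inter> pos (y ` I) = C \<inter> sphere 0 1"
    "G face_of C" "aff_dim G = int k + 1" "F = G \<inter> sphere 0 1"
    unfolding spherical_face_def conv_s_def by blast
  have C0: "0 \<in> C" "\<And>x r. x \<in> C \<Longrightarrow> 0 \<le> r \<Longrightarrow> r *\<^sub>R x \<in> C"
    using C(1) unfolding pointed_polyhedral_cone_def cone_def by auto
  have "C = pos (y ` I)"
  proof
    show "C \<subseteq> pos (y ` I)" by (rule cone_determined_by_sphere) (use C C0 zero_in_pos pos_cone in auto)
    show "pos (y ` I) \<subseteq> C" by (rule cone_determined_by_sphere) (use C C0 pos_cone in auto)
  qed
  moreover have "G \<noteq> {}" using C(4) by auto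
  ultimately have "face_index I y {i \<in> I. y i \<in> G}" "G = pos (y ` {i \<in> I. y i \<in> G})"
    using face_of_pos_imp_face_index[OF I, of G y] C(3) by auto
  moreover from this(2) have "int (dim (y ` {i \<in> I. y i \<in> G})) = int k + 1"
    using C(4) aff_dim_pos by metis
  ultimately show "pointed_polyhedral_cone (pos (y ` I)) \<and>
    (\<exists>J. J \<subseteq> I \<and> face_index I y J \<and> dim (y ` J) = k + 1 \<and> F = pos (y ` J) \<inter> sphere 0 1)"
    using C(1,5) \<open>C = pos (y ` I)\<close> by (intro conjI exI[of _ "{i \<in> I. y i \<in> G}"]) auto
next
  assume "pointed_polyhedral_cone (pos (y ` I)) \<and>
    (\<exists>J. J \<subseteq> I \<and> face_index I y J \<and> dim (y ` J) = k + 1 \<and> F = pos (y ` J) \<inter> sphere 0 1)"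
  then obtain J where J: "pointed_polyhedral_cone (pos (y ` I))" "J \<subseteq> I" "face_index I y J" "dim (y ` J) = k + 1" "F = pos (y ` J) \<inter> sphere 0 1"
    by blast
  then show "spherical_face k F (conv_s (y ` I))"
    unfolding spherical_face_def conv_s_def
    using face_index_imp_face_of(1)[OF I J(2,3)]
    by (intro exI[of _ "pos (y ` I)"] exI[of _ "pos (y ` J)"]) (auto simp: aff_dim_pos)
qed

lemma measure_great_sphere_face:
  fixes y :: "'i \<Rightarrow> 'a::euclidean_space"
  assumes D: "DIM('a) \<ge> 2" and J: "finite J" "dim (y ` J) = DIM('a) - 1"
  shows "measure (great_sphere_measure (span (pos (y ` J) \<inter> sphere 0 1))) (pos (y ` J) \<inter> sphere 0 1)
    = omega (DIM('a) - 1) * measure ball_measure (prism J y)"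
proof -
  obtain u where u: "norm u = 1" "span (y ` J) = {x. x \<bullet> u = 0}"
    using codim1_span_eq_hyperplane[OF J(2)] by blast
  let ?F = "pos (y ` J) \<inter> sphere 0 1"
  have "span ?F = {x. x \<bullet> u = 0}"
  proof -
    have "pos (y ` J) \<subseteq> span ?F"
      by (rule cone_determined_by_sphere) (auto simp: span_base span_scale pos_cone span_zero)
    then have "span (pos (y ` J)) \<subseteq> span ?F" by (simp add: span_minimal)
    moreover have "span ?F \<subseteq> span (pos (y ` J))" by (rule span_mono) auto
    ultimately show ?thesis using u(2) by (simp add: span_pos)
  qed
  moreover have "r *\<^sub>R x \<in> pos (y ` J) \<longleftrightarrow> x \<in> pos (y ` J)" if "0 < r" for r x
  proof
    assume "r *\<^sub>R x \<in> pos (y ` J)"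
    from pos_cone[OF this, of "inverse r"] show "x \<in> pos (y ` J)" using that by simp
  qed (use that in \<open>simp add: pos_cone\<close>)
  moreover have "pos (y ` J) \<in> sets borel" using J by (simp add: closed_pos)
  moreover have "{w. w - (w \<bullet> u) *\<^sub>R u \<in> pos (y ` J)} = prism J y"
    using prism_eq_projection[OF J(1) u] by auto
  ultimately show ?thesis using measure_great_sphere_hyperplane[OF u(1) D, of "pos (y ` J)"] by simp
qed

text \<open>Different index sets give different facets, since \<open>J\<close> consists of all
  indices whose points lie in the facet. So the sum over facets becomes a sum over subsets of
  \<open>I\<close>, in general position or not. If the hull is not pointed, there are no faces and
  the area is 0.\<close>

lemma surface_area_conv_s:
  fixes y :: "'i \<Rightarrow> 'a::euclidean_space"
  assumes I: "finite I" and D: "DIM('a) \<ge> 2"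
  shows "surface_area (conv_s (y ` I)) = (if face_index I y {i \<in> I. y i = 0} then
    (\<Sum>J | J \<subseteq> I \<and> face_index I y J \<and> dim (y ` J) = DIM('a) - 1.
      omega (DIM('a) - 1) * measure ball_measure (prism J y)) else 0)"
proof (cases "face_index I y {i \<in> I. y i = 0}")
  case False
  then have "{F. spherical_face (DIM('a) - 2) F (conv_s (y ` I))} = {}"
    unfolding spherical_face_conv_s_iff[OF I] pointed_pos_iff_face_index[OF I] by simp
  then show ?thesis using False by (simp add: surface_area_def)
next
  case True
  let ?Js = "{J. J \<subseteq> I \<and> face_index I y J \<and> dim (y ` J) = DIM('a) - 1}"
  have D1: "DIM('a) - 2 + 1 = DIM('a) - 1" using D by simp
  have eq: "{F. spherical_face (DIM('a) - 2) F (conv_s (y ` I))} = (\<lambda>J. pos (y ` J) \<inter> sphere 0 1) ` ?Js"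
    unfolding spherical_face_conv_s_iff[OF I] pointed_pos_iff_face_index[OF I] D1 using True by auto
  have inj: "inj_on (\<lambda>J. pos (y ` J) \<inter> sphere 0 1) ?Js"
  proof (rule inj_onI)
    fix J K assume J: "J \<in> ?Js" and K: "K \<in> ?Js" and e: "pos (y ` J) \<inter> sphere 0 1 = pos (y ` K) \<inter> sphere 0 1"
    have eq: "pos (y ` J) = pos (y ` K)"
    proof
      show "pos (y ` J) \<subseteq> pos (y ` K)"
        by (rule cone_determined_by_sphere) (use e in \<open>blast intro: zero_in_pos pos_cone\<close>)+
      show "pos (y ` K) \<subseteq> pos (y ` J)"
        by (rule cone_determined_by_sphere) (use e in \<open>blast intro: zero_in_pos pos_cone\<close>)+
    qed
    have a: "{i \<in> I. y i \<in> pos (y ` J)} = J" using J by (intro face_index_imp_face_of(2)[OF I]) auto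
    have b: "{i \<in> I. y i \<in> pos (y ` K)} = K" using K by (intro face_index_imp_face_of(2)[OF I]) auto
    show "J = K" by (rule trans[OF a[unfolded eq, symmetric] b])
  qed
  have "surface_area (conv_s (y ` I)) = (\<Sum>J\<in>?Js. measure (great_sphere_measure (span (pos (y ` J) \<inter> sphere 0 1))) (pos (y ` J) \<inter> sphere 0 1))"
    unfolding surface_area_def eq by (subst sum.reindex[OF inj]) simp
  also have "\<dots> = (\<Sum>J\<in>?Js. omega (DIM('a) - 1) * measure ball_measure (prism J y))"
    using I by (intro sum.cong refl measure_great_sphere_face[OF D]) (auto intro: finite_subset)
  finally show ?thesis using True by simp
qed

text \<open>Over a compact set of witnesses the projection of a closed set is closed, by the tube
  lemma. If witnesses can always be found in one of countably many compact sets, the projection is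
  an F-sigma set.\<close>

lemma borel_Ex_closed:
  fixes S :: "('x::topological_space \<times> 'c::t2_space) set"
  assumes S: "closed S" and K: "\<And>k::nat. compact (K k)"
    and red: "\<And>x c. (x, c) \<in> S \<Longrightarrow> \<exists>k. \<exists>c'\<in>K k. (x, c') \<in> S"
  shows "{x. \<exists>c. (x, c) \<in> S} \<in> sets borel"
proof -
  have "closed {x. \<exists>c\<in>K k. (x, c) \<in> S}" for k
  proof -
    have "open {x. \<forall>c\<in>K k. (x, c) \<notin> S}"
    proof (subst open_subopen, intro ballI)
      fix x0 assume "x0 \<in> {x. \<forall>c\<in>K k. (x, c) \<notin> S}"
      then have "{x0} \<times> K k \<subseteq> - S" by auto
      from Elementary_Topology.tube_lemma[OF K[of k] open_Compl[OF S] this]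
      obtain X0 where "x0 \<in> X0" "open X0" "X0 \<times> K k \<subseteq> - S" by blast
      then show "\<exists>T. open T \<and> x0 \<in> T \<and> T \<subseteq> {x. \<forall>c\<in>K k. (x, c) \<notin> S}"
        by (intro exI[of _ X0]) auto
    qed
    moreover have "{x. \<exists>c\<in>K k. (x, c) \<in> S} = - {x. \<forall>c\<in>K k. (x, c) \<notin> S}" by auto
    ultimately show ?thesis by (simp only: closed_Compl)
  qed
  then have "(\<Union>k. {x. \<exists>c\<in>K k. (x, c) \<in> S}) \<in> sets borel"
    by (intro sets.countable_UN) (auto intro: borel_closed)
  moreover have "{x. \<exists>c. (x, c) \<in> S} = (\<Union>k. {x. \<exists>c\<in>K k. (x, c) \<in> S})"
    using red by blast
  ultimately show ?thesis by simp
qed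

section \<open>Measurability\<close>

text \<open>A box over all natural numbers, compact in the product topology by Tychonoff.
  Coefficients outside the finite index set are replaced by 0 to land in it.\<close>

definition coeff_box :: "nat \<Rightarrow> (nat \<Rightarrow> real) set" where
  "coeff_box k = {c. \<forall>j. \<bar>c j\<bar> \<le> real k}"

lemma compact_coeff_box: "compact (coeff_box k)"
proof -
  have "compactin (product_topology (\<lambda>i::nat. euclidean) UNIV) (PiE UNIV (\<lambda>_. {- real k..real k}))"
    by (subst compactin_PiE) auto
  moreover have "PiE UNIV (\<lambda>_. {- real k..real k}) = coeff_box k"
    by (auto simp: coeff_box_def PiE_def Pi_def abs_le_iff) (smt (verit))+
  ultimately show ?thesis by (simp add: euclidean_product_topology)
qed

lemma coeff_box_restrict:
  assumes "finite J"
  shows "\<exists>k. (\<lambda>j. if j \<in> J then c j else 0) \<in> coeff_box k"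
proof -
  obtain k :: nat where k: "(\<Sum>j\<in>J. \<bar>c j\<bar>) \<le> real k" using real_arch_simple by blast
  have "\<bar>c j\<bar> \<le> real k" if "j \<in> J" for j
    using member_le_sum[of j J "\<lambda>j. \<bar>c j\<bar>"] that assms k by fastforce
  then show ?thesis by (intro exI[of _ k]) (auto simp: coeff_box_def)
qed

lemma continuous_on_coordinate:
  fixes f :: "'x::topological_space \<Rightarrow> 'i \<Rightarrow> 'b::topological_space"
  assumes "continuous_on S f"
  shows "continuous_on S (\<lambda>x. f x i)"
  using continuous_on_compose2[OF continuous_on_product_coordinates[of i] assms] by auto

lemma borel_face_index:
  fixes I J :: "nat set"
  shows "{y :: nat \<Rightarrow> 'a::euclidean_space. face_index I y J} \<in> sets borel"
proof -
  define S where "S = {p :: (nat \<Rightarrow> 'a) \<times> 'a. (\<forall>j\<in>J. snd p \<bullet> fst p j = 0) \<and> (\<forall>i\<in>I - J. 1 \<le> snd p \<bullet> fst p i)}"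
  have "S = (\<Inter>j\<in>J. {p. snd p \<bullet> fst p j = 0}) \<inter> (\<Inter>i\<in>I - J. {p. 1 \<le> snd p \<bullet> fst p i})"
    by (auto simp: S_def)
  moreover have "closed {p :: (nat \<Rightarrow> 'a) \<times> 'a. snd p \<bullet> fst p j = 0}" "closed {p :: (nat \<Rightarrow> 'a) \<times> 'a. 1 \<le> snd p \<bullet> fst p j}" for j
    by (intro closed_Collect_eq closed_Collect_le continuous_intros continuous_on_coordinate)+
  ultimately have "closed S" by (auto intro!: closed_INT closed_Int)
  then have "{y. \<exists>u. (y, u) \<in> S} \<in> sets borel"
  proof (rule borel_Ex_closed[where K = "\<lambda>k. cball 0 (real k)"])
    fix y u assume "(y, u) \<in> S"
    moreover obtain k :: nat where "norm u \<le> real k" using real_arch_simple by blast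
    ultimately show "\<exists>k. \<exists>u\<in>cball 0 (real k). (y, u) \<in> S"
      by (intro exI[of _ k] bexI[of _ u]) simp_all
  qed simp
  then show ?thesis by (simp add: S_def face_index_def)
qed

lemma borel_prism:
  fixes J :: "nat set"
  assumes J: "finite J"
  shows "{p :: (nat \<Rightarrow> 'a::euclidean_space) \<times> 'a. snd p \<in> prism J (fst p)} \<in> sets borel"
proof -
  define S where "S = {q :: ((nat \<Rightarrow> 'a) \<times> 'a) \<times> (nat \<Rightarrow> real). (\<forall>j\<in>J. 0 \<le> snd q j) \<and>
    (\<forall>i\<in>J. (snd (fst q) - (\<Sum>j\<in>J. snd q j *\<^sub>R fst (fst q) j)) \<bullet> fst (fst q) i = 0)}"
  have "S = (\<Inter>j\<in>J. {q. 0 \<le> snd q j}) \<inter> (\<Inter>i\<in>J. {q. (snd (fst q) - (\<Sum>j\<in>J. snd q j *\<^sub>R fst (fst q) j)) \<bullet> fst (fst q) i = 0})"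
    by (auto simp: S_def)
  moreover have "closed {q :: ((nat \<Rightarrow> 'a) \<times> 'a) \<times> (nat \<Rightarrow> real). 0 \<le> snd q j}"
    "closed {q :: ((nat \<Rightarrow> 'a) \<times> 'a) \<times> (nat \<Rightarrow> real). (snd (fst q) - (\<Sum>j\<in>J. snd q j *\<^sub>R fst (fst q) j)) \<bullet> fst (fst q) j = 0}" for j
    by (intro closed_Collect_eq closed_Collect_le continuous_intros continuous_on_coordinate)+
  ultimately have "closed S" by (auto intro!: closed_INT closed_Int)
  then have "{p. \<exists>c. (p, c) \<in> S} \<in> sets borel"
  proof (rule borel_Ex_closed[OF _ compact_coeff_box])
    fix p c assume a: "(p, c) \<in> S"
    obtain k where k: "(\<lambda>j. if j \<in> J then c j else 0) \<in> coeff_box k" using coeff_box_restrict[OF J] by blast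
    have "(\<Sum>j\<in>J. (if j \<in> J then c j else 0) *\<^sub>R fst p j) = (\<Sum>j\<in>J. c j *\<^sub>R fst p j)"
      by (intro sum.cong) auto
    then have "(p, \<lambda>j. if j \<in> J then c j else 0) \<in> S" using a by (simp add: S_def)
    then show "\<exists>k. \<exists>c'\<in>coeff_box k. (p, c') \<in> S" using k by blast
  qed
  then show ?thesis by (simp add: S_def prism_def)
qed

text \<open>The cone of the points in \<open>J\<close> plus the line through \<open>e\<close>, that
  is, the cylinder over its projection along \<open>e\<close>. It is the analogue of
  \<open>prism\<close> with the normal \<open>u\<close> replaced by \<open>e\<close>.\<close>

definition shadow :: "'a::euclidean_space \<Rightarrow> 'i set \<Rightarrow> ('i \<Rightarrow> 'a) \<Rightarrow> 'a set" where
  "shadow e J y = {w. \<exists>c s. (\<forall>j\<in>J. 0 \<le> c j) \<and> w = (\<Sum>j\<in>J. c j *\<^sub>R y j) + s *\<^sub>R e}"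

lemma borel_shadow:
  fixes J :: "nat set"
  assumes J: "finite J"
  shows "{p :: (nat \<Rightarrow> 'a::euclidean_space) \<times> 'a. snd p \<in> shadow e J (fst p)} \<in> sets borel"
proof -
  define S where "S = {q :: ((nat \<Rightarrow> 'a) \<times> 'a) \<times> ((nat \<Rightarrow> real) \<times> real). (\<forall>j\<in>J. 0 \<le> fst (snd q) j) \<and>
    snd (fst q) = (\<Sum>j\<in>J. fst (snd q) j *\<^sub>R fst (fst q) j) + snd (snd q) *\<^sub>R e}"
  have "S = (\<Inter>j\<in>J. {q. 0 \<le> fst (snd q) j}) \<inter> {q. snd (fst q) = (\<Sum>j\<in>J. fst (snd q) j *\<^sub>R fst (fst q) j) + snd (snd q) *\<^sub>R e}"
    by (auto simp: S_def)
  moreover have "closed {q :: ((nat \<Rightarrow> 'a) \<times> 'a) \<times> ((nat \<Rightarrow> real) \<times> real). 0 \<le> fst (snd q) j}" for j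
    by (intro closed_Collect_le continuous_intros continuous_on_coordinate)
  moreover have "closed {q :: ((nat \<Rightarrow> 'a) \<times> 'a) \<times> ((nat \<Rightarrow> real) \<times> real). snd (fst q) = (\<Sum>j\<in>J. fst (snd q) j *\<^sub>R fst (fst q) j) + snd (snd q) *\<^sub>R e}"
    by (intro closed_Collect_eq continuous_intros continuous_on_coordinate)
  ultimately have "closed S" by (auto intro!: closed_INT closed_Int)
  then have "{p. \<exists>c. (p, c) \<in> S} \<in> sets borel"
  proof (rule borel_Ex_closed[where K = "\<lambda>k. coeff_box k \<times> {- real k..real k}"])
    show "compact (coeff_box k \<times> {- real k..real k})" for k
      by (intro compact_Times compact_coeff_box) simp
    fix p c assume a: "(p, c) \<in> S"
    obtain k where k: "(\<lambda>j. if j \<in> J then fst c j else 0) \<in> coeff_box k" using coeff_box_restrict[OF J] by blast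
    obtain m :: nat where m: "\<bar>snd c\<bar> \<le> real m" using real_arch_simple by blast
    have "coeff_box k \<subseteq> coeff_box (max k m)"
      unfolding coeff_box_def by (auto intro: order_trans)
    then have "(\<lambda>j. if j \<in> J then fst c j else 0, snd c) \<in> coeff_box (max k m) \<times> {- real (max k m)..real (max k m)}"
      using k m by (auto simp: abs_le_iff)
    moreover have "(\<Sum>j\<in>J. (if j \<in> J then fst c j else 0) *\<^sub>R fst p j) = (\<Sum>j\<in>J. fst c j *\<^sub>R fst p j)"
      by (intro sum.cong) auto
    then have "(p, (\<lambda>j. if j \<in> J then fst c j else 0, snd c)) \<in> S" using a by (simp add: S_def)
    ultimately show "\<exists>k. \<exists>c'\<in>coeff_box k \<times> {- real k..real k}. (p, c') \<in> S" by blast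
  qed
  moreover have "{p. \<exists>c. (p, c) \<in> S} = {p. snd p \<in> shadow e J (fst p)}" by (simp add: S_def shadow_def)
  ultimately show ?thesis by simp
qed

text \<open>Independence of an indexed family: unlike independence of the image set, it fails when a
  point is repeated.\<close>

definition lin_indep :: "'i set \<Rightarrow> ('i \<Rightarrow> 'a::real_vector) \<Rightarrow> bool" where
  "lin_indep J y \<longleftrightarrow> (\<forall>c. (\<Sum>j\<in>J. c j *\<^sub>R y j) = 0 \<longrightarrow> (\<forall>j\<in>J. c j = 0))"

lemma lin_indep_iff:
  assumes J: "finite J"
  shows "lin_indep J y \<longleftrightarrow> inj_on y J \<and> independent (y ` J)"
proof
  assume L: "lin_indep J y"
  have inj: "inj_on y J"
  proof (rule inj_onI, rule ccontr)
    fix i j assume ij: "i \<in> J" "j \<in> J" "y i = y j" "i \<noteq> j"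
    define c where "c = (\<lambda>k. (if k = i then 1 else 0) - (if k = j then 1 else 0 :: real))"
    have "(\<Sum>k\<in>J. c k *\<^sub>R y k) = (\<Sum>k\<in>J. (if k = i then y i else 0) - (if k = j then y j else 0))"
      by (intro sum.cong) (auto simp: c_def)
    also have "\<dots> = 0" using ij J by (simp add: sum_subtractf)
    finally have "c i = 0" using L ij(1) unfolding lin_indep_def by blast
    then show False using ij by (simp add: c_def)
  qed
  moreover have "independent (y ` J)"
  proof
    assume "dependent (y ` J)"
    then obtain u where u: "\<exists>v\<in>y ` J. u v \<noteq> 0" "(\<Sum>v\<in>y ` J. u v *\<^sub>R v) = 0"
      using dependent_finite[of "y ` J"] J by auto
    have "(\<Sum>j\<in>J. u (y j) *\<^sub>R y j) = 0" using u(2) by (simp add: sum.reindex[OF inj])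
    then show False using L u(1) unfolding lin_indep_def by (metis imageE)
  qed
  ultimately show "inj_on y J \<and> independent (y ` J)" by simp
next
  assume a: "inj_on y J \<and> independent (y ` J)"
  show "lin_indep J y" unfolding lin_indep_def
  proof (intro allI impI)
    fix c assume c: "(\<Sum>j\<in>J. c j *\<^sub>R y j) = 0"
    define u where "u = (\<lambda>v. c (inv_into J y v))"
    have "(\<Sum>v\<in>y ` J. u v *\<^sub>R v) = (\<Sum>j\<in>J. c j *\<^sub>R y j)"
      using a by (subst sum.reindex) (auto simp: u_def inv_into_f_f intro!: sum.cong)
    then have "\<forall>v\<in>y ` J. u v = 0"
      using a c dependent_finite[of "y ` J"] J by auto
    then show "\<forall>j\<in>J. c j = 0" using a by (auto simp: u_def inv_into_f_f)
  qed
qed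

text \<open>Reduces the dimension to finitely many conditions \<open>lin_indep\<close>, which makes
  it measurable.\<close>

lemma dim_image_ge_iff:
  fixes y :: "'i \<Rightarrow> 'a::euclidean_space"
  assumes J: "finite J"
  shows "k \<le> dim (y ` J) \<longleftrightarrow> (\<exists>K\<subseteq>J. card K = k \<and> lin_indep K y)"
proof
  assume k: "k \<le> dim (y ` J)"
  obtain B where B: "B \<subseteq> y ` J" "independent B" "card B = dim (y ` J)"
    using basis_exists[of "y ` J"] by metis
  obtain B' where B': "B' \<subseteq> B" "card B' = k" using obtain_subset_with_card_n[of k B] k B(3) by metis
  define K where "K = inv_into J y ` B'"
  have sub: "B' \<subseteq> y ` J" using B B' by blast
  have inj: "inj_on (inv_into J y) B'" by (rule inj_on_inv_into[OF sub])
  have yK: "y (inv_into J y b) = b" if "b \<in> B'" for b using that sub by (auto intro: f_inv_into_f)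
  have "y ` K = B'" using yK by (force simp: K_def)
  moreover have "inj_on y K" using yK by (auto simp: K_def intro!: inj_onI)
  moreover have "independent B'" using B(2) B'(1) independent_mono by blast
  moreover have "K \<subseteq> J" using sub by (auto simp: K_def intro!: inv_into_into)
  moreover have "card K = k" using inj B'(2) by (simp add: K_def card_image)
  ultimately show "\<exists>K\<subseteq>J. card K = k \<and> lin_indep K y"
    using lin_indep_iff[of K y] J finite_subset by metis
next
  assume "\<exists>K\<subseteq>J. card K = k \<and> lin_indep K y"
  then obtain K where K: "K \<subseteq> J" "card K = k" "lin_indep K y" by blast
  have "finite K" using K(1) J finite_subset by blast
  then have "inj_on y K" "independent (y ` K)" using K(3) lin_indep_iff by blast+
  then have "k = dim (y ` K)" using K(2) by (simp add: dim_eq_card_independent card_image)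
  also have "\<dots> \<le> dim (y ` J)" using K(1) by (intro dim_subset) auto
  finally show "k \<le> dim (y ` J)" .
qed

text \<open>Dependence becomes a closed relation between points and coefficients once one
  coefficient is normalized to 1; the union over the choice of that coefficient is finite.\<close>

lemma borel_lin_indep:
  fixes J :: "nat set"
  assumes J: "finite J"
  shows "{y :: nat \<Rightarrow> 'a::euclidean_space. lin_indep J y} \<in> sets borel"
proof -
  have "{y :: nat \<Rightarrow> 'a. \<exists>c. c i = 1 \<and> (\<Sum>j\<in>J. c j *\<^sub>R y j) = 0} \<in> sets borel" if i: "i \<in> J" for i
  proof -
    define S where "S = {q :: (nat \<Rightarrow> 'a) \<times> (nat \<Rightarrow> real). snd q i = 1 \<and> (\<Sum>j\<in>J. snd q j *\<^sub>R fst q j) = 0}"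
    have "S = {q. snd q i = 1} \<inter> {q. (\<Sum>j\<in>J. snd q j *\<^sub>R fst q j) = 0}" by (auto simp: S_def)
    moreover have "closed {q :: (nat \<Rightarrow> 'a) \<times> (nat \<Rightarrow> real). snd q i = 1}"
      "closed {q :: (nat \<Rightarrow> 'a) \<times> (nat \<Rightarrow> real). (\<Sum>j\<in>J. snd q j *\<^sub>R fst q j) = 0}"
      by (intro closed_Collect_eq continuous_intros continuous_on_coordinate)+
    ultimately have "closed S" by (auto intro!: closed_Int)
    then have "{y. \<exists>c. (y, c) \<in> S} \<in> sets borel"
    proof (rule borel_Ex_closed[OF _ compact_coeff_box])
      fix y c assume a: "(y, c) \<in> S"
      obtain k where k: "(\<lambda>j. if j \<in> J then c j else 0) \<in> coeff_box k" using coeff_box_restrict[OF J] by blast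
      have "(\<Sum>j\<in>J. (if j \<in> J then c j else 0) *\<^sub>R y j) = (\<Sum>j\<in>J. c j *\<^sub>R y j)"
        by (intro sum.cong) auto
      then have "(y, \<lambda>j. if j \<in> J then c j else 0) \<in> S" using a i by (simp add: S_def)
      then show "\<exists>k. \<exists>c'\<in>coeff_box k. (y, c') \<in> S" using k by blast
    qed
    then show ?thesis by (simp add: S_def)
  qed
  then have B: "(\<Union>i\<in>J. {y :: nat \<Rightarrow> 'a. \<exists>c. c i = 1 \<and> (\<Sum>j\<in>J. c j *\<^sub>R y j) = 0}) \<in> sets borel"
    using J by (intro sets.finite_UN) auto
  have eq: "{y :: nat \<Rightarrow> 'a. lin_indep J y} = - (\<Union>i\<in>J. {y. \<exists>c. c i = 1 \<and> (\<Sum>j\<in>J. c j *\<^sub>R y j) = 0})"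
  proof (intro set_eqI iffI)
    fix y :: "nat \<Rightarrow> 'a" assume "y \<in> {y. lin_indep J y}"
    then show "y \<in> - (\<Union>i\<in>J. {y. \<exists>c. c i = 1 \<and> (\<Sum>j\<in>J. c j *\<^sub>R y j) = 0})"
      unfolding lin_indep_def by fastforce
  next
    fix y :: "nat \<Rightarrow> 'a" assume y: "y \<in> - (\<Union>i\<in>J. {y. \<exists>c. c i = 1 \<and> (\<Sum>j\<in>J. c j *\<^sub>R y j) = 0})"
    have "c i = 0" if c: "(\<Sum>j\<in>J. c j *\<^sub>R y j) = 0" and i: "i \<in> J" for c i
    proof (rule ccontr)
      assume "c i \<noteq> 0"
      have "(\<Sum>j\<in>J. (c j / c i) *\<^sub>R y j) = inverse (c i) *\<^sub>R (\<Sum>j\<in>J. c j *\<^sub>R y j)"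
        by (simp add: scaleR_sum_right divide_inverse mult.commute)
      then have "(\<Sum>j\<in>J. (c j / c i) *\<^sub>R y j) = 0" using c by simp
      moreover have "c i / c i = 1" using \<open>c i \<noteq> 0\<close> by simp
      ultimately have "\<exists>c. c i = 1 \<and> (\<Sum>j\<in>J. c j *\<^sub>R y j) = 0" by (intro exI[of _ "\<lambda>j. c j / c i"]) auto
      then show False using y i by blast
    qed
    then show "y \<in> {y. lin_indep J y}" by (auto simp: lin_indep_def)
  qed
  show ?thesis unfolding eq by (rule borel_comp[OF B])
qed

lemma borel_dim_image:
  fixes J :: "nat set"
  assumes J: "finite J"
  shows "{y :: nat \<Rightarrow> 'a::euclidean_space. dim (y ` J) = k} \<in> sets borel"
proof -
  have ge: "{y :: nat \<Rightarrow> 'a. k \<le> dim (y ` J)} \<in> sets borel" for k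
  proof -
    have "{y :: nat \<Rightarrow> 'a. k \<le> dim (y ` J)} = (\<Union>K\<in>{K. K \<subseteq> J \<and> card K = k}. {y. lin_indep K y})"
      using dim_image_ge_iff[OF J] by auto
    moreover have "\<dots> \<in> sets borel"
      using J finite_subset by (intro sets.finite_UN) (auto intro!: borel_lin_indep)
    ultimately show ?thesis by simp
  qed
  have "{y :: nat \<Rightarrow> 'a. dim (y ` J) = k} = {y. k \<le> dim (y ` J)} - {y. Suc k \<le> dim (y ` J)}" by auto
  then show ?thesis using sets.Diff[OF ge[of k] ge[of "Suc k"]] by simp
qed

lemma borel_measurable_section:
  fixes Q :: "((nat \<Rightarrow> 'a::euclidean_space) \<times> 'a) set"
  assumes "Q \<in> sets borel"
  shows "(\<lambda>y. measure ball_measure {w. (y, w) \<in> Q}) \<in> borel_measurable borel"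
    "(\<lambda>y. emeasure ball_measure {w. (y, w) \<in> Q}) \<in> borel_measurable borel"
proof -
  interpret prob_space "ball_measure :: 'a measure" by (rule prob_space_ball_measure)
  have e: "sets ((borel :: (nat \<Rightarrow> 'a) measure) \<Otimes>\<^sub>M (ball_measure :: 'a measure)) = sets (borel \<Otimes>\<^sub>M borel)"
    by (rule sets_pair_measure_cong) auto
  have Q: "Q \<in> sets ((borel :: (nat \<Rightarrow> 'a) measure) \<Otimes>\<^sub>M (ball_measure :: 'a measure))"
    unfolding e borel_prod by (rule assms)
  from measurable_emeasure_Pair[OF this]
  show *: "(\<lambda>y. emeasure ball_measure {w. (y, w) \<in> Q}) \<in> borel_measurable borel"
    by (simp add: vimage_def)
  then show "(\<lambda>y. measure ball_measure {w. (y, w) \<in> Q}) \<in> borel_measurable borel"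
    unfolding measure_def by measurable
qed

lemma borel_measurable_prism_measure:
  assumes "finite J"
  shows "(\<lambda>y :: nat \<Rightarrow> 'a::euclidean_space. measure ball_measure (prism J y)) \<in> borel_measurable borel"
  using borel_measurable_section(1)[OF borel_prism[OF assms]] by simp

lemma borel_measurable_surface_area:
  assumes I: "finite I" and D: "DIM('a::euclidean_space) \<ge> 2"
  shows "(\<lambda>y :: nat \<Rightarrow> 'a. surface_area (conv_s (y ` I))) \<in> borel_measurable borel"
proof -
  \<comment> \<open>The index set of zero vectors varies with \<open>y\<close>, so the event is
    split according to its value \<open>Z\<close>.\<close>
  have 1: "{y :: nat \<Rightarrow> 'a. face_index I y {i \<in> I. y i = 0}} \<in> sets borel"
  proof -
    have z: "{y :: nat \<Rightarrow> 'a. {i \<in> I. y i = 0} = Z} \<in> sets borel" if "Z \<subseteq> I" for Z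
    proof -
      have "closed {y :: nat \<Rightarrow> 'a. y i = 0}" for i
        by (intro closed_Collect_eq continuous_intros continuous_on_product_coordinates)
      then have [measurable]: "{y :: nat \<Rightarrow> 'a. y i = 0} \<in> sets borel" for i by (rule borel_closed)
      have "{y \<in> space (borel :: (nat \<Rightarrow> 'a) measure). \<forall>i\<in>I. (y i = 0) = (i \<in> Z)} \<in> sets borel"
      proof (rule sets.sets_Collect_finite_All[OF _ I])
        fix i
        show "{y \<in> space (borel :: (nat \<Rightarrow> 'a) measure). (y i = 0) = (i \<in> Z)} \<in> sets borel"
        proof (cases "i \<in> Z")
          case False
          have "- {y :: nat \<Rightarrow> 'a. y i = 0} \<in> sets borel" by (rule borel_comp) simp
          then show ?thesis using False by (simp add: Compl_eq)
        qed simp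
      qed
      moreover have "{y :: nat \<Rightarrow> 'a. {i \<in> I. y i = 0} = Z} = {y \<in> space borel. \<forall>i\<in>I. (y i = 0) = (i \<in> Z)}"
        using that by auto
      ultimately show ?thesis by simp
    qed
    have "{y :: nat \<Rightarrow> 'a. face_index I y {i \<in> I. y i = 0}}
      = (\<Union>Z\<in>Pow I. {y. {i \<in> I. y i = 0} = Z} \<inter> {y. face_index I y Z})"
    proof (intro equalityI subsetI)
      fix y :: "nat \<Rightarrow> 'a" assume y: "y \<in> {y. face_index I y {i \<in> I. y i = 0}}"
      show "y \<in> (\<Union>Z\<in>Pow I. {y. {i \<in> I. y i = 0} = Z} \<inter> {y. face_index I y Z})"
        by (rule UN_I[of "{i \<in> I. y i = 0}"]) (use y in simp_all)
    next
      fix y :: "nat \<Rightarrow> 'a" assume "y \<in> (\<Union>Z\<in>Pow I. {y. {i \<in> I. y i = 0} = Z} \<inter> {y. face_index I y Z})"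
      then obtain Z where "{i \<in> I. y i = 0} = Z" "face_index I y Z" by blast
      then show "y \<in> {y. face_index I y {i \<in> I. y i = 0}}" by simp
    qed
    also have "\<dots> \<in> sets borel"
    proof (rule sets.finite_UN)
      show "finite (Pow I)" using I by simp
      fix Z assume "Z \<in> Pow I"
      then show "{y :: nat \<Rightarrow> 'a. {i \<in> I. y i = 0} = Z} \<inter> {y. face_index I y Z} \<in> sets borel"
        by (intro sets.Int[OF z borel_face_index]) simp
    qed
    finally show ?thesis .
  qed
  have "(\<lambda>y :: nat \<Rightarrow> 'a. surface_area (conv_s (y ` I))) = (\<lambda>y. indicator {y. face_index I y {i \<in> I. y i = 0}} y *
    (\<Sum>J\<in>Pow I. indicator ({y. face_index I y J} \<inter> {y. dim (y ` J) = DIM('a) - 1}) y *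
      (omega (DIM('a) - 1) * measure ball_measure (prism J y))))"
  proof
    fix y :: "nat \<Rightarrow> 'a"
    have "(\<Sum>J | J \<subseteq> I \<and> face_index I y J \<and> dim (y ` J) = DIM('a) - 1. omega (DIM('a) - 1) * measure ball_measure (prism J y))
      = (\<Sum>J\<in>Pow I. indicator ({y. face_index I y J} \<inter> {y. dim (y ` J) = DIM('a) - 1}) y *
      (omega (DIM('a) - 1) * measure ball_measure (prism J y)))"
      using I by (intro sum.mono_neutral_cong_left) auto
    then show "surface_area (conv_s (y ` I)) = indicator {y. face_index I y {i \<in> I. y i = 0}} y *
    (\<Sum>J\<in>Pow I. indicator ({y. face_index I y J} \<inter> {y. dim (y ` J) = DIM('a) - 1}) y *
      (omega (DIM('a) - 1) * measure ball_measure (prism J y)))"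
      by (simp add: surface_area_conv_s[OF I D])
  qed
  also have "\<dots> \<in> borel_measurable borel"
    using I finite_subset
    by (intro borel_measurable_times borel_measurable_sum borel_measurable_indicator borel_measurable_const
        borel_measurable_prism_measure 1 sets.Int borel_face_index borel_dim_image) auto
  finally show ?thesis .
qed

section \<open>Samples from a product of balls\<close>

interpretation ball_PiM: product_prob_space "\<lambda>_::nat. ball_measure :: 'a::euclidean_space measure" "UNIV :: nat set"
  by (rule product_prob_spaceI) (rule prob_space_ball_measure)

abbreviation ball_product :: "nat set \<Rightarrow> (nat \<Rightarrow> 'a::euclidean_space) measure" where
  "ball_product I \<equiv> \<Pi>\<^sub>M i\<in>I. ball_measure"

lemma prob_space_ball_product: "prob_space (ball_product I)"
  by (rule prob_space_PiM) (rule prob_space_ball_measure)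

text \<open>Members of the product space over \<open>I\<close> are constant off \<open>I\<close>, so
  every coordinate is measurable, and Borel facts about all sequences apply on
  \<open>ball_product I\<close>.\<close>

lemma measurable_ball_product_id[measurable]: "(\<lambda>z. z) \<in> ball_product I \<rightarrow>\<^sub>M borel"
proof (rule measurable_coordinatewise_then_product)
  fix i
  show "(\<lambda>z. z i) \<in> borel_measurable (ball_product I :: (nat \<Rightarrow> 'a) measure)"
  proof (cases "i \<in> I")
    case True
    then show ?thesis using measurable_component_singleton[of i I "\<lambda>_. ball_measure :: 'a measure"]
      by (simp cong: measurable_cong_sets)
  next
    case False
    have c: "(\<lambda>z. undefined) \<in> borel_measurable (ball_product I :: (nat \<Rightarrow> 'a) measure)" by simp
    have "z i = undefined" if "z \<in> space (ball_product I :: (nat \<Rightarrow> 'a) measure)" for z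
      using that False by (auto simp: space_PiM PiE_def extensional_def)
    then show ?thesis by (rule measurable_cong[THEN iffD2, OF _ c])
  qed
qed

lemma measurable_ball_product_borel:
  "f \<in> borel \<rightarrow>\<^sub>M N \<Longrightarrow> f \<in> (ball_product I :: (nat \<Rightarrow> 'a::euclidean_space) measure) \<rightarrow>\<^sub>M N"
  using measurable_compose[OF measurable_ball_product_id] by blast

lemma measurable_coordinate[measurable]:
  "(\<lambda>y :: nat \<Rightarrow> 'a::euclidean_space. y i) \<in> borel_measurable borel"
  by (intro borel_measurable_continuous_onI continuous_on_product_coordinates)

abbreviation flips :: "'a::euclidean_space \<Rightarrow> ('i \<Rightarrow> 'a) \<Rightarrow> 'i \<Rightarrow> 'a" where
  "flips e z \<equiv> \<lambda>i. flip e (z i)"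

lemma measurable_flips:
  fixes f :: "'b \<Rightarrow> 'a::euclidean_space" and g :: "'b \<Rightarrow> nat \<Rightarrow> 'a"
  assumes [measurable]: "f \<in> borel_measurable M" "g \<in> M \<rightarrow>\<^sub>M borel"
  shows "(\<lambda>x. flips (f x) (g x)) \<in> M \<rightarrow>\<^sub>M borel"
proof (rule measurable_coordinatewise_then_product)
  fix i
  have "(\<lambda>x. g x i) \<in> borel_measurable M" by (rule measurable_compose[OF assms(2) measurable_coordinate])
  then show "(\<lambda>x. flip (f x) (g x i)) \<in> borel_measurable M" by measurable
qed

section \<open>General position\<close>

lemma lin_indep_insert:
  assumes "finite J" "i \<notin> J" "lin_indep J y" "y i \<notin> span (y ` J)"
  shows "lin_indep (insert i J) y"
proof -
  have a: "inj_on y J" "independent (y ` J)" using assms lin_indep_iff by blast+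
  have ni: "y i \<notin> y ` J" using assms(4) span_base[of "y i" "y ` J"] by auto
  have "independent (insert (y i) (y ` J))" using a(2) ni assms(4) by (simp add: independent_insert)
  moreover have "inj_on y (insert i J)" using a(1) ni assms(2) by simp
  ultimately show ?thesis using assms(1) by (intro lin_indep_iff[THEN iffD2]) auto
qed

lemma AE_ball_measure_span:
  fixes A :: "'a::euclidean_space set"
  assumes "dim A < DIM('a)" shows "AE x in ball_measure. x \<notin> span A"
proof (rule AE_ball_measure)
  have "negligible (span A)" using assms by (intro negligible_lowdim) simp
  then have "AE x in lebesgue. x \<notin> span A"
    by (intro AE_I'[of "span A"]) (auto simp: negligible_iff_null_sets)
  then show "AE x in lborel. x \<notin> span A" by (simp add: AE_completion_iff)
qed

text \<open>Points are added one at a time: fewer than \<open>DIM('a)\<close> points span a null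
  set, and by Fubini the next point almost surely avoids it.\<close>

lemma AE_lin_indep:
  fixes I J :: "nat set"
  assumes "finite I" "J \<subseteq> I" "card J \<le> DIM('a::euclidean_space)"
  shows "AE z in (ball_product I :: (nat \<Rightarrow> 'a) measure). lin_indep J z"
proof -
  have "finite J" using assms finite_subset by blast
  then show ?thesis using assms
  proof (induction J arbitrary: I)
    case empty
    then show ?case by (simp add: lin_indep_def)
  next
    case (insert i J)
    define I' where "I' = I - {i}"
    have I': "finite I'" "i \<notin> I'" "I = insert i I'" "J \<subseteq> I'" using insert by (auto simp: I'_def)
    have IH: "AE z in (ball_product I' :: (nat \<Rightarrow> 'a) measure). lin_indep J z"
      using insert I' by (intro insert.IH) auto
    let ?N = "{y :: nat \<Rightarrow> 'a. \<not> lin_indep (insert i J) y}"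
    have "- {y :: nat \<Rightarrow> 'a. lin_indep (insert i J) y} \<in> sets borel"
      using insert by (intro borel_comp borel_lin_indep) simp
    then have N: "?N \<in> sets borel" by (simp add: Compl_eq)
    have m: "indicator ?N \<in> borel_measurable (ball_product I :: (nat \<Rightarrow> 'a) measure)"
      using N by (intro measurable_ball_product_borel) simp
    have "(\<integral>\<^sup>+z. indicator ?N z \<partial>ball_product I)
      = (\<integral>\<^sup>+x. \<integral>\<^sup>+y. indicator ?N (x(i := y)) \<partial>ball_measure \<partial>ball_product I')"
      unfolding I'(3) by (rule ball_PiM.product_nn_integral_insert[OF I'(1,2)]) (use m I' in simp)
    also have "\<dots> = (\<integral>\<^sup>+x. 0 \<partial>(ball_product I' :: (nat \<Rightarrow> 'a) measure))"
    proof (rule nn_integral_cong_AE, use IH in eventually_elim)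
      fix x :: "nat \<Rightarrow> 'a" assume x: "lin_indep J x"
      have "dim (x ` J) \<le> card (x ` J)" using insert by (simp add: dim_le_card')
      also have "\<dots> \<le> card J" using insert by (simp add: card_image_le)
      also have "\<dots> < DIM('a)" using insert by simp
      finally have "AE y in ball_measure. y \<notin> span (x ` J)" by (rule AE_ball_measure_span)
      then have "AE y in ball_measure. indicator ?N (x(i := y)) = (0::ennreal)"
      proof eventually_elim
        fix y assume y: "y \<notin> span (x ` J)"
        have im: "(x(i := y)) ` J = x ` J" using insert by auto
        have "lin_indep J (x(i := y))"
        proof -
          have "(\<Sum>j\<in>J. c j *\<^sub>R (x(i := y)) j) = (\<Sum>j\<in>J. c j *\<^sub>R x j)" for c
            using insert by (intro sum.cong) auto
          then show ?thesis using x by (simp add: lin_indep_def)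
        qed
        then have "lin_indep (insert i J) (x(i := y))"
          using insert y im by (intro lin_indep_insert) auto
        then show "indicator ?N (x(i := y)) = (0::ennreal)" by simp
      qed
      then have "(\<integral>\<^sup>+y. indicator ?N (x(i := y)) \<partial>ball_measure) = (\<integral>\<^sup>+y. 0 \<partial>(ball_measure :: 'a measure))"
        by (rule nn_integral_cong_AE)
      then show "(\<integral>\<^sup>+y. indicator ?N (x(i := y)) \<partial>ball_measure) = 0" by simp
    qed
    finally have "(\<integral>\<^sup>+z. indicator ?N z \<partial>(ball_product I :: (nat \<Rightarrow> 'a) measure)) = 0" by simp
    then have "AE z in (ball_product I :: (nat \<Rightarrow> 'a) measure). indicator ?N z = (0::ennreal)"
      by (rule nn_integral_0_iff_AE[OF m, THEN iffD1])
    then show ?case by eventually_elim (auto simp: indicator_def split: if_splits)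
  qed
qed

definition general_position :: "'i set \<Rightarrow> ('i \<Rightarrow> 'a::euclidean_space) \<Rightarrow> bool" where
  "general_position I y \<longleftrightarrow> (\<forall>J\<subseteq>I. card J \<le> DIM('a) \<longrightarrow> lin_indep J y)"

lemma AE_general_position:
  assumes "finite I"
  shows "AE z in (ball_product I :: (nat \<Rightarrow> 'a::euclidean_space) measure). general_position I z"
proof -
  have "AE z in (ball_product I :: (nat \<Rightarrow> 'a) measure). \<forall>J\<in>{J. J \<subseteq> I \<and> card J \<le> DIM('a)}. lin_indep J z"
  proof (rule AE_finite_allI)
    show "finite {J. J \<subseteq> I \<and> card J \<le> DIM('a)}" using assms by simp
    show "AE z in (ball_product I :: (nat \<Rightarrow> 'a) measure). lin_indep J z"
      if "J \<in> {J. J \<subseteq> I \<and> card J \<le> DIM('a)}" for J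
      using that by (intro AE_lin_indep[OF assms]) auto
  qed
  then show ?thesis by eventually_elim (auto simp: general_position_def)
qed

lemma lin_indep_flips: "lin_indep J (flips e z) \<longleftrightarrow> lin_indep J z"
proof -
  define s where "s = (\<lambda>i. if z i \<bullet> e \<ge> 0 then 1 else -1 :: real)"
  have f: "flip e (z i) = s i *\<^sub>R z i" for i by (simp add: flip_def s_def)
  have ss: "s i * s i = 1" "s i \<noteq> 0" for i by (auto simp: s_def)
  show ?thesis
  proof
    assume L: "lin_indep J (flips e z)"
    show "lin_indep J z" unfolding lin_indep_def
    proof (intro allI impI)
      fix c assume "(\<Sum>j\<in>J. c j *\<^sub>R z j) = 0"
      then have "(\<Sum>j\<in>J. (c j * s j) *\<^sub>R flip e (z j)) = 0" by (simp add: f mult.assoc ss)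
      then have "\<forall>j\<in>J. c j * s j = 0" using L unfolding lin_indep_def by (elim allE[of _ "\<lambda>j. c j * s j"]) simp
      then show "\<forall>j\<in>J. c j = 0" using ss by auto
    qed
  next
    assume L: "lin_indep J z"
    show "lin_indep J (flips e z)" unfolding lin_indep_def
    proof (intro allI impI)
      fix c assume "(\<Sum>j\<in>J. c j *\<^sub>R flip e (z j)) = 0"
      then have "(\<Sum>j\<in>J. (c j * s j) *\<^sub>R z j) = 0" by (simp add: f)
      then have "\<forall>j\<in>J. c j * s j = 0" using L unfolding lin_indep_def by (elim allE[of _ "\<lambda>j. c j * s j"]) simp
      then show "\<forall>j\<in>J. c j = 0" using ss by auto
    qed
  qed
qed

lemma general_position_flips: "general_position I (flips e z) \<longleftrightarrow> general_position I z"
  by (simp add: general_position_def lin_indep_flips)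

lemma general_position_dim:
  fixes y :: "'i \<Rightarrow> 'a::euclidean_space"
  assumes I: "finite I" "J \<subseteq> I" and g: "general_position I y"
  shows "dim (y ` J) = min (card J) DIM('a)"
proof (cases "card J \<le> DIM('a)")
  case True
  have "finite J" using I finite_subset by blast
  moreover have "lin_indep J y" using g True I(2) unfolding general_position_def by simp
  ultimately have "inj_on y J" "independent (y ` J)" by (simp_all add: lin_indep_iff)
  then show ?thesis using True by (simp add: dim_eq_card_independent card_image)
next
  case False
  have "finite J" using I finite_subset by blast
  obtain K where K: "K \<subseteq> J" "card K = DIM('a)" using False obtain_subset_with_card_n[of "DIM('a)" J] by auto
  have "K \<subseteq> I" using K(1) I(2) by (rule subset_trans)
  then have "lin_indep K y" using g K(2) unfolding general_position_def by simp
  then have "DIM('a) \<le> dim (y ` J)"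
    using K by (intro dim_image_ge_iff[OF \<open>finite J\<close>, THEN iffD2] exI[of _ K]) simp
  moreover have "dim (y ` J) \<le> DIM('a)" by (rule dim_subset_UNIV)
  ultimately show ?thesis using False by simp
qed

lemma flip_inner_pos: "z \<bullet> e \<noteq> 0 \<Longrightarrow> 0 < flip e z \<bullet> e"
  by (simp add: flip_def)

lemma AE_ball_product_component:
  assumes "finite I" "i \<in> I" and P: "AE x in (ball_measure :: 'a::euclidean_space measure). P x"
    and [measurable]: "Measurable.pred borel P"
  shows "AE z in (ball_product I :: (nat \<Rightarrow> 'a) measure). P (z i)"
proof -
  have d: "distr (ball_product I :: (nat \<Rightarrow> 'a) measure) ball_measure (\<lambda>z. z i) = ball_measure"
    by (rule distr_PiM_component) (use assms(2) prob_space_ball_measure in auto)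
  have "AE x in distr (ball_product I :: (nat \<Rightarrow> 'a) measure) ball_measure (\<lambda>z. z i). P x"
    unfolding d by (rule P)
  then show ?thesis
    using assms(2) by (subst (asm) AE_distr_iff) (auto intro: measurable_component_singleton)
qed

lemma AE_inner_nonzero:
  fixes e :: "'a::euclidean_space"
  assumes "finite I" "e \<noteq> 0"
  shows "AE z in (ball_product I :: (nat \<Rightarrow> 'a) measure). \<forall>i\<in>I. z i \<bullet> e \<noteq> 0"
proof (rule AE_finite_allI[OF assms(1)])
  fix i assume "i \<in> I"
  then show "AE z in (ball_product I :: (nat \<Rightarrow> 'a) measure). z i \<bullet> e \<noteq> 0"
    by (intro AE_ball_product_component[OF assms(1)] AE_ball_measure_hyperplane assms(2)) measurable
qed

text \<open>All flipped points have positive inner product with \<open>e\<close>, so the cone is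
  pointed. In general position a face spanning a hyperplane contains exactly
  \<open>DIM('a) - 1\<close> of the points.\<close>

lemma surface_area_general_position:
  fixes z :: "nat \<Rightarrow> 'a::euclidean_space"
  assumes I: "finite I" and D: "DIM('a) \<ge> 2" and g: "general_position I z"
    and nz: "\<forall>i\<in>I. z i \<bullet> e \<noteq> 0"
  shows "surface_area (conv_s (flips e z ` I)) = omega (DIM('a) - 1) *
    (\<Sum>J | J \<subseteq> I \<and> card J = DIM('a) - 1. indicator {y. face_index I y J} (flips e z) * measure ball_measure (prism J (flips e z)))"
proof -
  have "face_index I (flips e z) {i \<in> I. flip e (z i) = 0}"
    unfolding face_index_iff_pos[OF I]
  proof (intro exI[of _ e] conjI ballI)
    fix i assume "i \<in> I - {i \<in> I. flip e (z i) = 0}"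
    then show "0 < e \<bullet> flip e (z i)" using flip_inner_pos[of "z i" e] nz by (simp add: inner_commute)
  qed simp
  then have "surface_area (conv_s (flips e z ` I)) =
    (\<Sum>J | J \<subseteq> I \<and> face_index I (flips e z) J \<and> dim (flips e z ` J) = DIM('a) - 1.
      omega (DIM('a) - 1) * measure ball_measure (prism J (flips e z)))"
    by (simp add: surface_area_conv_s[OF I D])
  also have "\<dots> = (\<Sum>J | J \<subseteq> I \<and> card J = DIM('a) - 1. omega (DIM('a) - 1) *
      (indicator {y. face_index I y J} (flips e z) * measure ball_measure (prism J (flips e z))))"
  proof (rule sum.mono_neutral_cong_left)
    show "finite {J. J \<subseteq> I \<and> card J = DIM('a) - 1}" using I by simp
    have dc: "dim (flips e z ` J) = DIM('a) - 1 \<longleftrightarrow> card J = DIM('a) - 1" if "J \<subseteq> I" for J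
      using general_position_dim[OF I that, of "flips e z"] g D unfolding general_position_flips by auto
    then show "{J. J \<subseteq> I \<and> face_index I (flips e z) J \<and> dim (flips e z ` J) = DIM('a) - 1} \<subseteq> {J. J \<subseteq> I \<and> card J = DIM('a) - 1}"
      by auto
    show "\<forall>J\<in>{J. J \<subseteq> I \<and> card J = DIM('a) - 1} - {J. J \<subseteq> I \<and> face_index I (flips e z) J \<and> dim (flips e z ` J) = DIM('a) - 1}.
       omega (DIM('a) - 1) * (indicator {y. face_index I y J} (flips e z) * measure ball_measure (prism J (flips e z))) = 0"
      using dc by (auto simp: indicator_def)
  qed auto
  finally show ?thesis by (simp add: sum_distrib_left)
qed

lemma emeasure_flip_halfspace:
  fixes e u :: "'a::euclidean_space"
  assumes e: "norm e = 1" and u: "norm u = 1" and D: "DIM('a) \<ge> 2"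
  shows "emeasure ball_measure {z. 0 < u \<bullet> flip e z} = ennreal (1 - arccos (u \<bullet> e) / pi)"
    "emeasure ball_measure {z. u \<bullet> flip e z < 0} = ennreal (arccos (u \<bullet> e) / pi)"
proof -
  show "emeasure ball_measure {z. 0 < u \<bullet> flip e z} = ennreal (1 - arccos (u \<bullet> e) / pi)"
    by (simp add: ball_PiM.M.emeasure_eq_measure measure_flip_halfspace[OF e u D])
  have ue: "\<bar>u \<bullet> e\<bar> \<le> 1" using Cauchy_Schwarz_ineq2[of u e] e u by simp
  have "measure ball_measure {z. 0 < (- u) \<bullet> flip e z} = 1 - arccos ((- u) \<bullet> e) / pi"
    using u by (intro measure_flip_halfspace[OF e _ D]) simp
  also have "arccos ((- u) \<bullet> e) = pi - arccos (u \<bullet> e)"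
    using ue arccos_minus[of "u \<bullet> e"] by (simp add: abs_le_iff)
  also have "1 - (pi - arccos (u \<bullet> e)) / pi = arccos (u \<bullet> e) / pi" by (simp add: field_simps)
  finally show "emeasure ball_measure {z. u \<bullet> flip e z < 0} = ennreal (arccos (u \<bullet> e) / pi)"
    by (simp add: ball_PiM.M.emeasure_eq_measure)
qed

text \<open>A vector annihilating the points of \<open>J\<close> is a multiple of \<open>u\<close>.
  So all other points must lie strictly on one side of the hyperplane, and the sign of the multiple
  says on which.\<close>

lemma face_index_hyperplane_iff:
  fixes y :: "'i \<Rightarrow> 'a::euclidean_space"
  assumes fin: "finite J" "finite K" and "K \<noteq> {}" "J \<inter> K = {}"
    and u: "norm u = 1" and sp: "span (y ` J) = {x. x \<bullet> u = 0}"
  shows "face_index (J \<union> K) y J \<longleftrightarrow> (\<forall>i\<in>K. 0 < u \<bullet> y i) \<or> (\<forall>i\<in>K. u \<bullet> y i < 0)"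
proof -
  have K: "J \<union> K - J = K" using assms by auto
  have yu: "y j \<bullet> u = 0" if "j \<in> J" for j using span_base[of "y j" "y ` J"] sp that by auto
  show ?thesis
  proof
    assume "face_index (J \<union> K) y J"
    then obtain v where v: "\<forall>j\<in>J. v \<bullet> y j = 0" "\<forall>i\<in>K. 0 < v \<bullet> y i"
      using face_index_iff_pos[of "J \<union> K" y J] fin K by auto
    define v' where "v' = v - (v \<bullet> u) *\<^sub>R u"
    have "v' \<bullet> u = 0" using u by (simp add: v'_def inner_diff_left norm_eq_1)
    then have "v' \<in> span (y ` J)" using sp by simp
    moreover have "orthogonal v' x" if "x \<in> y ` J" for x
      using that v(1) yu by (auto simp: v'_def orthogonal_def inner_diff_left inner_diff_right inner_commute)
    then have "orthogonal v' x" if "x \<in> span (y ` J)" for x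
      using that orthogonal_to_span by blast
    ultimately have "v' = 0" by (metis orthogonal_self)
    then have vu: "v = (v \<bullet> u) *\<^sub>R u" by (simp add: v'_def)
    have vy: "v \<bullet> y i = (v \<bullet> u) * (u \<bullet> y i)" for i by (subst vu) simp
    consider "v \<bullet> u > 0" | "v \<bullet> u < 0" | "v \<bullet> u = 0" by linarith
    then show "(\<forall>i\<in>K. 0 < u \<bullet> y i) \<or> (\<forall>i\<in>K. u \<bullet> y i < 0)"
    proof cases
      case 1 then show ?thesis using v(2) vy by (auto simp: zero_less_mult_iff)
    next
      case 2 then show ?thesis using v(2) vy by (auto simp: zero_less_mult_iff)
    next
      case 3 then show ?thesis using v(2) vy assms(3) by auto
    qed
  next
    assume "(\<forall>i\<in>K. 0 < u \<bullet> y i) \<or> (\<forall>i\<in>K. u \<bullet> y i < 0)"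
    then show "face_index (J \<union> K) y J"
    proof
      assume "\<forall>i\<in>K. 0 < u \<bullet> y i"
      then show ?thesis using face_index_iff_pos[of "J \<union> K" y J] fin K yu
        by (auto intro!: exI[of _ u] simp: inner_commute)
    next
      assume "\<forall>i\<in>K. u \<bullet> y i < 0"
      then show ?thesis using face_index_iff_pos[of "J \<union> K" y J] fin K yu
        by (auto intro!: exI[of _ "- u"] simp: inner_commute)
    qed
  qed
qed

lemma span_flips: "span (flips e x ` J) = span (x ` J)"
proof -
  have "flip e (x j) \<in> span (x ` J)" if "j \<in> J" for j
    using that by (auto simp: flip_def intro: span_base span_neg)
  moreover have "x j \<in> span (flips e x ` J)" if "j \<in> J" for j
  proof -
    have f: "flip e (x j) \<in> span (flips e x ` J)" using that by (intro span_base) auto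
    have "x j = flip e (x j) \<or> x j = - flip e (x j)" by (simp add: flip_def)
    then show ?thesis using f span_neg[OF f] by auto
  qed
  ultimately show ?thesis by (intro equalityI span_minimal) auto
qed

section \<open>The integral over a single facet\<close>

definition side_prob :: "nat \<Rightarrow> real \<Rightarrow> real" where
  "side_prob m x = (1 - x / pi) ^ m + (x / pi) ^ m"

text \<open>Given the points of \<open>J\<close>, the others are independent, and each lies on the
  positive side with probability 1 - x/pi, where x is the angle between \<open>u\<close> and
  \<open>e\<close>. The two sides contribute the two terms of \<open>side_prob\<close>.\<close>

lemma emeasure_face_index:
  fixes e u :: "'a::euclidean_space" and J K :: "nat set"
  assumes fin: "finite J" "finite K" and "K \<noteq> {}" "J \<inter> K = {}"
    and e: "norm e = 1" and u: "norm u = 1" and D: "DIM('a) \<ge> 2" and sp: "span (x ` J) = {v. v \<bullet> u = 0}"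
  shows "emeasure (ball_product K) {z \<in> space (ball_product K). face_index (J \<union> K) (flips e (merge J K (x, z))) J}
    = ennreal (side_prob (card K) (arccos (u \<bullet> e)))"
proof -
  have ue: "\<bar>u \<bullet> e\<bar> \<le> 1" using Cauchy_Schwarz_ineq2[of u e] e u by simp
  then have th: "0 \<le> arccos (u \<bullet> e)" "arccos (u \<bullet> e) \<le> pi"
    by (auto simp: arccos_lbound arccos_ubound abs_le_iff)
  define A where "A = (\<Pi>\<^sub>E i\<in>K. {z. 0 < u \<bullet> flip e z})"
  define B where "B = (\<Pi>\<^sub>E i\<in>K. {z. u \<bullet> flip e z < 0})"
  have mA: "{z. 0 < u \<bullet> flip e z} \<in> sets borel" "{z. u \<bullet> flip e z < 0} \<in> sets borel" by measurable
  have AB: "A \<in> sets (ball_product K)" "B \<in> sets (ball_product K)"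
    unfolding A_def B_def using mA by (auto intro!: sets_PiM_I_finite fin)
  have m1: "merge J K (x, z) j = x j" if "j \<in> J" for z j using that by (simp add: merge_def)
  have m2: "merge J K (x, z) i = z i" if "i \<in> K" for z i using that assms(4) by (auto simp: merge_def)
  have "{z \<in> space (ball_product K). face_index (J \<union> K) (flips e (merge J K (x, z))) J} = A \<union> B"
  proof (intro set_eqI)
    fix z :: "nat \<Rightarrow> 'a"
    have "flips e (merge J K (x, z)) ` J = flips e x ` J" by (intro image_cong refl) (simp add: m1)
    then have "span (flips e (merge J K (x, z)) ` J) = {v. v \<bullet> u = 0}" by (simp add: span_flips sp)
    from face_index_hyperplane_iff[OF assms(1-4) u this]
    have "face_index (J \<union> K) (flips e (merge J K (x, z))) J \<longleftrightarrow> (\<forall>i\<in>K. 0 < u \<bullet> flip e (z i)) \<or> (\<forall>i\<in>K. u \<bullet> flip e (z i) < 0)"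
      by (simp add: m2)
    then show "z \<in> {z \<in> space (ball_product K). face_index (J \<union> K) (flips e (merge J K (x, z))) J} \<longleftrightarrow> z \<in> A \<union> B"
      by (auto simp: A_def B_def space_PiM PiE_def Pi_def)
  qed
  \<comment> \<open>The events are disjoint because \<open>K\<close> is nonempty; with no further
    points both would be the whole space.\<close>
  moreover have "A \<inter> B = {}"
  proof -
    obtain i where "i \<in> K" using assms(3) by blast
    then show ?thesis unfolding A_def B_def by (auto simp: PiE_def Pi_def dest!: bspec[of K _ i]) (metis less_asym)
  qed
  ultimately have "emeasure (ball_product K) {z \<in> space (ball_product K). face_index (J \<union> K) (flips e (merge J K (x, z))) J}
    = emeasure (ball_product K) A + emeasure (ball_product K) B"
    using AB by (simp add: plus_emeasure)
  also have "emeasure (ball_product K) A = ennreal (1 - arccos (u \<bullet> e) / pi) ^ card K"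
    unfolding A_def using mA
    by (subst ball_PiM.emeasure_PiM[OF fin(2)]) (auto simp: emeasure_flip_halfspace[OF e u D])
  also have "emeasure (ball_product K) B = ennreal (arccos (u \<bullet> e) / pi) ^ card K"
    unfolding B_def using mA
    by (subst ball_PiM.emeasure_PiM[OF fin(2)]) (auto simp: emeasure_flip_halfspace[OF e u D])
  finally have F: "emeasure (ball_product K) {z \<in> space (ball_product K). face_index (J \<union> K) (flips e (merge J K (x, z))) J}
    = ennreal (1 - arccos (u \<bullet> e) / pi) ^ card K + ennreal (arccos (u \<bullet> e) / pi) ^ card K" .
  show ?thesis
  proof -
    have "0 \<le> 1 - arccos (u \<bullet> e) / pi" "0 \<le> arccos (u \<bullet> e) / pi" using th by simp_all
    then show ?thesis
      unfolding F
      by (simp only: side_prob_def ennreal_power ennreal_plus zero_le_power)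
  qed
qed

text \<open>The contribution of \<open>J\<close> to the surface area up to the factor
  \<open>omega (DIM('a) - 1)\<close>, in \<open>ennreal\<close> for use with Fubini.\<close>

definition facet_weight :: "nat set \<Rightarrow> nat set \<Rightarrow> (nat \<Rightarrow> 'a::euclidean_space) \<Rightarrow> ennreal" where
  "facet_weight I J y = indicator {y. face_index I y J} y * emeasure ball_measure (prism J y)"

lemma borel_measurable_emeasure_prism:
  assumes "finite J"
  shows "(\<lambda>y :: nat \<Rightarrow> 'a::euclidean_space. emeasure ball_measure (prism J y)) \<in> borel_measurable borel"
  using borel_measurable_section(2)[OF borel_prism[OF assms]] by simp

lemma borel_measurable_facet_weight:
  assumes "finite J"
  shows "facet_weight I J \<in> borel_measurable (borel :: (nat \<Rightarrow> 'a::euclidean_space) measure)"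
  unfolding facet_weight_def
  by (intro borel_measurable_times_ennreal borel_measurable_indicator borel_face_index borel_measurable_emeasure_prism assms)

lemma prism_orthogonal:
  fixes T :: "'a::euclidean_space \<Rightarrow> 'a"
  assumes T: "orthogonal_transformation T"
  shows "T w \<in> prism J (\<lambda>i. T (y i)) \<longleftrightarrow> w \<in> prism J y"
proof -
  have lin: "linear T" using T orthogonal_transformation_linear by blast
  have "T w - (\<Sum>j\<in>J. c j *\<^sub>R T (y j)) = T (w - (\<Sum>j\<in>J. c j *\<^sub>R y j))" for c
    by (simp add: linear_diff[OF lin] linear_sum[OF lin] linear_scale[OF lin])
  then show ?thesis using T by (simp add: prism_def orthogonal_transformation_def)
qed

lemma face_index_orthogonal:
  fixes T :: "'a::euclidean_space \<Rightarrow> 'a"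
  assumes T: "orthogonal_transformation T"
  shows "face_index I (\<lambda>i. T (y i)) J \<longleftrightarrow> face_index I y J"
proof
  have in_T: "T u \<bullet> T v = u \<bullet> v" for u v using T by (simp add: orthogonal_transformation_def)
  show "face_index I y J \<Longrightarrow> face_index I (\<lambda>i. T (y i)) J"
    unfolding face_index_def by (metis in_T)
  assume "face_index I (\<lambda>i. T (y i)) J"
  then obtain u where u: "\<forall>j\<in>J. u \<bullet> T (y j) = 0" "\<forall>i\<in>I - J. 1 \<le> u \<bullet> T (y i)"
    unfolding face_index_def by blast
  obtain v where "u = T v" using orthogonal_transformation_surj[OF T] by (auto simp: surj_def)
  then show "face_index I y J" unfolding face_index_def using u in_T by auto
qed

lemma facet_weight_orthogonal:
  fixes T :: "'a::euclidean_space \<Rightarrow> 'a"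
  assumes T: "orthogonal_transformation T" and J: "finite J"
  shows "facet_weight I J (\<lambda>i. T (y i)) = facet_weight I J y"
proof -
  have "linear T" using T orthogonal_transformation_linear by blast
  then have m: "T \<in> borel_measurable borel"
    by (intro borel_measurable_continuous_onI linear_continuous_on linear_linear[THEN iffD2])
  have sec: "prism J (\<lambda>i. T (y i)) \<in> sets borel"
  proof -
    have "(\<lambda>w. (\<lambda>i. T (y i), w)) \<in> borel \<rightarrow>\<^sub>M (borel :: ((nat \<Rightarrow> 'a) \<times> 'a) measure)"
      by (intro borel_measurable_continuous_onI continuous_intros)
    from measurable_sets_borel[OF this borel_prism[OF J]] show ?thesis by (simp add: vimage_def)
  qed
  have "emeasure ball_measure (prism J (\<lambda>i. T (y i))) = emeasure (distr ball_measure borel T) (prism J (\<lambda>i. T (y i)))"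
    by (simp add: distr_ball_measure_orthogonal[OF T])
  also have "\<dots> = emeasure ball_measure (T -` prism J (\<lambda>i. T (y i)))"
    using m sec by (subst emeasure_distr) (auto cong: measurable_cong_sets)
  also have "T -` prism J (\<lambda>i. T (y i)) = prism J y"
    using prism_orthogonal[OF T] by auto
  finally show ?thesis
    by (simp add: facet_weight_def face_index_orthogonal[OF T] indicator_def)
qed

definition facet_integral :: "'a::euclidean_space \<Rightarrow> nat set \<Rightarrow> nat set \<Rightarrow> ennreal" where
  "facet_integral e I J = (\<integral>\<^sup>+z. facet_weight I J (flips e z) \<partial>ball_product I)"

lemma flip_scale: "r > 0 \<Longrightarrow> flip (r *\<^sub>R e) z = flip e z"
  by (simp add: flip_def zero_le_mult_iff)

lemma flip_orthogonal:
  assumes "orthogonal_transformation T"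
  shows "flip (T e) (T z) = T (flip e z)"
  using assms orthogonal_transformation_linear[OF assms]
  by (simp add: flip_def orthogonal_transformation_def linear_neg)

text \<open>The Householder reflection in the hyperplane orthogonal to e - e'.\<close>

lemma reflection_exists:
  fixes e e' :: "'a::euclidean_space"
  assumes "norm e = norm e'"
  obtains T where "orthogonal_transformation T" "T e = e'"
proof (cases "e = e'")
  case True
  then show ?thesis using that[of "\<lambda>x. x"] by (simp add: orthogonal_transformation_id)
next
  case False
  define v where "v = e - e'"
  define T where "T = (\<lambda>x. x - (2 * (x \<bullet> v) / (v \<bullet> v)) *\<^sub>R v)"
  have v: "v \<bullet> v \<noteq> 0" using False by (simp add: v_def)
  have "linear T" unfolding T_def
    by (intro linearI) (simp_all add: inner_add_left algebra_simps add_divide_distrib)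
  moreover have "T x \<bullet> T z = x \<bullet> z" for x z
    using v by (simp add: T_def inner_diff_left inner_diff_right field_simps inner_commute)
  moreover have "T e = e'"
  proof -
    have ee: "e \<bullet> e = e' \<bullet> e'" using assms by (simp add: norm_eq_sqrt_inner)
    have "2 * (e \<bullet> v) = v \<bullet> v" using ee by (simp add: v_def inner_diff_left inner_diff_right inner_commute)
    then show ?thesis using v by (simp add: T_def v_def)
  qed
  ultimately show ?thesis using that[of T] by (simp add: orthogonal_transformation_def)
qed

lemma facet_integral_invariant:
  fixes e e' :: "'a::euclidean_space"
  assumes I: "finite I" "J \<subseteq> I" and e: "e \<noteq> 0" "e' \<noteq> 0"
  shows "facet_integral e I J = facet_integral e' I J"
proof -
  have J: "finite J" using I finite_subset by blast
  obtain T where T: "orthogonal_transformation T" "T (e /\<^sub>R norm e) = e' /\<^sub>R norm e'"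
    using reflection_exists[of "e /\<^sub>R norm e" "e' /\<^sub>R norm e'"] e by auto
  have "linear T" using T orthogonal_transformation_linear by blast
  then have m[measurable]: "T \<in> borel_measurable borel"
    by (intro borel_measurable_continuous_onI linear_continuous_on linear_linear[THEN iffD2])
  have mT: "T \<in> (ball_measure :: 'a measure) \<rightarrow>\<^sub>M ball_measure" by (simp cong: measurable_cong_sets)
  have dT: "distr (ball_product I :: (nat \<Rightarrow> 'a) measure) (ball_product I) (compose I T) = ball_product I"
  proof -
    have "distr (ball_product I :: (nat \<Rightarrow> 'a) measure) (ball_product I) (compose I T)
      = (\<Pi>\<^sub>M i\<in>I. distr ball_measure ball_measure T)"
      by (rule distr_PiM_finite_prob_space'[OF I(1)]) (auto intro: prob_space_ball_measure mT)
    also have "distr ball_measure ball_measure T = (ball_measure :: 'a measure)"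
      using distr_ball_measure_orthogonal[OF T(1)] by (simp cong: distr_cong)
    finally show ?thesis .
  qed
  have mw: "(\<lambda>z. facet_weight I J (flips c z)) \<in> borel_measurable (ball_product I)" for c :: 'a
    using borel_measurable_facet_weight[OF J] measurable_flips[of "\<lambda>_. c" "ball_product I" "\<lambda>z. z"]
    by (intro measurable_compose[where f="\<lambda>z. flips c z" and g="facet_weight I J"]) auto
  have mc: "compose I T \<in> (ball_product I :: (nat \<Rightarrow> 'a) measure) \<rightarrow>\<^sub>M ball_product I"
    unfolding compose_def by (intro measurable_restrict) (simp cong: measurable_cong_sets)
  have loc: "facet_weight I J y = facet_weight I J y'" if "\<And>i. i \<in> I \<union> J \<Longrightarrow> y i = y' i" for y y' :: "nat \<Rightarrow> 'a"
  proof -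
    have "prism J y = prism J y'" using that by (simp add: prism_def cong: sum.cong)
    moreover have "face_index I y J = face_index I y' J" using that by (simp add: face_index_def)
    ultimately show ?thesis by (simp add: facet_weight_def indicator_def)
  qed
    have "facet_integral e' I J = (\<integral>\<^sup>+z. facet_weight I J (flips e' z) \<partial>distr (ball_product I :: (nat \<Rightarrow> 'a) measure) (ball_product I) (compose I T))"
      unfolding facet_integral_def dT ..
    also have "\<dots> = (\<integral>\<^sup>+z. facet_weight I J (flips e' (compose I T z)) \<partial>ball_product I)"
      by (rule nn_integral_distr[OF mc]) (use mw in simp)
    also have "\<dots> = (\<integral>\<^sup>+z. facet_weight I J (flips e z) \<partial>ball_product I)"
    proof (rule nn_integral_cong)
      fix z :: "nat \<Rightarrow> 'a"
      have "facet_weight I J (flips e' (compose I T z)) = facet_weight I J (\<lambda>i. T (flips e z i))"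
      proof (rule loc)
        fix i assume "i \<in> I \<union> J"
        then have "compose I T z i = T (z i)" using I(2) by (auto simp: compose_def)
        then show "flips e' (compose I T z) i = T (flips e z i)"
        proof -
          have "flip e' (T (z i)) = flip (T (e /\<^sub>R norm e)) (T (z i))" unfolding T(2) using e(2) by (simp add: flip_scale)
          also have "\<dots> = T (flip e (z i))"
            unfolding flip_orthogonal[OF T(1)] using e(1) by (simp add: flip_scale)
          finally show ?thesis using \<open>compose I T z i = T (z i)\<close> by simp
        qed
      qed
      also have "\<dots> = facet_weight I J (flips e z)" by (rule facet_weight_orthogonal[OF T(1) J])
      finally show "facet_weight I J (flips e' (compose I T z)) = facet_weight I J (flips e z)" .
    qed
    finally show ?thesis by (simp add: facet_integral_def)
qed

text \<open>With p = \<open>DIM('a) - 2\<close> this is, up to normalization, the expectation of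
  \<open>\<phi>\<close> at the angle between a fixed and a uniformly random direction.\<close>

definition sphere_weight :: "nat \<Rightarrow> (real \<Rightarrow> ennreal) \<Rightarrow> ennreal" where
  "sphere_weight p \<phi> = (\<integral>\<^sup>+t. \<phi> t * ennreal (sin t ^ p) * indicator {0..pi} t \<partial>lborel)"

text \<open>Up to the factor \<open>omega (DIM('a) - 1)\<close>, the mean area of the spherical hull
  of the points of \<open>J\<close> for random points and a random pole, whether or not it is a
  facet. The type argument fixes the dimension, which \<open>J\<close> does not show.\<close>

definition prism_mean :: "nat set \<Rightarrow> 'a::euclidean_space itself \<Rightarrow> ennreal" where
  "prism_mean J _ = (\<integral>\<^sup>+x. \<integral>\<^sup>+e. emeasure ball_measure (prism J (flips e x)) \<partial>ball_measure \<partial>(ball_product J :: (nat \<Rightarrow> 'a) measure))"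

lemma prism_cong: "(\<And>j. j \<in> J \<Longrightarrow> y j = y' j) \<Longrightarrow> prism J y = prism J y'"
  by (simp add: prism_def cong: sum.cong)

lemma measurable_ball_measure_borel:
  "f \<in> borel \<rightarrow>\<^sub>M N \<Longrightarrow> f \<in> (ball_measure :: 'a::euclidean_space measure) \<rightarrow>\<^sub>M N"
  by (simp cong: measurable_cong_sets)

text \<open>For fixed points, \<open>nn_integral_angle_split\<close> yields both integrals with the
  same factor \<open>C\<close>: once with the probability of being a facet as a function of the
  angle, once with 1. Multiplying crosswise eliminates \<open>C\<close> and avoids a division in
  \<open>ennreal\<close>.\<close>

lemma nn_integral_direction_facet:
  fixes x :: "nat \<Rightarrow> 'a::euclidean_space" and J K :: "nat set"
  assumes fin: "finite J" "finite K" and ne: "K \<noteq> {}" "J \<inter> K = {}"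
    and D: "DIM('a) \<ge> 2" and card: "card J = DIM('a) - 1" and x: "lin_indep J x"
  shows "(\<integral>\<^sup>+e. \<integral>\<^sup>+z. facet_weight (J \<union> K) J (flips e (merge J K (x, z))) \<partial>ball_product K \<partial>ball_measure) * sphere_weight (DIM('a) - 2) (\<lambda>_. 1)
    = (\<integral>\<^sup>+e. emeasure ball_measure (prism J (flips e x)) \<partial>ball_measure) * sphere_weight (DIM('a) - 2) (\<lambda>t. ennreal (side_prob (card K) t))"
proof -
  have "inj_on x J" "independent (x ` J)" using x lin_indep_iff[OF fin(1)] by auto
  then have "dim (x ` J) = DIM('a) - 1" using card by (simp add: dim_eq_card_independent card_image)
  then obtain u where u: "norm u = 1" "span (x ` J) = {v. v \<bullet> u = 0}" by (rule codim1_span_eq_hyperplane)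
  have xu: "x j \<bullet> u = 0" if "j \<in> J" for j using span_base[of "x j" "x ` J"] u(2) that by auto
  define G where "G = (\<lambda>e. emeasure ball_measure (prism J (flips e x)))"
  have mG: "G \<in> borel_measurable borel"
  proof -
    have "(\<lambda>e. flips e x) \<in> borel \<rightarrow>\<^sub>M (borel :: (nat \<Rightarrow> 'a) measure)"
      by (rule measurable_flips) auto
    then show ?thesis unfolding G_def
      by (rule measurable_compose[OF _ borel_measurable_emeasure_prism[OF fin(1)]])
  qed
  \<comment> \<open>The points of \<open>J\<close> are orthogonal to \<open>u\<close>, so moving the
    pole along \<open>u\<close> flips none of them.\<close>
  have G1: "G (s *\<^sub>R u + e) = G e" for s e
    unfolding G_def
    by (intro arg_cong[where f="emeasure ball_measure"] prism_cong) (simp add: flip_def inner_add_right xu)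
  have G2: "G (r *\<^sub>R e) = G e" if "r > 0" for r e
    unfolding G_def using that by (simp add: flip_scale)
  have "\<exists>C. \<forall>\<phi>. \<phi> \<in> borel_measurable borel \<longrightarrow> (\<integral>\<^sup>+e. \<phi> (arccos ((u \<bullet> e) / norm e)) * G e \<partial>ball_measure)
      = C * sphere_weight (DIM('a) - 2) \<phi>"
  proof (rule nn_integral_angle_split[OF u(1) D mG G1 G2])
    fix C assume "\<And>\<phi>. \<phi> \<in> borel_measurable borel \<Longrightarrow> (\<integral>\<^sup>+e. \<phi> (arccos ((u \<bullet> e) / norm e)) * G e \<partial>ball_measure)
      = C * (\<integral>\<^sup>+t. \<phi> t * ennreal (sin t ^ (DIM('a) - 2)) * indicator {0..pi} t \<partial>lborel)"
    then show "\<exists>C. \<forall>\<phi>. \<phi> \<in> borel_measurable borel \<longrightarrow> (\<integral>\<^sup>+e. \<phi> (arccos ((u \<bullet> e) / norm e)) * G e \<partial>ball_measure)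
      = C * sphere_weight (DIM('a) - 2) \<phi>" unfolding sphere_weight_def by blast
  qed
  then obtain C where C: "\<And>\<phi>. \<phi> \<in> borel_measurable borel \<Longrightarrow> (\<integral>\<^sup>+e. \<phi> (arccos ((u \<bullet> e) / norm e)) * G e \<partial>ball_measure)
      = C * sphere_weight (DIM('a) - 2) \<phi>" by blast
  have mpsi: "(\<lambda>t. ennreal (side_prob (card K) t)) \<in> borel_measurable borel"
    unfolding side_prob_def by measurable
  have AE0: "AE e in (ball_measure :: 'a measure). e \<bullet> u \<noteq> 0"
    using u(1) by (intro AE_ball_measure_hyperplane) auto
  have "(\<integral>\<^sup>+e. \<integral>\<^sup>+z. facet_weight (J \<union> K) J (flips e (merge J K (x, z))) \<partial>ball_product K \<partial>ball_measure)
     = (\<integral>\<^sup>+e. ennreal (side_prob (card K) (arccos ((u \<bullet> e) / norm e))) * G e \<partial>ball_measure)"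
  proof (rule nn_integral_cong_AE, use AE0 in eventually_elim)
    fix e :: 'a assume "e \<bullet> u \<noteq> 0"
    then have e: "e \<noteq> 0" by auto
    let ?S = "{z \<in> space (ball_product K). face_index (J \<union> K) (flips e (merge J K (x, z))) J}"
    have pr: "prism J (flips e (merge J K (x, z))) = prism J (flips e x)" for z
      by (rule prism_cong) (simp add: merge_def)
    have S: "?S \<in> sets (ball_product K)"
    proof -
      have "(\<lambda>z. merge J K (x, z)) \<in> ball_product K \<rightarrow>\<^sub>M (borel :: (nat \<Rightarrow> 'a) measure)"
      proof (rule measurable_coordinatewise_then_product)
        fix i
        show "(\<lambda>z. merge J K (x, z) i) \<in> borel_measurable (ball_product K)"
        proof (cases "i \<in> K \<and> i \<notin> J")
          case True
          have "(\<lambda>z :: nat \<Rightarrow> 'a. z i) \<in> borel_measurable (ball_product K)"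
            by (rule measurable_ball_product_borel) measurable
          then show ?thesis using True by (simp add: merge_def)
        qed (auto simp: merge_def)
      qed
      then have "(\<lambda>z. flips e (merge J K (x, z))) \<in> ball_product K \<rightarrow>\<^sub>M (borel :: (nat \<Rightarrow> 'a) measure)"
        by (intro measurable_flips) auto
      from measurable_sets[OF this borel_face_index[of "J \<union> K" J]]
      show ?thesis by (simp add: vimage_def Int_def conj_commute)
    qed
    have "(\<integral>\<^sup>+z. facet_weight (J \<union> K) J (flips e (merge J K (x, z))) \<partial>ball_product K)
      = (\<integral>\<^sup>+z. G e * indicator ?S z \<partial>ball_product K)"
      by (intro nn_integral_cong) (auto simp: facet_weight_def pr G_def indicator_def)
    also have "\<dots> = G e * emeasure (ball_product K) ?S"
      using S by (simp add: nn_integral_cmult_indicator)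
    also have "emeasure (ball_product K) ?S = ennreal (side_prob (card K) (arccos (u \<bullet> (e /\<^sub>R norm e))))"
    proof -
      have "flip e v = flip (e /\<^sub>R norm e) v" for v using e by (simp add: flip_scale)
      then have eq: "?S = {z \<in> space (ball_product K). face_index (J \<union> K) (flips (e /\<^sub>R norm e) (merge J K (x, z))) J}"
        by simp
      show ?thesis unfolding eq
        by (rule emeasure_face_index[OF fin ne _ u(1) D u(2)]) (use e in simp)
    qed
    finally show "(\<integral>\<^sup>+z. facet_weight (J \<union> K) J (flips e (merge J K (x, z))) \<partial>ball_product K)
      = ennreal (side_prob (card K) (arccos ((u \<bullet> e) / norm e))) * G e"
      by (simp add: divide_inverse mult.commute)
  qed
  also have "\<dots> = C * sphere_weight (DIM('a) - 2) (\<lambda>t. ennreal (side_prob (card K) t))"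
    by (rule C[OF mpsi])
  finally have 1: "(\<integral>\<^sup>+e. \<integral>\<^sup>+z. facet_weight (J \<union> K) J (flips e (merge J K (x, z))) \<partial>ball_product K \<partial>ball_measure)
     = C * sphere_weight (DIM('a) - 2) (\<lambda>t. ennreal (side_prob (card K) t))" .
  have 2: "(\<integral>\<^sup>+e. G e \<partial>ball_measure) = C * sphere_weight (DIM('a) - 2) (\<lambda>_. 1)"
    using C[of "\<lambda>_. 1"] by simp
  show ?thesis unfolding 1 G_def[symmetric] 2 by (simp add: mult_ac)
qed

lemma measurable_prism_mean_integrand:
  assumes "finite J"
  shows "(\<lambda>x. \<integral>\<^sup>+e. emeasure ball_measure (prism J (flips e x)) \<partial>ball_measure) \<in> borel_measurable (ball_product I :: (nat \<Rightarrow> 'a::euclidean_space) measure)"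
proof -
  have "snd \<in> (ball_product I :: (nat \<Rightarrow> 'a) measure) \<Otimes>\<^sub>M ball_measure \<rightarrow>\<^sub>M ball_measure" by measurable
  then have 1: "snd \<in> borel_measurable ((ball_product I :: (nat \<Rightarrow> 'a) measure) \<Otimes>\<^sub>M ball_measure)"
    by (simp cong: measurable_cong_sets)
  have 2: "fst \<in> (ball_product I :: (nat \<Rightarrow> 'a) measure) \<Otimes>\<^sub>M (ball_measure :: 'a measure) \<rightarrow>\<^sub>M borel"
    by (rule measurable_compose[OF measurable_fst measurable_ball_product_id])
  have "(\<lambda>p. emeasure ball_measure (prism J (flips (snd p) (fst p)))) \<in> borel_measurable ((ball_product I :: (nat \<Rightarrow> 'a) measure) \<Otimes>\<^sub>M ball_measure)"
    by (rule measurable_compose[OF measurable_flips[OF 1 2] borel_measurable_emeasure_prism[OF assms]])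
  then show ?thesis
    by (intro ball_PiM.M.borel_measurable_nn_integral) (simp add: case_prod_beta')
qed

text \<open>By invariance the integral equals its average over a pole drawn from the ball. Fubini
  moves the integral over the pole inside, so that the previous lemma applies for fixed points of
  \<open>J\<close>.\<close>

lemma facet_integral_formula:
  fixes e :: "'a::euclidean_space" and J K :: "nat set"
  assumes fin: "finite J" "finite K" and ne: "K \<noteq> {}" "J \<inter> K = {}"
    and D: "DIM('a) \<ge> 2" and card: "card J = DIM('a) - 1" and e: "e \<noteq> 0"
  shows "facet_integral e (J \<union> K) J * sphere_weight (DIM('a) - 2) (\<lambda>_. 1)
    = prism_mean J TYPE('a) * sphere_weight (DIM('a) - 2) (\<lambda>t. ennreal (side_prob (card K) t))"
proof -
  define I where "I = J \<union> K"
  have I: "finite I" "J \<subseteq> I" using fin by (auto simp: I_def)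
  define PJ where "PJ = (ball_product J :: (nat \<Rightarrow> 'a) measure)"
  define PK where "PK = (ball_product K :: (nat \<Rightarrow> 'a) measure)"
  interpret PJ: prob_space PJ unfolding PJ_def by (rule prob_space_ball_product)
  interpret PK: prob_space PK unfolding PK_def by (rule prob_space_ball_product)
  interpret B: prob_space "ball_measure :: 'a measure" by (rule prob_space_ball_measure)
  interpret PP: pair_sigma_finite PJ "ball_measure :: 'a measure" ..
  have mfw: "facet_weight I J \<in> borel_measurable (borel :: (nat \<Rightarrow> 'a) measure)"
    by (rule borel_measurable_facet_weight[OF fin(1)])
  have mjoint: "(\<lambda>(x, e'). \<integral>\<^sup>+z. facet_weight I J (flips e' (merge J K (x, z))) \<partial>PK) \<in> borel_measurable (PJ \<Otimes>\<^sub>M (ball_measure :: 'a measure))"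
  proof -
    have "(\<lambda>p. merge J K (fst (fst p), snd p)) \<in> (PJ \<Otimes>\<^sub>M (ball_measure :: 'a measure)) \<Otimes>\<^sub>M PK \<rightarrow>\<^sub>M ball_product (J \<union> K)"
      unfolding PJ_def PK_def
      by (intro measurable_compose[OF _ measurable_merge] measurable_Pair) measurable
    then have 1: "(\<lambda>p. merge J K (fst (fst p), snd p)) \<in> (PJ \<Otimes>\<^sub>M (ball_measure :: 'a measure)) \<Otimes>\<^sub>M PK \<rightarrow>\<^sub>M borel"
      by (rule measurable_compose[OF _ measurable_ball_product_id])
    have "(\<lambda>p. snd (fst p)) \<in> (PJ \<Otimes>\<^sub>M (ball_measure :: 'a measure)) \<Otimes>\<^sub>M PK \<rightarrow>\<^sub>M ball_measure"
      by measurable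
    then have 2: "(\<lambda>p. snd (fst p)) \<in> borel_measurable ((PJ \<Otimes>\<^sub>M (ball_measure :: 'a measure)) \<Otimes>\<^sub>M PK)"
      by (simp cong: measurable_cong_sets)
    have "(\<lambda>p. facet_weight I J (flips (snd (fst p)) (merge J K (fst (fst p), snd p)))) \<in> borel_measurable ((PJ \<Otimes>\<^sub>M (ball_measure :: 'a measure)) \<Otimes>\<^sub>M PK)"
      by (intro measurable_compose[OF measurable_flips[OF 2 1] mfw])
    then have "(\<lambda>q. \<integral>\<^sup>+z. facet_weight I J (flips (snd q) (merge J K (fst q, z))) \<partial>PK) \<in> borel_measurable (PJ \<Otimes>\<^sub>M (ball_measure :: 'a measure))"
      by (intro PK.borel_measurable_nn_integral) (simp add: case_prod_beta')
    then show ?thesis by (simp add: case_prod_beta')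
  qed
  have AE0: "AE e' in (ball_measure :: 'a measure). e' \<bullet> e \<noteq> 0"
    using e by (rule AE_ball_measure_hyperplane)
  have "facet_integral e I J = (\<integral>\<^sup>+e'. facet_integral e I J \<partial>(ball_measure :: 'a measure))"
    using ball_PiM.M.emeasure_space_1[where 'a='a] by simp
  also have "\<dots> = (\<integral>\<^sup>+e'. facet_integral e' I J \<partial>(ball_measure :: 'a measure))"
  proof (rule nn_integral_cong_AE, use AE0 in eventually_elim)
    fix e' :: 'a assume "e' \<bullet> e \<noteq> 0"
    then have "e' \<noteq> 0" by auto
    then show "facet_integral e I J = facet_integral e' I J" by (rule facet_integral_invariant[OF I e])
  qed
  also have "\<dots> = (\<integral>\<^sup>+e'. \<integral>\<^sup>+x. \<integral>\<^sup>+z. facet_weight I J (flips e' (merge J K (x, z))) \<partial>PK \<partial>PJ \<partial>ball_measure)"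
  proof (rule nn_integral_cong)
    fix e' :: 'a
    have "(\<lambda>z. facet_weight I J (flips e' z)) \<in> borel_measurable (ball_product (J \<union> K))"
      by (intro measurable_compose[OF measurable_flips mfw]) auto
    then show "facet_integral e' I J = (\<integral>\<^sup>+x. \<integral>\<^sup>+z. facet_weight I J (flips e' (merge J K (x, z))) \<partial>PK \<partial>PJ)"
      unfolding facet_integral_def PJ_def PK_def I_def
      by (rule ball_PiM.product_nn_integral_fold[OF ne(2) fin])
  qed
  also have "\<dots> = (\<integral>\<^sup>+x. \<integral>\<^sup>+e'. \<integral>\<^sup>+z. facet_weight I J (flips e' (merge J K (x, z))) \<partial>PK \<partial>ball_measure \<partial>PJ)"
    by (rule PP.Fubini'[OF mjoint])
  finally have 1: "facet_integral e I J = \<dots>" .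
  define w where "w = sphere_weight (DIM('a) - 2) (\<lambda>_. 1)"
  define wm where "wm = sphere_weight (DIM('a) - 2) (\<lambda>t. ennreal (side_prob (card K) t))"
  have mx1: "(\<lambda>x. \<integral>\<^sup>+e'. \<integral>\<^sup>+z. facet_weight I J (flips e' (merge J K (x, z))) \<partial>PK \<partial>ball_measure) \<in> borel_measurable PJ"
    by (rule ball_PiM.M.borel_measurable_nn_integral[OF mjoint])
  have mx2: "(\<lambda>x. \<integral>\<^sup>+e'. emeasure ball_measure (prism J (flips e' x)) \<partial>ball_measure) \<in> borel_measurable PJ"
    unfolding PJ_def by (rule measurable_prism_mean_integrand[OF fin(1)])
  have "facet_integral e I J * w = (\<integral>\<^sup>+x. (\<integral>\<^sup>+e'. \<integral>\<^sup>+z. facet_weight I J (flips e' (merge J K (x, z))) \<partial>PK \<partial>ball_measure) * w \<partial>PJ)"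
    unfolding 1 by (rule nn_integral_multc[OF mx1, symmetric])
  also have "\<dots> = (\<integral>\<^sup>+x. (\<integral>\<^sup>+e'. emeasure ball_measure (prism J (flips e' x)) \<partial>ball_measure) * wm \<partial>PJ)"
  proof (rule nn_integral_cong_AE)
    have "AE x in PJ. lin_indep J x" unfolding PJ_def using card by (intro AE_lin_indep fin) auto
    then show "AE x in PJ. (\<integral>\<^sup>+e'. \<integral>\<^sup>+z. facet_weight I J (flips e' (merge J K (x, z))) \<partial>PK \<partial>ball_measure) * w
       = (\<integral>\<^sup>+e'. emeasure ball_measure (prism J (flips e' x)) \<partial>ball_measure) * wm"
      by eventually_elim (unfold I_def PK_def w_def wm_def, rule nn_integral_direction_facet[OF fin ne D card])
  qed
  also have "\<dots> = prism_mean J TYPE('a) * wm"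
    unfolding prism_mean_def PJ_def[symmetric] by (rule nn_integral_multc[OF mx2])
  finally show ?thesis by (simp add: I_def w_def wm_def)
qed

lemma prism_reindex:
  assumes "bij_betw g J' J" "finite J'"
  shows "prism J' (\<lambda>i. y (g i)) = prism J y"
proof -
  have im: "g ` J' = J" and inj: "inj_on g J'" using assms by (auto simp: bij_betw_def)
  have s: "(\<Sum>j\<in>J. c j *\<^sub>R y j) = (\<Sum>i\<in>J'. c (g i) *\<^sub>R y (g i))" for c
    using sum.reindex_bij_betw[OF assms(1), of "\<lambda>j. c j *\<^sub>R y j"] by simp
  show ?thesis
  proof (intro equalityI subsetI)
    fix w assume "w \<in> prism J' (\<lambda>i. y (g i))"
    then obtain c where c: "\<forall>i\<in>J'. 0 \<le> c i" "\<forall>i\<in>J'. (w - (\<Sum>j\<in>J'. c j *\<^sub>R y (g j))) \<bullet> y (g i) = 0"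
      unfolding prism_def by blast
    define c' where "c' = (\<lambda>j. c (inv_into J' g j))"
    have c'g: "c' (g i) = c i" if "i \<in> J'" for i using that inj by (simp add: c'_def inv_into_f_f)
    have "(\<Sum>j\<in>J. c' j *\<^sub>R y j) = (\<Sum>i\<in>J'. c i *\<^sub>R y (g i))"
      unfolding s by (intro sum.cong) (auto simp: c'g)
    then show "w \<in> prism J y" unfolding prism_def im[symmetric] using c c'g im
      by (intro CollectI exI[of _ c']) auto
  next
    fix w assume "w \<in> prism J y"
    then obtain c where "\<forall>j\<in>J. 0 \<le> c j" "\<forall>i\<in>J. (w - (\<Sum>j\<in>J. c j *\<^sub>R y j)) \<bullet> y i = 0"
      unfolding prism_def by blast
    then have "\<forall>i\<in>J'. 0 \<le> c (g i)" "\<forall>i\<in>J'. (w - (\<Sum>j\<in>J'. c (g j) *\<^sub>R y (g j))) \<bullet> y (g i) = 0"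
      using im by (auto simp: s[symmetric])
    then show "w \<in> prism J' (\<lambda>i. y (g i))" unfolding prism_def
      by (intro CollectI exI[of _ "\<lambda>i. c (g i)"]) simp
  qed
qed

text \<open>The points are identically distributed, so renaming indices changes nothing. Thus one
  constant serves every facet and every n.\<close>

lemma prism_mean_card:
  assumes "finite J" "finite J'" "card J = card J'"
  shows "prism_mean J' TYPE('a::euclidean_space) = prism_mean J TYPE('a)"
proof -
  obtain g where g: "bij_betw g J' J" using assms by (metis finite_same_card_bij)
  have inj: "inj_on g J'" and gJ: "g \<in> J' \<rightarrow> J" using g by (auto simp: bij_betw_def)
  define t where "t = (\<lambda>\<omega> :: nat \<Rightarrow> 'a. \<lambda>n\<in>J'. \<omega> (g n))"
  have d: "distr (ball_product J :: (nat \<Rightarrow> 'a) measure) (ball_product J') t = ball_product J'"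
    unfolding t_def by (rule distr_PiM_reindex[OF _ inj gJ]) (rule prob_space_ball_measure)
  have mt: "t \<in> (ball_product J :: (nat \<Rightarrow> 'a) measure) \<rightarrow>\<^sub>M ball_product J'"
    unfolding t_def using gJ by (intro measurable_restrict measurable_component_singleton) auto
  have m: "(\<lambda>x. \<integral>\<^sup>+e. emeasure ball_measure (prism J' (flips e x)) \<partial>ball_measure) \<in> borel_measurable (ball_product J' :: (nat \<Rightarrow> 'a) measure)"
    by (rule measurable_prism_mean_integrand[OF assms(2)])
  have "prism_mean J' TYPE('a) = (\<integral>\<^sup>+x. \<integral>\<^sup>+e. emeasure ball_measure (prism J' (flips e x)) \<partial>ball_measure \<partial>distr (ball_product J :: (nat \<Rightarrow> 'a) measure) (ball_product J') t)"
    by (simp add: prism_mean_def d)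
  also have "\<dots> = (\<integral>\<^sup>+x. \<integral>\<^sup>+e. emeasure ball_measure (prism J' (flips e (t x))) \<partial>ball_measure \<partial>ball_product J)"
    by (rule nn_integral_distr[OF mt]) (use m in simp)
  also have "\<dots> = prism_mean J TYPE('a)"
    unfolding prism_mean_def
  proof (intro nn_integral_cong arg_cong[where f="emeasure ball_measure"])
    fix x :: "nat \<Rightarrow> 'a" and e :: 'a
    have "prism J' (flips e (t x)) = prism J' (\<lambda>i. flips e x (g i))"
      by (rule prism_cong) (simp add: t_def)
    then show "prism J' (flips e (t x)) = prism J (flips e x)"
      using prism_reindex[OF g assms(2), of "flips e x"] by simp
  qed
  finally show ?thesis .
qed

section \<open>Comparison of prisms and shadows\<close>

lemma emeasure_lborel_cone_ball:
  fixes A :: "'a::euclidean_space set"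
  assumes [measurable]: "A \<in> sets borel" and cone: "\<And>r x. 0 < r \<Longrightarrow> r *\<^sub>R x \<in> A \<longleftrightarrow> x \<in> A" and r: "0 < r"
  shows "emeasure lborel (A \<inter> cball 0 r) = ennreal (r ^ DIM('a)) * emeasure lborel (A \<inter> cball 0 1)"
proof -
  have [measurable]: "cball (0::'a) r \<in> sets borel" "cball (0::'a) 1 \<in> sets borel" by simp_all
  have "emeasure lborel (A \<inter> cball 0 r) = (\<integral>\<^sup>+x. indicator (A \<inter> cball 0 r) x \<partial>lborel)" by simp
  also have "\<dots> = ennreal (\<bar>r\<bar> ^ DIM('a)) * (\<integral>\<^sup>+x. indicator (A \<inter> cball 0 r) (0 + r *\<^sub>R x) \<partial>lborel)"
    by (rule nn_integral_lborel_affine) (use r in auto)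
  also have "(\<integral>\<^sup>+x. indicator (A \<inter> cball 0 r) (0 + r *\<^sub>R x) \<partial>lborel) = (\<integral>\<^sup>+x. indicator (A \<inter> cball 0 1) x \<partial>lborel)"
    using r by (intro nn_integral_cong) (auto simp: indicator_def cone)
  finally show ?thesis using r by simp
qed

lemma shadow_iff_pos:
  assumes "finite J"
  shows "w \<in> shadow e J y \<longleftrightarrow> (\<exists>s. w - s *\<^sub>R e \<in> pos (y ` J))"
proof -
  have "w - s *\<^sub>R e = v \<longleftrightarrow> w = v + s *\<^sub>R e" for s v by (auto simp: algebra_simps)
  then show ?thesis unfolding shadow_def pos_image_iff[OF assms] by auto
qed

lemma borel_shadow_section:
  fixes y :: "nat \<Rightarrow> 'a::euclidean_space"
  assumes J: "finite J"
  shows "shadow e J y \<in> sets borel" "prism J y \<in> sets borel"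
proof -
  have m: "(\<lambda>w. (y, w)) \<in> borel \<rightarrow>\<^sub>M (borel :: ((nat \<Rightarrow> 'a) \<times> 'a) measure)"
    by (intro borel_measurable_continuous_onI continuous_intros)
  from measurable_sets_borel[OF m borel_shadow[OF J, of e]] show "shadow e J y \<in> sets borel" by (simp add: vimage_def)
  from measurable_sets_borel[OF m borel_prism[OF J]] show "prism J y \<in> sets borel" by (simp add: vimage_def)
qed

lemma emeasure_ball_measure_Int:
  fixes A :: "'a::euclidean_space set"
  assumes "A \<in> sets borel"
  shows "emeasure ball_measure A = emeasure lborel (A \<inter> cball 0 1) / emeasure lborel (cball (0::'a) 1)"
  unfolding ball_measure_def using assms by (subst emeasure_uniform_measure) (auto simp: Int_commute)

text \<open>The linear map fixing \<open>u\<^sup>\<bottom>\<close> and sending \<open>u\<close> to \<open>e\<close> turns the prism into the shadow;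
  it is bi-Lipschitz with constants \<open>1 \<plusminus> \<eta>\<close>, and its determinant is controlled by
  its effect on the unit ball.\<close>

lemma prism_shadow_compare:
  fixes y :: "nat \<Rightarrow> 'a::euclidean_space"
  assumes J: "finite J" and u: "norm u = 1" and sp: "span (y ` J) = {x. x \<bullet> u = 0}"
    and eta: "norm (e - u) \<le> \<eta>" "\<eta> < 1"
  defines "q \<equiv> ((1 + \<eta>) / (1 - \<eta>)) ^ DIM('a)"
  shows "emeasure ball_measure (prism J y) \<le> ennreal q * emeasure ball_measure (shadow e J y)"
    "emeasure ball_measure (shadow e J y) \<le> ennreal q * emeasure ball_measure (prism J y)"
proof -
  let ?D = "DIM('a)"
  have eta0: "0 \<le> \<eta>" using eta(1) norm_ge_zero order_trans by blast
  have uu: "u \<bullet> u = 1" using u by (simp add: norm_eq_1)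
  define T where "T = (\<lambda>x. x + (x \<bullet> u) *\<^sub>R (e - u))"
  have lin: "linear T" unfolding T_def
    by (intro linearI) (simp_all add: inner_add_left algebra_simps)
  have Td: "norm (T x - x) \<le> \<eta> * norm x" for x
  proof -
    have "norm (T x - x) = \<bar>x \<bullet> u\<bar> * norm (e - u)" by (simp add: T_def)
    also have "\<dots> \<le> norm x * \<eta>"
      using Cauchy_Schwarz_ineq2[of x u] u eta eta0 by (intro mult_mono) auto
    finally show ?thesis by (simp add: mult.commute)
  qed
  have up: "norm (T x) \<le> (1 + \<eta>) * norm x" for x
    using Td[of x] norm_triangle_ineq[of "T x - x" x] by (simp add: algebra_simps)
  have lo: "(1 - \<eta>) * norm x \<le> norm (T x)" for x
    using Td[of x] norm_triangle_ineq[of "x - T x" "T x"] by (simp add: algebra_simps norm_minus_commute)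
  have inj: "inj T"
  proof (rule linear_injective_0[OF lin, THEN iffD2], intro allI impI)
    fix x assume "T x = 0"
    then show "x = 0" using lo[of x] eta by (simp add: mult_le_0_iff)
  qed
  \<comment> \<open>\<open>T\<close> carries a point of the hyperplane plus a multiple of
    \<open>u\<close> to the same point plus that multiple of \<open>e\<close>; injectivity gives the
    converse inclusion.\<close>
  have TP: "T -` shadow e J y = prism J y"
  proof (intro set_eqI)
    fix w
    have yJ: "x \<bullet> u = 0" if "x \<in> pos (y ` J)" for x
      using that span_pos[of "y ` J"] span_base[of x "pos (y ` J)"] sp by auto
    have Tw: "T w = w - (w \<bullet> u) *\<^sub>R u + (w \<bullet> u) *\<^sub>R e" by (simp add: T_def algebra_simps)
    have "T w \<in> shadow e J y \<longleftrightarrow> w - (w \<bullet> u) *\<^sub>R u \<in> pos (y ` J)"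
    proof
      assume "w - (w \<bullet> u) *\<^sub>R u \<in> pos (y ` J)"
      then show "T w \<in> shadow e J y" unfolding shadow_iff_pos[OF J] Tw by (intro exI[of _ "w \<bullet> u"]) simp
    next
      assume "T w \<in> shadow e J y"
      then obtain s where s: "T w - s *\<^sub>R e \<in> pos (y ` J)" unfolding shadow_iff_pos[OF J] by blast
      define p where "p = T w - s *\<^sub>R e"
      have pu: "p \<bullet> u = 0" using yJ s by (simp add: p_def)
      have "T (p + s *\<^sub>R u) = p + s *\<^sub>R e" using pu uu by (simp add: T_def inner_add_left algebra_simps)
      also have "\<dots> = T w" by (simp add: p_def)
      finally have "w = p + s *\<^sub>R u" using inj by (simp add: inj_eq)
      then have "w - (w \<bullet> u) *\<^sub>R u = p" using pu uu by (simp add: inner_add_left)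
      then show "w - (w \<bullet> u) *\<^sub>R u \<in> pos (y ` J)" using s by (simp add: p_def)
    qed
    then show "w \<in> T -` shadow e J y \<longleftrightarrow> w \<in> prism J y"
      using prism_eq_projection[OF J u sp, of w] by simp
  qed
  obtain c where c: "0 \<le> c" "\<And>A. A \<in> sets borel \<Longrightarrow> emeasure lborel (T -` A) = ennreal c * emeasure lborel A"
    by (rule emeasure_lborel_linear_vimage[OF lin inj]) blast
  note bor = borel_shadow_section(1)[OF J, of e y] borel_shadow_section(2)[OF J, of y]
  have in1: "T -` cball 0 1 \<subseteq> cball 0 (1 / (1 - \<eta>))"
  proof
    fix x assume "x \<in> T -` cball 0 1"
    then have "(1 - \<eta>) * norm x \<le> 1" using lo[of x] by simp
    then show "x \<in> cball 0 (1 / (1 - \<eta>))" using eta by (simp add: field_simps)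
  qed
  have in2: "cball 0 (1 / (1 + \<eta>)) \<subseteq> T -` cball 0 1"
  proof
    fix x :: 'a assume "x \<in> cball 0 (1 / (1 + \<eta>))"
    then have "(1 + \<eta>) * norm x \<le> 1" using eta0 by (simp add: field_simps)
    then show "x \<in> T -` cball 0 1" using up[of x] by simp
  qed
  have mT: "T \<in> borel_measurable borel"
    using lin by (intro borel_measurable_continuous_onI linear_continuous_on linear_linear[THEN iffD2])
  have TB: "T -` cball 0 1 \<in> sets borel" by (rule measurable_sets_borel[OF mT]) simp
  have conep: "r *\<^sub>R x \<in> prism J y \<longleftrightarrow> x \<in> prism J y" if "0 < r" for r x
  proof -
    have "r *\<^sub>R x - (r *\<^sub>R x \<bullet> u) *\<^sub>R u = r *\<^sub>R (x - (x \<bullet> u) *\<^sub>R u)" by (simp add: algebra_simps)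
    moreover have "r *\<^sub>R v \<in> pos (y ` J) \<longleftrightarrow> v \<in> pos (y ` J)" for v
      using pos_cone[of "r *\<^sub>R v" "y ` J" "inverse r"] pos_cone[of v "y ` J" r] that by auto
    ultimately show ?thesis unfolding prism_eq_projection[OF J u sp] by simp
  qed
  define l where "l = measure lborel (cball (0::'a) 1)"
  have lf: "emeasure lborel (cball (0::'a) 1) = ennreal l"
    unfolding l_def by (rule emeasure_eq_ennreal_measure) (use emeasure_cball_pos_finite[where 'a='a] in auto)
  have l: "l > 0" using emeasure_cball_pos_finite(1)[where 'a='a] unfolding lf by simp
  define a where "a = measure lborel (prism J y \<inter> cball 0 1)"
  define b where "b = measure lborel (shadow e J y \<inter> cball 0 1)"
  have fin: "emeasure lborel (A \<inter> cball (0::'a) 1) \<noteq> \<infinity>" if "A \<in> sets borel" for A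
  proof -
    have "emeasure lborel (A \<inter> cball (0::'a) 1) \<le> emeasure lborel (cball (0::'a) 1)" by (intro emeasure_mono) auto
    then show ?thesis using emeasure_cball_pos_finite[where 'a='a] by (auto simp: top_unique)
  qed
  have af: "emeasure lborel (prism J y \<inter> cball 0 1) = ennreal a"
    unfolding a_def by (rule emeasure_eq_ennreal_measure) (use fin[OF bor(2)] in simp)
  have bf: "emeasure lborel (shadow e J y \<inter> cball 0 1) = ennreal b"
    unfolding b_def by (rule emeasure_eq_ennreal_measure) (use fin[OF bor(1)] in simp)
  have ab0: "0 \<le> a" "0 \<le> b" by (auto simp: a_def b_def)
  have vS: "T -` (shadow e J y \<inter> cball 0 1) = prism J y \<inter> T -` cball 0 1" using TP by auto
  have cb: "ennreal c * ennreal b = emeasure lborel (prism J y \<inter> T -` cball 0 1)"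
    using c(2)[of "shadow e J y \<inter> cball 0 1"] bor unfolding vS bf by simp
  have cl: "ennreal c * ennreal l = emeasure lborel (T -` cball 0 1)"
    using c(2)[of "cball 0 1"] unfolding lf by simp
  have r1: "1 / (1 - \<eta>) > 0" and r2: "1 / (1 + \<eta>) > 0" using eta eta0 by auto
  \<comment> \<open>Here a, b, l are the volumes of the prism, the shadow and the whole space inside
    the unit ball. The preimage of the ball under \<open>T\<close> lies between balls of radii 1/(1
    + \<eta>) and 1/(1 - \<eta>), and c b is the volume of its intersection with the prism. So
    \<open>1\<close> and \<open>2\<close> bound c b by multiples of a; \<open>3\<close> and
    \<open>4\<close>, the same for the whole space, bound c. Eliminating c compares a with
    b.\<close>
  have "ennreal c * ennreal b \<le> emeasure lborel (prism J y \<inter> cball 0 (1 / (1 - \<eta>)))"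
    unfolding cb using in1 bor by (intro emeasure_mono) auto
  also have "\<dots> = ennreal ((1 / (1 - \<eta>)) ^ ?D * a)"
    using emeasure_lborel_cone_ball[OF bor(2) conep r1] r1 ab0 by (simp add: af ennreal_mult)
  finally have 1: "c * b \<le> (1 / (1 - \<eta>)) ^ ?D * a"
    using c(1) ab0 r1 by (simp add: ennreal_mult'[symmetric])
  have "ennreal ((1 / (1 + \<eta>)) ^ ?D * a) = emeasure lborel (prism J y \<inter> cball 0 (1 / (1 + \<eta>)))"
    using emeasure_lborel_cone_ball[OF bor(2) conep r2] r2 ab0 by (simp add: af ennreal_mult)
  also have "\<dots> \<le> ennreal c * ennreal b"
    unfolding cb using in2 bor TB by (intro emeasure_mono) auto
  finally have 2: "(1 / (1 + \<eta>)) ^ ?D * a \<le> c * b"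
    using c(1) ab0 r2 by (simp add: ennreal_mult'[symmetric])
  have "ennreal c * ennreal l \<le> emeasure lborel (UNIV \<inter> cball (0::'a) (1 / (1 - \<eta>)))"
    unfolding cl using in1 by (intro emeasure_mono) auto
  also have "\<dots> = ennreal ((1 / (1 - \<eta>)) ^ ?D * l)"
    using emeasure_lborel_cone_ball[of "UNIV :: 'a set", OF _ _ r1] r1 l by (simp add: lf ennreal_mult)
  finally have "c * l \<le> (1 / (1 - \<eta>)) ^ ?D * l"
    using c(1) l r1 by (simp add: ennreal_mult'[symmetric])
  then have 3: "c \<le> (1 / (1 - \<eta>)) ^ ?D" using l by simp
  have "ennreal ((1 / (1 + \<eta>)) ^ ?D * l) = emeasure lborel (UNIV \<inter> cball (0::'a) (1 / (1 + \<eta>)))"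
    using emeasure_lborel_cone_ball[of "UNIV :: 'a set", OF _ _ r2] r2 l by (simp add: lf ennreal_mult)
  also have "\<dots> \<le> ennreal c * ennreal l"
    unfolding cl using in2 TB by (intro emeasure_mono) auto
  finally have "(1 / (1 + \<eta>)) ^ ?D * l \<le> c * l"
    using c(1) l r2 by (simp add: ennreal_mult'[symmetric])
  then have 4: "(1 / (1 + \<eta>)) ^ ?D \<le> c" using l by simp
  have E: "0 < (1 + \<eta>) ^ ?D" "0 < (1 - \<eta>) ^ ?D" using eta eta0 by auto
  have qe: "q = (1 + \<eta>) ^ ?D * (1 / (1 - \<eta>)) ^ ?D" by (simp add: q_def power_divide)
  have q0: "0 \<le> q" using E by (simp add: q_def power_divide)
  have i1: "(1 + \<eta>) ^ ?D * (1 / (1 + \<eta>)) ^ ?D = 1" using eta0 by (simp flip: power_mult_distrib)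
  have ab: "a \<le> q * b"
  proof -
    have "a = (1 + \<eta>) ^ ?D * ((1 / (1 + \<eta>)) ^ ?D * a)" using i1 by (simp add: mult.assoc[symmetric])
    also have "\<dots> \<le> (1 + \<eta>) ^ ?D * (c * b)" using 2 E by (intro mult_left_mono) auto
    also have "\<dots> \<le> (1 + \<eta>) ^ ?D * ((1 / (1 - \<eta>)) ^ ?D * b)"
      using 3 E ab0 by (intro mult_left_mono mult_right_mono) auto
    finally show ?thesis by (simp add: qe mult.assoc)
  qed
  have ba: "b \<le> q * a"
  proof -
    have "b = (1 + \<eta>) ^ ?D * ((1 / (1 + \<eta>)) ^ ?D * b)" using i1 by (simp add: mult.assoc[symmetric])
    also have "\<dots> \<le> (1 + \<eta>) ^ ?D * (c * b)" using 4 E ab0 by (intro mult_left_mono mult_right_mono) auto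
    also have "\<dots> \<le> (1 + \<eta>) ^ ?D * ((1 / (1 - \<eta>)) ^ ?D * a)"
      using 1 E by (intro mult_left_mono) auto
    finally show ?thesis by (simp add: qe mult.assoc)
  qed
  have ep: "emeasure ball_measure (prism J y) = ennreal (a / l)"
    using emeasure_ball_measure_Int[OF bor(2)] af lf l ab0 by (simp add: divide_ennreal)
  have es: "emeasure ball_measure (shadow e J y) = ennreal (b / l)"
    using emeasure_ball_measure_Int[OF bor(1)] bf lf l ab0 by (simp add: divide_ennreal)
  show "emeasure ball_measure (prism J y) \<le> ennreal q * emeasure ball_measure (shadow e J y)"
    unfolding ep es using ab q0 l ab0 by (simp add: ennreal_mult'[symmetric] divide_right_mono)
  show "emeasure ball_measure (shadow e J y) \<le> ennreal q * emeasure ball_measure (prism J y)"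
    unfolding ep es using ba q0 l ab0 by (simp add: ennreal_mult'[symmetric] divide_right_mono)
qed

section \<open>The shadows of the facets tile the space\<close>

text \<open>Dual form of the statement that, for finite \<open>I\<close>, \<open>e\<close> is
  interior to the cone of the points: a nonzero \<open>h\<close> that is nonnegative on all of them
  is positive at \<open>e\<close>.\<close>

definition positively_spanning :: "'a::euclidean_space \<Rightarrow> 'i set \<Rightarrow> ('i \<Rightarrow> 'a) \<Rightarrow> bool" where
  "positively_spanning e I y \<longleftrightarrow> (\<forall>h. h \<noteq> 0 \<longrightarrow> h \<bullet> e \<le> 0 \<longrightarrow> (\<exists>i\<in>I. h \<bullet> y i < 0))"

lemma shadow_eq_span:
  assumes "finite J" "w - s *\<^sub>R e \<in> span (y ` J)"
  shows "w \<in> span (insert e (y ` J))"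
proof -
  have "w - s *\<^sub>R e \<in> span (insert e (y ` J))" using assms span_mono[of "y ` J" "insert e (y ` J)"] by auto
  moreover have "s *\<^sub>R e \<in> span (insert e (y ` J))" by (intro span_scale span_base) auto
  ultimately have "(w - s *\<^sub>R e) + s *\<^sub>R e \<in> span (insert e (y ` J))" by (rule span_add)
  then show ?thesis by simp
qed

text \<open>Follow the line through \<open>w\<close> in the direction -e to its last point
  \<open>p\<close> in the cone. A hyperplane separating the cone from the rest of the ray supports
  the cone at \<open>p\<close>, and the points on it form \<open>J\<close>. General position bounds
  their number from above, genericity of \<open>w\<close> from below.\<close>

lemma exit_facet_exists:
  fixes y :: "nat \<Rightarrow> 'a::euclidean_space"
  assumes I: "finite I" "card I \<ge> DIM('a)" and D: "DIM('a) \<ge> 2"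
    and gp: "general_position I y" and yp: "\<And>i. i \<in> I \<Longrightarrow> 0 < y i \<bullet> e"
    and ps: "positively_spanning e I y" and e: "norm e = 1"
    and w: "\<And>K. K \<subseteq> I \<Longrightarrow> card K \<le> DIM('a) - 2 \<Longrightarrow> w \<notin> span (insert e (y ` K))"
  obtains J where "J \<subseteq> I" "card J = DIM('a) - 1" "face_index I y J" "w \<in> shadow e J y"
proof -
  define C where "C = pos (y ` I)"
  have C: "closed C" "convex C" "0 \<in> C" "\<And>x r. x \<in> C \<Longrightarrow> 0 \<le> r \<Longrightarrow> r *\<^sub>R x \<in> C"
    unfolding C_def using I by (auto simp: closed_pos convex_pos zero_in_pos pos_cone)
  have Ce: "0 \<le> x \<bullet> e" if "x \<in> C" for x
  proof -
    have "x \<in> pos (y ` I)" using that by (simp add: C_def)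
    then obtain c where c: "\<forall>i\<in>I. 0 \<le> c i" "x = (\<Sum>i\<in>I. c i *\<^sub>R y i)"
      by (rule pos_image_iff[OF I(1), THEN iffD1, THEN exE]) blast
    have "0 \<le> (\<Sum>i\<in>I. c i * (y i \<bullet> e))"
    proof (rule sum_nonneg)
      fix i assume "i \<in> I"
      then show "0 \<le> c i * (y i \<bullet> e)" using c(1) yp[of i] by simp
    qed
    then show ?thesis by (simp add: c(2) inner_sum_left)
  qed
  define S where "S = {s. w - s *\<^sub>R e \<in> C}"
  have clS: "closed S"
  proof -
    have "continuous_on UNIV (\<lambda>s. w - s *\<^sub>R e)" by (intro continuous_intros)
    from closed_vimage[OF C(1) this] show ?thesis by (simp add: S_def vimage_def)
  qed
  \<comment> \<open>If the line missed the cone, a separating hyperplane would be parallel to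
    \<open>e\<close>, and its normal would contradict \<open>positively_spanning\<close>.\<close>
  have "S \<noteq> {}"
  proof
    assume "S = {}"
    define R where "R = range (\<lambda>s. w - s *\<^sub>R e)"
    have "C \<inter> R = {}" using \<open>S = {}\<close> by (auto simp: S_def R_def)
    moreover have "convex R"
    proof -
      have "R = (\<lambda>x. w + x) ` range (\<lambda>s. s *\<^sub>R (- e))" by (auto simp: R_def image_image)
      moreover have "convex (range (\<lambda>s::real. s *\<^sub>R (- e)))"
        by (intro convex_linear_image) (auto simp: linear_iff scaleR_left_distrib algebra_simps)
      ultimately show ?thesis by (simp add: convex_translation)
    qed
    ultimately obtain a b where ab: "a \<noteq> 0" "\<forall>x\<in>C. a \<bullet> x \<le> b" "\<forall>x\<in>R. b \<le> a \<bullet> x"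
      using separating_hyperplane_sets[of C R] C by (auto simp: R_def)
    have line: "b \<le> a \<bullet> w - s * (a \<bullet> e)" for s
    proof -
      have "b \<le> a \<bullet> (w - s *\<^sub>R e)" using ab(3) by (auto simp: R_def)
      then show ?thesis by (simp add: inner_diff_right)
    qed
    have ae: "a \<bullet> e = 0"
    proof (rule ccontr)
      assume n: "a \<bullet> e \<noteq> 0"
      have "b \<le> a \<bullet> w - ((a \<bullet> w - b + 1) / (a \<bullet> e)) * (a \<bullet> e)" by (rule line)
      then show False using n by simp
    qed
    have aC: "a \<bullet> x \<le> 0" if x: "x \<in> C" for x
    proof (rule ccontr)
      assume "\<not> a \<bullet> x \<le> 0"
      then have p: "a \<bullet> x > 0" by simp
      have "0 \<le> b" using ab(2) C(3) by force
      then have "((b + 1) / (a \<bullet> x)) *\<^sub>R x \<in> C" using p by (intro C(4)[OF x]) auto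
      then have "a \<bullet> (((b + 1) / (a \<bullet> x)) *\<^sub>R x) \<le> b" using ab(2) by blast
      then show False using p by simp
    qed
    have "- a \<noteq> 0" "(- a) \<bullet> e \<le> 0" using ab(1) ae by simp_all
    then obtain i where i: "i \<in> I" "(- a) \<bullet> y i < 0"
      using ps unfolding positively_spanning_def by blast
    have "y i \<in> C" unfolding C_def using i by (intro pos_inc) auto
    then show False using aC[of "y i"] i by simp
  qed
  moreover have bd: "s \<le> w \<bullet> e" if "s \<in> S" for s
  proof -
    have "0 \<le> (w - s *\<^sub>R e) \<bullet> e" using that Ce by (simp add: S_def)
    then show ?thesis using e by (simp add: inner_diff_left norm_eq_1)
  qed
  then have bdd: "bdd_above S" by (intro bdd_aboveI)
  ultimately have sS: "Sup S \<in> S" using clS by (intro closed_contains_Sup)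
  define p where "p = w - Sup S *\<^sub>R e"
  have pC: "p \<in> C" using sS by (simp add: S_def p_def)
  have out: "p - t *\<^sub>R e \<notin> C" if "t > 0" for t
  proof
    assume "p - t *\<^sub>R e \<in> C"
    then have "Sup S + t \<in> S" by (simp add: S_def p_def algebra_simps)
    then have "Sup S + t \<le> Sup S" using bdd by (intro cSup_upper)
    then show False using that by simp
  qed
  define R where "R = (\<lambda>t. p - t *\<^sub>R e) ` {0<..}"
  have "C \<inter> R = {}" using out by (auto simp: R_def)
  moreover have "convex R"
  proof -
    have "R = (\<lambda>x. p + x) ` (\<lambda>t. t *\<^sub>R (- e)) ` {0<..}" by (auto simp: R_def image_image)
    moreover have "convex ((\<lambda>t. t *\<^sub>R (- e)) ` {0::real<..})"
      by (intro convex_linear_image) (auto simp: linear_iff scaleR_left_distrib algebra_simps)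
    ultimately show ?thesis by (simp add: convex_translation)
  qed
  moreover have "R \<noteq> {}" by (auto simp: R_def)
  ultimately obtain a b where ab: "a \<noteq> 0" "\<forall>x\<in>C. a \<bullet> x \<le> b" "\<forall>x\<in>R. b \<le> a \<bullet> x"
    using separating_hyperplane_sets[of C R] C by auto
  have b0: "0 \<le> b" using ab(2) C(3) by force
  have aC: "a \<bullet> x \<le> 0" if x: "x \<in> C" for x
  proof (rule ccontr)
    assume "\<not> a \<bullet> x \<le> 0"
    then have q: "a \<bullet> x > 0" by simp
    have "((b + 1) / (a \<bullet> x)) *\<^sub>R x \<in> C" using q b0 by (intro C(4)[OF x]) auto
    then have "a \<bullet> (((b + 1) / (a \<bullet> x)) *\<^sub>R x) \<le> b" using ab(2) by blast
    then show False using q by simp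
  qed
  have line: "b \<le> a \<bullet> p - t * (a \<bullet> e)" if "t > 0" for t
  proof -
    have "b \<le> a \<bullet> (p - t *\<^sub>R e)" using ab(3) that by (auto simp: R_def)
    then show ?thesis by (simp add: inner_diff_right)
  qed
  \<comment> \<open>Approaching \<open>p\<close> along the ray forces a \<bullet> p \<ge> 0. The
    chosen \<open>t\<close> is so small that t |a \<bullet> e| is at most half of the supposed
    gap.\<close>
  have ap: "a \<bullet> p = 0"
  proof (rule ccontr)
    assume "a \<bullet> p \<noteq> 0"
    then have n: "a \<bullet> p < 0" using aC[OF pC] by simp
    define t where "t = (- (a \<bullet> p) / 2) / (\<bar>a \<bullet> e\<bar> + 1)"
    have t: "t > 0" unfolding t_def using n by (intro divide_pos_pos) auto
    have "t * \<bar>a \<bullet> e\<bar> \<le> t * (\<bar>a \<bullet> e\<bar> + 1)" using t by (intro mult_left_mono) auto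
    also have "\<dots> = - (a \<bullet> p) / 2"
    proof -
      have "X / Y * Y = X" if "Y > 0" for X Y :: real using that by simp
      then show ?thesis unfolding t_def by (metis abs_ge_zero add_nonneg_pos zero_less_one)
    qed
    finally have "- (t * (a \<bullet> e)) \<le> - (a \<bullet> p) / 2"
      using t abs_ge_minus_self[of "t * (a \<bullet> e)"] by (simp add: abs_mult)
    then show False using line[OF t] n b0 by simp
  qed
  define J where "J = {i \<in> I. (- a) \<bullet> y i = 0}"
  have J: "J \<subseteq> I" "finite J" using I by (auto simp: J_def)
  have s1: "(- a) \<bullet> y j = 0" if "j \<in> J" for j using that by (simp add: J_def)
  have s2: "0 < (- a) \<bullet> y i" if "i \<in> I - J" for i
  proof -
    have "y i \<in> C" unfolding C_def using that by (intro pos_inc) auto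
    then show ?thesis using aC[of "y i"] that by (auto simp: J_def)
  qed
  have fi: "face_index I y J" unfolding face_index_iff_pos[OF I(1)] using s1 s2 by blast
  have "pos (y ` I) \<inter> {x. (- a) \<bullet> x = 0} = pos (y ` J)"
    by (rule supporting_face_eq_pos(2)[OF I(1) J(1) s1 s2])
  moreover have "p \<in> pos (y ` I) \<inter> {x. (- a) \<bullet> x = 0}" using pC ap by (simp add: C_def)
  ultimately have pJ: "p \<in> pos (y ` J)" by simp
  have "dim (y ` J) < DIM('a)"
  proof -
    have "y ` J \<subseteq> {x. a \<bullet> x = 0}" by (auto simp: J_def)
    then have "dim (y ` J) \<le> dim {x. a \<bullet> x = 0}" by (rule dim_subset)
    then show ?thesis using dim_hyperplane[OF ab(1)] D by simp
  qed
  \<comment> \<open>In general position the bound on the dimension is one on the cardinality. Fewer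
    than D - 1 points are excluded, as \<open>w\<close> would then lie in the span of
    \<open>e\<close> and at most D - 2 points.\<close>
  then have "card J \<le> DIM('a) - 1"
    using general_position_dim[OF I(1) J(1) gp] by auto
  moreover have "\<not> card J \<le> DIM('a) - 2"
  proof
    assume c: "card J \<le> DIM('a) - 2"
    have "w - Sup S *\<^sub>R e \<in> span (y ` J)"
      using pJ span_pos[of "y ` J"] span_base[of p "pos (y ` J)"] by (simp add: p_def)
    then show False using w[OF J(1) c] shadow_eq_span[OF J(2)] by blast
  qed
  ultimately have cJ: "card J = DIM('a) - 1" using D by simp
  have "w \<in> shadow e J y" unfolding shadow_iff_pos[OF J(2)] using pJ by (auto simp: p_def)
  then show ?thesis using that[OF J(1) cJ fi] by blast
qed

text \<open>The inner normal \<open>u\<close> of a facet satisfies u \<bullet> e > 0, so no point of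
  the cone on the line comes after the exit through that facet. By symmetry both exits coincide, and
  the exit point lies in the span of the points common to \<open>J\<close> and \<open>J'\<close>,
  too few for a generic \<open>w\<close>.\<close>

lemma exit_facet_unique:
  fixes y :: "nat \<Rightarrow> 'a::euclidean_space"
  assumes I: "finite I" "card I \<ge> DIM('a)" and D: "DIM('a) \<ge> 2"
    and ps: "positively_spanning e I y"
    and w: "\<And>K. K \<subseteq> I \<Longrightarrow> card K \<le> DIM('a) - 2 \<Longrightarrow> w \<notin> span (insert e (y ` K))"
    and J: "J \<subseteq> I" "card J = DIM('a) - 1" "face_index I y J" "w \<in> shadow e J y"
    and J': "J' \<subseteq> I" "card J' = DIM('a) - 1" "face_index I y J'" "w \<in> shadow e J' y"
  shows "J = J'"
proof (rule ccontr)
  assume ne: "J \<noteq> J'"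
  have fJ: "finite J" "finite J'" using I J J' finite_subset by blast+
  \<comment> \<open>If s = s', then \<open>u\<close> annihilates the second point too, so its
    coefficients outside \<open>J\<close> vanish; this places it in the span of the common
    points.\<close>
  have key: "s' \<le> s \<and> (s = s' \<longrightarrow> w - s' *\<^sub>R e \<in> pos (y ` J) \<inter> pos (y ` J'))
      \<and> (s = s' \<longrightarrow> w - s' *\<^sub>R e \<in> span (y ` (J \<inter> J')))"
    if J: "J \<subseteq> I" "card J = DIM('a) - 1" "face_index I y J" "w - s *\<^sub>R e \<in> pos (y ` J)"
      and J': "J' \<subseteq> I" "w - s' *\<^sub>R e \<in> pos (y ` J')" and f: "finite J" "finite J'"
    for J J' s s'
  proof -
    obtain u where u: "\<forall>j\<in>J. u \<bullet> y j = 0" "\<forall>i\<in>I - J. 0 < u \<bullet> y i"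
      using J(3) face_index_iff_pos[OF I(1)] by blast
    have "J \<noteq> I" using J(2) I D by auto
    then have "u \<noteq> 0" using u(2) J(1) by auto
    have nn: "0 \<le> u \<bullet> y i" if "i \<in> I" for i using u that by (cases "i \<in> J") (auto simp: less_imp_le)
    have ue: "u \<bullet> e > 0"
    proof (rule ccontr)
      assume "\<not> u \<bullet> e > 0"
      then obtain i where "i \<in> I" "u \<bullet> y i < 0" using ps \<open>u \<noteq> 0\<close> unfolding positively_spanning_def by force
      then show False using nn by force
    qed
    obtain c where c: "\<forall>j\<in>J. 0 \<le> c j" "w - s *\<^sub>R e = (\<Sum>j\<in>J. c j *\<^sub>R y j)"
      using J(4) pos_image_iff[OF f(1)] by blast
    obtain c' where c': "\<forall>j\<in>J'. 0 \<le> c' j" "w - s' *\<^sub>R e = (\<Sum>j\<in>J'. c' j *\<^sub>R y j)"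
      using J'(2) pos_image_iff[OF f(2)] by blast
    have "u \<bullet> (w - s *\<^sub>R e) = 0" unfolding c(2) using u(1) by (simp add: inner_sum_right)
    moreover have eq': "u \<bullet> (w - s' *\<^sub>R e) = (\<Sum>j\<in>J'. c' j * (u \<bullet> y j))" unfolding c'(2) by (simp add: inner_sum_right)
    moreover have nn': "0 \<le> c' j * (u \<bullet> y j)" if "j \<in> J'" for j using c'(1) nn J'(1) that by auto
    moreover have "0 \<le> (\<Sum>j\<in>J'. c' j * (u \<bullet> y j))" using nn' by (intro sum_nonneg) auto
    ultimately have "0 \<le> (s - s') * (u \<bullet> e)" by (simp add: inner_diff_right algebra_simps)
    then have le: "s' \<le> s" using ue by (simp add: zero_le_mult_iff)
    have sp: "w - s' *\<^sub>R e \<in> span (y ` (J \<inter> J'))" if "s = s'"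
    proof -
      have "(\<Sum>j\<in>J'. c' j * (u \<bullet> y j)) = 0" using eq' \<open>u \<bullet> (w - s *\<^sub>R e) = 0\<close> that by simp
      then have z: "\<forall>j\<in>J'. c' j * (u \<bullet> y j) = 0" using nn' f(2) by (subst (asm) sum_nonneg_eq_0_iff) auto
      have "c' j = 0" if "j \<in> J' - J" for j
      proof -
        have "0 < u \<bullet> y j" using u(2) that J'(1) by auto
        then show ?thesis using z that by force
      qed
      then have "w - s' *\<^sub>R e = (\<Sum>j\<in>J \<inter> J'. c' j *\<^sub>R y j)"
        unfolding c'(2) using f by (intro sum.mono_neutral_right) auto
      moreover have "(\<Sum>j\<in>J \<inter> J'. c' j *\<^sub>R y j) \<in> span (y ` (J \<inter> J'))"
        by (rule span_sum, rule span_scale, rule span_base) auto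
      ultimately show ?thesis by simp
    qed
    show ?thesis using le sp J(4) J'(2) by auto
  qed
  obtain s where s: "w - s *\<^sub>R e \<in> pos (y ` J)" using J(4) shadow_iff_pos[OF fJ(1)] by blast
  obtain s' where s': "w - s' *\<^sub>R e \<in> pos (y ` J')" using J'(4) shadow_iff_pos[OF fJ(2)] by blast
  have "s' \<le> s" "s \<le> s'"
    using key[OF J(1-3) s J'(1) s' fJ] key[OF J'(1-3) s' J(1) s fJ(2,1)] by auto
  then have "w - s' *\<^sub>R e \<in> span (y ` (J \<inter> J'))"
    using key[OF J(1-3) s J'(1) s' fJ] by auto
  then have "w \<in> span (insert e (y ` (J \<inter> J')))" using fJ by (intro shadow_eq_span) auto
  moreover have "card (J \<inter> J') \<le> DIM('a) - 2"
  proof -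
    have "J \<inter> J' \<subset> J" using ne J(2) J'(2) fJ by (metis card_subset_eq inf.absorb_iff1 inf_le1 psubsetI)
    then have "card (J \<inter> J') < card J" using fJ by (intro psubset_card_mono)
    then show ?thesis using J(2) by simp
  qed
  ultimately show False using w[of "J \<inter> J'"] J(1) by auto
qed

definition shadow_weight :: "'a::euclidean_space \<Rightarrow> nat set \<Rightarrow> nat set \<Rightarrow> (nat \<Rightarrow> 'a) \<Rightarrow> ennreal" where
  "shadow_weight e I J y = indicator {y. face_index I y J} y * emeasure ball_measure (shadow e J y)"

text \<open>Almost every ball point \<open>w\<close> avoids the finitely many spans of
  \<open>e\<close> with at most D - 2 points, and is then covered by the shadow of exactly one
  facet.\<close>

lemma sum_shadow_weight:
  fixes y :: "nat \<Rightarrow> 'a::euclidean_space"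
  assumes I: "finite I" "card I \<ge> DIM('a)" and D: "DIM('a) \<ge> 2"
    and gp: "general_position I y" and yp: "\<And>i. i \<in> I \<Longrightarrow> 0 < y i \<bullet> e"
    and ps: "positively_spanning e I y" and e: "norm e = 1"
  shows "(\<Sum>J | J \<subseteq> I \<and> card J = DIM('a) - 1. shadow_weight e I J y) = 1"
proof -
  let ?Js = "{J. J \<subseteq> I \<and> card J = DIM('a) - 1}"
  have fin: "finite ?Js" using I by simp
  have fJ: "finite J" if "J \<in> ?Js" for J using that I finite_subset by blast
  have AEw: "AE w in ball_measure. \<forall>K\<in>{K. K \<subseteq> I \<and> card K \<le> DIM('a) - 2}. w \<notin> span (insert e (y ` K))"
  proof (rule AE_finite_allI)
    show "finite {K. K \<subseteq> I \<and> card K \<le> DIM('a) - 2}" using I by simp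
    fix K assume K: "K \<in> {K. K \<subseteq> I \<and> card K \<le> DIM('a) - 2}"
    then have fK: "finite K" using I finite_subset by blast
    have "dim (insert e (y ` K)) \<le> card (insert e (y ` K))" using fK by (simp add: dim_le_card')
    also have "\<dots> \<le> Suc (card (y ` K))" by (simp add: card_insert_le_m1 card_insert_if fK)
    also have "\<dots> \<le> Suc (card K)" using fK by (simp add: card_image_le)
    also have "\<dots> < DIM('a)" using K D by auto
    finally show "AE w in ball_measure. w \<notin> span (insert e (y ` K))" by (rule AE_ball_measure_span)
  qed
  have "(\<Sum>J\<in>?Js. shadow_weight e I J y) = (\<Sum>J\<in>?Js. \<integral>\<^sup>+w. indicator {y. face_index I y J} y * indicator (shadow e J y) w \<partial>ball_measure)"
  proof (rule sum.cong[OF refl])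
    fix J assume "J \<in> ?Js"
    then have "shadow e J y \<in> sets ball_measure" using borel_shadow_section(1)[OF fJ] by simp
    then show "shadow_weight e I J y = (\<integral>\<^sup>+w. indicator {y. face_index I y J} y * indicator (shadow e J y) w \<partial>ball_measure)"
      by (simp add: shadow_weight_def nn_integral_cmult_indicator)
  qed
  also have "\<dots> = (\<integral>\<^sup>+w. (\<Sum>J\<in>?Js. indicator {y. face_index I y J} y * indicator (shadow e J y) w) \<partial>ball_measure)"
  proof (rule nn_integral_sum[symmetric])
    fix J assume "J \<in> ?Js"
    then have m: "shadow e J y \<in> sets ball_measure" using borel_shadow_section(1)[OF fJ] by simp
    show "(\<lambda>w. indicator {y. face_index I y J} y * indicator (shadow e J y) w :: ennreal) \<in> borel_measurable ball_measure"
      by (intro borel_measurable_times_ennreal borel_measurable_const borel_measurable_indicator m)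
  qed
  also have "\<dots> = (\<integral>\<^sup>+w. 1 \<partial>(ball_measure :: 'a measure))"
  proof (rule nn_integral_cong_AE, use AEw in eventually_elim)
    fix w assume "\<forall>K\<in>{K. K \<subseteq> I \<and> card K \<le> DIM('a) - 2}. w \<notin> span (insert e (y ` K))"
    then have w: "\<And>K. K \<subseteq> I \<Longrightarrow> card K \<le> DIM('a) - 2 \<Longrightarrow> w \<notin> span (insert e (y ` K))" by blast
    obtain J where J: "J \<subseteq> I" "card J = DIM('a) - 1" "face_index I y J" "w \<in> shadow e J y"
      using exit_facet_exists[OF I D gp yp ps e w] by blast
    have "(\<Sum>K\<in>?Js. indicator {y. face_index I y K} y * indicator (shadow e K y) w) = (\<Sum>K\<in>{J}. indicator {y. face_index I y K} y * indicator (shadow e K y) w :: ennreal)"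
    proof (rule sum.mono_neutral_right[OF fin])
      show "{J} \<subseteq> ?Js" using J by simp
      show "\<forall>K\<in>?Js - {J}. indicator {y. face_index I y K} y * indicator (shadow e K y) w = (0::ennreal)"
      proof
        fix K assume K: "K \<in> ?Js - {J}"
        have "\<not> (face_index I y K \<and> w \<in> shadow e K y)"
          using exit_facet_unique[OF I D ps w J, of K] K by auto
        then show "indicator {y. face_index I y K} y * indicator (shadow e K y) w = (0::ennreal)"
          by (auto simp: indicator_def)
      qed
    qed
    then show "(\<Sum>K\<in>?Js. indicator {y. face_index I y K} y * indicator (shadow e K y) w) = (1::ennreal)"
      using J by simp
  qed
  also have "\<dots> = 1" using ball_PiM.M.emeasure_space_1[where 'a='a] by simp
  finally show ?thesis .
qed

text \<open>Points of \<open>cap e v\<close> have direction near \<open>e + v/2\<close>; once every cap with \<open>v\<close> a signed basis vector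
  is hit, the cone contains \<open>e\<close> in its interior.\<close>

definition cap :: "'a::euclidean_space \<Rightarrow> 'a \<Rightarrow> 'a set" where
  "cap e v = ball ((1/2) *\<^sub>R (e + (1/2) *\<^sub>R v)) (1 / (8 * real DIM('a)))"

abbreviation axes :: "'a::euclidean_space set" where
  "axes \<equiv> Basis \<union> uminus ` Basis"

text \<open>The centre has norm at most 1/2 + 1/4 and inner product at least 1/2 - 1/4 with
  \<open>e\<close>; the radius, at most 1/8, is absorbed by both.\<close>

lemma cap_subset:
  fixes e v :: "'a::euclidean_space"
  assumes e: "norm e = 1" and v: "v \<in> axes" and z: "z \<in> cap e v"
  shows "z \<in> cball 0 1" "0 < z \<bullet> e"
proof -
  define p where "p = (1/2) *\<^sub>R (e + (1/2) *\<^sub>R v)"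
  have nv: "norm v = 1" using v by auto
  have zp: "norm (z - p) \<le> 1/8"
  proof -
    have "norm (z - p) < 1 / (8 * real DIM('a))" using z by (simp add: cap_def p_def dist_norm norm_minus_commute)
    also have "\<dots> \<le> 1/8"
    proof -
      have "real DIM('a) \<ge> 1" using DIM_positive[where 'a='a] by linarith
      then show ?thesis by (simp add: field_simps)
    qed
    finally show ?thesis by simp
  qed
  have "norm p \<le> 3/4"
    using norm_triangle_ineq[of e "(1/2) *\<^sub>R v"] e nv by (simp add: p_def)
  then show "z \<in> cball 0 1" using zp norm_triangle_ineq[of "z - p" p] by simp
  have "\<bar>e \<bullet> v\<bar> \<le> 1" using Cauchy_Schwarz_ineq2[of e v] e nv by simp
  then have "p \<bullet> e \<ge> 1/4" using e inner_commute[of v e] by (simp add: p_def inner_add_left norm_eq_1 abs_le_iff)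
  moreover have "\<bar>(z - p) \<bullet> e\<bar> \<le> 1/8" using Cauchy_Schwarz_ineq2[of "z - p" e] e zp by simp
  ultimately show "0 < z \<bullet> e" unfolding inner_diff_left by linarith
qed

text \<open>For h \<bullet> e \<le> 0 take a coordinate of \<open>h\<close> of size at least norm h
  / D, which exists since the sizes sum to at least norm h, and the axis \<open>v\<close> opposing
  it. At the centre of its cap \<open>h\<close> takes a value of at most -norm h / (4 D), and the
  radius 1/(8 D) can make up only half of this.\<close>

lemma caps_positively_spanning:
  fixes e :: "'a::euclidean_space"
  assumes e: "norm e = 1" and hit: "\<And>v. v \<in> axes \<Longrightarrow> \<exists>i\<in>I. z i \<in> cap e v"
  shows "positively_spanning e I (flips e z)"
  unfolding positively_spanning_def
proof (intro allI impI)
  fix h :: 'a assume h: "h \<noteq> 0" "h \<bullet> e \<le> 0"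
  let ?D = "real DIM('a)"
  have D: "?D \<ge> 1" using DIM_positive[where 'a='a] by linarith
  have "\<exists>b\<in>Basis. norm h / ?D \<le> \<bar>h \<bullet> b\<bar>"
  proof (rule ccontr)
    assume "\<not> (\<exists>b\<in>Basis. norm h / ?D \<le> \<bar>h \<bullet> b\<bar>)"
    then have "(\<Sum>b\<in>Basis. \<bar>h \<bullet> b\<bar>) < (\<Sum>b\<in>(Basis :: 'a set). norm h / ?D)"
      by (intro sum_strict_mono) (auto simp: not_le)
    also have "\<dots> = norm h" by simp
    finally show False using norm_le_l1[of h] by simp
  qed
  then obtain b where b: "b \<in> Basis" "norm h / ?D \<le> \<bar>h \<bullet> b\<bar>" by blast
  define v where "v = (if h \<bullet> b \<le> 0 then b else - b)"
  have v: "v \<in> axes" using b(1) by (auto simp: v_def)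
  have hv: "h \<bullet> v = - \<bar>h \<bullet> b\<bar>" by (simp add: v_def)
  obtain i where i: "i \<in> I" "z i \<in> cap e v" using hit[OF v] by blast
  define p where "p = (1/2) *\<^sub>R (e + (1/2) *\<^sub>R v)"
  have "h \<bullet> p \<le> - (norm h / ?D) / 4" using h(2) b(2) hv by (simp add: p_def inner_add_right)
  moreover have "h \<bullet> (z i - p) \<le> norm h * (1 / (8 * ?D))"
  proof -
    have "h \<bullet> (z i - p) \<le> norm h * norm (z i - p)" by (rule norm_cauchy_schwarz)
    also have "\<dots> \<le> norm h * (1 / (8 * ?D))"
      using i(2) by (intro mult_left_mono) (auto simp: cap_def p_def dist_norm norm_minus_commute)
    finally show ?thesis .
  qed
  ultimately have "h \<bullet> z i \<le> - (norm h / ?D) / 8" by (simp add: inner_diff_right)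
  moreover have "norm h / ?D > 0" using h(1) D by simp
  then have "- (norm h / ?D) / 8 < 0" by simp
  ultimately have "h \<bullet> z i < 0" by (rule le_less_trans)
  moreover have "flip e (z i) = z i" using cap_subset(2)[OF e v i(2)] by (simp add: flip_def)
  ultimately show "\<exists>i\<in>I. h \<bullet> flip e (z i) < 0" by (intro bexI[of _ i] i(1)) simp
qed

definition cap_prob :: "'a::euclidean_space \<Rightarrow> 'a \<Rightarrow> real" where
  "cap_prob e v = measure ball_measure (cap e v)"

lemma cap_prob_bounds:
  fixes e v :: "'a::euclidean_space"
  assumes e: "norm e = 1" and v: "v \<in> axes"
  shows "0 < cap_prob e v" "cap_prob e v \<le> 1"
proof -
  have D: "real DIM('a) > 0" by simp
  have "cap e v \<inter> cball 0 1 = cap e v" using cap_subset(1)[OF e v] by auto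
  then have "emeasure ball_measure (cap e v) = emeasure lborel (cap e v) / emeasure lborel (cball (0::'a) 1)"
    using emeasure_ball_measure_Int[of "cap e v"] by (simp add: cap_def)
  moreover have "emeasure lborel (cap e v) > 0" using D by (simp add: cap_def emeasure_ball)
  ultimately have "emeasure ball_measure (cap e v) > 0"
    using emeasure_cball_pos_finite[where 'a='a] by (simp add: ennreal_zero_less_divide less_top)
  then show "0 < cap_prob e v" unfolding cap_prob_def by (simp add: ball_PiM.M.emeasure_eq_measure)
  show "cap_prob e v \<le> 1" unfolding cap_prob_def by (rule ball_PiM.M.prob_le_1)
qed

lemma emeasure_miss_cap:
  fixes e v :: "'a::euclidean_space"
  assumes I: "finite I"
  shows "{z \<in> space (ball_product I). \<forall>i\<in>I. z i \<notin> cap e v} \<in> sets (ball_product I)"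
    "emeasure (ball_product I) {z \<in> space (ball_product I). \<forall>i\<in>I. z i \<notin> cap e v} = ennreal ((1 - cap_prob e v) ^ card I)"
proof -
  have eq: "{z \<in> space (ball_product I). \<forall>i\<in>I. z i \<notin> cap e v} = (\<Pi>\<^sub>E i\<in>I. - cap e v)"
    by (auto simp: space_PiM PiE_def Pi_def)
  have m: "cap e v \<in> sets ball_measure" "- cap e v \<in> sets ball_measure" by (auto simp: cap_def intro!: borel_comp)
  show "{z \<in> space (ball_product I). \<forall>i\<in>I. z i \<notin> cap e v} \<in> sets (ball_product I)"
    unfolding eq using m I by (intro sets_PiM_I_finite) auto
  have "measure ball_measure (- cap e v) = 1 - cap_prob e v"
    unfolding cap_prob_def using ball_PiM.M.prob_compl[OF m(1)] by (simp add: Compl_eq_Diff_UNIV)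
  then have "emeasure ball_measure (- cap e v) = ennreal (1 - cap_prob e v)"
    by (simp add: ball_PiM.M.emeasure_eq_measure)
  moreover have "0 \<le> 1 - cap_prob e v" unfolding cap_prob_def by (simp add: ball_PiM.M.prob_le_1)
  ultimately show "emeasure (ball_product I) {z \<in> space (ball_product I). \<forall>i\<in>I. z i \<notin> cap e v} = ennreal ((1 - cap_prob e v) ^ card I)"
    unfolding eq using m by (subst ball_PiM.emeasure_PiM[OF I]) (auto simp: ennreal_power)
qed

lemma borel_measurable_shadow_weight:
  assumes "finite J"
  shows "shadow_weight e I J \<in> borel_measurable (borel :: (nat \<Rightarrow> 'a::euclidean_space) measure)"
  unfolding shadow_weight_def
  by (intro borel_measurable_times_ennreal borel_measurable_indicator borel_face_index)
     (use borel_measurable_section(2)[OF borel_shadow[OF assms]] in simp)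

lemma measurable_weight_flips:
  fixes c :: "'a::euclidean_space"
  assumes "W \<in> borel_measurable (borel :: (nat \<Rightarrow> 'a) measure)"
  shows "(\<lambda>z. W (flips c z)) \<in> borel_measurable (ball_product I)"
  by (rule measurable_compose[OF measurable_flips assms]) auto

text \<open>A union bound for the probability that some cap contains none of n points. It decays
  exponentially, as there are finitely many caps, each of positive probability.\<close>

definition miss_sum :: "'a::euclidean_space \<Rightarrow> nat \<Rightarrow> real" where
  "miss_sum e n = (\<Sum>v\<in>axes. (1 - cap_prob e v) ^ n)"

text \<open>If every cap is hit, the shadows tile and the weights sum to 1. Otherwise the sum is
  between 0 and the number of index sets, each weight being at most 1. So the deviation from 1 is
  controlled by the bound for a missed cap, times a binomial coefficient in the upper
  estimate.\<close>

lemma shadow_integral_bounds: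
  fixes e :: "'a::euclidean_space"
  assumes I: "finite I" "card I \<ge> DIM('a)" and D: "DIM('a) \<ge> 2" and e: "norm e = 1"
  defines "s \<equiv> (\<Sum>J | J \<subseteq> I \<and> card J = DIM('a) - 1. \<integral>\<^sup>+z. shadow_weight e I J (flips e z) \<partial>ball_product I)"
  shows "s \<le> 1 + ennreal (real (card I choose (DIM('a) - 1)) * miss_sum e (card I))"
    "1 \<le> s + ennreal (miss_sum e (card I))"
proof -
  let ?Js = "{J. J \<subseteq> I \<and> card J = DIM('a) - 1}"
  let ?M = "ball_product I :: (nat \<Rightarrow> 'a) measure"
  interpret M: prob_space ?M by (rule prob_space_ball_product)
  define C where "C = card I choose (DIM('a) - 1)"
  have cJs: "card ?Js = C" using n_subsets[OF I(1)] by (simp add: C_def)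
  define S where "S = (\<lambda>z. \<Sum>J\<in>?Js. shadow_weight e I J (flips e z))"
  define N where "N = (\<lambda>z. \<Sum>v\<in>axes. indicator {z \<in> space ?M. \<forall>i\<in>I. z i \<notin> cap e v} z :: ennreal)"
  have fJ: "finite J" if "J \<in> ?Js" for J using that I finite_subset by blast
  have mS: "(\<lambda>z. shadow_weight e I J (flips e z)) \<in> borel_measurable ?M" if "J \<in> ?Js" for J
    using that by (intro measurable_weight_flips borel_measurable_shadow_weight fJ)
  have sS: "s = (\<integral>\<^sup>+z. S z \<partial>?M)"
    unfolding s_def S_def by (rule nn_integral_sum[symmetric]) (rule mS)
  have mS': "S \<in> borel_measurable ?M" unfolding S_def by (rule borel_measurable_sum) (rule mS)
  have mN: "N \<in> borel_measurable ?M" unfolding N_def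
    by (intro borel_measurable_sum borel_measurable_indicator emeasure_miss_cap(1) I)
  have iN: "(\<integral>\<^sup>+z. N z \<partial>?M) = ennreal (miss_sum e (card I))"
  proof -
    have "(\<integral>\<^sup>+z. N z \<partial>?M) = (\<Sum>v\<in>axes. \<integral>\<^sup>+z. indicator {z \<in> space ?M. \<forall>i\<in>I. z i \<notin> cap e v} z \<partial>?M)"
      unfolding N_def by (intro nn_integral_sum borel_measurable_indicator emeasure_miss_cap(1) I)
    also have "\<dots> = (\<Sum>v\<in>axes. ennreal ((1 - cap_prob e v) ^ card I))"
      using emeasure_miss_cap[OF I(1), of e] by (intro sum.cong refl) simp
    also have "\<dots> = ennreal (miss_sum e (card I))"
      unfolding miss_sum_def using cap_prob_bounds[OF e] by (intro sum_ennreal) auto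
    finally show ?thesis .
  qed
  have sw1: "shadow_weight e I J y \<le> 1" for J and y :: "nat \<Rightarrow> 'a"
    unfolding shadow_weight_def using ball_PiM.M.emeasure_le_1 by (auto simp: indicator_def)
  have AEg: "AE z in ?M. general_position I z \<and> (\<forall>i\<in>I. z i \<bullet> e \<noteq> 0)"
  proof -
    have "e \<noteq> 0" using e by auto
    then show ?thesis using AE_general_position[OF I(1)] AE_inner_nonzero[OF I(1)] by (auto intro: AE_conjI)
  qed
  have key: "S z \<le> 1 + of_nat C * N z \<and> 1 \<le> S z + N z"
    if z: "z \<in> space ?M" "general_position I z" "\<forall>i\<in>I. z i \<bullet> e \<noteq> 0" for z
  proof (cases "\<forall>v\<in>axes. \<exists>i\<in>I. z i \<in> cap e v")
    case True
    then have ps: "positively_spanning e I (flips e z)" by (intro caps_positively_spanning[OF e]) blast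
    have "S z = 1" unfolding S_def
      by (rule sum_shadow_weight[OF I D _ _ ps e]) (use z in \<open>auto simp: general_position_flips intro: flip_inner_pos\<close>)
    then show ?thesis by simp
  next
    case False
    then obtain v where v: "v \<in> axes" "\<forall>i\<in>I. z i \<notin> cap e v" by blast
    have "1 = (indicator {z \<in> space ?M. \<forall>i\<in>I. z i \<notin> cap e v} z :: ennreal)" using v z by simp
    also have "\<dots> \<le> N z" unfolding N_def using v(1) by (intro member_le_sum) auto
    finally have N1: "1 \<le> N z" .
    have "S z \<le> (\<Sum>J\<in>?Js. 1)" unfolding S_def by (intro sum_mono sw1)
    also have "\<dots> = of_nat C" using cJs by simp
    also have "\<dots> \<le> of_nat C * N z" using mult_left_mono[OF N1, of "of_nat C"] by simp
    finally have "S z \<le> 1 + of_nat C * N z" by (simp add: add_increasing)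
    then show ?thesis using N1 by (simp add: add_increasing)
  qed
  have AE1: "AE z in ?M. S z \<le> 1 + of_nat C * N z" and AE2: "AE z in ?M. 1 \<le> S z + N z"
    using AEg AE_space[of ?M] by (eventually_elim, use key in blast)+
  have "s \<le> (\<integral>\<^sup>+z. 1 + of_nat C * N z \<partial>?M)" unfolding sS using AE1 by (rule nn_integral_mono_AE)
  also have "\<dots> = 1 + of_nat C * ennreal (miss_sum e (card I))"
    using mN by (simp add: nn_integral_add nn_integral_cmult iN M.emeasure_space_1)
  also have "of_nat C * ennreal (miss_sum e (card I)) = ennreal (real C * miss_sum e (card I))"
    by (simp add: ennreal_mult' ennreal_of_nat_eq_real_of_nat)
  finally show "s \<le> 1 + ennreal (real (card I choose (DIM('a) - 1)) * miss_sum e (card I))" by (simp add: C_def)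
  have "1 = (\<integral>\<^sup>+z. 1 \<partial>?M)" by (simp add: M.emeasure_space_1)
  also have "\<dots> \<le> (\<integral>\<^sup>+z. S z + N z \<partial>?M)" using AE2 by (rule nn_integral_mono_AE)
  also have "\<dots> = s + ennreal (miss_sum e (card I))"
    using mS' mN by (simp add: nn_integral_add sS iN)
  finally show "1 \<le> s + ennreal (miss_sum e (card I))" .
qed

section \<open>Facets far from orthogonal to the pole\<close>

text \<open>arccos (1 - \<eta>^2/2) is the angle between unit vectors at distance
  \<open>\<eta>\<close>. The bound is the probability that a point lies on the larger side of a
  hyperplane whose normal has this angle to \<open>e\<close>.\<close>

definition tilt_bound :: "real \<Rightarrow> real" where
  "tilt_bound \<eta> = 1 - arccos (1 - \<eta>\<^sup>2 / 2) / pi"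

lemma tilt_bound_range:
  assumes "0 < \<eta>" "\<eta> < 1"
  shows "0 \<le> tilt_bound \<eta>" "tilt_bound \<eta> < 1"
proof -
  have e: "0 < \<eta>\<^sup>2" "\<eta>\<^sup>2 \<le> 1" using assms by (auto simp: power_le_one)
  have "arccos (1 - \<eta>\<^sup>2 / 2) \<le> pi" using e by (intro arccos_ubound) auto
  then show "0 \<le> tilt_bound \<eta>" by (simp add: tilt_bound_def)
  have "arccos 1 < arccos (1 - \<eta>\<^sup>2 / 2)" using e by (intro arccos_less_arccos) auto
  then show "tilt_bound \<eta> < 1" by (simp add: tilt_bound_def)
qed

text \<open>Distance above \<open>\<eta>\<close> from both \<open>e\<close> and -e keeps the angle
  away from 0 and from pi by the same amount, so both bases in \<open>side_prob\<close> are at most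
  \<open>tilt_bound \<eta>\<close>.\<close>

lemma side_prob_tilted:
  fixes e u :: "'a::euclidean_space"
  assumes e: "norm e = 1" and u: "norm u = 1" and eta: "0 < \<eta>" "\<eta> < 1"
    and far: "\<eta> < norm (e - u)" "\<eta> < norm (e + u)"
  shows "side_prob m (arccos (u \<bullet> e)) \<le> 2 * tilt_bound \<eta> ^ m"
proof -
  have e2: "0 < \<eta>\<^sup>2" "\<eta>\<^sup>2 \<le> 1" using eta by (auto simp: power_le_one)
  have "\<eta>\<^sup>2 < (norm (e - u))\<^sup>2" "\<eta>\<^sup>2 < (norm (e + u))\<^sup>2"
    using far eta by (auto intro!: power_strict_mono)
  then have c: "u \<bullet> e < 1 - \<eta>\<^sup>2 / 2" "- (1 - \<eta>\<^sup>2 / 2) < u \<bullet> e"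
    using e u unfolding power2_norm_eq_inner
    by (auto simp: norm_eq_1 inner_diff_left inner_diff_right inner_add_left inner_add_right inner_commute)
  have c': "- 1 \<le> u \<bullet> e" "u \<bullet> e \<le> 1" "u \<bullet> e \<le> 1 - \<eta>\<^sup>2 / 2" "- (1 - \<eta>\<^sup>2 / 2) \<le> u \<bullet> e" "- 1 \<le> - (1 - \<eta>\<^sup>2 / 2)" "1 - \<eta>\<^sup>2 / 2 \<le> 1"
    using c e2 by linarith+
  define \<theta> where "\<theta> = arccos (u \<bullet> e)"
  define \<delta> where "\<delta> = arccos (1 - \<eta>\<^sup>2 / 2)"
  have 1: "\<delta> \<le> \<theta>" unfolding \<theta>_def \<delta>_def by (intro arccos_le_arccos c')
  have "arccos (u \<bullet> e) \<le> arccos (- (1 - \<eta>\<^sup>2 / 2))" by (intro arccos_le_arccos c')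
  also have "\<dots> = pi - \<delta>" unfolding \<delta>_def using e2 by (intro arccos_minus) auto
  finally have 2: "\<theta> \<le> pi - \<delta>" by (simp add: \<theta>_def)
  have d: "0 \<le> \<delta>" unfolding \<delta>_def using e2 by (intro arccos_lbound) auto
  have tb: "tilt_bound \<eta> = 1 - \<delta> / pi" by (simp add: tilt_bound_def \<delta>_def)
  have "1 - \<theta> / pi \<le> 1 - \<delta> / pi" using 1 by (simp add: divide_right_mono)
  moreover have "\<theta> / pi \<le> 1 - \<delta> / pi" using 2 by (simp add: field_simps)
  moreover have "0 \<le> 1 - \<theta> / pi" "0 \<le> \<theta> / pi" using 1 2 d by (auto simp: field_simps)
  ultimately have "(1 - \<theta> / pi) ^ m + (\<theta> / pi) ^ m \<le> tilt_bound \<eta> ^ m + tilt_bound \<eta> ^ m"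
    unfolding tb by (intro add_mono power_mono)
  then show ?thesis by (simp add: side_prob_def \<theta>_def)
qed

text \<open>If a unit normal of the hyperplane is within \<open>\<eta>\<close> of \<open>e\<close>
  or -e, the weights are compared directly. Otherwise the facet occurs only with exponentially small
  probability, and \<open>W1\<close> is at most 1. The weights are abstract because prism and shadow
  are to be compared in both directions.\<close>

lemma facet_weight_compare:
  fixes e :: "'a::euclidean_space" and J K :: "nat set" and W1 W2 :: "(nat \<Rightarrow> 'a) \<Rightarrow> ennreal"
  assumes fin: "finite J" "finite K" and ne: "K \<noteq> {}" "J \<inter> K = {}"
    and D: "DIM('a) \<ge> 2" and card: "card J = DIM('a) - 1" and e: "norm e = 1" and eta: "0 < \<eta>" "\<eta> < 1" and q: "0 \<le> q"
    and W: "W1 \<in> borel_measurable borel" "W2 \<in> borel_measurable borel"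
    and loc: "\<And>y y'. (\<And>j. j \<in> J \<Longrightarrow> y j = y' j) \<Longrightarrow> W1 y = W1 y'" "\<And>y y'. (\<And>j. j \<in> J \<Longrightarrow> y j = y' j) \<Longrightarrow> W2 y = W2 y'"
    and W1: "\<And>y. W1 y \<le> 1"
    and comp: "\<And>y u. norm u = 1 \<Longrightarrow> span (y ` J) = {x. x \<bullet> u = 0} \<Longrightarrow> norm (e - u) \<le> \<eta> \<Longrightarrow> W1 y \<le> ennreal q * W2 y"
  shows "(\<integral>\<^sup>+z. indicator {y. face_index (J \<union> K) y J} (flips e z) * W1 (flips e z) \<partial>ball_product (J \<union> K))
    \<le> ennreal q * (\<integral>\<^sup>+z. indicator {y. face_index (J \<union> K) y J} (flips e z) * W2 (flips e z) \<partial>ball_product (J \<union> K))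
      + ennreal (2 * tilt_bound \<eta> ^ card K)"
proof -
  define PJ where "PJ = (ball_product J :: (nat \<Rightarrow> 'a) measure)"
  define PK where "PK = (ball_product K :: (nat \<Rightarrow> 'a) measure)"
  interpret PJ: prob_space PJ unfolding PJ_def by (rule prob_space_ball_product)
  interpret PK: prob_space PK unfolding PK_def by (rule prob_space_ball_product)
  let ?F = "{y :: nat \<Rightarrow> 'a. face_index (J \<union> K) y J}"
  define P where "P = (\<lambda>x. \<integral>\<^sup>+z. indicator ?F (flips e (merge J K (x, z))) \<partial>PK)"
  have mF: "(indicator ?F :: _ \<Rightarrow> ennreal) \<in> borel_measurable borel"
    by (intro borel_measurable_indicator borel_face_index)
  have mm: "(\<lambda>p. flips e (merge J K (fst p, snd p))) \<in> PJ \<Otimes>\<^sub>M PK \<rightarrow>\<^sub>M borel"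
  proof -
    have "(\<lambda>p. merge J K (fst p, snd p)) \<in> PJ \<Otimes>\<^sub>M PK \<rightarrow>\<^sub>M ball_product (J \<union> K)"
      unfolding PJ_def PK_def using measurable_merge[of J K "\<lambda>_. ball_measure :: 'a measure"] by simp
    then have "(\<lambda>p. merge J K (fst p, snd p)) \<in> PJ \<Otimes>\<^sub>M PK \<rightarrow>\<^sub>M borel"
      by (rule measurable_compose[OF _ measurable_ball_product_id])
    then show ?thesis by (intro measurable_flips) auto
  qed
  have mP: "P \<in> borel_measurable PJ"
    unfolding P_def
    by (rule PK.borel_measurable_nn_integral) (use measurable_compose[OF mm mF] in \<open>simp add: case_prod_beta'\<close>)
  have fold: "(\<integral>\<^sup>+z. indicator ?F (flips e z) * W (flips e z) \<partial>ball_product (J \<union> K)) = (\<integral>\<^sup>+x. W (flips e x) * P x \<partial>PJ)"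
    if W: "W \<in> borel_measurable borel" and loc: "\<And>y y'. (\<And>j. j \<in> J \<Longrightarrow> y j = y' j) \<Longrightarrow> W y = W y'" for W
  proof -
    have mW: "(\<lambda>y. indicator ?F y * W y) \<in> borel_measurable borel" by (intro borel_measurable_times_ennreal mF W)
    have "(\<integral>\<^sup>+z. indicator ?F (flips e z) * W (flips e z) \<partial>ball_product (J \<union> K))
      = (\<integral>\<^sup>+x. \<integral>\<^sup>+z. indicator ?F (flips e (merge J K (x, z))) * W (flips e (merge J K (x, z))) \<partial>PK \<partial>PJ)"
      unfolding PJ_def PK_def
      by (rule ball_PiM.product_nn_integral_fold[OF ne(2) fin measurable_weight_flips[OF mW]])
    also have "\<dots> = (\<integral>\<^sup>+x. W (flips e x) * P x \<partial>PJ)"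
    proof (rule nn_integral_cong)
      fix x assume x: "x \<in> space PJ"
      have "W (flips e (merge J K (x, z))) = W (flips e x)" for z
        by (rule loc) (simp add: merge_def)
      moreover have "(\<lambda>z. flips e (merge J K (x, z))) \<in> PK \<rightarrow>\<^sub>M borel"
        using measurable_compose[OF measurable_Pair1'[OF x] mm] by simp
      then have "(\<lambda>z. indicator ?F (flips e (merge J K (x, z))) :: ennreal) \<in> borel_measurable PK"
        by (rule measurable_compose[OF _ mF])
      ultimately show "(\<integral>\<^sup>+z. indicator ?F (flips e (merge J K (x, z))) * W (flips e (merge J K (x, z))) \<partial>PK) = W (flips e x) * P x"
        by (simp add: P_def nn_integral_cmult mult.commute)
    qed
    finally show ?thesis .
  qed
  have pt: "W1 (flips e x) * P x \<le> ennreal q * (W2 (flips e x) * P x) + ennreal (2 * tilt_bound \<eta> ^ card K)"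
    if x: "x \<in> space PJ" "lin_indep J x" for x
  proof -
    have "inj_on x J" "independent (x ` J)" using x(2) lin_indep_iff[OF fin(1)] by auto
    then have "dim (x ` J) = DIM('a) - 1" using card by (simp add: dim_eq_card_independent card_image)
    then obtain u where u: "norm u = 1" "span (x ` J) = {v. v \<bullet> u = 0}" by (rule codim1_span_eq_hyperplane)
    have sp: "span (flips e x ` J) = {v. v \<bullet> u = 0}" by (simp add: span_flips u(2))
    consider "norm (e - u) \<le> \<eta>" | "norm (e + u) \<le> \<eta>" | "\<eta> < norm (e - u)" "\<eta> < norm (e + u)" by linarith
    then show ?thesis
    proof cases
      case 1
      have "W1 (flips e x) * P x \<le> (ennreal q * W2 (flips e x)) * P x"
        by (intro mult_right_mono comp[OF u(1) sp 1]) simp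
      then show ?thesis by (simp add: mult.assoc add_increasing2)
    next
      case 2
      have "W1 (flips e x) \<le> ennreal q * W2 (flips e x)"
        by (rule comp[of "- u"]) (use u(1) sp 2 in auto)
      then have "W1 (flips e x) * P x \<le> (ennreal q * W2 (flips e x)) * P x"
        by (intro mult_right_mono zero_le)
      then show ?thesis by (simp add: mult.assoc add_increasing2)
    next
      case 3
      have "P x = emeasure PK {z \<in> space PK. face_index (J \<union> K) (flips e (merge J K (x, z))) J}"
      proof -
        have "(\<lambda>z. flips e (merge J K (x, z))) \<in> PK \<rightarrow>\<^sub>M borel"
          using measurable_compose[OF measurable_Pair1'[OF x(1)] mm] by simp
        from measurable_sets[OF this borel_face_index[of "J \<union> K" J]]
        have m: "{z \<in> space PK. face_index (J \<union> K) (flips e (merge J K (x, z))) J} \<in> sets PK"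
          by (simp add: vimage_def Int_def conj_commute)
        have "P x = (\<integral>\<^sup>+z. indicator {z \<in> space PK. face_index (J \<union> K) (flips e (merge J K (x, z))) J} z \<partial>PK)"
          unfolding P_def by (intro nn_integral_cong) (auto simp: indicator_def)
        then show ?thesis using m by simp
      qed
      also have "\<dots> = ennreal (side_prob (card K) (arccos (u \<bullet> e)))"
        unfolding PK_def by (rule emeasure_face_index[OF fin ne e u(1) D u(2)])
      also have "\<dots> \<le> ennreal (2 * tilt_bound \<eta> ^ card K)"
        by (intro ennreal_leI side_prob_tilted[OF e u(1) eta 3])
      finally have "P x \<le> ennreal (2 * tilt_bound \<eta> ^ card K)" .
      moreover have "W1 (flips e x) * P x \<le> 1 * P x" by (intro mult_right_mono W1) simp
      ultimately have "W1 (flips e x) * P x \<le> ennreal (2 * tilt_bound \<eta> ^ card K)" by simp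
      then show ?thesis by (simp add: add_increasing)
    qed
  qed
  have mW2: "(\<lambda>x. W2 (flips e x) * P x) \<in> borel_measurable PJ"
    using measurable_weight_flips[OF W(2), of e J] mP unfolding PJ_def by (intro borel_measurable_times_ennreal) auto
  have "(\<integral>\<^sup>+x. W1 (flips e x) * P x \<partial>PJ) \<le> (\<integral>\<^sup>+x. ennreal q * (W2 (flips e x) * P x) + ennreal (2 * tilt_bound \<eta> ^ card K) \<partial>PJ)"
  proof (rule nn_integral_mono_AE)
    have "AE x in PJ. lin_indep J x" unfolding PJ_def using card by (intro AE_lin_indep fin) auto
    then show "AE x in PJ. W1 (flips e x) * P x \<le> ennreal q * (W2 (flips e x) * P x) + ennreal (2 * tilt_bound \<eta> ^ card K)"
      using AE_space[of PJ] by eventually_elim (rule pt)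
  qed
  also have "\<dots> = ennreal q * (\<integral>\<^sup>+x. W2 (flips e x) * P x \<partial>PJ) + ennreal (2 * tilt_bound \<eta> ^ card K)"
    using mW2 by (simp add: nn_integral_add nn_integral_cmult PJ.emeasure_space_1)
  finally have le: "(\<integral>\<^sup>+x. W1 (flips e x) * P x \<partial>PJ) \<le> ennreal q * (\<integral>\<^sup>+x. W2 (flips e x) * P x \<partial>PJ) + ennreal (2 * tilt_bound \<eta> ^ card K)" .
  have f1: "(\<integral>\<^sup>+z. indicator ?F (flips e z) * W1 (flips e z) \<partial>ball_product (J \<union> K)) = (\<integral>\<^sup>+x. W1 (flips e x) * P x \<partial>PJ)"
    by (rule fold[OF W(1) loc(1)])
  have f2: "(\<integral>\<^sup>+z. indicator ?F (flips e z) * W2 (flips e z) \<partial>ball_product (J \<union> K)) = (\<integral>\<^sup>+x. W2 (flips e x) * P x \<partial>PJ)"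
    by (rule fold[OF W(2) loc(2)])
  show ?thesis unfolding f1 f2 by (rule le)
qed

section \<open>Limits and the value of the facet integral\<close>

text \<open>For \<open>r\<close> strictly between \<open>\<rho>\<close> and 1, each term of the
  binomial expansion of ((1 - r) + r)^n is at most 1. This bounds the coefficient by a multiple of
  r^-(n-d), and \<rho>/r decays geometrically.\<close>

lemma binomial_geometric_tendsto_0:
  fixes \<rho> :: real
  assumes "0 \<le> \<rho>" "\<rho> < 1"
  shows "(\<lambda>n. real (n choose d) * \<rho> ^ (n - d)) \<longlonglongrightarrow> 0"
proof -
  define r where "r = (1 + \<rho>) / 2"
  have r: "0 < r" "r < 1" "\<rho> < r" using assms by (auto simp: r_def)
  define c where "c = inverse ((1 - r) ^ d)"
  have bound: "real (n choose d) * \<rho> ^ (n - d) \<le> c * (\<rho> / r) ^ (n - d)" if n: "n \<ge> d" for n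
  proof -
    have "real (n choose d) * r ^ (n - d) * (1 - r) ^ d \<le> (\<Sum>k\<le>n. real (n choose k) * (1 - r) ^ k * r ^ (n - k))"
      using r n member_le_sum[of d "{..n}" "\<lambda>k. real (n choose k) * (1 - r) ^ k * r ^ (n - k)"] by (simp add: mult_ac)
    also have "\<dots> = ((1 - r) + r) ^ n" by (rule binomial_ring[symmetric])
    finally have "real (n choose d) * r ^ (n - d) * (1 - r) ^ d \<le> 1" by simp
    then have 1: "real (n choose d) * r ^ (n - d) \<le> c" using r by (simp add: c_def field_simps)
    have "real (n choose d) * \<rho> ^ (n - d) = real (n choose d) * r ^ (n - d) * (\<rho> / r) ^ (n - d)"
      using r by (simp add: power_divide)
    also have "\<dots> \<le> c * (\<rho> / r) ^ (n - d)"
      using 1 assms r by (intro mult_right_mono) auto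
    finally show ?thesis .
  qed
  have "(\<lambda>n. (\<rho> / r) ^ n) \<longlonglongrightarrow> 0" using assms r by (intro LIMSEQ_realpow_zero) auto
  then have "(\<lambda>n. (\<rho> / r) ^ (n - d)) \<longlonglongrightarrow> 0"
    by (intro LIMSEQ_offset[where k = d and f = "\<lambda>n. (\<rho> / r) ^ (n - d)"]) simp
  then have lim: "(\<lambda>n. c * (\<rho> / r) ^ (n - d)) \<longlonglongrightarrow> 0" by (rule tendsto_mult_right_zero)
  show ?thesis
  proof (rule tendsto_sandwich[OF _ _ tendsto_const lim])
    show "eventually (\<lambda>n. 0 \<le> real (n choose d) * \<rho> ^ (n - d)) sequentially" using assms by simp
    show "eventually (\<lambda>n. real (n choose d) * \<rho> ^ (n - d) \<le> c * (\<rho> / r) ^ (n - d)) sequentially"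
      using eventually_ge_at_top[of d] by eventually_elim (rule bound)
  qed
qed

lemma sphere_weight_eq_integral:
  assumes f: "continuous_on {0..pi} f" "\<And>t. t \<in> {0..pi} \<Longrightarrow> 0 \<le> f t"
  shows "sphere_weight p (\<lambda>t. ennreal (f t)) = ennreal (integral {0..pi} (\<lambda>t. f t * sin t ^ p))"
proof -
  have "continuous_on {0..pi} (\<lambda>t. f t * sin t ^ p)" by (intro continuous_intros f)
  then have si: "set_integrable lborel {0..pi} (\<lambda>t. f t * sin t ^ p)" by (rule borel_integrable_atLeastAtMost')
  have "sphere_weight p (\<lambda>t. ennreal (f t)) = (\<integral>\<^sup>+t. ennreal (indicator {0..pi} t *\<^sub>R (f t * sin t ^ p)) \<partial>lborel)"
    unfolding sphere_weight_def
    by (intro nn_integral_cong) (auto simp: indicator_def ennreal_mult f(2) sin_ge_zero)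
  also have "\<dots> = ennreal (LINT t:{0..pi}|lborel. f t * sin t ^ p)"
    using si unfolding set_integrable_def set_lebesgue_integral_def
    by (intro nn_integral_eq_integral) (auto simp: indicator_def f(2) sin_ge_zero)
  also have "(LINT t:{0..pi}|lborel. f t * sin t ^ p) = integral {0..pi} (\<lambda>t. f t * sin t ^ p)"
    using si by (rule set_borel_integral_eq_integral(2))
  finally show ?thesis .
qed

definition facet_int :: "nat \<Rightarrow> nat \<Rightarrow> real" where
  "facet_int p m = integral {0..pi} (\<lambda>x. (1 - x / pi) ^ m * sin x ^ p)"

lemma sphere_weight_power:
  "sphere_weight p (\<lambda>t. ennreal ((1 - t / pi) ^ m)) = ennreal (facet_int p m)"
  unfolding facet_int_def by (rule sphere_weight_eq_integral) (auto intro!: continuous_intros)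

lemma facet_int_nonneg: "0 \<le> facet_int p m"
  unfolding facet_int_def
proof (rule integral_nonneg)
  show "(\<lambda>x. (1 - x / pi) ^ m * sin x ^ p) integrable_on {0..pi}"
    by (intro integrable_continuous_real continuous_intros) auto
  fix x :: real assume x: "x \<in> {0..pi}"
  then have "0 \<le> 1 - x / pi" "0 \<le> sin x" by (auto simp: sin_ge_zero)
  then show "0 \<le> (1 - x / pi) ^ m * sin x ^ p" by simp
qed

lemma facet_int_le: "facet_int p m \<le> facet_int p 0"
  unfolding facet_int_def
proof (intro integral_le integrable_continuous_real continuous_intros)
  fix x :: real assume x: "x \<in> {0..pi}"
  have "(1 - x / pi) ^ m \<le> (1 - x / pi) ^ 0" using x by (intro power_decreasing) auto
  then show "(1 - x / pi) ^ m * sin x ^ p \<le> (1 - x / pi) ^ 0 * sin x ^ p"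
    using x by (intro mult_right_mono) (auto simp: sin_ge_zero)
qed auto

text \<open>The reflection t to pi - t exchanges the two terms of \<open>side_prob\<close> and
  preserves the sine, so the two sides of the hyperplane merge into a factor 2.\<close>

lemma sphere_weight_side_prob:
  "sphere_weight p (\<lambda>t. ennreal (side_prob m t)) = ennreal (2 * facet_int p m)"
proof -
  have "sphere_weight p (\<lambda>t. ennreal ((t / pi) ^ m))
     = (\<integral>\<^sup>+t. ennreal (((pi - t) / pi) ^ m) * ennreal (sin (pi - t) ^ p) * indicator {0..pi} (pi - t) \<partial>lborel)"
    unfolding sphere_weight_def by (subst nn_integral_real_affine[where t=pi and c="-1"]) auto
  also have "\<dots> = sphere_weight p (\<lambda>t. ennreal ((1 - t / pi) ^ m))"
    unfolding sphere_weight_def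
    by (intro nn_integral_cong) (auto simp: indicator_def diff_divide_distrib)
  finally have sym: "sphere_weight p (\<lambda>t. ennreal ((t / pi) ^ m)) = ennreal (facet_int p m)"
    by (simp add: sphere_weight_power)
  have "sphere_weight p (\<lambda>t. ennreal (side_prob m t))
    = (\<integral>\<^sup>+t. ennreal ((1 - t / pi) ^ m) * ennreal (sin t ^ p) * indicator {0..pi} t
        + ennreal ((t / pi) ^ m) * ennreal (sin t ^ p) * indicator {0..pi} t \<partial>lborel)"
    unfolding sphere_weight_def
    by (intro nn_integral_cong) (auto simp: indicator_def side_prob_def ennreal_plus distrib_right)
  also have "\<dots> = sphere_weight p (\<lambda>t. ennreal ((1 - t / pi) ^ m)) + sphere_weight p (\<lambda>t. ennreal ((t / pi) ^ m))"
    unfolding sphere_weight_def by (rule nn_integral_add) auto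
  also have "\<dots> = ennreal (2 * facet_int p m)"
    unfolding sym sphere_weight_power mult_2
    by (rule ennreal_plus[symmetric, OF facet_int_nonneg facet_int_nonneg])
  finally show ?thesis .
qed

lemma facet_coefficient_tendsto:
  assumes "d \<ge> 1"
  shows "(\<lambda>n. real d / pi ^ d * real (n choose d) * facet_int (d - 1) (n - d)) \<longlonglongrightarrow> 1"
proof -
  define A where "A = (\<lambda>n. real d / pi ^ d * real (n choose d) * facet_int (d - 1) (n - d))"
  define K where "K = real ((d + 1) choose 3) * pi\<^sup>2"
  have "(\<lambda>n. A n - (1 - K / real n ^ 2)) \<in> O(\<lambda>n. 1 / real n ^ 3)"
    using facet_integral_expansion[OF assms] by (simp add: A_def K_def facet_int_def)
  also have "(\<lambda>n. 1 / real n ^ 3) \<in> o(\<lambda>n. 1 :: real)" by real_asymp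
  finally have "(\<lambda>n. A n - (1 - K / real n ^ 2)) \<longlonglongrightarrow> 0" using smalloD_tendsto by fastforce
  moreover have "(\<lambda>n. K / real n ^ 2) \<longlonglongrightarrow> 0" by real_asymp
  ultimately have "(\<lambda>n. (A n - (1 - K / real n ^ 2)) + (1 - K / real n ^ 2)) \<longlonglongrightarrow> 0 + (1 - 0)"
    by (intro tendsto_add tendsto_diff tendsto_const)
  then show ?thesis by (simp add: A_def)
qed

lemma prism_mean_le_1: "prism_mean J TYPE('a::euclidean_space) \<le> 1"
proof -
  interpret M: prob_space "ball_product J :: (nat \<Rightarrow> 'a) measure" by (rule prob_space_ball_product)
  have "prism_mean J TYPE('a) \<le> (\<integral>\<^sup>+x. \<integral>\<^sup>+e. 1 \<partial>(ball_measure :: 'a measure) \<partial>(ball_product J :: (nat \<Rightarrow> 'a) measure))"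
    unfolding prism_mean_def by (intro nn_integral_mono ball_PiM.M.emeasure_le_1)
  also have "\<dots> = 1" using ball_PiM.M.emeasure_space_1[where 'a='a] by (simp add: M.emeasure_space_1)
  finally show ?thesis .
qed

text \<open>The comparison is applied twice with prism and shadow in exchanged roles; both weights
  are probabilities and depend only on the points of \<open>J\<close>.\<close>

lemma facet_integral_compare:
  fixes e :: "'a::euclidean_space"
  assumes fin: "finite J" "finite K" and ne: "K \<noteq> {}" "J \<inter> K = {}"
    and D: "DIM('a) \<ge> 2" and card: "card J = DIM('a) - 1" and e: "norm e = 1" and eta: "0 < \<eta>" "\<eta> < 1"
  defines "q \<equiv> ((1 + \<eta>) / (1 - \<eta>)) ^ DIM('a)"
  shows "facet_integral e (J \<union> K) J \<le> ennreal q * (\<integral>\<^sup>+z. shadow_weight e (J \<union> K) J (flips e z) \<partial>ball_product (J \<union> K)) + ennreal (2 * tilt_bound \<eta> ^ card K)"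
    "(\<integral>\<^sup>+z. shadow_weight e (J \<union> K) J (flips e z) \<partial>ball_product (J \<union> K)) \<le> ennreal q * facet_integral e (J \<union> K) J + ennreal (2 * tilt_bound \<eta> ^ card K)"
proof -
  have q: "0 \<le> q" using eta by (simp add: q_def)
  have mp: "(\<lambda>y. emeasure ball_measure (prism J y)) \<in> borel_measurable (borel :: (nat \<Rightarrow> 'a) measure)"
    by (rule borel_measurable_emeasure_prism[OF fin(1)])
  have ms: "(\<lambda>y. emeasure ball_measure (shadow e J y)) \<in> borel_measurable (borel :: (nat \<Rightarrow> 'a) measure)"
    using borel_measurable_section(2)[OF borel_shadow[OF fin(1)]] by simp
  have lp: "emeasure ball_measure (prism J y) = emeasure ball_measure (prism J y')" if "\<And>j. j \<in> J \<Longrightarrow> y j = y' j" for y y' :: "nat \<Rightarrow> 'a"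
    using prism_cong[of J y y'] that by simp
  have ls: "emeasure ball_measure (shadow e J y) = emeasure ball_measure (shadow e J y')" if "\<And>j. j \<in> J \<Longrightarrow> y j = y' j" for y y' :: "nat \<Rightarrow> 'a"
    using that by (simp add: shadow_def cong: sum.cong)
  show "facet_integral e (J \<union> K) J \<le> ennreal q * (\<integral>\<^sup>+z. shadow_weight e (J \<union> K) J (flips e z) \<partial>ball_product (J \<union> K)) + ennreal (2 * tilt_bound \<eta> ^ card K)"
    unfolding facet_integral_def facet_weight_def shadow_weight_def
    by (rule facet_weight_compare[OF fin ne D card e eta q mp ms lp ls ball_PiM.M.emeasure_le_1])
       (auto simp: q_def intro!: prism_shadow_compare(1)[OF fin(1)] eta(2))
  show "(\<integral>\<^sup>+z. shadow_weight e (J \<union> K) J (flips e z) \<partial>ball_product (J \<union> K)) \<le> ennreal q * facet_integral e (J \<union> K) J + ennreal (2 * tilt_bound \<eta> ^ card K)"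
    unfolding facet_integral_def facet_weight_def shadow_weight_def
    by (rule facet_weight_compare[OF fin ne D card e eta q ms mp ls lp ball_PiM.M.emeasure_le_1])
       (auto simp: q_def intro!: prism_shadow_compare(2)[OF fin(1)] eta(2))
qed

lemma binomial_miss_sum_tendsto_0:
  fixes e :: "'a::euclidean_space"
  assumes e: "norm e = 1"
  shows "(\<lambda>n. real (n choose d) * miss_sum e n) \<longlonglongrightarrow> 0"
proof -
  have "(\<lambda>n. real (n choose d) * (1 - cap_prob e v) ^ n) \<longlonglongrightarrow> 0" if v: "v \<in> axes" for v
  proof (rule tendsto_sandwich[OF _ _ tendsto_const binomial_geometric_tendsto_0[of "1 - cap_prob e v" d]])
    note b = cap_prob_bounds[OF e v]
    show "0 \<le> 1 - cap_prob e v" "1 - cap_prob e v < 1" using b by auto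
    show "eventually (\<lambda>n. 0 \<le> real (n choose d) * (1 - cap_prob e v) ^ n) sequentially" using b by simp
    show "eventually (\<lambda>n. real (n choose d) * (1 - cap_prob e v) ^ n \<le> real (n choose d) * (1 - cap_prob e v) ^ (n - d)) sequentially"
      using b by (intro always_eventually allI mult_left_mono power_decreasing) auto
  qed
  then have "(\<lambda>n. \<Sum>v\<in>axes. real (n choose d) * (1 - cap_prob e v) ^ n) \<longlonglongrightarrow> (\<Sum>v\<in>(axes :: 'a set). 0)"
    by (intro tendsto_sum)
  then show ?thesis by (simp add: miss_sum_def sum_distrib_left)
qed

lemma miss_sum_tendsto_0:
  fixes e :: "'a::euclidean_space"
  assumes e: "norm e = 1"
  shows "miss_sum e \<longlonglongrightarrow> 0"
  using binomial_miss_sum_tendsto_0[OF e, of 0] by simp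

lemma miss_sum_nonneg:
  fixes e :: "'a::euclidean_space"
  assumes "norm e = 1" shows "0 \<le> miss_sum e n"
  unfolding miss_sum_def
proof (rule sum_nonneg)
  fix v :: 'a assume "v \<in> axes"
  with assms show "0 \<le> (1 - cap_prob e v) ^ n" using cap_prob_bounds(2)[of e v] by simp
qed

text \<open>The common constant is determined by letting \<open>n \<rightarrow> \<infinity>\<close>: the shadows of the facets tile the space
  as soon as the cone contains \<open>e\<close> in its interior, and facets that are not nearly
  orthogonal to \<open>e\<close> are exponentially unlikely.\<close>

lemma facet_integral_value:
  fixes e :: "'a::euclidean_space"
  assumes D: "DIM('a) = d + 1" "d \<ge> 1" and e: "norm e = 1"
    and n: "n \<ge> d + 1" and J: "J \<subseteq> {1..n}" "card J = d"
  shows "facet_integral e {1..n} J = ennreal (real d / pi ^ d * facet_int (d - 1) (n - d))"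
proof -
  have D2: "DIM('a) \<ge> 2" and Dd: "DIM('a) - 1 = d" "DIM('a) - 2 = d - 1" using D by auto
  have e0: "e \<noteq> 0" using e by auto
  \<comment> \<open>One number for all facets and all n: \<open>prism_mean\<close> depends on
    \<open>J\<close> only through its cardinality, and is finite as an average of
    probabilities.\<close>
  define \<kappa> where "\<kappa> = enn2real (prism_mean {1..d} TYPE('a))"
  have kap: "prism_mean J TYPE('a) = ennreal \<kappa>" if "finite J" "card J = d" for J
  proof -
    have "prism_mean J TYPE('a) = prism_mean {1..d} TYPE('a)"
      by (rule prism_mean_card) (use that in auto)
    moreover have "prism_mean {1..d} TYPE('a) < \<infinity>" using prism_mean_le_1[of "{1..d}", where 'a='a] le_less_trans by fastforce
    ultimately show ?thesis by (simp add: \<kappa>_def)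
  qed
  have kap0: "0 \<le> \<kappa>" by (simp add: \<kappa>_def)
  define c where "c = (\<lambda>n. real d / pi ^ d * real (n choose d) * facet_int (d - 1) (n - d))"
  have clim: "c \<longlonglongrightarrow> 1" unfolding c_def by (rule facet_coefficient_tendsto[OF D(2)])
  define w where "w = facet_int (d - 1) 0"
  \<comment> \<open>If \<open>w\<close> vanished, so would every \<open>facet_int\<close>, which it
    dominates, and \<open>c\<close> would be identically 0 instead of tending to 1.\<close>
  have w: "w > 0"
  proof (rule ccontr)
    assume "\<not> w > 0"
    then have "facet_int (d - 1) (n - d) = 0" for n
      using facet_int_le[of "d - 1" "n - d"] facet_int_nonneg[of "d - 1" "n - d"] by (simp add: w_def)
    then have "c = (\<lambda>_. 0)" by (simp add: c_def)
    then show False using clim LIMSEQ_unique[of "\<lambda>_::nat. 0::real" 0 1] by simp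
  qed
  have w1: "sphere_weight (d - 1) (\<lambda>_. 1) = ennreal w"
    using sphere_weight_power[of "d - 1" 0] by (simp add: w_def)
  \<comment> \<open>The 2 comes from \<open>side_prob\<close>, the division by \<open>w\<close>
    undoes the crosswise multiplication.\<close>
  define \<alpha> where "\<alpha> = 2 * \<kappa> / w"
  have al0: "0 \<le> \<alpha>" using kap0 w by (simp add: \<alpha>_def)
  have val: "facet_integral e {1..n} J = ennreal (\<alpha> * facet_int (d - 1) (n - d))"
    if n: "n \<ge> d + 1" and J: "J \<subseteq> {1..n}" "card J = d" for n J
  proof -
    define K where "K = {1..n} - J"
    have fin: "finite J" "finite K" using J finite_subset by (auto simp: K_def)
    have cK: "card K = n - d" using J fin by (simp add: K_def card_Diff_subset)
    then have K: "K \<noteq> {}" "J \<inter> K = {}" "{1..n} = J \<union> K" using J n by (auto simp: K_def)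
    have "facet_integral e (J \<union> K) J * ennreal w = ennreal \<kappa> * ennreal (2 * facet_int (d - 1) (n - d))"
    proof -
      have "card J = DIM('a) - 1" using J(2) Dd by simp
      from facet_integral_formula[OF fin K(1,2) D2 this e0] show ?thesis
        unfolding Dd w1 sphere_weight_side_prob cK kap[OF fin(1) J(2)] .
    qed
    then have "facet_integral e (J \<union> K) J * ennreal w / ennreal w = ennreal (\<kappa> * (2 * facet_int (d - 1) (n - d))) / ennreal w"
      using kap0 facet_int_nonneg by (simp add: ennreal_mult)
    moreover have "facet_integral e (J \<union> K) J * ennreal w / ennreal w = facet_integral e (J \<union> K) J"
      using w by (simp add: ennreal_mult_divide_eq)
    ultimately have "facet_integral e (J \<union> K) J = ennreal (\<kappa> * (2 * facet_int (d - 1) (n - d)) / w)"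
      using w kap0 facet_int_nonneg by (simp add: divide_ennreal)
    then show ?thesis unfolding K(3) by (simp add: \<alpha>_def mult_ac)
  qed
  \<comment> \<open>Normalized so that the facet integrals sum to \<open>A * c n\<close>, where
    \<open>c\<close> tends to 1. The claim amounts to A = 1.\<close>
  define A where "A = \<alpha> * (pi ^ d / real d)"
  have Ac: "real (n choose d) * (\<alpha> * facet_int (d - 1) (n - d)) = A * c n" for n
    using D(2) by (simp add: A_def c_def)
  \<comment> \<open>Summing the comparison over all d-subsets multiplies the tilt error by
    binom(n,d), and \<open>shadow_integral_bounds\<close> replaces the total shadow mass by
    1.\<close>
  have ineq: "A * c n \<le> q * (1 + real (n choose d) * miss_sum e n) + 2 * (real (n choose d) * tilt_bound \<eta> ^ (n - d))
      \<and> 1 \<le> q * (A * c n) + 2 * (real (n choose d) * tilt_bound \<eta> ^ (n - d)) + miss_sum e n"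
    if n: "n \<ge> d + 1" and eta: "0 < \<eta>" "\<eta> < 1" and qd: "q = ((1 + \<eta>) / (1 - \<eta>)) ^ DIM('a)" for n \<eta> q
  proof -
    let ?Js = "{J. J \<subseteq> {1..n} \<and> card J = d}"
    let ?s = "\<lambda>J. \<integral>\<^sup>+z. shadow_weight e {1..n} J (flips e z) \<partial>(ball_product {1..n} :: (nat \<Rightarrow> 'a) measure)"
    define C where "C = real (n choose d)"
    define \<tau> where "\<tau> = tilt_bound \<eta> ^ (n - d)"
    have tau: "0 \<le> \<tau>" using tilt_bound_range(1)[OF eta] by (simp add: \<tau>_def)
    have q0: "0 \<le> q" using eta by (simp add: qd)
    have C0: "0 \<le> C" by (simp add: C_def)
    have P0: "0 \<le> miss_sum e n" by (rule miss_sum_nonneg[OF e])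
    have cJs: "real (card ?Js) = C" using n_subsets[of "{1..n}" d] by (simp add: C_def)
    have comp: "facet_integral e {1..n} J \<le> ennreal q * ?s J + ennreal (2 * \<tau>)" "?s J \<le> ennreal q * facet_integral e {1..n} J + ennreal (2 * \<tau>)"
      if "J \<in> ?Js" for J
    proof -
      define K where "K = {1..n} - J"
      have J: "J \<subseteq> {1..n}" "card J = d" using that by auto
      have fin: "finite J" "finite K" using J finite_subset by (auto simp: K_def)
      have cK: "card K = n - d" using J fin by (simp add: K_def card_Diff_subset)
      then have K: "K \<noteq> {}" "J \<inter> K = {}" "{1..n} = J \<union> K" using J n by (auto simp: K_def)
      have cJ: "card J = DIM('a) - 1" using J Dd by simp
      note cmp = facet_integral_compare[OF fin K(1,2) D2 cJ e eta, folded qd K(3), unfolded cK, folded \<tau>_def]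
      show "facet_integral e {1..n} J \<le> ennreal q * ?s J + ennreal (2 * \<tau>)" by (rule cmp(1))
      show "?s J \<le> ennreal q * facet_integral e {1..n} J + ennreal (2 * \<tau>)" by (rule cmp(2))
    qed
    have sumF: "(\<Sum>J\<in>?Js. facet_integral e {1..n} J) = ennreal (A * c n)"
    proof -
      have "(\<Sum>J\<in>?Js. facet_integral e {1..n} J) = (\<Sum>J\<in>?Js. ennreal (\<alpha> * facet_int (d - 1) (n - d)))"
        using n by (intro sum.cong refl val) auto
      also have "\<dots> = ennreal (real (card ?Js) * (\<alpha> * facet_int (d - 1) (n - d)))"
        by (subst sum_ennreal) (use al0 facet_int_nonneg in auto)
      finally show ?thesis unfolding cJs C_def Ac .
    qed
    have sums: "(\<Sum>J\<in>?Js. ennreal (2 * \<tau>)) = ennreal (C * (2 * \<tau>))"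
      using tau cJs by (subst sum_ennreal) auto
    define s where "s = (\<Sum>J\<in>?Js. ?s J)"
    have sb: "s \<le> 1 + ennreal (C * miss_sum e n)" "1 \<le> s + ennreal (miss_sum e n)"
      using shadow_integral_bounds[of "{1..n}", OF _ _ D2 e] n D(1) unfolding Dd by (simp_all add: s_def C_def)
    have "ennreal (A * c n) \<le> (\<Sum>J\<in>?Js. ennreal q * ?s J + ennreal (2 * \<tau>))"
      unfolding sumF[symmetric] by (rule sum_mono) (rule comp(1))
    also have "\<dots> = ennreal q * s + ennreal (C * (2 * \<tau>))"
      unfolding sum.distrib sums s_def by (simp add: sum_distrib_left)
    also have "\<dots> \<le> ennreal q * (1 + ennreal (C * miss_sum e n)) + ennreal (C * (2 * \<tau>))"
      by (intro add_right_mono mult_left_mono sb) simp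
    also have "\<dots> = ennreal (q * (1 + C * miss_sum e n) + C * (2 * \<tau>))"
      using q0 C0 P0 tau by (simp add: ennreal_plus ennreal_mult flip: ennreal_1)
    finally have 1: "A * c n \<le> q * (1 + C * miss_sum e n) + C * (2 * \<tau>)"
      using q0 C0 P0 tau by (subst (asm) ennreal_le_iff) auto
    have "1 \<le> s + ennreal (miss_sum e n)" by (rule sb(2))
    also have "s \<le> (\<Sum>J\<in>?Js. ennreal q * facet_integral e {1..n} J + ennreal (2 * \<tau>))"
      unfolding s_def by (rule sum_mono) (rule comp(2))
    also have "\<dots> = ennreal q * ennreal (A * c n) + ennreal (C * (2 * \<tau>))"
      unfolding sum.distrib sums sumF[symmetric] by (simp add: sum_distrib_left)
    finally have "ennreal 1 \<le> ennreal q * ennreal (A * c n) + ennreal (C * (2 * \<tau>)) + ennreal (miss_sum e n)" by simp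
    also have "\<dots> = ennreal (q * (A * c n) + C * (2 * \<tau>) + miss_sum e n)"
    proof -
      have "0 \<le> A * c n" using al0 facet_int_nonneg by (simp add: Ac[symmetric])
      then show ?thesis using q0 C0 P0 tau by (simp add: ennreal_plus ennreal_mult)
    qed
    finally have 2: "1 \<le> q * (A * c n) + C * (2 * \<tau>) + miss_sum e n"
      by (subst (asm) ennreal_le_iff2) auto
    show ?thesis using 1 2 by (simp add: C_def \<tau>_def mult_ac)
  qed
  \<comment> \<open>With \<open>\<eta>\<close> fixed, all errors are at most binomial coefficients
    against geometric decay, so they vanish as n grows.\<close>
  have lims: "A \<le> q \<and> 1 \<le> q * A" if eta: "0 < \<eta>" "\<eta> < 1" and qd: "q = ((1 + \<eta>) / (1 - \<eta>)) ^ DIM('a)" for \<eta> q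
  proof -
    note tl = binomial_geometric_tendsto_0[OF tilt_bound_range[OF eta], of d]
    note ml = binomial_miss_sum_tendsto_0[OF e, of d]
    have ev: "eventually (\<lambda>n. A * c n \<le> q * (1 + real (n choose d) * miss_sum e n) + 2 * (real (n choose d) * tilt_bound \<eta> ^ (n - d))) sequentially"
      "eventually (\<lambda>n. 1 \<le> q * (A * c n) + 2 * (real (n choose d) * tilt_bound \<eta> ^ (n - d)) + miss_sum e n) sequentially"
      using eventually_ge_at_top[of "d + 1"] by (eventually_elim, use ineq[OF _ eta qd] in blast)+
    have "A * 1 \<le> q * (1 + 0) + 2 * 0"
      by (rule tendsto_le[OF _ _ _ ev(1)], simp) (intro tendsto_intros clim tl ml)+
    moreover have "1 \<le> q * (A * 1) + 2 * 0 + 0"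
      by (rule tendsto_le[OF _ _ tendsto_const ev(2)], simp) (intro tendsto_intros clim tl miss_sum_tendsto_0[OF e])
    ultimately show ?thesis by simp
  qed
  \<comment> \<open>Now the tolerance \<open>\<eta>\<close> tends to 0 from the right, and the
    distortion factor tends to 1.\<close>
  have "A = 1"
  proof -
    define Q where "Q = (\<lambda>\<eta>::real. ((1 + \<eta>) / (1 - \<eta>)) ^ DIM('a))"
    have "(Q \<longlongrightarrow> ((1 + 0) / (1 - 0)) ^ DIM('a)) (at_right 0)"
      unfolding Q_def by (intro tendsto_intros) auto
    then have Q: "(Q \<longlongrightarrow> 1) (at_right 0)" by simp
    have ev: "eventually (\<lambda>\<eta>::real. \<eta> \<in> {0<..<1}) (at_right 0)"
      by (rule eventually_at_right_real) simp
    have "A \<le> 1"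
      by (rule tendsto_le[OF _ Q tendsto_const]) (auto intro: eventually_mono[OF ev] simp: lims[OF _ _ Q_def[THEN fun_cong]])
    moreover have "1 \<le> 1 * A"
      by (rule tendsto_le[OF _ tendsto_mult[OF Q tendsto_const] tendsto_const]) (auto intro: eventually_mono[OF ev] simp: lims[OF _ _ Q_def[THEN fun_cong]])
    ultimately show ?thesis by simp
  qed
  then have "\<alpha> = real d / pi ^ d" using D(2) by (simp add: A_def field_simps)
  then show ?thesis using val[OF n J] by simp
qed

lemma pos_scale:
  fixes y :: "'i \<Rightarrow> 'a::euclidean_space"
  assumes "\<And>i. i \<in> I \<Longrightarrow> 0 < r i"
  shows "pos ((\<lambda>i. r i *\<^sub>R y i) ` I) = pos (y ` I)"
proof
  show "pos ((\<lambda>i. r i *\<^sub>R y i) ` I) \<subseteq> pos (y ` I)"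
    unfolding pos_eq_convex_cone_hull[of "(\<lambda>i. r i *\<^sub>R y i) ` I"]
  proof (rule hull_minimal)
    show "(\<lambda>i. r i *\<^sub>R y i) ` I \<subseteq> pos (y ` I)"
    proof
      fix x assume "x \<in> (\<lambda>i. r i *\<^sub>R y i) ` I"
      then obtain i where i: "i \<in> I" "x = r i *\<^sub>R y i" by blast
      show "x \<in> pos (y ` I)" unfolding i(2)
        using less_imp_le[OF assms[OF i(1)]] i(1) by (intro pos_cone pos_inc imageI)
    qed
    show "convex_cone (pos (y ` I))" unfolding pos_eq_convex_cone_hull by (rule convex_cone_convex_cone_hull)
  qed
  show "pos (y ` I) \<subseteq> pos ((\<lambda>i. r i *\<^sub>R y i) ` I)"
    unfolding pos_eq_convex_cone_hull[of "y ` I"]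
  proof (rule hull_minimal)
    show "y ` I \<subseteq> pos ((\<lambda>i. r i *\<^sub>R y i) ` I)"
    proof
      fix x assume "x \<in> y ` I"
      then obtain i where i: "i \<in> I" "x = y i" by blast
      have "inverse (r i) *\<^sub>R (r i *\<^sub>R y i) \<in> pos ((\<lambda>i. r i *\<^sub>R y i) ` I)"
        using i(1) less_imp_le[OF assms[OF i(1)]] by (intro pos_cone pos_inc[OF imageI]) simp_all
      then show "x \<in> pos ((\<lambda>i. r i *\<^sub>R y i) ` I)" using i assms[OF i(1)] by simp
    qed
    show "convex_cone (pos ((\<lambda>i. r i *\<^sub>R y i) ` I))" unfolding pos_eq_convex_cone_hull by (rule convex_cone_convex_cone_hull)
  qed
qed

text \<open>Only directions matter for the hull, so ball points may stand in for their
  normalizations. Since sgn 0 = 0, a zero vector is given the scale 1, which keeps all scales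
  positive.\<close>

lemma conv_s_sgn:
  fixes y :: "'i \<Rightarrow> 'a::euclidean_space"
  shows "conv_s ((\<lambda>i. sgn (y i)) ` I) = conv_s (y ` I)"
proof -
  have "(\<lambda>i. sgn (y i)) ` I = (\<lambda>i. (if y i = 0 then 1 else inverse (norm (y i))) *\<^sub>R y i) ` I"
    by (intro image_cong) (auto simp: sgn_div_norm)
  moreover have "pos ((\<lambda>i. (if y i = 0 then 1 else inverse (norm (y i))) *\<^sub>R y i) ` I) = pos (y ` I)"
    by (rule pos_scale) simp
  ultimately show ?thesis unfolding conv_s_def by (simp only:)
qed

section \<open>The expected surface area\<close>

lemma surface_area_nonneg: "0 \<le> surface_area P"
  unfolding surface_area_def by (intro sum_nonneg) simp

text \<open>Almost surely the points are in general position, and the area is a sum over d-subsets.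
  By linearity the expectation is \<open>omega d\<close> times binom(n,d) equal facet
  integrals.\<close>

lemma nn_integral_surface_area:
  fixes e :: "'a::euclidean_space"
  assumes D: "DIM('a) = d + 1" "d \<ge> 1" and e: "norm e = 1" and n: "n \<ge> d + 1"
  shows "(\<integral>\<^sup>+z. ennreal (surface_area (conv_s (flips e z ` {1..n}))) \<partial>ball_product {1..n})
    = ennreal (omega d * (real d / pi ^ d * real (n choose d) * facet_int (d - 1) (n - d)))"
proof -
  let ?Js = "{J. J \<subseteq> {1..n} \<and> card J = d}"
  let ?M = "ball_product {1..n} :: (nat \<Rightarrow> 'a) measure"
  have D2: "DIM('a) \<ge> 2" and Dd: "DIM('a) - 1 = d" using D by auto
  have e0: "e \<noteq> 0" using e by auto
  have om: "0 \<le> omega d" using omega_pos[of d] D(2) by simp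
  have fJ: "finite J" if "J \<in> ?Js" for J using that finite_subset by blast
  have "(\<integral>\<^sup>+z. ennreal (surface_area (conv_s (flips e z ` {1..n}))) \<partial>?M)
    = (\<integral>\<^sup>+z. ennreal (omega d) * (\<Sum>J\<in>?Js. facet_weight {1..n} J (flips e z)) \<partial>?M)"
  proof (rule nn_integral_cong_AE)
    show "AE z in ?M. ennreal (surface_area (conv_s (flips e z ` {1..n}))) = ennreal (omega d) * (\<Sum>J\<in>?Js. facet_weight {1..n} J (flips e z))"
      using AE_general_position[OF finite_atLeastAtMost, of 1 n] AE_inner_nonzero[OF finite_atLeastAtMost e0, of 1 n]
    proof (eventually_elim)
      fix z :: "nat \<Rightarrow> 'a" assume z: "general_position {1..n} z" "\<forall>i\<in>{1..n}. z i \<bullet> e \<noteq> 0"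
      have fw: "facet_weight {1..n} J (flips e z)
          = ennreal (indicator {y. face_index {1..n} y J} (flips e z) * measure ball_measure (prism J (flips e z)))" for J
        by (simp add: facet_weight_def ball_PiM.M.emeasure_eq_measure indicator_def)
      have "ennreal (surface_area (conv_s (flips e z ` {1..n}))) = ennreal (omega d *
        (\<Sum>J\<in>?Js. indicator {y. face_index {1..n} y J} (flips e z) * measure ball_measure (prism J (flips e z))))"
        using surface_area_general_position[OF _ D2 z] unfolding Dd by simp
      also have "\<dots> = ennreal (omega d) * ennreal (\<Sum>J\<in>?Js. indicator {y. face_index {1..n} y J} (flips e z) * measure ball_measure (prism J (flips e z)))"
        using om by (intro ennreal_mult sum_nonneg) auto
      also have "ennreal (\<Sum>J\<in>?Js. indicator {y. face_index {1..n} y J} (flips e z) * measure ball_measure (prism J (flips e z)))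
        = (\<Sum>J\<in>?Js. facet_weight {1..n} J (flips e z))"
        unfolding fw by (rule sum_ennreal[symmetric]) simp
      finally show "ennreal (surface_area (conv_s (flips e z ` {1..n}))) = ennreal (omega d) * (\<Sum>J\<in>?Js. facet_weight {1..n} J (flips e z))" .
    qed
  qed
  also have "\<dots> = ennreal (omega d) * (\<Sum>J\<in>?Js. facet_integral e {1..n} J)"
  proof -
    have m: "(\<lambda>z. facet_weight {1..n} J (flips e z)) \<in> borel_measurable ?M" if "J \<in> ?Js" for J
      using that by (intro measurable_weight_flips borel_measurable_facet_weight fJ)
    have "(\<integral>\<^sup>+z. ennreal (omega d) * (\<Sum>J\<in>?Js. facet_weight {1..n} J (flips e z)) \<partial>?M)
      = ennreal (omega d) * (\<integral>\<^sup>+z. (\<Sum>J\<in>?Js. facet_weight {1..n} J (flips e z)) \<partial>?M)"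
      by (rule nn_integral_cmult) (rule borel_measurable_sum[OF m])
    also have "(\<integral>\<^sup>+z. (\<Sum>J\<in>?Js. facet_weight {1..n} J (flips e z)) \<partial>?M) = (\<Sum>J\<in>?Js. facet_integral e {1..n} J)"
      unfolding facet_integral_def by (rule nn_integral_sum[OF m])
    finally show ?thesis .
  qed
  also have "(\<Sum>J\<in>?Js. facet_integral e {1..n} J) = (\<Sum>J\<in>?Js. ennreal (real d / pi ^ d * facet_int (d - 1) (n - d)))"
    using n by (intro sum.cong refl facet_integral_value[OF D e]) auto
  also have "\<dots> = ennreal (real (card ?Js) * (real d / pi ^ d * facet_int (d - 1) (n - d)))"
    by (subst sum_ennreal) (use facet_int_nonneg in auto)
  also have "card ?Js = n choose d" using n_subsets[of "{1..n}" d] by simp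
  also have "ennreal (omega d) * ennreal (real (n choose d) * (real d / pi ^ d * facet_int (d - 1) (n - d)))
    = ennreal (omega d * (real d / pi ^ d * real (n choose d) * facet_int (d - 1) (n - d)))"
    using om facet_int_nonneg by (simp add: ennreal_mult[symmetric] mult_ac)
  finally show ?thesis .
qed

text \<open>Independence and the common law make the sample a product measure, which is the image of
  \<open>ball_product\<close> under normalized flips. The value is found as a nonnegative integral,
  whose finiteness gives integrability.\<close>

lemma expected_surface_area_formula:
  fixes e :: "'a::euclidean_space" and M :: "'w measure"
  assumes D: "DIM('a) = d + 1" "d \<ge> 1" and e: "norm e = 1" and n: "n \<ge> d + 1"
    and X: "halfsphere_sample e n M X"
  shows "integrable M (\<lambda>\<omega>. surface_area (conv_s ((\<lambda>i. X i \<omega>) ` {1..n})))"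
    "expected_surface_area n M X = omega d * (real d / pi ^ d * real (n choose d) * facet_int (d - 1) (n - d))"
proof -
  let ?I = "{1..n}"
  interpret M: prob_space M using X by (simp add: halfsphere_sample_def)
  have D2: "DIM('a) \<ge> 2" using D by auto
  have iv: "M.indep_vars (\<lambda>_. borel) X ?I" and dX: "\<And>i. i \<in> ?I \<Longrightarrow> distr M borel (X i) = halfsphere_uniform e"
    using X by (auto simp: halfsphere_sample_def)
  have rv: "X i \<in> borel_measurable M" if "i \<in> ?I" for i
    using iv that unfolding M.indep_vars_def by simp
  define f where "f = (\<lambda>y :: nat \<Rightarrow> 'a. surface_area (conv_s (y ` ?I)))"
  have mf: "f \<in> borel_measurable borel" unfolding f_def by (rule borel_measurable_surface_area[OF _ D2]) simp
  \<comment> \<open>Restricting to the indices 1 to n makes the sample a member of the product space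
    and leaves the hull unchanged.\<close>
  define Y where "Y = (\<lambda>\<omega>. \<lambda>i\<in>?I. X i \<omega>)"
  have fY: "surface_area (conv_s ((\<lambda>i. X i \<omega>) ` ?I)) = f (Y \<omega>)" for \<omega>
  proof -
    have "(\<lambda>i. X i \<omega>) ` ?I = Y \<omega> ` ?I" unfolding Y_def by (intro image_cong) auto
    then show ?thesis by (simp add: f_def)
  qed
  define P where "P = (\<Pi>\<^sub>M i\<in>?I. (borel :: 'a measure))"
  have mY: "Y \<in> M \<rightarrow>\<^sub>M P" unfolding Y_def P_def by (intro measurable_restrict rv)
  have idP: "(\<lambda>y. y) \<in> P \<rightarrow>\<^sub>M borel"
  proof -
    have "sets P = sets (ball_product ?I :: (nat \<Rightarrow> 'a) measure)" unfolding P_def by (intro sets_PiM_cong) auto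
    then show ?thesis using measurable_ball_product_id[of ?I, where 'a='a] by (simp cong: measurable_cong_sets)
  qed
  have mfP: "f \<in> borel_measurable P" using measurable_compose[OF idP mf] by simp
  have dY: "distr M P Y = (\<Pi>\<^sub>M i\<in>?I. halfsphere_uniform e)"
  proof -
    have "distr M P Y = (\<Pi>\<^sub>M i\<in>?I. distr M borel (X i))"
      unfolding P_def Y_def
      by (rule M.indep_vars_iff_distr_eq_PiM'[THEN iffD1, OF _ _ iv]) (use n rv in auto)
    also have "\<dots> = (\<Pi>\<^sub>M i\<in>?I. halfsphere_uniform e)" by (intro PiM_cong refl dX)
    finally show ?thesis .
  qed
  define g where "g = (\<lambda>z. sgn (flip e z))"
  have mg: "g \<in> borel_measurable borel" unfolding g_def by measurable
  have mg': "g \<in> ball_measure \<rightarrow>\<^sub>M (borel :: 'a measure)" by (rule measurable_ball_measure_borel[OF mg])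
  have pd: "prob_space (halfsphere_uniform e)"
    unfolding halfsphere_uniform_eq_distr[OF e] using mg' unfolding g_def by (rule ball_PiM.M.prob_space_distr)
  have hs: "sets (halfsphere_uniform e) = sets borel" by (simp add: halfsphere_uniform_eq_distr[OF e])
  have mg2: "g \<in> ball_measure \<rightarrow>\<^sub>M halfsphere_uniform e" using mg' hs by (simp cong: measurable_cong_sets)
  have dz: "(\<Pi>\<^sub>M i\<in>?I. halfsphere_uniform e) = distr (ball_product ?I) P (compose ?I g)"
  proof -
    have "distr (ball_product ?I) (\<Pi>\<^sub>M i\<in>?I. halfsphere_uniform e) (compose ?I g) = (\<Pi>\<^sub>M i\<in>?I. distr ball_measure (halfsphere_uniform e) g)"
      by (rule distr_PiM_finite_prob_space') (auto intro: prob_space_ball_measure pd mg2)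
    also have "distr ball_measure (halfsphere_uniform e) g = halfsphere_uniform e"
    proof -
      have "distr ball_measure (halfsphere_uniform e) g = distr ball_measure borel g"
        using hs by (intro distr_cong) auto
      then show ?thesis by (simp add: halfsphere_uniform_eq_distr[OF e] g_def)
    qed
    also have "distr (ball_product ?I) (\<Pi>\<^sub>M i\<in>?I. halfsphere_uniform e) (compose ?I g) = distr (ball_product ?I) P (compose ?I g)"
      unfolding P_def by (intro distr_cong sets_PiM_cong refl) (simp add: hs)
    finally show ?thesis by simp
  qed
  have mc: "compose ?I g \<in> ball_product ?I \<rightarrow>\<^sub>M P"
    unfolding compose_def P_def
  proof (rule measurable_restrict)
    show "(\<lambda>z. g (z i)) \<in> ball_product ?I \<rightarrow>\<^sub>M borel" if "i \<in> ?I" for i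
      by (rule measurable_compose[OF measurable_component_singleton[OF that] mg'])
  qed
  have fc: "f (compose ?I g z) = surface_area (conv_s (flips e z ` ?I))" for z
  proof -
    have "compose ?I g z ` ?I = (\<lambda>i. sgn (flip e (z i))) ` ?I"
      by (intro image_cong) (auto simp: compose_def g_def)
    then show ?thesis unfolding f_def by (simp only: conv_s_sgn)
  qed
  have nn: "(\<integral>\<^sup>+\<omega>. ennreal (surface_area (conv_s ((\<lambda>i. X i \<omega>) ` ?I))) \<partial>M)
    = ennreal (omega d * (real d / pi ^ d * real (n choose d) * facet_int (d - 1) (n - d)))"
  proof -
    have "(\<integral>\<^sup>+\<omega>. ennreal (surface_area (conv_s ((\<lambda>i. X i \<omega>) ` ?I))) \<partial>M) = (\<integral>\<^sup>+\<omega>. ennreal (f (Y \<omega>)) \<partial>M)"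
      by (simp only: fY)
    also have "\<dots> = (\<integral>\<^sup>+y. ennreal (f y) \<partial>distr M P Y)"
      using mfP by (intro nn_integral_distr[symmetric] mY) simp
    also have "distr M P Y = distr (ball_product ?I) P (compose ?I g)" unfolding dY dz ..
    also have "(\<integral>\<^sup>+y. ennreal (f y) \<partial>distr (ball_product ?I) P (compose ?I g)) = (\<integral>\<^sup>+z. ennreal (f (compose ?I g z)) \<partial>ball_product ?I)"
      using mfP by (intro nn_integral_distr mc) simp
    also have "\<dots> = ennreal (omega d * (real d / pi ^ d * real (n choose d) * facet_int (d - 1) (n - d)))"
      unfolding fc by (rule nn_integral_surface_area[OF D e n])
    finally show ?thesis .
  qed
  have mS: "(\<lambda>\<omega>. surface_area (conv_s ((\<lambda>i. X i \<omega>) ` ?I))) \<in> borel_measurable M"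
    unfolding fY by (rule measurable_compose[OF mY mfP])
  show "integrable M (\<lambda>\<omega>. surface_area (conv_s ((\<lambda>i. X i \<omega>) ` ?I)))"
  proof (rule integrableI_nonneg[OF mS])
    show "AE \<omega> in M. 0 \<le> surface_area (conv_s ((\<lambda>i. X i \<omega>) ` ?I))" by (simp add: surface_area_nonneg)
    show "(\<integral>\<^sup>+\<omega>. ennreal (surface_area (conv_s ((\<lambda>i. X i \<omega>) ` ?I))) \<partial>M) < \<infinity>" unfolding nn by simp
  qed
  have nonneg: "0 \<le> omega d * (real d / pi ^ d * real (n choose d) * facet_int (d - 1) (n - d))"
    using omega_pos[of d] D(2) facet_int_nonneg by (intro mult_nonneg_nonneg divide_nonneg_nonneg) (auto simp: less_imp_le)
  have "expected_surface_area n M X = enn2real (\<integral>\<^sup>+\<omega>. ennreal (surface_area (conv_s ((\<lambda>i. X i \<omega>) ` ?I))) \<partial>M)"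
    unfolding expected_surface_area_def
    by (rule integral_eq_nn_integral[OF mS]) (simp add: surface_area_nonneg)
  then show "expected_surface_area n M X = omega d * (real d / pi ^ d * real (n choose d) * facet_int (d - 1) (n - d))"
    unfolding nn enn2real_ennreal[OF nonneg] .
qed

theorem theorem5p1:
  fixes e :: "'a::euclidean_space" and d :: nat
  assumes "d \<ge> 2" and "DIM('a) = d + 1" and "e \<in> sphere 0 1"
  shows "(\<forall>n (M :: 'w measure) X. n \<ge> d + 1 \<longrightarrow> halfsphere_sample e n M X \<longrightarrow>
            integrable M (\<lambda>\<omega>. surface_area (conv_s ((\<lambda>i. X i \<omega>) ` {1..n}))) \<and>
            expected_surface_area n M X =
              real d * omega d / pi ^ d * real (n choose d) *
              integral {0..pi} (\<lambda>x. (1 - x / pi) ^ (n - d) * sin x ^ (d - 1))) \<and>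
         (\<forall>(M :: nat \<Rightarrow> 'w measure) X. (\<forall>n\<ge>d + 1. halfsphere_sample e n (M n) (X n)) \<longrightarrow>
            (\<lambda>n. expected_surface_area n (M n) (X n)
                 - omega d * (1 - real ((d + 1) choose 3) * pi\<^sup>2 / real n ^ 2))
              \<in> O(\<lambda>n. 1 / real n ^ 3))"
proof (intro conjI allI impI)
  have d: "d \<ge> 1" and e: "norm e = 1" using assms by auto
  note formula = expected_surface_area_formula[OF assms(2) d e]
  {
    fix n :: nat and M :: "'w measure" and X
    assume n: "n \<ge> d + 1" and X: "halfsphere_sample e n M X"
    show "integrable M (\<lambda>\<omega>. surface_area (conv_s ((\<lambda>i. X i \<omega>) ` {1..n})))"
      by (rule formula(1)[OF n X])
    show "expected_surface_area n M X =
              real d * omega d / pi ^ d * real (n choose d) *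
              integral {0..pi} (\<lambda>x. (1 - x / pi) ^ (n - d) * sin x ^ (d - 1))"
      unfolding formula(2)[OF n X] facet_int_def by simp
  next
    fix M :: "nat \<Rightarrow> 'w measure" and X
    assume X: "\<forall>n\<ge>d + 1. halfsphere_sample e n (M n) (X n)"
    have "(\<lambda>n. real d / pi ^ d * real (n choose d) * facet_int (d - 1) (n - d)
        - (1 - real ((d + 1) choose 3) * pi\<^sup>2 / real n ^ 2)) \<in> O(\<lambda>n. 1 / real n ^ 3)"
      unfolding facet_int_def by (rule facet_integral_expansion[OF d])
    then have "(\<lambda>n. omega d * (real d / pi ^ d * real (n choose d) * facet_int (d - 1) (n - d)
        - (1 - real ((d + 1) choose 3) * pi\<^sup>2 / real n ^ 2))) \<in> O(\<lambda>n. 1 / real n ^ 3)"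
      using omega_pos[of d] d by (subst landau_o.big.cmult_in_iff) auto
    \<comment> \<open>The formula is available for n \<ge> d + 1, that is, eventually, which
      suffices for membership in an O-class.\<close>
    moreover have "eventually (\<lambda>n. expected_surface_area n (M n) (X n)
                 - omega d * (1 - real ((d + 1) choose 3) * pi\<^sup>2 / real n ^ 2)
        = omega d * (real d / pi ^ d * real (n choose d) * facet_int (d - 1) (n - d)
        - (1 - real ((d + 1) choose 3) * pi\<^sup>2 / real n ^ 2))) sequentially"
      using eventually_ge_at_top[of "d + 1"]
    proof eventually_elim
      fix n assume n: "n \<ge> d + 1"
      show "expected_surface_area n (M n) (X n)
                 - omega d * (1 - real ((d + 1) choose 3) * pi\<^sup>2 / real n ^ 2)
        = omega d * (real d / pi ^ d * real (n choose d) * facet_int (d - 1) (n - d)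
        - (1 - real ((d + 1) choose 3) * pi\<^sup>2 / real n ^ 2))"
        using formula(2)[OF n X[rule_format, OF n]] by (simp add: right_diff_distrib)
    qed
    ultimately show "(\<lambda>n. expected_surface_area n (M n) (X n)
                 - omega d * (1 - real ((d + 1) choose 3) * pi\<^sup>2 / real n ^ 2))
              \<in> O(\<lambda>n. 1 / real n ^ 3)"
      by (subst landau_o.big.in_cong)
  }
qed

end
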